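(* Write $\mathcal U=\mathcal U_q(\mathcal L\mathfrak g^\sigma)$ and $X^+=\sum_{j\in I,m\in\mathbb Z}\mathbb C\,x^+_{j,m}\subset\mathcal U$. For all $i\in I$, $m\in\mathbb Z$, $k\ge0$, $l>0$, the following congruences hold modulo $\mathcal U\otimes\mathcal U X^+$: $$\Delta(x^+_{i,m})\equiv x^+_{i,m}\otimes1,$$ $$\Delta(x^-_{i,l})\equiv1\otimes x^-_{i,l}+\sum_{j=1}^lx^-_{i,j}\otimes\phi^+_{i,l-j},$$ $$\Delta(x^-_{i,-k})\equiv1\otimes x^-_{i,-k}+\sum_{j=0}^kx^-_{i,-j}\otimes\phi^-_{i,-k+j},$$ $$\Delta(\phi^+_{i,k})\equiv\sum_{j=0}^k\phi^+_{i,k-j}\otimes\phi^+_{i,j},\qquad \Delta(\phi^-_{i,-k})\equiv\sum_{j=0}^k\phi^-_{i,-k+j}\otimes\phi^-_{i,-j}.$$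
   Context: Twisted data. $\mathfrak g$ is a simple complex Lie algebra of type $A_m$ ($m\ge2$), $D_m$ ($m\ge4$) or $E_6$ with Dynkin nodes $I$ and Cartan matrix $C$; $\sigma:I\to I$ is a non-trivial diagram automorphism of order $M\in\{2,3\}$; $\omega=e^{2\pi\sqrt{-1}/M}$. $I_\sigma$ is the set of $\sigma$-orbits, $\bar i$ the orbit of $i$; in each orbit a representative is fixed, the smallest node in the standard labelling ($1,\dots,n$ for $A_{2n}^{(2)},A_{2n-1}^{(2)},D_{n+1}^{(2)}$; $1$ and the trivalent node $2$ for $D_4^{(3)}$; in all cases a connected subdiagram). $d_{\bar i}=\frac12\sum_{r=1}^MC_{i,\sigma^r(i)}$. $\hat I_\sigma=I_\sigma\sqcup\{\epsilon\}$; $C^\sigma$ is the generalized Cartan matrix of the twisted affine type, $\epsilon$ the affine node (for $A_{2n}^{(2)}$ the end node with longest root), so $d_{\bar i}C^\sigma_{\bar i,\bar j}=\sum_{r=1}^MC_{i,\sigma^r(j)}$ on $I_\sigma$; $d_\epsilon$ makes $(d_iC^\sigma_{i,j})$ symmetric; $(a_i)_{i\in\hat I_\sigma}$ are the positive integers with $\sum_ia_id_iC^\sigma_{i,j}=0$ for all $j$, $a_\epsilon=1$. $q\in\mathbb C^*$ is not a root of unity (with a fixed square root), $q_i=q^{d_i}$, $[m]_p=\frac{p^m-p^{-m}}{p-p^{-1}}$. Algebra. $\mathcal U_q(\mathcal L\mathfrak g^\sigma)$ has generators $e_i^\pm,k_i^{\pm1}$ ($i\in\hat I_\sigma$) and relations: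 the $k_i$ are invertible and commute, $k_ie_j^\pm=q_i^{\pm C^\sigma_{i,j}}e_j^\pm k_i$, $[e_i^+,e_j^-]=\delta_{i,j}\frac{k_i-k_i^{-1}}{q_i-q_i^{-1}}$, the quantum Serre relations of $C^\sigma$, and $\prod_ik_i^{a_i}=1$. Coproduct: $\Delta(k_i)=k_i\otimes k_i$, $\Delta(e_i^+)=e_i^+\otimes1+k_i\otimes e_i^+$, $\Delta(e_i^-)=e_i^-\otimes k_i^{-1}+1\otimes e_i^-$. It is also generated by the Drinfeld generators $x_{i,m}^\pm$ ($m\in\mathbb Z$), $h_{i,r}$ ($r\neq0$), $k_i^{\pm1}$, $i\in I$, of its Drinfeld presentation (Chari–Pressley, Damiani), where $x_{i,0}^\pm=e_{\bar i}^\pm$, $k_i=k_{\bar i}$ for representatives $i$, $e_\epsilon^\pm$ has degree $\pm1$ for the grading $\deg x_{i,m}^\pm=m,\deg h_{i,r}=r,\deg k_i=0$, and $x_{\sigma(i),m}^\pm=\omega^mx_{i,m}^\pm$, $h_{\sigma(i),r}=\omega^rh_{i,r}$, $k_{\sigma(i)}=k_i$, the $h$'s and $k$'s commute, $k_ix_{j,m}^\pm=q^{\pm\sum_{r=1}^MC_{i,\sigma^r(j)}}x_{j,m}^\pm k_i$, $[h_{i,s},x_{j,l}^\pm]=\pm\frac1s\left(\sum_{r=1}^M[sC_{i,\sigma^r(j)}/d_{\bar i}]_{q_{\bar i}}\omega^{sr}\right)x_{j,s+l}^\pm$, $[x_{i,s}^+,x_{j,l}^-]=\frac{\sum_{r=1}^M\delta_{\sigma^r(i),j}\omega^{rl}}{N_i}\frac{\phi_{i,s+l}^+-\phi_{i,s+l}^-}{q_{\bar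 i}-q_{\bar i}^{-1}}$ with $N_i=M$ if $\sigma(i)=i$, $N_i=1$ otherwise, and $\phi_i^\pm(u)=\sum_{m\ge0}\phi^\pm_{i,\pm m}u^{\pm m}=k_i^{\pm1}\exp(\pm(q_{\bar i}-q_{\bar i}^{-1})\sum_{l\ge1}h_{i,\pm l}u^{\pm l})$ (other $\phi^\pm_{i,m}$ are $0$). *)

theory Defs
  imports Complex_Main "HOL-Library.Poly_Mapping" "HOL-Computational_Algebra.Formal_Power_Series"
begin

class complex_algebra_1 = ring_1 +
  fixes scaleC :: "complex \<Rightarrow> 'a \<Rightarrow> 'a"  (infixr "*\<^sub>C" 75)
  assumes scaleC_add_right: "a *\<^sub>C (x + y) = a *\<^sub>C x + a *\<^sub>C y"
    and scaleC_add_left: "(a + b) *\<^sub>C x = a *\<^sub>C x + b *\<^sub>C x"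
    and scaleC_scaleC: "a *\<^sub>C b *\<^sub>C x = (a * b) *\<^sub>C x"
    and scaleC_one: "1 *\<^sub>C x = x"
    and mult_scaleC_left: "(a *\<^sub>C x) * y = a *\<^sub>C (x * y)"
    and mult_scaleC_right: "x * (a *\<^sub>C y) = a *\<^sub>C (x * y)"

interpretation complex_vector: vector_space "scaleC :: complex \<Rightarrow> 'a \<Rightarrow> 'a::complex_algebra_1"
  by unfold_locales (simp_all add: scaleC_add_right scaleC_add_left scaleC_scaleC scaleC_one)

text \<open>The algebra \<open>A \<otimes> B\<close> is the quotient of the complex vector space with basis \<open>A \<times> B\<close> by the
  subspace of bilinearity relations. Taking the symbols \<open>Pure a b\<close> as a monoid under the
  componentwise product (written additively, as the exponents of \<open>\<Rightarrow>\<^sub>0\<close> are) makes the convolution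
  product of \<open>\<Rightarrow>\<^sub>0\<close> induce \<open>(a \<otimes> b)(c \<otimes> d) = ac \<otimes> bd\<close>.\<close>

datatype ('a, 'b) pure = Pure 'a 'b

instantiation pure :: (monoid_mult, monoid_mult) monoid_add
begin

definition zero_pure :: "('a, 'b) pure" where "0 = Pure 1 1"

fun plus_pure :: "('a, 'b) pure \<Rightarrow> ('a, 'b) pure \<Rightarrow> ('a, 'b) pure" where
  "Pure a b + Pure c d = Pure (a * c) (b * d)"

instance
proof
  fix x y z :: "('a, 'b) pure"
  show "x + y + z = x + (y + z)" by (cases x; cases y; cases z) (simp add: mult.assoc)
  show "0 + x = x" by (cases x) (simp add: zero_pure_def)
  show "x + 0 = x" by (cases x) (simp add: zero_pure_def)
qed

end

inductive_set tensor_null ::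
    "(('a::complex_algebra_1, 'b::complex_algebra_1) pure \<Rightarrow>\<^sub>0 complex) set" where
  null_zero: "0 \<in> tensor_null"
| null_add_left: "f \<in> tensor_null \<Longrightarrow>
    f + (Poly_Mapping.single (Pure (a + a') b) c - Poly_Mapping.single (Pure a b) c
         - Poly_Mapping.single (Pure a' b) c) \<in> tensor_null"
| null_add_right: "f \<in> tensor_null \<Longrightarrow>
    f + (Poly_Mapping.single (Pure a (b + b')) c - Poly_Mapping.single (Pure a b) c
         - Poly_Mapping.single (Pure a b') c) \<in> tensor_null"
| null_scale_left: "f \<in> tensor_null \<Longrightarrow>
    f + (Poly_Mapping.single (Pure (z *\<^sub>C a) b) c - Poly_Mapping.single (Pure a b) (z * c)) \<in> tensor_null"
| null_scale_right: "f \<in> tensor_null \<Longrightarrow>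
    f + (Poly_Mapping.single (Pure a (z *\<^sub>C b)) c - Poly_Mapping.single (Pure a b) (z * c)) \<in> tensor_null"

lemma tensor_null_add:
  assumes "g \<in> tensor_null" and f: "f \<in> tensor_null" shows "f + g \<in> tensor_null"
  using assms(1)
  by induct (auto simp only: add_0_right f add.assoc[symmetric] intro: tensor_null.intros)

lemma tensor_null_gens:
  "Poly_Mapping.single (Pure (a + a') b) c - Poly_Mapping.single (Pure a b) c
         - Poly_Mapping.single (Pure a' b) c \<in> tensor_null"
  "Poly_Mapping.single (Pure a (b + b')) c - Poly_Mapping.single (Pure a b) c
         - Poly_Mapping.single (Pure a b') c \<in> tensor_null"
  "Poly_Mapping.single (Pure (z *\<^sub>C a) b) c - Poly_Mapping.single (Pure a b) (z * c) \<in> tensor_null"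
  "Poly_Mapping.single (Pure a (z *\<^sub>C b)) c - Poly_Mapping.single (Pure a b) (z * c) \<in> tensor_null"
  using null_add_left[OF null_zero, of a a' b c] null_add_right[OF null_zero, of a b b' c]
    null_scale_left[OF null_zero, of z a b c] null_scale_right[OF null_zero, of a z b c]
  by (simp_all only: add_0_left)

lemma poly_mapping_additive_induct [case_names zero single add]:
  fixes f :: "'k \<Rightarrow>\<^sub>0 'c::comm_monoid_add"
  assumes "P 0" "\<And>k c. P (Poly_Mapping.single k c)" "\<And>f g. P f \<Longrightarrow> P g \<Longrightarrow> P (f + g)"
  shows "P f"
proof (induct f rule: update_induct)
  case const show ?case by (rule assms)
next
  case (update f k c)
  have "Poly_Mapping.update k c f = f + Poly_Mapping.single k c"
    using update(1)
    by (intro poly_mapping_eqI) (auto simp: lookup_update lookup_add lookup_single when_def in_keys_iff)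
  then show ?case using assms update by metis
qed

lemma tensor_null_mult_single:
  assumes "f \<in> tensor_null"
  shows "Poly_Mapping.single k e * f \<in> tensor_null" (is ?L) and "f * Poly_Mapping.single k e \<in> tensor_null" (is ?R)
proof -
  obtain u v where k: "k = Pure u v" by (cases k)
  note N = tensor_null_gens
  show ?L using assms
  proof induct
    case null_zero show ?case by (simp add: tensor_null.null_zero)
  next
    case (null_add_left f a a' b c)
    show ?case using tensor_null_add[OF N(1)[of "u*a" "u*a'" "v*b" "e*c"] null_add_left(2)]
      by (simp add: k algebra_simps mult_single)
  next
    case (null_add_right f a b b' c)
    show ?case using tensor_null_add[OF N(2)[of "u*a" "v*b" "v*b'" "e*c"] null_add_right(2)]
      by (simp add: k algebra_simps mult_single)
  next
    case (null_scale_left f z a b c)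
    show ?case using tensor_null_add[OF N(3)[of z "u*a" "v*b" "e*c"] null_scale_left(2)]
      by (simp add: k algebra_simps mult_single mult_scaleC_right)
  next
    case (null_scale_right f a z b c)
    show ?case using tensor_null_add[OF N(4)[of "u*a" z "v*b" "e*c"] null_scale_right(2)]
      by (simp add: k algebra_simps mult_single mult_scaleC_right)
  qed
  show ?R using assms
  proof induct
    case null_zero show ?case by (simp add: tensor_null.null_zero)
  next
    case (null_add_left f a a' b c)
    show ?case using tensor_null_add[OF N(1)[of "a*u" "a'*u" "b*v" "e*c"] null_add_left(2)]
      by (simp add: k algebra_simps mult_single)
  next
    case (null_add_right f a b b' c)
    show ?case using tensor_null_add[OF N(2)[of "a*u" "b*v" "b'*v" "e*c"] null_add_right(2)]
      by (simp add: k algebra_simps mult_single)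
  next
    case (null_scale_left f z a b c)
    show ?case using tensor_null_add[OF N(3)[of z "a*u" "b*v" "e*c"] null_scale_left(2)]
      by (simp add: k algebra_simps mult_single mult_scaleC_left)
  next
    case (null_scale_right f a z b c)
    show ?case using tensor_null_add[OF N(4)[of "a*u" z "b*v" "e*c"] null_scale_right(2)]
      by (simp add: k algebra_simps mult_single mult_scaleC_left)
  qed
qed

lemma tensor_null_mult:
  assumes f: "f \<in> tensor_null"
  shows "g * f \<in> tensor_null" "f * g \<in> tensor_null"
proof -
  show "g * f \<in> tensor_null"
    by (induct g rule: poly_mapping_additive_induct)
      (auto simp: tensor_null_mult_single[OF f] null_zero distrib_right intro: tensor_null_add)
  show "f * g \<in> tensor_null"
    by (induct g rule: poly_mapping_additive_induct)
      (auto simp: tensor_null_mult_single[OF f] null_zero distrib_left intro: tensor_null_add)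
qed

lemma tensor_null_uminus: "f \<in> tensor_null \<Longrightarrow> - f \<in> tensor_null"
  using tensor_null_mult(1)[of f "- 1"] by simp

quotient_type (overloaded) ('a, 'b) tensor =
  "('a::complex_algebra_1, 'b::complex_algebra_1) pure \<Rightarrow>\<^sub>0 complex" /
  "\<lambda>f g. f - g \<in> tensor_null"
proof (rule equivpI)
  show "reflp (\<lambda>f g. f - g \<in> tensor_null)" by (rule reflpI) (simp add: null_zero)
  show "symp (\<lambda>f g. f - g \<in> tensor_null)"
    by (rule sympI) (metis minus_diff_eq tensor_null_uminus)
  show "transp (\<lambda>f g. f - g \<in> tensor_null)"
  proof (rule transpI)
    fix f g h :: "('c::complex_algebra_1, 'd::complex_algebra_1) pure \<Rightarrow>\<^sub>0 complex"
    assume "f - g \<in> tensor_null" "g - h \<in> tensor_null"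
    then have "(f - g) + (g - h) \<in> tensor_null" by (intro tensor_null_add)
    then show "f - h \<in> tensor_null" by simp
  qed
qed

lift_definition tens ::
    "'a::complex_algebra_1 \<Rightarrow> 'b::complex_algebra_1 \<Rightarrow> ('a, 'b) tensor"  (infixr "\<otimes>" 72)
  is "\<lambda>a b. Poly_Mapping.single (Pure a b) 1" .

lemma single_zero_central:
  "f * Poly_Mapping.single 0 c = Poly_Mapping.single 0 (c::complex) * (f::'k::monoid_add \<Rightarrow>\<^sub>0 complex)"
  by (induct f rule: poly_mapping_additive_induct)
    (simp_all add: mult_single distrib_left distrib_right mult.commute)

lemma single_one_not_null:
  "(1 :: ('a::complex_algebra_1, 'b::complex_algebra_1) pure \<Rightarrow>\<^sub>0 complex) \<notin> tensor_null"
proof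
  assume one: "(1 :: ('a, 'b) pure \<Rightarrow>\<^sub>0 complex) \<in> tensor_null"
  interpret pa: vector_space_pair "scaleC :: complex \<Rightarrow> 'a \<Rightarrow> 'a" "(*) :: complex \<Rightarrow> complex \<Rightarrow> complex"
    by unfold_locales (simp_all add: algebra_simps)
  interpret pb: vector_space_pair "scaleC :: complex \<Rightarrow> 'b \<Rightarrow> 'b" "(*) :: complex \<Rightarrow> complex \<Rightarrow> complex"
    by unfold_locales (simp_all add: algebra_simps)
  have "complex_vector.independent {1::'a}" "complex_vector.independent {1::'b}" by simp_all
  then obtain l1 l2 where
      lam: "Vector_Spaces.linear scaleC (*) l1" "l1 (1::'a) = (1::complex)"
      and mu: "Vector_Spaces.linear scaleC (*) l2" "l2 (1::'b) = (1::complex)"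
    using pa.linear_independent_extend[of "{1}" "\<lambda>_. 1"] pb.linear_independent_extend[of "{1}" "\<lambda>_. 1"]
    by auto
  define w where "w = (\<lambda>k. case k of Pure a b \<Rightarrow> l1 a * l2 b)"
  define F where "F = (\<lambda>f :: ('a, 'b) pure \<Rightarrow>\<^sub>0 complex. \<Sum>k\<in>Poly_Mapping.keys f. Poly_Mapping.lookup f k * w k)"
  have F_sup: "F f = (\<Sum>k\<in>S. Poly_Mapping.lookup f k * w k)"
    if "finite S" "Poly_Mapping.keys f \<subseteq> S" for f S
    unfolding F_def using that by (intro sum.mono_neutral_left) (auto simp: in_keys_iff)
  have F_add: "F (f + g) = F f + F g" for f g
    using Poly_Mapping.keys_add[of f g]
    by (simp add: F_sup[of "Poly_Mapping.keys f \<union> Poly_Mapping.keys g"] lookup_add distrib_right sum.distrib)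
  have F_single: "F (Poly_Mapping.single k c) = c * w k" for k c
    by (simp add: F_sup[of "{k}"])
  have F_diff: "F (f - g) = F f - F g" for f g
    using F_add[of "f - g" g] by simp
  have l1: "l1 (a + a') = l1 a + l1 a'" "l1 (z *\<^sub>C a) = z * l1 a" for a a' z
    using lam(1) by (simp_all add: pa.linear_add pa.linear_scale)
  have l2: "l2 (b + b') = l2 b + l2 b'" "l2 (z *\<^sub>C b) = z * l2 b" for b b' z
    using mu(1) by (simp_all add: pb.linear_add pb.linear_scale)
  have F_zero: "F 0 = 0" by (simp add: F_def)
  have "F f = 0" if "f \<in> tensor_null" for f
    using that
    by induct (simp_all add: F_zero F_add F_diff F_single w_def l1 l2 ring_distribs mult.left_commute)
  moreover have "F 1 = 1"
  proof -
    have "w 0 = 1" by (simp add: w_def zero_pure_def lam mu)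
    then show ?thesis using F_single[of 0 1] by simp
  qed
  ultimately show False using one by force
qed

instantiation tensor :: (complex_algebra_1, complex_algebra_1) complex_algebra_1
begin

lift_definition zero_tensor :: "('a, 'b) tensor" is 0 .

lift_definition one_tensor :: "('a, 'b) tensor" is 1 .

lift_definition plus_tensor :: "('a, 'b) tensor \<Rightarrow> ('a, 'b) tensor \<Rightarrow> ('a, 'b) tensor" is "(+)"
  by (metis add_diff_add tensor_null_add)

lift_definition uminus_tensor :: "('a, 'b) tensor \<Rightarrow> ('a, 'b) tensor" is uminus
  by (metis minus_diff_minus tensor_null_uminus)

lift_definition minus_tensor :: "('a, 'b) tensor \<Rightarrow> ('a, 'b) tensor \<Rightarrow> ('a, 'b) tensor" is "(-)"
proof -
  fix f f' g g' :: "('a, 'b) pure \<Rightarrow>\<^sub>0 complex"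
  assume "f - f' \<in> tensor_null" "g - g' \<in> tensor_null"
  then have "(f - f') + - (g - g') \<in> tensor_null" by (intro tensor_null_add tensor_null_uminus)
  then show "f - g - (f' - g') \<in> tensor_null" by (simp add: algebra_simps)
qed

lift_definition times_tensor :: "('a, 'b) tensor \<Rightarrow> ('a, 'b) tensor \<Rightarrow> ('a, 'b) tensor" is "(*)"
proof -
  fix f f' g g' :: "('a, 'b) pure \<Rightarrow>\<^sub>0 complex"
  assume "f - f' \<in> tensor_null" "g - g' \<in> tensor_null"
  then have "(f - f') * g + f' * (g - g') \<in> tensor_null"
    by (intro tensor_null_add tensor_null_mult)
  then show "f * g - f' * g' \<in> tensor_null" by (simp add: algebra_simps)
qed

lift_definition scaleC_tensor :: "complex \<Rightarrow> ('a, 'b) tensor \<Rightarrow> ('a, 'b) tensor"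
  is "\<lambda>c f. Poly_Mapping.single 0 c * f"
  by (simp add: right_diff_distrib[symmetric] tensor_null_mult)

instance
proof
  fix x y z :: "('a, 'b) tensor" and c d :: complex
  show "x + y + z = x + (y + z)" by transfer (simp add: add.assoc null_zero)
  show "x + y = y + x" by transfer (simp add: add.commute null_zero)
  show "0 + x = x" by transfer (simp add: null_zero)
  show "- x + x = 0" by transfer (simp add: null_zero)
  show "x - y = x + - y" by transfer (simp add: null_zero)
  show "x * y * z = x * (y * z)" by transfer (simp add: mult.assoc null_zero)
  show "1 * x = x" by transfer (simp add: null_zero)
  show "x * 1 = x" by transfer (simp add: null_zero)
  show "(x + y) * z = x * z + y * z" by transfer (simp add: distrib_right null_zero)
  show "x * (y + z) = x * y + x * z" by transfer (simp add: distrib_left null_zero)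
  show "(0 :: ('a, 'b) tensor) \<noteq> 1"
    by transfer (use single_one_not_null tensor_null_uminus in fastforce)
  show "c *\<^sub>C (x + y) = c *\<^sub>C x + c *\<^sub>C y" by transfer (simp add: distrib_left null_zero)
  show "(c + d) *\<^sub>C x = c *\<^sub>C x + d *\<^sub>C x"
    by transfer (simp add: single_add distrib_right null_zero)
  show "c *\<^sub>C d *\<^sub>C x = (c * d) *\<^sub>C x"
    by transfer (simp add: mult.assoc[symmetric] mult_single null_zero)
  show "1 *\<^sub>C x = x" by transfer (simp add: null_zero)
  show "(c *\<^sub>C x) * y = c *\<^sub>C (x * y)" by transfer (simp add: mult.assoc null_zero)
  show "x * (c *\<^sub>C y) = c *\<^sub>C (x * y)"
    by transfer (simp add: mult.assoc[symmetric] single_zero_central null_zero)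
qed

end

lemma tens_add_left: "(a + a') \<otimes> b = a \<otimes> b + a' \<otimes> b"
  by transfer (use tensor_null_gens(1)[of _ _ _ 1] in \<open>simp add: algebra_simps\<close>)

lemma tens_add_right: "a \<otimes> (b + b') = a \<otimes> b + a \<otimes> b'"
  by transfer (use tensor_null_gens(2)[of _ _ _ 1] in \<open>simp add: algebra_simps\<close>)

lemma tens_scale_left: "(c *\<^sub>C a) \<otimes> b = c *\<^sub>C (a \<otimes> b)"
  by transfer (use tensor_null_gens(3)[of _ _ _ 1] in \<open>simp add: mult_single zero_pure_def\<close>)

lemma tens_scale_right: "a \<otimes> (c *\<^sub>C b) = c *\<^sub>C (a \<otimes> b)"
  by transfer (use tensor_null_gens(4)[of _ _ _ 1] in \<open>simp add: mult_single zero_pure_def\<close>)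

lemma tens_mult: "(a \<otimes> b) * (c \<otimes> d) = (a * c) \<otimes> (b * d)"
  by transfer (simp add: mult_single null_zero)

lemma tens_one: "1 \<otimes> 1 = 1"
  by transfer (simp add: zero_pure_def[symmetric] null_zero)


definition algebra_hom :: "('a::complex_algebra_1 \<Rightarrow> 'b::complex_algebra_1) \<Rightarrow> bool" where
  "algebra_hom f \<longleftrightarrow> f 1 = 1 \<and> (\<forall>x y. f (x + y) = f x + f y) \<and> (\<forall>x y. f (x * y) = f x * f y) \<and>
    (\<forall>c x. f (c *\<^sub>C x) = c *\<^sub>C f x)"

inductive_set generated_algebra :: "'a::complex_algebra_1 set \<Rightarrow> 'a set" for S where
  "x \<in> S \<Longrightarrow> x \<in> generated_algebra S"
| "1 \<in> generated_algebra S"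
| "x \<in> generated_algebra S \<Longrightarrow> y \<in> generated_algebra S \<Longrightarrow> x + y \<in> generated_algebra S"
| "x \<in> generated_algebra S \<Longrightarrow> y \<in> generated_algebra S \<Longrightarrow> x * y \<in> generated_algebra S"
| "x \<in> generated_algebra S \<Longrightarrow> c *\<^sub>C x \<in> generated_algebra S"

definition algebra_grading :: "(int \<Rightarrow> 'a::complex_algebra_1 set) \<Rightarrow> bool" where
  "algebra_grading V \<longleftrightarrow> (\<forall>n. complex_vector.subspace (V n)) \<and> 1 \<in> V 0 \<and>
    (\<forall>m n. \<forall>x\<in>V m. \<forall>y\<in>V n. x * y \<in> V (m + n)) \<and>
    (\<forall>x. \<exists>!c. finite {n. c n \<noteq> 0} \<and> (\<forall>n. c n \<in> V n) \<and> x = (\<Sum>n | c n \<noteq> 0. c n))"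

text \<open>The free algebra on a set of letters: finite complex combinations of words, with the
  convolution product of \<open>\<Rightarrow>\<^sub>0\<close> induced by concatenation.\<close>

datatype 'g word = Word (letters: "'g list")

instantiation word :: (type) monoid_add
begin

definition zero_word :: "'a word" where "0 = Word []"

definition plus_word :: "'a word \<Rightarrow> 'a word \<Rightarrow> 'a word" where "v + w = Word (letters v @ letters w)"

instance by standard (simp_all add: zero_word_def plus_word_def)

end

type_synonym 'g free_algebra = "'g word \<Rightarrow>\<^sub>0 complex"

definition letter :: "'g \<Rightarrow> 'g free_algebra" where
  "letter x = Poly_Mapping.single (Word [x]) 1"

definition scalar :: "complex \<Rightarrow> 'g free_algebra" where
  "scalar c = Poly_Mapping.single 0 c"

definition free_algebra_on :: "'g set \<Rightarrow> 'g free_algebra set" where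
  "free_algebra_on G = {f. \<forall>w\<in>Poly_Mapping.keys f. set (letters w) \<subseteq> G}"

definition eval_free :: "('g \<Rightarrow> 'a::complex_algebra_1) \<Rightarrow> 'g free_algebra \<Rightarrow> 'a" where
  "eval_free g f = (\<Sum>w\<in>Poly_Mapping.keys f. Poly_Mapping.lookup f w *\<^sub>C prod_list (map g (letters w)))"

inductive_set relation_ideal :: "'g set \<Rightarrow> 'g free_algebra set \<Rightarrow> 'g free_algebra set" for G R where
  "0 \<in> relation_ideal G R"
| "f \<in> relation_ideal G R \<Longrightarrow> a \<in> free_algebra_on G \<Longrightarrow> b \<in> free_algebra_on G \<Longrightarrow> r \<in> R \<Longrightarrow>
    f + a * r * b \<in> relation_ideal G R"

text \<open>The ambient algebra is the algebra with generators \<open>G\<close> and relations \<open>R\<close>, the class of the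
  generator \<open>x\<close> being \<open>g x\<close>.\<close>

definition presented_by :: "'g set \<Rightarrow> 'g free_algebra set \<Rightarrow> ('g \<Rightarrow> 'a::complex_algebra_1) \<Rightarrow> bool" where
  "presented_by G R g \<longleftrightarrow> eval_free g ` free_algebra_on G = UNIV \<and>
    (\<forall>f\<in>free_algebra_on G. eval_free g f = 0 \<longleftrightarrow> f \<in> relation_ideal G R)"

text \<open>Nodes are labelled as by Bourbaki.\<close>

datatype dynkin = Type_A nat | Type_D nat | Type_E6

fun nodes :: "dynkin \<Rightarrow> nat set" where
  "nodes (Type_A m) = {1..m}"
| "nodes (Type_D m) = {1..m}"
| "nodes Type_E6 = {1..6}"

fun adjacent :: "dynkin \<Rightarrow> nat \<Rightarrow> nat \<Rightarrow> bool" where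
  "adjacent (Type_A m) i j \<longleftrightarrow> j = Suc i \<or> i = Suc j"
| "adjacent (Type_D m) i j \<longleftrightarrow> (j = Suc i \<and> j < m) \<or> (i = Suc j \<and> i < m) \<or> {i, j} = {m - 2, m}"
| "adjacent Type_E6 i j \<longleftrightarrow> {i, j} \<in> {{1, 3}, {3, 4}, {4, 5}, {5, 6}, {2, 4}}"

definition cartan :: "dynkin \<Rightarrow> nat \<Rightarrow> nat \<Rightarrow> int" where
  "cartan X i j = (if i = j then 2 else if adjacent X i j then - 1 else 0)"

text \<open>\<open>aut\<close> is \<open>\<sigma>\<close> and \<open>aut_order\<close> is \<open>M\<close>. The component \<open>sqrt_q\<close> is the fixed square root of \<open>q\<close>; it is
  needed because \<open>d\<^sub>i\<close> may be a half-integer.\<close>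

record twisted_datum =
  type_of :: dynkin
  aut :: "nat \<Rightarrow> nat"
  aut_order :: nat
  sqrt_q :: complex

definition qq :: "twisted_datum \<Rightarrow> complex" where
  "qq T = (sqrt_q T)\<^sup>2"

definition twisted_datum :: "twisted_datum \<Rightarrow> bool" where
  "twisted_datum T \<longleftrightarrow>
    (case type_of T of Type_A m \<Rightarrow> m \<ge> 2 | Type_D m \<Rightarrow> m \<ge> 4 | Type_E6 \<Rightarrow> True) \<and>
    bij_betw (aut T) (nodes (type_of T)) (nodes (type_of T)) \<and>
    (\<forall>i\<in>nodes (type_of T). \<forall>j\<in>nodes (type_of T).
      cartan (type_of T) (aut T i) (aut T j) = cartan (type_of T) i j) \<and>
    (\<exists>i\<in>nodes (type_of T). aut T i \<noteq> i) \<and>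
    aut_order T \<in> {2, 3} \<and> (\<forall>i\<in>nodes (type_of T). (aut T ^^ aut_order T) i = i) \<and>
    qq T \<noteq> 0 \<and> (\<forall>n>0. qq T ^ n \<noteq> 1)"

abbreviation II :: "twisted_datum \<Rightarrow> nat set" where
  "II T \<equiv> nodes (type_of T)"

definition omega :: "twisted_datum \<Rightarrow> complex" where
  "omega T = cis (2 * pi / real (aut_order T))"

definition rep :: "twisted_datum \<Rightarrow> nat \<Rightarrow> nat" where
  "rep T i = Min ((\<lambda>r. (aut T ^^ r) i) ` {..<aut_order T})"

text \<open>\<open>bform T i j\<close> is \<open>\<Sum>\<^sub>r C\<^bsub>i,\<sigma>\<^sup>r(j)\<^esub>\<close>, so \<open>bform T i i = 2 d\<^sub>i\<close>. An orbit is encoded by its representative: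
  \<open>Orbit i\<close> is used for \<open>i \<in> rep T ` II T\<close> only.\<close>

definition bform :: "twisted_datum \<Rightarrow> nat \<Rightarrow> nat \<Rightarrow> int" where
  "bform T i j = (\<Sum>r=1..aut_order T. cartan (type_of T) i ((aut T ^^ r) j))"

datatype affine_node = Eps | Orbit nat

abbreviation bar :: "twisted_datum \<Rightarrow> nat \<Rightarrow> affine_node" where
  "bar T i \<equiv> Orbit (rep T i)"

definition affine_nodes :: "twisted_datum \<Rightarrow> affine_node set" where
  "affine_nodes T = insert Eps (bar T ` II T)"

text \<open>The representatives for \<open>D\<^bsub>n+1\<^esub>\<^sup>(\<^sup>2\<^sup>)\<close> along the diagram, the short end last. The second case
  occurs for \<open>D\<^sub>4\<close> only, when \<open>\<sigma>\<close> exchanges node 1 with another leaf.\<close>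

definition D_chain :: "nat \<Rightarrow> (nat \<Rightarrow> nat) \<Rightarrow> nat list" where
  "D_chain m s = (if s 1 = 1 then [1..<m] else [7 - s 1, 2, 1])"

text \<open>\<open>affine_edge T = (j, C\<^bsub>\<epsilon>,j\<^esub>, C\<^bsub>j,\<epsilon>\<^esub>)\<close> for the only node \<open>j\<close> joined to \<open>\<epsilon>\<close>. The cases are
  \<open>A\<^sub>2\<^sup>(\<^sup>2\<^sup>)\<close>, \<open>A\<^bsub>2n\<^esub>\<^sup>(\<^sup>2\<^sup>)\<close>, \<open>A\<^sub>3\<^sup>(\<^sup>2\<^sup>)\<close>, \<open>A\<^bsub>2n-1\<^esub>\<^sup>(\<^sup>2\<^sup>)\<close>, \<open>D\<^sub>4\<^sup>(\<^sup>3\<^sup>)\<close>, \<open>D\<^bsub>n+1\<^esub>\<^sup>(\<^sup>2\<^sup>)\<close>, \<open>E\<^sub>6\<^sup>(\<^sup>2\<^sup>)\<close>.\<close>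

definition affine_edge :: "twisted_datum \<Rightarrow> nat \<times> int \<times> int" where
  "affine_edge T = (case type_of T of
      Type_A m \<Rightarrow> if m = 2 then (1, - 1, - 4) else if even m then (1, - 1, - 2)
             else if m = 3 then (2, - 2, - 1) else (2, - 1, - 1)
    | Type_D m \<Rightarrow> if aut_order T = 3 then (1, - 1, - 1) else (hd (D_chain m (aut T)), - 2, - 1)
    | Type_E6 \<Rightarrow> (1, - 1, - 1))"

text \<open>\<open>C\<^sup>\<sigma>\<close>; the division is exact, as \<open>d\<^sub>i C\<^sup>\<sigma>\<^bsub>i,j\<^esub> = bform T i j\<close>.\<close>

fun affine_cartan :: "twisted_datum \<Rightarrow> affine_node \<Rightarrow> affine_node \<Rightarrow> int" where
  "affine_cartan T (Orbit i) (Orbit j) = 2 * bform T i j div bform T i i"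
| "affine_cartan T Eps (Orbit j) = (case affine_edge T of (p, c, c') \<Rightarrow> if j = p then c else 0)"
| "affine_cartan T (Orbit j) Eps = (case affine_edge T of (p, c, c') \<Rightarrow> if j = p then c' else 0)"
| "affine_cartan T Eps Eps = 2"

text \<open>\<open>2 d\<^sub>i\<close>; thus \<open>q\<^sub>i = q\<^bsup>d\<^sub>i\<^esup>\<close> is an integral power of \<open>sqrt_q\<close>.\<close>

fun two_d :: "twisted_datum \<Rightarrow> affine_node \<Rightarrow> int" where
  "two_d T (Orbit i) = bform T i i"
| "two_d T Eps = (case type_of T of Type_A m \<Rightarrow> if even m then 4 else 2 | _ \<Rightarrow> 2)"

definition qi :: "twisted_datum \<Rightarrow> affine_node \<Rightarrow> complex" where
  "qi T i = sqrt_q T powi two_d T i"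

definition affine_marks :: "twisted_datum \<Rightarrow> (affine_node \<Rightarrow> nat) \<Rightarrow> bool" where
  "affine_marks T a \<longleftrightarrow> a Eps = 1 \<and> (\<forall>i\<in>affine_nodes T. a i > 0) \<and>
    (\<forall>j\<in>affine_nodes T. (\<Sum>i\<in>affine_nodes T. int (a i) * two_d T i * affine_cartan T i j) = 0)"

definition q_int :: "complex \<Rightarrow> nat \<Rightarrow> complex" where
  "q_int p n = (p ^ n - inverse p ^ n) / (p - inverse p)"

definition q_fact :: "complex \<Rightarrow> nat \<Rightarrow> complex" where
  "q_fact p n = (\<Prod>k=1..n. q_int p k)"

definition q_binomial :: "complex \<Rightarrow> nat \<Rightarrow> nat \<Rightarrow> complex" where
  "q_binomial p n k = q_fact p n / (q_fact p k * q_fact p (n - k))"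

datatype pm = Plus | Minus

fun sgn_pm :: "pm \<Rightarrow> int" where
  "sgn_pm Plus = 1"
| "sgn_pm Minus = - 1"

datatype chevalley = Egen pm affine_node | Kgen affine_node | Kgen_inv affine_node

definition chevalley_gens :: "twisted_datum \<Rightarrow> chevalley set" where
  "chevalley_gens T = (\<Union>i\<in>affine_nodes T. {Egen Plus i, Egen Minus i, Kgen i, Kgen_inv i})"

text \<open>The product of the \<open>k\<^sub>i\<^bsup>a\<^sub>i\<^esup>\<close> needs an ordering of the nodes; as the \<open>k\<^sub>i\<close> commute, its choice
  does not matter.\<close>

definition affine_node_list :: "twisted_datum \<Rightarrow> affine_node list" where
  "affine_node_list T = Eps # map Orbit (sorted_list_of_set (rep T ` II T))"

definition chevalley_rels :: "twisted_datum \<Rightarrow> (affine_node \<Rightarrow> nat) \<Rightarrow> chevalley free_algebra set" where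
  "chevalley_rels T a =
    (\<Union>i\<in>affine_nodes T. {letter (Kgen i) * letter (Kgen_inv i) - 1, letter (Kgen_inv i) * letter (Kgen i) - 1}) \<union>
    (\<Union>i\<in>affine_nodes T. \<Union>j\<in>affine_nodes T.
      {letter (Kgen i) * letter (Kgen j) - letter (Kgen j) * letter (Kgen i)}) \<union>
    (\<Union>s. \<Union>i\<in>affine_nodes T. \<Union>j\<in>affine_nodes T.
      {letter (Kgen i) * letter (Egen s j)
        - scalar (qi T i powi (sgn_pm s * affine_cartan T i j)) * letter (Egen s j) * letter (Kgen i)}) \<union>
    (\<Union>i\<in>affine_nodes T. \<Union>j\<in>affine_nodes T.
      {letter (Egen Plus i) * letter (Egen Minus j) - letter (Egen Minus j) * letter (Egen Plus i)
        - (if i = j then scalar (1 / (qi T i - inverse (qi T i))) * (letter (Kgen i) - letter (Kgen_inv i))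
           else 0)}) \<union>
    (\<Union>s. \<Union>i\<in>affine_nodes T. \<Union>j\<in>affine_nodes T - {i}.
      {let n = nat (1 - affine_cartan T i j) in
        \<Sum>r=0..n. scalar ((- 1) ^ r * q_binomial (qi T i) n r)
          * letter (Egen s i) ^ (n - r) * letter (Egen s j) * letter (Egen s i) ^ r}) \<union>
    {prod_list (map (\<lambda>i. letter (Kgen i) ^ a i) (affine_node_list T)) - 1}"

definition quantum_loop_algebra ::
    "twisted_datum \<Rightarrow> (affine_node \<Rightarrow> nat) \<Rightarrow> (chevalley \<Rightarrow> 'u::complex_algebra_1) \<Rightarrow> bool" where
  "quantum_loop_algebra T a g \<longleftrightarrow> presented_by (chevalley_gens T) (chevalley_rels T a) g"

definition coproduct ::
    "twisted_datum \<Rightarrow> (chevalley \<Rightarrow> 'u::complex_algebra_1) \<Rightarrow> ('u \<Rightarrow> ('u, 'u) tensor) \<Rightarrow> bool" where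
  "coproduct T g \<Delta> \<longleftrightarrow> algebra_hom \<Delta> \<and>
    (\<forall>i\<in>affine_nodes T.
      \<Delta> (g (Kgen i)) = g (Kgen i) \<otimes> g (Kgen i) \<and>
      \<Delta> (g (Egen Plus i)) = g (Egen Plus i) \<otimes> 1 + g (Kgen i) \<otimes> g (Egen Plus i) \<and>
      \<Delta> (g (Egen Minus i)) = g (Egen Minus i) \<otimes> g (Kgen_inv i) + 1 \<otimes> g (Egen Minus i))"

text \<open>The coefficient of \<open>u\<^sup>m\<close> in \<open>exp (\<Sum>\<^bsub>l\<ge>1\<^esub> a\<^sub>l u\<^sup>l)\<close>: the \<open>n\<close>-th power of the exponent has no terms of
  degree below \<open>n\<close>.\<close>

definition exp_coeff :: "(nat \<Rightarrow> 'u::complex_algebra_1) \<Rightarrow> nat \<Rightarrow> 'u" where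
  "exp_coeff a m = (\<Sum>n\<le>m. (1 / fact n) *\<^sub>C fps_nth (Abs_fps (\<lambda>l. if l = 0 then 0 else a l) ^ n) m)"

fun phi :: "twisted_datum \<Rightarrow> (chevalley \<Rightarrow> 'u::complex_algebra_1) \<Rightarrow> (nat \<Rightarrow> int \<Rightarrow> 'u) \<Rightarrow>
    pm \<Rightarrow> nat \<Rightarrow> int \<Rightarrow> 'u" where
  "phi T g h Plus i m = (if m < 0 then 0 else
     g (Kgen (bar T i)) * exp_coeff (\<lambda>l. (qi T (bar T i) - inverse (qi T (bar T i))) *\<^sub>C h i (int l)) (nat m))"
| "phi T g h Minus i m = (if m > 0 then 0 else
     g (Kgen_inv (bar T i)) *
       exp_coeff (\<lambda>l. (- (qi T (bar T i) - inverse (qi T (bar T i)))) *\<^sub>C h i (- int l)) (nat (- m)))"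

text \<open>The relations of the Drinfeld generators for \<open>k\<^sub>i = k\<^bsub>\<sigma>(i)\<^esub>\<close> the class of \<open>Kgen (bar T i)\<close>. In the last
  clause but one, \<open>[s C\<^bsub>i,\<sigma>\<^sup>r(j)\<^esub> / d\<^sub>i]\<close> at \<open>q\<^sub>i\<close> is written out with \<open>q\<^sub>i\<^bsup>1/d\<^sub>i\<^esup> = q\<close>.\<close>

definition drinfeld_relations ::
    "twisted_datum \<Rightarrow> (chevalley \<Rightarrow> 'u::complex_algebra_1) \<Rightarrow>
     (pm \<Rightarrow> nat \<Rightarrow> int \<Rightarrow> 'u) \<Rightarrow> (nat \<Rightarrow> int \<Rightarrow> 'u) \<Rightarrow> bool" where
  "drinfeld_relations T g x h \<longleftrightarrow>
    (\<forall>s. \<forall>i\<in>II T. \<forall>m. x s (aut T i) m = (omega T powi m) *\<^sub>C x s i m) \<and>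
    (\<forall>i\<in>II T. \<forall>r. r \<noteq> 0 \<longrightarrow> h (aut T i) r = (omega T powi r) *\<^sub>C h i r) \<and>
    (\<forall>i\<in>II T. \<forall>j\<in>II T. \<forall>r t. r \<noteq> 0 \<longrightarrow> t \<noteq> 0 \<longrightarrow> h i r * h j t = h j t * h i r) \<and>
    (\<forall>i\<in>II T. \<forall>j\<in>II T. \<forall>r. r \<noteq> 0 \<longrightarrow> g (Kgen (bar T i)) * h j r = h j r * g (Kgen (bar T i))) \<and>
    (\<forall>s. \<forall>i\<in>II T. \<forall>j\<in>II T. \<forall>m.
      g (Kgen (bar T i)) * x s j m = (qq T powi (sgn_pm s * bform T i j)) *\<^sub>C (x s j m * g (Kgen (bar T i)))) \<and>
    (\<forall>s. \<forall>i\<in>II T. \<forall>j\<in>II T. \<forall>n l. n \<noteq> 0 \<longrightarrow>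
      h i n * x s j l - x s j l * h i n =
        (of_int (sgn_pm s) / of_int n *
          (\<Sum>r=1..aut_order T.
            (qq T powi (n * cartan (type_of T) i ((aut T ^^ r) j))
              - qq T powi (- (n * cartan (type_of T) i ((aut T ^^ r) j))))
            / (qi T (bar T i) - inverse (qi T (bar T i))) * omega T powi (n * int r)))
        *\<^sub>C x s j (n + l)) \<and>
    (\<forall>i\<in>II T. \<forall>j\<in>II T. \<forall>n l.
      x Plus i n * x Minus j l - x Minus j l * x Plus i n =
        ((\<Sum>r=1..aut_order T. if (aut T ^^ r) i = j then omega T powi (int r * l) else 0)
          / (if aut T i = i then of_nat (aut_order T) else 1)
          / (qi T (bar T i) - inverse (qi T (bar T i))))
        *\<^sub>C (phi T g h Plus i (n + l) - phi T g h Minus i (n + l)))"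

text \<open>Chevalley generators and Drinfeld generators are identified as follows. The commutation
  relations, the grading and \<open>x\<^bsub>i,0\<^esub>\<^sup>\<plusminus> = e\<^sub>i\<^sup>\<plusminus>\<close> alone do not determine the Drinfeld generators:
  conjugation (in a completion) by the ribbon element of the subalgebra generated by the \<open>e\<^sub>i\<^sup>\<plusminus>\<close>,
  \<open>k\<^sub>i\<^sup>\<plusminus>\<^sup>1\<close> with \<open>i \<noteq> \<epsilon>\<close> is an automorphism that respects all of these, but moves the other Drinfeld generators. What fixes them (up to
  \<open>x\<^bsub>i,m\<^esub>\<^sup>\<plusminus> \<mapsto> c\<^sup>m x\<^bsub>i,m\<^esub>\<^sup>\<plusminus>\<close>) is the formula expressing one of the \<open>x\<^bsub>i,1\<^esub>\<^sup>-\<close> and \<open>x\<^bsub>i,-1\<^esub>\<^sup>+\<close>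
  by iterated \<open>q\<close>-commutators, up to scalars: for \<open>j\<^sub>1,\<dots>,j\<^sub>p\<close> with \<open>\<delta> - \<alpha>\<^sub>i = \<alpha>\<^sub>\<epsilon> + \<alpha>\<^bsub>j\<^sub>1\<^esub> + \<dots> + \<alpha>\<^bsub>j\<^sub>p\<^esub>\<close> and all
  partial sums roots, \<open>x\<^bsub>i,1\<^esub>\<^sup>- = c [e\<^sup>+\<^bsub>j\<^sub>p\<^esub>, \<dots>, [e\<^sup>+\<^bsub>j\<^sub>1\<^esub>, e\<^sup>+\<^sub>\<epsilon>]]k\<^sub>i\<close> and \<open>x\<^bsub>i,-1\<^esub>\<^sup>+ = c' k\<^sub>i\<^sup>-\<^sup>1[[e\<^sup>-\<^sub>\<epsilon>, e\<^sup>-\<^bsub>j\<^sub>1\<^esub>], \<dots>, e\<^sup>-\<^bsub>j\<^sub>p\<^esub>]\<close>. For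
  \<open>u\<close> of weight \<open>\<beta>\<close> the brackets are \<open>[e\<^sup>+\<^sub>j, u] = e\<^sup>+\<^sub>j u - q\<^bsup>-(\<alpha>\<^sub>j,\<beta>)\<^esup> u e\<^sup>+\<^sub>j\<close> and
  \<open>[u, e\<^sup>-\<^sub>j] = u e\<^sup>-\<^sub>j - q\<^bsup>-(\<alpha>\<^sub>j,\<beta>)\<^esup> e\<^sup>-\<^sub>j u\<close>, the power of \<open>q\<close> being produced by conjugation with \<open>k\<^sub>j\<close>.\<close>

definition bracket_plus :: "(chevalley \<Rightarrow> 'u::complex_algebra_1) \<Rightarrow> nat \<Rightarrow> 'u \<Rightarrow> 'u" where
  "bracket_plus g j u =
    g (Egen Plus (Orbit j)) * u - g (Kgen_inv (Orbit j)) * u * g (Kgen (Orbit j)) * g (Egen Plus (Orbit j))"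

definition bracket_minus :: "(chevalley \<Rightarrow> 'u::complex_algebra_1) \<Rightarrow> nat \<Rightarrow> 'u \<Rightarrow> 'u" where
  "bracket_minus g j u =
    u * g (Egen Minus (Orbit j)) - g (Egen Minus (Orbit j)) * g (Kgen_inv (Orbit j)) * u * g (Kgen (Orbit j))"

text \<open>The node \<open>i\<close> and the list \<open>j\<^sub>1,\<dots>,j\<^sub>p\<close>.\<close>

definition root_path :: "twisted_datum \<Rightarrow> nat \<times> nat list" where
  "root_path T = (case type_of T of
      Type_A m \<Rightarrow> if even m then (1, [1..<Suc (m div 2)] @ rev [2..<Suc (m div 2)])
             else (1, [2..<Suc m div 2] @ rev [2..<Suc (Suc m div 2)])
    | Type_D m \<Rightarrow> if aut_order T = 3 then (1, [1, 2])
             else (last (D_chain m (aut T)), butlast (D_chain m (aut T)))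
    | Type_E6 \<Rightarrow> (1, [1, 3, 4, 2, 3, 4, 3]))"

definition drinfeld_identification ::
    "twisted_datum \<Rightarrow> (chevalley \<Rightarrow> 'u::complex_algebra_1) \<Rightarrow> (pm \<Rightarrow> nat \<Rightarrow> int \<Rightarrow> 'u) \<Rightarrow> bool" where
  "drinfeld_identification T g x \<longleftrightarrow>
    (\<forall>s. \<forall>i\<in>rep T ` II T. x s i 0 = g (Egen s (Orbit i))) \<and>
    (case root_path T of (i, js) \<Rightarrow> \<exists>c c'.
      x Minus i 1 = c *\<^sub>C (fold (bracket_plus g) js (g (Egen Plus Eps)) * g (Kgen (Orbit i))) \<and>
      x Plus i (- 1) = c' *\<^sub>C (g (Kgen_inv (Orbit i)) * fold (bracket_minus g) js (g (Egen Minus Eps))))"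

definition drinfeld_grading ::
    "twisted_datum \<Rightarrow> (chevalley \<Rightarrow> 'u::complex_algebra_1) \<Rightarrow>
     (pm \<Rightarrow> nat \<Rightarrow> int \<Rightarrow> 'u) \<Rightarrow> (nat \<Rightarrow> int \<Rightarrow> 'u) \<Rightarrow> (int \<Rightarrow> 'u set) \<Rightarrow> bool" where
  "drinfeld_grading T g x h V \<longleftrightarrow> algebra_grading V \<and>
    (\<forall>s. \<forall>i\<in>II T. \<forall>m. x s i m \<in> V m) \<and> (\<forall>i\<in>II T. \<forall>r. r \<noteq> 0 \<longrightarrow> h i r \<in> V r) \<and>
    (\<forall>i\<in>II T. g (Kgen (bar T i)) \<in> V 0) \<and> (\<forall>s. g (Egen s Eps) \<in> V (sgn_pm s))"

definition drinfeld_generators ::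
    "twisted_datum \<Rightarrow> (chevalley \<Rightarrow> 'u::complex_algebra_1) \<Rightarrow>
     (pm \<Rightarrow> nat \<Rightarrow> int \<Rightarrow> 'u) \<Rightarrow> (nat \<Rightarrow> int \<Rightarrow> 'u) \<Rightarrow> bool" where
  "drinfeld_generators T g x h \<longleftrightarrow>
    drinfeld_relations T g x h \<and>
    drinfeld_identification T g x \<and>
    generated_algebra ({x s i m | s i m. i \<in> II T} \<union> {h i r | i r. i \<in> II T \<and> r \<noteq> 0} \<union>
      {g (Kgen (bar T i)) | i. i \<in> II T} \<union> {g (Kgen_inv (bar T i)) | i. i \<in> II T}) = UNIV \<and>
    (\<exists>V. drinfeld_grading T g x h V)"

definition X_plus :: "twisted_datum \<Rightarrow> (pm \<Rightarrow> nat \<Rightarrow> int \<Rightarrow> 'u::complex_algebra_1) \<Rightarrow> 'u set" where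
  "X_plus T x = complex_vector.span {x Plus j m | j m. j \<in> II T}"

definition cong_X_plus :: "twisted_datum \<Rightarrow> (pm \<Rightarrow> nat \<Rightarrow> int \<Rightarrow> 'u::complex_algebra_1) \<Rightarrow>
    ('u, 'u) tensor \<Rightarrow> ('u, 'u) tensor \<Rightarrow> bool" where
  "cong_X_plus T x y z \<longleftrightarrow> y - z \<in> complex_vector.span {a \<otimes> (b * c) | a b c. c \<in> X_plus T x}"

end

(*
  The generators x_{j,m} arise from e_j and f_j by repeated commutators with one element u of the
  commutative part: u = k_j^-1 phi_{j,1} if j is not fixed by the diagram automorphism, and otherwise
  u = k_i^-1 phi_{i,M} for the node i preceding j in the chain of representatives. So it suffices to
  know the coproduct of u up to terms a (x) b with the weight of b not bounded by alpha_j. Such terms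
  do not matter: by the triangular decomposition every element of a weight that is not <= 0 lies in
  U X^+. What remains is
      1 (x) u + u (x) 1 + D_j [u, f_j] (x) e_j    (for fixed j, plus products of commuting elements),
  with D_j = q_j - q_j^-1, and the formulas for x_{j,m} follow by induction on m, those for phi from
  [e_j, x^-_{j,m}].

  For the coproduct of u, the bracket formula for x^-_{1,1} gives a coproduct
  K (x) F + (sum over words w of r_w (x) e_w). The coefficients r_w form an element X of a free algebra
  over U; commutation with the f_a becomes a skew derivation of X, and the vanishing of the k_a^-1
  component of [F, f_a] becomes a differential equation L_a X = 0. As the orbits form a chain, this
  equation determines the components of X that matter. Passing to the opposite algebra with e and f
  exchanged gives the elements of negative degree.
*)

theory Submission
  imports Defs
begin

section \<open>Words with noncommuting coefficients\<close>

text \<open>The monomials in the \<open>e b\<close> are linearly dependent, so a coproduct does not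
  determine its coefficients. Carrying a formal lift through every bracket gives the derivation and
  the equation \<open>L a X = 0\<close> a meaning without a basis of the positive part. In these
  computations the relations among the \<open>e b\<close> enter only when a lift is evaluated, and
  only as commutation of non-neighbours: the weight bounds leave words without repeated letters. The
  obstacle is that U \<otimes> U X^+ is a left ideal only, and that a commutator with
  \<open>f j\<close> lowers second weights by \<alpha>_j; an error term must exceed zero with
  \<alpha>_j to spare. Passing from \<open>psi a M\<close> to \<open>psi (Suc a) M\<close> uses up
  this room at \<open>Suc a\<close>: the term with \<open>e (Suc a)\<close> is afterwards
  indistinguishable from the error. Hence a fixed node is shifted by the series of its predecessor,
  not by its own. At the border between the two kinds of nodes the bound grants one unit at every
  remaining node, and the words it admits must be understood: those in fixed letters vanish, those
  that also contain the last non-fixed letter have coefficients commuting with the x^+ at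
  hand.\<close>

lemma single_central:
  "f * Poly_Mapping.single 0 (c *\<^sub>C (1::'u::complex_algebra_1)) =
    Poly_Mapping.single 0 (c *\<^sub>C 1) * (f :: 'k::monoid_add \<Rightarrow>\<^sub>0 'u)"
  by (induct f rule: poly_mapping_additive_induct)
    (simp_all add: mult_single distrib_left distrib_right mult_scaleC_left mult_scaleC_right)

text \<open>Substitutions with values in the word algebra itself, such as \<open>tau\<close> and
  \<open>delete_letter\<close>, and evaluations in a tensor product can then be treated by one
  locale, \<open>word_subst\<close>. Scalars act through constants on the empty word, which are
  central by \<open>single_central\<close>.\<close>

instantiation poly_mapping :: (monoid_add, complex_algebra_1) complex_algebra_1
begin

definition scaleC_poly_mapping :: "complex \<Rightarrow> ('a \<Rightarrow>\<^sub>0 'b) \<Rightarrow> 'a \<Rightarrow>\<^sub>0 'b" where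
  "scaleC_poly_mapping c f = Poly_Mapping.single 0 (c *\<^sub>C 1) * f"

instance
proof
  fix x y :: "'a \<Rightarrow>\<^sub>0 'b" and c d :: complex
  show "c *\<^sub>C (x + y) = c *\<^sub>C x + c *\<^sub>C y"
    by (simp add: scaleC_poly_mapping_def distrib_left)
  show "(c + d) *\<^sub>C x = c *\<^sub>C x + d *\<^sub>C x"
    by (simp add: scaleC_poly_mapping_def distrib_right scaleC_add_left single_add)
  show "c *\<^sub>C d *\<^sub>C x = (c * d) *\<^sub>C x"
    by (simp add: scaleC_poly_mapping_def mult.assoc[symmetric] mult_single mult_scaleC_left scaleC_scaleC)
  show "1 *\<^sub>C x = x" by (simp add: scaleC_poly_mapping_def scaleC_one)
  show "(c *\<^sub>C x) * y = c *\<^sub>C (x * y)" by (simp add: scaleC_poly_mapping_def mult.assoc)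
  show "x * (c *\<^sub>C y) = c *\<^sub>C (x * y)"
    by (simp add: scaleC_poly_mapping_def mult.assoc[symmetric] single_central)
qed

end

lemmas scaleC_right_diff = complex_vector.scale_right_diff_distrib

lemma scaleC_single:
  "c *\<^sub>C Poly_Mapping.single k r = Poly_Mapping.single k (c *\<^sub>C (r::'u::complex_algebra_1))"
  for k :: "'k::monoid_add"
  by (simp add: scaleC_poly_mapping_def mult_single mult_scaleC_left)

lemma lookup_scaleC [simp]:
  "Poly_Mapping.lookup (c *\<^sub>C X) k = c *\<^sub>C Poly_Mapping.lookup (X :: 'k::monoid_add \<Rightarrow>\<^sub>0 'u::complex_algebra_1) k"
  by (induct X rule: poly_mapping_additive_induct)
    (simp_all add: scaleC_add_right scaleC_single lookup_add lookup_single when_def)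

lemmas scaleC_mult = mult_scaleC_left mult_scaleC_right

definition plift :: "('k \<Rightarrow> 'c::zero \<Rightarrow> 'm::comm_monoid_add) \<Rightarrow> ('k \<Rightarrow>\<^sub>0 'c) \<Rightarrow> 'm" where
  "plift \<phi> X = (\<Sum>w\<in>Poly_Mapping.keys X. \<phi> w (Poly_Mapping.lookup X w))"

locale additive_family =
  fixes \<phi> :: "'k \<Rightarrow> 'c::ab_group_add \<Rightarrow> 'm::ab_group_add"
  assumes fam_add: "\<phi> w (r + s) = \<phi> w r + \<phi> w s"
begin

lemma fam_zero [simp]: "\<phi> w 0 = 0" using fam_add[of w 0 0] by simp

lemma plift_superset:
  assumes "finite S" "Poly_Mapping.keys X \<subseteq> S"
  shows "plift \<phi> X = (\<Sum>w\<in>S. \<phi> w (Poly_Mapping.lookup X w))"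
  unfolding plift_def using assms by (intro sum.mono_neutral_left) (auto simp: in_keys_iff)

lemma add: "plift \<phi> (X + Y) = plift \<phi> X + plift \<phi> Y"
  using Poly_Mapping.keys_add[of X Y]
  by (simp add: plift_superset[of "Poly_Mapping.keys X \<union> Poly_Mapping.keys Y"] lookup_add fam_add sum.distrib)

lemma zero: "plift \<phi> 0 = 0" by (simp add: plift_def)

lemma single: "plift \<phi> (Poly_Mapping.single w r) = \<phi> w r"
  by (simp add: plift_superset[of "{w}"])

lemma diff: "plift \<phi> (X - Y) = plift \<phi> X - plift \<phi> Y"
  using add[of "X - Y" Y] by simp

lemma sum: "plift \<phi> (\<Sum>i\<in>S. X i) = (\<Sum>i\<in>S. plift \<phi> (X i))"
  by (induct S rule: infinite_finite_induct) (simp_all add: zero add)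

end

definition cst :: "'u::complex_algebra_1 \<Rightarrow> nat word \<Rightarrow>\<^sub>0 'u" where
  "cst r = Poly_Mapping.single 0 r"

definition lett :: "nat \<Rightarrow> nat word \<Rightarrow>\<^sub>0 'u::complex_algebra_1" where
  "lett b = Poly_Mapping.single (Word [b]) 1"

definition wmono :: "nat list \<Rightarrow> nat word \<Rightarrow>\<^sub>0 'u::complex_algebra_1" where
  "wmono w = Poly_Mapping.single (Word w) 1"

lemma cst_simps: "cst 0 = 0" "cst 1 = 1" "cst (r + s) = cst r + cst s" "cst (r - s) = cst r - cst s"
   "cst (r * s) = cst r * cst s" "cst (c *\<^sub>C r) = c *\<^sub>C cst r" "cst (- r) = - cst r"
  by (simp_all add: cst_def single_add single_diff mult_single scaleC_single single_uminus)

lemma cst_lett: "lett b * cst r = cst r * lett b"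
  by (simp add: cst_def lett_def mult_single)

lemma mono_simps: "wmono [] = 1" "wmono (b # w) = lett b * wmono w"
  by (simp_all add: wmono_def lett_def mult_single plus_word_def flip: zero_word_def)

lemma mono_append: "wmono (u @ v) = wmono u * wmono v"
  by (simp add: wmono_def mult_single plus_word_def)

lemma single_eq_mono: "Poly_Mapping.single w r = cst r * wmono (letters w)"
  by (cases w) (simp add: cst_def wmono_def mult_single)

text \<open>Coefficients commute with letters, so a monomial with its coefficient is built from a
  constant by multiplying letters on the left.\<close>

lemma words_induct [case_names const letter sum]:
  fixes X :: "nat word \<Rightarrow>\<^sub>0 'u::complex_algebra_1"
  assumes "\<And>r. P (cst r)" "\<And>b X. P X \<Longrightarrow> P (lett b * X)" "\<And>X Y. P X \<Longrightarrow> P Y \<Longrightarrow> P (X + Y)"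
  shows "P X"
proof (induct X rule: poly_mapping_additive_induct)
  case zero show ?case using assms(1)[of 0] by (simp add: cst_simps)
next
  case (single w r)
  have "P (cst r * wmono v)" for v
  proof (induct v)
    case Nil show ?case using assms(1) by (simp add: mono_simps)
  next
    case (Cons b v)
    have "cst r * wmono (b # v) = lett b * (cst r * wmono v)"
      by (simp add: mono_simps mult.assoc[symmetric] cst_lett)
    then show ?case using assms(2)[OF Cons] by simp
  qed
  then show ?case by (simp add: single_eq_mono)
qed (rule assms(3))

definition wsubst :: "('u::complex_algebra_1 \<Rightarrow> 'b::complex_algebra_1) \<Rightarrow> (nat \<Rightarrow> 'b) \<Rightarrow> (nat word \<Rightarrow>\<^sub>0 'u) \<Rightarrow> 'b" where
  "wsubst \<phi> \<psi> = plift (\<lambda>w r. \<phi> r * prod_list (map \<psi> (letters w)))"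

locale word_subst =
  fixes \<phi> :: "'u::complex_algebra_1 \<Rightarrow> 'b::complex_algebra_1" and \<psi> :: "nat \<Rightarrow> 'b"
  assumes hom: "algebra_hom \<phi>" and commute: "\<psi> b * \<phi> r = \<phi> r * \<psi> b"
begin

abbreviation "h \<equiv> wsubst \<phi> \<psi>"

sublocale fam: additive_family "\<lambda>w r. \<phi> r * prod_list (map \<psi> (letters w))"
  by unfold_locales (use hom in \<open>simp add: algebra_hom_def distrib_right\<close>)

lemma add: "h (X + Y) = h X + h Y" and zero: "h 0 = 0" and diff: "h (X - Y) = h X - h Y"
  unfolding wsubst_def by (rule fam.add fam.zero fam.diff)+

lemma cst: "h (cst r) = \<phi> r"
  by (simp add: wsubst_def cst_def fam.single zero_word_def)

lemma wsingle: "h (Poly_Mapping.single (Word w) r) = \<phi> r * prod_list (map \<psi> w)"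
  by (simp add: wsubst_def fam.single)

lemma lett_mult: "h (lett b * X) = \<psi> b * h X"
proof (induct X rule: poly_mapping_additive_induct)
  case (single w r)
  have "lett b * Poly_Mapping.single w r = Poly_Mapping.single (Word (b # letters w)) r"
    by (simp add: lett_def mult_single plus_word_def)
  then show ?case using commute[of b r] by (cases w) (simp add: wsingle mult.assoc[symmetric])
qed (simp_all add: zero add distrib_left)

lemma cst_mult: "h (cst r * X) = \<phi> r * h X"
proof (induct X rule: poly_mapping_additive_induct)
  case (single w s)
  have "cst r * Poly_Mapping.single w s = Poly_Mapping.single w (r * s)"
    by (simp add: cst_def mult_single)
  then show ?case using hom by (cases w) (simp add: wsingle algebra_hom_def mult.assoc)
qed (simp_all add: zero add distrib_left)

lemma mult: "h (X * Y) = h X * h Y"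
proof (induct X rule: words_induct)
  case (const r) show ?case by (simp add: cst_mult cst)
next
  case (letter b X) then show ?case by (simp add: lett_mult mult.assoc)
next
  case (sum X X') then show ?case by (simp add: distrib_right add)
qed

lemma lett: "h (lett b) = \<psi> b"
  using wsingle[of "[b]" 1] hom by (simp add: lett_def algebra_hom_def)

lemma one: "h 1 = 1"
  using cst[of 1] hom by (simp add: cst_simps algebra_hom_def)

lemma scaleC: "h (c *\<^sub>C X) = c *\<^sub>C h X"
proof -
  have "c *\<^sub>C X = cst (c *\<^sub>C 1) * X" by (simp add: cst_simps scaleC_mult)
  then show ?thesis using hom by (simp add: cst_mult algebra_hom_def scaleC_mult)
qed

lemmas simps = add zero diff cst lett mult one scaleC

end

text \<open>For \<open>\<kappa> b = q powi B a b\<close> this is conjugation by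
  \<open>1 \<odot> k a\<close> on lifts, and for the opposite exponents conjugation by
  \<open>1 \<odot> kinv a\<close>; see \<open>k_ev\<close> and \<open>kinv_ev\<close>.\<close>

definition tau :: "(nat \<Rightarrow> complex) \<Rightarrow> (nat word \<Rightarrow>\<^sub>0 'u) \<Rightarrow> nat word \<Rightarrow>\<^sub>0 'u::complex_algebra_1" where
  "tau \<kappa> = wsubst cst (\<lambda>b. \<kappa> b *\<^sub>C lett b)"

interpretation tau: word_subst cst "\<lambda>b. \<kappa> b *\<^sub>C lett b"
  rewrites "wsubst cst (\<lambda>b. \<kappa> b *\<^sub>C lett b) = tau \<kappa>" for \<kappa>
  by (unfold_locales, simp_all add: algebra_hom_def cst_simps scaleC_mult cst_lett tau_def)

lemma tau_mono: "tau \<kappa> (wmono v) = prod_list (map \<kappa> v) *\<^sub>C wmono v"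
  by (induct v) (simp_all add: mono_simps tau.simps scaleC_mult scaleC_scaleC scaleC_one)

lemma lookup_tau: "Poly_Mapping.lookup (tau \<kappa> X) w = prod_list (map \<kappa> (letters w)) *\<^sub>C Poly_Mapping.lookup X w"
proof (induct X rule: poly_mapping_additive_induct)
  case (single v r)
  have "tau \<kappa> (Poly_Mapping.single v r) = Poly_Mapping.single v (prod_list (map \<kappa> (letters v)) *\<^sub>C r)"
    by (simp add: single_eq_mono[of v] tau.simps tau_mono cst_simps scaleC_mult)
  then show ?case by (simp add: lookup_single when_def)
qed (simp_all add: tau.simps lookup_add scaleC_add_right)

lemma tau_tau: "tau \<kappa> (tau \<kappa>' X) = tau (\<lambda>b. \<kappa> b * \<kappa>' b) X"
  by (induct X rule: words_induct)
    (simp_all add: tau.simps scaleC_mult scaleC_scaleC mult.commute)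

lemma tau_commute: "tau \<kappa> (tau \<kappa>' X) = tau \<kappa>' (tau \<kappa> X)"
  by (simp add: tau_tau mult.commute)

lemma tau_one: "tau (\<lambda>_. 1) X = X"
  by (induct X rule: words_induct) (simp_all add: tau.simps scaleC_one)

fun skew_list :: "(nat \<Rightarrow> complex) \<Rightarrow> nat \<Rightarrow> nat list \<Rightarrow> nat word \<Rightarrow>\<^sub>0 'u::complex_algebra_1" where
  "skew_list \<kappa> a [] = 0"
| "skew_list \<kappa> a (b # v) = lett b * skew_list \<kappa> a v + (if b = a then tau \<kappa> (wmono v) else 0)"

text \<open>The skew derivation of the free algebra with \<open>x\<^sub>b \<mapsto> \<delta>\<^bsub>a,b\<^esub>\<close>.\<close>

definition skew :: "(nat \<Rightarrow> complex) \<Rightarrow> nat \<Rightarrow> (nat word \<Rightarrow>\<^sub>0 'u) \<Rightarrow> nat word \<Rightarrow>\<^sub>0 'u::complex_algebra_1" where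
  "skew \<kappa> a = plift (\<lambda>w r. cst r * skew_list \<kappa> a (letters w))"

interpretation skew: additive_family "\<lambda>w r. cst r * skew_list \<kappa> a (letters w)"
  rewrites "plift (\<lambda>w r. cst r * skew_list \<kappa> a (letters w)) = skew \<kappa> a" for \<kappa> a
  by (unfold_locales, simp_all add: cst_simps distrib_right skew_def)

lemma skew_single: "skew \<kappa> a (Poly_Mapping.single (Word w) r) = cst r * skew_list \<kappa> a w"
  by (simp add: skew.single)

lemma skew_cst: "skew \<kappa> a (cst r) = 0"
  by (simp add: cst_def skew.single zero_word_def)

lemma skew_cst_mult: "skew \<kappa> a (cst r * X) = cst r * skew \<kappa> a X"
  by (induct X rule: poly_mapping_additive_induct)
    (simp_all add: skew.zero skew.add skew.single distrib_left, simp add: cst_def mult_single skew.single mult.assoc[symmetric])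

lemma skew_lett_mult: "skew \<kappa> a (lett b * X) = lett b * skew \<kappa> a X + (if b = a then tau \<kappa> X else 0)"
proof (induct X rule: poly_mapping_additive_induct)
  case (single w r)
  have "lett b * Poly_Mapping.single w r = Poly_Mapping.single (Word (b # letters w)) r"
    by (simp add: lett_def mult_single plus_word_def)
  then have "skew \<kappa> a (lett b * Poly_Mapping.single w r) = cst r * skew_list \<kappa> a (b # letters w)"
    by (simp only: skew_single)
  moreover have "skew \<kappa> a (Poly_Mapping.single w r) = cst r * skew_list \<kappa> a (letters w)"
    by (rule skew.single)
  moreover have "tau \<kappa> (Poly_Mapping.single w r) = cst r * tau \<kappa> (wmono (letters w))"
    by (simp add: single_eq_mono[of w] tau.simps)
  ultimately show ?case by (simp add: distrib_left mult.assoc[symmetric] cst_lett)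
qed (simp_all add: skew.zero skew.add distrib_left tau.simps)

lemma skew_mult: "skew \<kappa> a (X * Y) = X * skew \<kappa> a Y + skew \<kappa> a X * tau \<kappa> Y"
proof (induct X rule: words_induct)
  case (const r) show ?case by (simp add: skew_cst_mult skew_cst)
next
  case (letter b X)
  then show ?case by (simp add: skew_lett_mult mult.assoc distrib_left distrib_right tau.simps)
next
  case (sum X X') then show ?case by (simp add: distrib_right distrib_left skew.add algebra_simps)
qed

lemma skew_one: "skew \<kappa> a 1 = 0"
  using skew_cst[of \<kappa> a 1] by (simp add: cst_simps)

lemma skew_lett: "skew \<kappa> a (lett b) = (if b = a then 1 else 0 :: nat word \<Rightarrow>\<^sub>0 'u::complex_algebra_1)"
  using skew_lett_mult[of \<kappa> a b "1 :: nat word \<Rightarrow>\<^sub>0 'u"] by (simp add: skew_one tau.one)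

lemma skew_mult_cst: "skew \<kappa> a (X * cst r) = skew \<kappa> a X * cst r"
  by (simp add: skew_mult skew_cst tau.simps)

lemma skew_scaleC: "skew \<kappa> a (c *\<^sub>C X) = c *\<^sub>C skew \<kappa> a X"
proof -
  have *: "c *\<^sub>C Y = cst (c *\<^sub>C 1) * Y" for Y :: "nat word \<Rightarrow>\<^sub>0 'u::complex_algebra_1"
    by (simp add: cst_simps scaleC_mult)
  show ?thesis unfolding * by (rule skew_cst_mult)
qed

lemma skew_tau: "skew \<kappa> a (tau \<kappa>' X) = \<kappa>' a *\<^sub>C tau \<kappa>' (skew \<kappa> a X)"
proof (induct X rule: words_induct)
  case (const r) show ?case by (simp add: tau.simps skew_cst)
next
  case (letter b X)
  then show ?case
    by (simp add: tau.simps skew_scaleC skew_lett_mult scaleC_mult scaleC_add_right scaleC_scaleC tau_commute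
        mult.commute)
next
  case (sum X Y) then show ?case by (simp add: tau.simps skew.add scaleC_add_right)
qed

text \<open>Both sides delete one \<open>a\<close> and one \<open>b\<close>. In a word with
  \<open>a\<close> left of \<open>b\<close>, deleting \<open>a\<close> first costs an extra
  \<open>\<kappa>' b\<close>; in a word with \<open>b\<close> left of \<open>a\<close>, deleting
  \<open>b\<close> first costs an extra \<open>\<kappa> a\<close>. One scalar serves both cases
  because \<open>\<kappa> a * \<kappa>' b = 1\<close>.\<close>

lemma skew_skew:
  assumes "\<kappa> a * \<kappa>' b = 1"
  shows "skew \<kappa> b (skew \<kappa>' a X) = \<kappa>' b *\<^sub>C skew \<kappa>' a (skew \<kappa> b X)"
proof (induct X rule: words_induct)
  case (const r) show ?case by (simp add: skew_cst skew.zero)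
next
  case (letter c X)
  then show ?case
    using assms by (auto simp: skew_lett_mult skew.add skew.zero skew_tau distrib_left scaleC_add_right
        mult_scaleC_right scaleC_scaleC scaleC_one mult.commute)
next
  case (sum X Y) then show ?case by (simp add: skew.add scaleC_add_right)
qed

section \<open>Coproducts of iterated brackets\<close>

lemma algebra_homD:
  assumes "algebra_hom \<phi>"
  shows "\<phi> (x + y) = \<phi> x + \<phi> y" "\<phi> (x * y) = \<phi> x * \<phi> y" "\<phi> 1 = 1" "\<phi> (c *\<^sub>C x) = c *\<^sub>C \<phi> x"
    "\<phi> 0 = 0" "\<phi> (x - y) = \<phi> x - \<phi> y" "\<phi> (- x) = - \<phi> x"
proof -
  show *: "\<phi> (x + y) = \<phi> x + \<phi> y" "\<phi> (x * y) = \<phi> x * \<phi> y" "\<phi> 1 = 1" "\<phi> (c *\<^sub>C x) = c *\<^sub>C \<phi> x" for x y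
    using assms by (simp_all add: algebra_hom_def)
  show 0: "\<phi> 0 = 0" using *(1)[of 0 0] by simp
  show "\<phi> (x - y) = \<phi> x - \<phi> y" using *(1)[of "x - y" y] by simp
  show "\<phi> (- x) = - \<phi> x" using *(1)[of "- x" x] 0 by (simp add: eq_neg_iff_add_eq_0)
qed

text \<open>The coefficient of the empty word, see \<open>aug_lookup\<close>. On an evaluated lift
  it is the effect of id \<otimes> counit, and so it recovers an element from the lift of its
  coproduct.\<close>

definition aug :: "(nat word \<Rightarrow>\<^sub>0 'u) \<Rightarrow> 'u::complex_algebra_1" where
  "aug = wsubst (\<lambda>r. r) (\<lambda>_. 0)"

interpretation aug: word_subst "\<lambda>r. r" "\<lambda>_. 0"
  rewrites "wsubst (\<lambda>r. r) (\<lambda>_. 0) = aug"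
  by (unfold_locales, simp_all add: algebra_hom_def aug_def)

lemma aug_tau: "aug (tau \<kappa> X) = aug X"
  by (induct X rule: words_induct) (simp_all add: tau.simps aug.simps)

text \<open>Only words of length one contribute, and on these the derivation has no further letter
  to twist.\<close>

lemma aug_skew: "aug (skew \<kappa> a X) = aug (skew \<kappa>' a X)"
  by (induct X rule: words_induct) (simp_all add: skew_cst skew_lett_mult skew.add aug.simps aug_tau)

definition simple_root :: "nat \<Rightarrow> nat \<Rightarrow> int" where
  "simple_root a b = (if b = a then 1 else 0)"

text \<open>The Chevalley generators of a quantum group with a coproduct into an algebra that receives two
  commuting copies of it. The type of the target is kept abstract so that the locale also applies to
  the opposite algebra.\<close>

locale coproduct_data =
  fixes N :: nat and B :: "nat \<Rightarrow> nat \<Rightarrow> int" and q :: complex and D :: "nat \<Rightarrow> complex"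
    and e f k kinv :: "nat \<Rightarrow> 'u::complex_algebra_1"
    and tp :: "'u \<Rightarrow> 'u \<Rightarrow> 'b::complex_algebra_1"  (infixr "\<odot>" 72) and \<Delta> :: "'u \<Rightarrow> 'b"
  assumes q_nz: "q \<noteq> 0" and B_sym: "B a b = B b a" and B_out: "b \<ge> N \<Longrightarrow> B a b = 0"
    and tp_add_left: "(u + u') \<odot> v = u \<odot> v + u' \<odot> v" and tp_add_right: "u \<odot> (v + v') = u \<odot> v + u \<odot> v'"
    and tp_scale_left: "(c *\<^sub>C u) \<odot> v = c *\<^sub>C (u \<odot> v)" and tp_scale_right: "u \<odot> (c *\<^sub>C v) = c *\<^sub>C (u \<odot> v)"
    and tp_mult: "(u \<odot> v) * (u' \<odot> v') = (u * u') \<odot> (v * v')" and tp_one: "1 \<odot> 1 = 1"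
    and hom_\<Delta>: "algebra_hom \<Delta>"
    and k_kinv: "k a * kinv a = 1" and kinv_k: "kinv a * k a = 1" and k_k: "k a * k b = k b * k a"
    and k_e: "k a * e b = q powi B a b *\<^sub>C (e b * k a)"
    and k_f: "k a * f b = q powi (- B a b) *\<^sub>C (f b * k a)"
    and D_nz: "D a \<noteq> 0"
    and e_f: "e a * f b - f b * e a = (if a = b then (1 / D a) *\<^sub>C (k a - kinv a) else 0)"
    and \<Delta>_e: "\<Delta> (e a) = e a \<odot> 1 + k a \<odot> e a"
    and \<Delta>_f: "\<Delta> (f a) = f a \<odot> kinv a + 1 \<odot> f a"
    and \<Delta>_k: "\<Delta> (k a) = k a \<odot> k a"
begin

lemmas \<Delta> = algebra_homD[OF hom_\<Delta>]

lemma tp_zero [simp]: "0 \<odot> v = 0" "u \<odot> 0 = 0"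
  using tp_scale_left[of 0] tp_scale_right[of _ 0] by simp_all

lemma tp_diff_left: "(u - u') \<odot> v = u \<odot> v - u' \<odot> v"
  using tp_add_left[of "u - u'" u' v] by simp

lemma tp_diff_right: "u \<odot> (v - v') = u \<odot> v - u \<odot> v'"
  using tp_add_right[of u "v - v'" v'] by simp

lemmas tp_linear = tp_add_left tp_add_right tp_diff_left tp_diff_right tp_scale_left tp_scale_right

lemma tp_mult_assoc: "X * (u \<odot> v) * (u' \<odot> v') = X * ((u * u') \<odot> (v * v'))"
  by (simp add: mult.assoc tp_mult)

lemmas tp_simps = tp_linear tp_mult tp_mult_assoc

definition wt :: "nat \<Rightarrow> (nat \<Rightarrow> int) \<Rightarrow> int" where
  "wt a \<beta> = (\<Sum>b<N. B a b * \<beta> b)"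

lemma wt_add: "wt a (\<lambda>b. \<beta> b + \<gamma> b) = wt a \<beta> + wt a \<gamma>"
  by (simp add: wt_def distrib_left sum.distrib)

lemma wt_diff: "wt a (\<lambda>b. \<beta> b - \<gamma> b) = wt a \<beta> - wt a \<gamma>"
  by (simp add: wt_def right_diff_distrib sum_subtractf)

lemma wt_minus: "wt a (\<lambda>b. - \<beta> b) = - wt a \<beta>"
  by (simp add: wt_def sum_negf)

lemma wt_zero: "wt a (\<lambda>b. 0) = 0"
  by (simp add: wt_def)

lemma wt_simple_root: "wt a (simple_root t) = B a t"
  by (cases "t < N") (simp_all add: wt_def simple_root_def if_distrib[of "\<lambda>x. _ * x"] B_out sum.delta cong: if_cong)

lemmas wt_simps = wt_add wt_diff wt_minus wt_zero wt_simple_root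

lemma wt_sum_list: "wt a (\<lambda>b. \<Sum>t\<leftarrow>ts. simple_root t b) = (\<Sum>t\<leftarrow>ts. B a t)"
  by (induct ts) (simp_all add: wt_simps)

lemma q_add: "q powi (m + n) = q powi m * q powi n"
  using q_nz by (simp add: power_int_add)

lemma q_minus: "q powi m * q powi (- m) = 1" "q powi (- m) * q powi m = 1"
  using q_nz by (simp_all add: power_int_minus)

abbreviation "P a b \<equiv> q powi B a b"
abbreviation "Pm a b \<equiv> q powi (- B a b)"

lemma kinv_comm:
  assumes "k a * u = q powi m *\<^sub>C (u * k a)"
  shows "kinv a * u = q powi (- m) *\<^sub>C (u * kinv a)"
proof -
  have "u * kinv a = kinv a * (k a * u) * kinv a" by (simp add: mult.assoc[symmetric] kinv_k)
  also have "\<dots> = q powi m *\<^sub>C (kinv a * u)"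
    by (simp add: assms scaleC_mult mult.assoc k_kinv)
  finally show ?thesis by (simp add: scaleC_scaleC q_minus scaleC_one)
qed

lemma kinv_e: "kinv a * e b = Pm a b *\<^sub>C (e b * kinv a)" by (rule kinv_comm[OF k_e])

lemma kinv_f: "kinv a * f b = P a b *\<^sub>C (f b * kinv a)" using kinv_comm[OF k_f] by simp

lemma kinv_k_comm: "kinv a * k b = k b * kinv a"
  using kinv_comm[of a "k b" 0] by (simp add: scaleC_one k_k)

lemma kinv_kinv: "kinv a * kinv b = kinv b * kinv a"
  using kinv_comm[of a "kinv b" 0] kinv_k_comm[of b a] by (simp add: scaleC_one)

lemma prod_k_kinv: "prod_list (map k (rev ts)) * prod_list (map kinv ts) = 1"
proof (induct ts)
  case (Cons t ts)
  have "prod_list (map k (rev (t # ts))) * prod_list (map kinv (t # ts)) =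
     prod_list (map k (rev ts)) * (k t * kinv t) * prod_list (map kinv ts)"
    by (simp add: mult.assoc)
  then show ?case by (simp add: k_kinv Cons)
qed simp

lemma \<Delta>_kinv: "\<Delta> (kinv a) = kinv a \<odot> kinv a"
proof -
  have "\<Delta> (kinv a) = \<Delta> (kinv a) * ((k a \<odot> k a) * (kinv a \<odot> kinv a))"
    by (simp add: k_kinv tp_mult tp_one)
  also have "\<dots> = \<Delta> (kinv a * k a) * (kinv a \<odot> kinv a)"
    by (simp only: \<Delta> \<Delta>_k mult.assoc)
  finally show ?thesis by (simp add: kinv_k \<Delta>)
qed

text \<open>Conjugation by the \<open>k a\<close> sees a weight only through its values at positions
  below \<open>N\<close>; \<open>good_cong\<close> relies on this.\<close>

definition weight_space :: "(nat \<Rightarrow> int) \<Rightarrow> 'u set" where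
  "weight_space \<beta> = {u. \<forall>a. k a * u = q powi wt a \<beta> *\<^sub>C (u * k a)}"

lemma weight_space_mult:
  assumes "u \<in> weight_space \<beta>" "v \<in> weight_space \<gamma>"
  shows "u * v \<in> weight_space (\<lambda>b. \<beta> b + \<gamma> b)"
  unfolding weight_space_def
proof (intro CollectI allI)
  fix a
  have "k a * (u * v) = q powi wt a \<beta> *\<^sub>C (u * (k a * v))"
    using assms(1) by (simp add: weight_space_def mult.assoc[symmetric] scaleC_mult)
  also have "\<dots> = q powi wt a (\<lambda>b. \<beta> b + \<gamma> b) *\<^sub>C (u * v * k a)"
    using assms(2) by (simp add: weight_space_def scaleC_mult scaleC_scaleC wt_add q_add mult.assoc)
  finally show "k a * (u * v) = q powi wt a (\<lambda>b. \<beta> b + \<gamma> b) *\<^sub>C (u * v * k a)" .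
qed

lemma weight_space_simps:
  "0 \<in> weight_space \<beta>" "1 \<in> weight_space (\<lambda>_. 0)" "k a \<in> weight_space (\<lambda>_. 0)" "kinv a \<in> weight_space (\<lambda>_. 0)"
  "e a \<in> weight_space (simple_root a)" "f a \<in> weight_space (\<lambda>b. - simple_root a b)"
  by (simp_all add: weight_space_def wt_simps scaleC_one k_e k_f k_k kinv_k_comm)

lemma weight_space_diff: "u \<in> weight_space \<beta> \<Longrightarrow> v \<in> weight_space \<beta> \<Longrightarrow> u - v \<in> weight_space \<beta>"
  and weight_space_scaleC: "u \<in> weight_space \<beta> \<Longrightarrow> c *\<^sub>C u \<in> weight_space \<beta>"
  by (simp_all add: weight_space_def algebra_simps scaleC_mult scaleC_scaleC scaleC_add_right scaleC_right_diff)

lemma weight_kinv: "u \<in> weight_space \<beta> \<Longrightarrow> kinv a * u = q powi (- wt a \<beta>) *\<^sub>C (u * kinv a)"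
  by (intro kinv_comm) (simp add: weight_space_def)

lemma weight_k: "u \<in> weight_space \<beta> \<Longrightarrow> k a * u = q powi wt a \<beta> *\<^sub>C (u * k a)"
  by (simp add: weight_space_def)

definition ev :: "(nat word \<Rightarrow>\<^sub>0 'u) \<Rightarrow> 'b" where
  "ev = wsubst (\<lambda>r. r \<odot> 1) (\<lambda>b. 1 \<odot> e b)"

sublocale ev: word_subst "\<lambda>r. r \<odot> 1" "\<lambda>b. 1 \<odot> e b"
  rewrites "wsubst (\<lambda>r. r \<odot> 1) (\<lambda>b. 1 \<odot> e b) = ev"
  by (unfold_locales, simp_all add: algebra_hom_def tp_simps tp_one ev_def)

text \<open>For \<open>ev X\<close> the part of \<open>\<Delta> u\<close> with second factors generated by the \<open>e\<^sub>b\<close>, \<open>L a X = 0\<close> says that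
  \<open>[u, f\<^sub>a]\<close> has no component involving \<open>k\<^sub>a\<^sup>-\<^sup>1\<close>.\<close>

definition L :: "nat \<Rightarrow> (nat word \<Rightarrow>\<^sub>0 'u) \<Rightarrow> nat word \<Rightarrow>\<^sub>0 'u" where
  "L a X = D a *\<^sub>C (X * cst (f a) - cst (f a) * tau (Pm a) X) - skew (Pm a) a X"

lemma L_add: "L a (X + Y) = L a X + L a Y"
  by (simp add: L_def algebra_simps tau.simps skew.add scaleC_add_right scaleC_right_diff)

lemma L_diff: "L a (X - Y) = L a X - L a Y"
  by (simp add: L_def algebra_simps tau.simps skew.diff scaleC_add_right scaleC_right_diff)

lemma L_scaleC: "L a (c *\<^sub>C X) = c *\<^sub>C L a X"
  by (simp add: L_def tau.simps skew_scaleC scaleC_mult scaleC_right_diff scaleC_scaleC mult.commute)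

lemma L_mult: "L a (X * Y) = X * L a Y + L a X * tau (Pm a) Y"
  by (simp add: L_def tau.simps skew_mult scaleC_mult scaleC_right_diff algebra_simps)

lemma L_cst: "L a (cst r) = D a *\<^sub>C cst (r * f a - f a * r)"
  by (simp add: L_def tau.simps skew_cst cst_simps)

lemma kinv_ev: "(1 \<odot> kinv a) * ev X = ev (tau (Pm a) X) * (1 \<odot> kinv a)"
proof (induct X rule: words_induct)
  case (const r) show ?case by (simp add: tau.simps ev.simps tp_simps)
next
  case (letter b X)
  have "(1 \<odot> kinv a) * ev (lett b * X) = Pm a b *\<^sub>C ((1 \<odot> e b) * ((1 \<odot> kinv a) * ev X))"
    by (simp add: ev.simps mult.assoc[symmetric] tp_mult kinv_e tp_scale_right scaleC_mult)
  then show ?case by (simp add: letter tau.simps ev.simps scaleC_mult mult.assoc)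
next
  case (sum X Y) then show ?case by (simp add: tau.simps ev.simps distrib_left distrib_right)
qed

lemma k_ev: "(1 \<odot> k a) * ev X = ev (tau (P a) X) * (1 \<odot> k a)"
proof -
  have 1: "(1 \<odot> kinv a) * (1 \<odot> k a) = 1" "(1 \<odot> k a) * (1 \<odot> kinv a) = 1"
    by (simp_all add: tp_mult kinv_k k_kinv tp_one)
  have "ev X = ev (tau (Pm a) (tau (P a) X))" by (simp add: tau_tau q_minus tau_one)
  then have "(1 \<odot> k a) * ev X = (1 \<odot> k a) * (ev (tau (Pm a) (tau (P a) X)) * (1 \<odot> kinv a)) * (1 \<odot> k a)"
    by (simp add: mult.assoc 1)
  also have "\<dots> = ((1 \<odot> k a) * (1 \<odot> kinv a)) * ev (tau (P a) X) * (1 \<odot> k a)"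
    by (simp only: kinv_ev[symmetric] mult.assoc)
  finally show ?thesis by (simp only: 1 mult_1_left)
qed

text \<open>Both sides obey the same twisted Leibniz rule, so single letters decide. The summand
  \<open>1 \<odot> f a\<close> of the coproduct of \<open>f a\<close> yields the two derivations,
  which are the free versions of Kashiwara's operators for the components with \<open>k a\<close>
  and \<open>kinv a\<close>. The summand \<open>f a \<odot> kinv a\<close> only contributes to the
  component with \<open>kinv a\<close> and gives the remaining terms of
  \<open>L a X\<close>.\<close>

lemma commutator_f:
  "D a *\<^sub>C (ev X * \<Delta> (f a) - \<Delta> (f a) * ev X) =
    ev (skew (P a) a X) * (1 \<odot> k a) + ev (L a X) * (1 \<odot> kinv a)"
proof (induct X rule: words_induct)
  case (const r)
  show ?case by (simp add: skew_cst ev.simps L_cst \<Delta>_f cst_simps algebra_simps tp_simps scaleC_mult)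
next
  case (letter b X)
  let ?V = "\<Delta> (f a)"
  have V: "D a *\<^sub>C ((1 \<odot> e b) * ?V - ?V * (1 \<odot> e b)) =
    D a *\<^sub>C ((1 - Pm a b) *\<^sub>C (f a \<odot> (e b * kinv a))) + (if b = a then 1 \<odot> k a - 1 \<odot> kinv a else 0)"
  proof -
    have 1: "(1 \<odot> e b) * ?V - ?V * (1 \<odot> e b) = f a \<odot> (e b * kinv a - kinv a * e b) + 1 \<odot> (e b * f a - f a * e b)"
      by (simp add: \<Delta>_f algebra_simps tp_simps)
    have 2: "e b * kinv a - kinv a * e b = (1 - Pm a b) *\<^sub>C (e b * kinv a)"
      by (simp add: kinv_e complex_vector.scale_left_diff_distrib scaleC_one)
    show ?thesis unfolding 1 2
      using D_nz[of a] by (simp add: e_f tp_linear scaleC_add_right scaleC_scaleC scaleC_one)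
  qed
  have Lb: "L a (lett b) = D a *\<^sub>C ((1 - Pm a b) *\<^sub>C (cst (f a) * lett b)) - (if b = a then 1 else 0)"
    by (simp add: L_def cst_lett tau.simps skew_lett scaleC_mult complex_vector.scale_left_diff_distrib scaleC_one)
  have eb: "f a \<odot> (e b * kinv a) = (f a \<odot> 1) * ((1 \<odot> e b) * (1 \<odot> kinv a))" by (simp add: tp_mult)
  have "D a *\<^sub>C (ev (lett b * X) * ?V - ?V * ev (lett b * X)) =
     (1 \<odot> e b) * (D a *\<^sub>C (ev X * ?V - ?V * ev X)) + (D a *\<^sub>C ((1 \<odot> e b) * ?V - ?V * (1 \<odot> e b))) * ev X"
    by (simp add: ev.simps algebra_simps scaleC_mult scaleC_right_diff)
  also have "\<dots> = ev (skew (P a) a (lett b * X)) * (1 \<odot> k a) + ev (L a (lett b * X)) * (1 \<odot> kinv a)"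
    unfolding letter V eb
    by (simp add: L_mult Lb skew_lett_mult ev.simps algebra_simps scaleC_mult k_ev kinv_ev)
  finally show ?case .
next
  case (sum X Y) then show ?case
    by (simp add: ev.simps skew.add L_add algebra_simps scaleC_add_right scaleC_right_diff)
qed

text \<open>The total weight, that is, the weight of a coefficient plus the weight of its word;
  \<open>words_weight_lookup\<close> says this coefficient by coefficient. In terms of conjugation,
  multiplicativity is immediate.\<close>

definition words_weight :: "(nat \<Rightarrow> int) \<Rightarrow> (nat word \<Rightarrow>\<^sub>0 'u) \<Rightarrow> bool" where
  "words_weight \<beta> X \<longleftrightarrow> (\<forall>a. cst (k a) * tau (P a) X = q powi wt a \<beta> *\<^sub>C (X * cst (k a)))"

lemma words_weight_mult:
  assumes "words_weight \<beta> X" "words_weight \<gamma> Y"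
  shows "words_weight (\<lambda>b. \<beta> b + \<gamma> b) (X * Y)"
  unfolding words_weight_def
proof
  fix a
  have "cst (k a) * tau (P a) (X * Y) = q powi wt a \<beta> *\<^sub>C (X * (cst (k a) * tau (P a) Y))"
    using assms(1) by (simp add: words_weight_def tau.simps mult.assoc[symmetric] scaleC_mult)
  also have "\<dots> = q powi wt a (\<lambda>b. \<beta> b + \<gamma> b) *\<^sub>C (X * Y * cst (k a))"
    using assms(2) by (simp add: words_weight_def scaleC_mult scaleC_scaleC wt_add q_add mult.assoc)
  finally show "cst (k a) * tau (P a) (X * Y) = q powi wt a (\<lambda>b. \<beta> b + \<gamma> b) *\<^sub>C (X * Y * cst (k a))" .
qed

lemma words_weight_add: "words_weight \<beta> X \<Longrightarrow> words_weight \<beta> Y \<Longrightarrow> words_weight \<beta> (X + Y)"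
  and words_weight_diff: "words_weight \<beta> X \<Longrightarrow> words_weight \<beta> Y \<Longrightarrow> words_weight \<beta> (X - Y)"
  and words_weight_scaleC: "words_weight \<beta> X \<Longrightarrow> words_weight \<beta> (c *\<^sub>C X)"
  by (simp_all add: words_weight_def algebra_simps scaleC_mult scaleC_scaleC scaleC_add_right scaleC_right_diff tau.simps)

lemma words_weight_cst: "words_weight \<beta> (cst u) \<longleftrightarrow> u \<in> weight_space \<beta>"
proof -
  have inj: "cst u = cst v \<Longrightarrow> u = v" for u v :: 'u using aug.cst by metis
  show ?thesis
    unfolding words_weight_def weight_space_def mem_Collect_eq tau.cst
    by (simp add: cst_simps(5,6)[symmetric]) (metis inj)
qed

lemma words_weight_lett: "words_weight (simple_root b) (lett b)"
  by (simp add: words_weight_def wt_simps tau.simps scaleC_mult cst_lett)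

lemma words_weight_kinv:
  assumes "words_weight \<beta> X"
  shows "cst (kinv a) * tau (Pm a) X = q powi (- wt a \<beta>) *\<^sub>C (X * cst (kinv a))"
proof -
  have "X * cst (kinv a) = tau (Pm a) (tau (P a) X) * cst (kinv a)"
    by (simp add: tau_tau q_minus tau_one)
  also have "\<dots> = cst (kinv a) * tau (Pm a) (cst (k a) * tau (P a) X) * cst (kinv a)"
    by (simp add: tau.simps mult.assoc[symmetric] cst_simps(5)[symmetric] kinv_k) (simp add: cst_simps)
  also have "cst (k a) * tau (P a) X = q powi wt a \<beta> *\<^sub>C (X * cst (k a))"
    using assms by (simp add: words_weight_def)
  finally have "X * cst (kinv a) = q powi wt a \<beta> *\<^sub>C (cst (kinv a) * tau (Pm a) X * cst (k a * kinv a))"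
    by (simp add: tau.simps scaleC_mult mult.assoc cst_simps)
  then show ?thesis by (simp add: k_kinv cst_simps scaleC_scaleC q_minus scaleC_one)
qed

lemma words_weight_skew:
  assumes "words_weight \<beta> X"
  shows "words_weight (\<lambda>b. \<beta> b - simple_root t b) (skew \<kappa> t X)"
  unfolding words_weight_def
proof
  fix a
  have "skew \<kappa> t (cst (k a) * tau (P a) X) = q powi wt a \<beta> *\<^sub>C (skew \<kappa> t X * cst (k a))"
    using assms by (simp add: words_weight_def skew_scaleC skew_mult_cst)
  then have "P a t *\<^sub>C (cst (k a) * tau (P a) (skew \<kappa> t X)) = q powi wt a \<beta> *\<^sub>C (skew \<kappa> t X * cst (k a))"
    by (simp add: skew_cst_mult skew_tau scaleC_mult)
  then have "Pm a t *\<^sub>C (P a t *\<^sub>C (cst (k a) * tau (P a) (skew \<kappa> t X))) =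
      Pm a t *\<^sub>C (q powi wt a \<beta> *\<^sub>C (skew \<kappa> t X * cst (k a)))" by simp
  then show "cst (k a) * tau (P a) (skew \<kappa> t X) =
      q powi wt a (\<lambda>b. \<beta> b - simple_root t b) *\<^sub>C (skew \<kappa> t X * cst (k a))"
    using q_add[of "wt a \<beta>" "- B a t"]
    by (simp add: scaleC_scaleC q_minus scaleC_one wt_simps mult.commute)
qed

definition bracket :: "nat \<Rightarrow> 'u \<Rightarrow> 'u" where
  "bracket t u = e t * u - kinv t * u * k t * e t"

lemma bracket_weight:
  assumes "u \<in> weight_space \<beta>"
  shows "bracket t u = e t * u - q powi (- wt t \<beta>) *\<^sub>C (u * e t)"
  by (simp add: bracket_def weight_kinv[OF assms] scaleC_mult) (simp add: mult.assoc kinv_k mult.assoc[symmetric, of "kinv t"])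

definition good :: "nat set \<Rightarrow> 'b set \<Rightarrow> 'u \<Rightarrow> (nat \<Rightarrow> int) \<Rightarrow> 'u \<Rightarrow> (nat word \<Rightarrow>\<^sub>0 'u) \<Rightarrow> bool" where
  "good A J F \<beta> K X \<longleftrightarrow> F \<in> weight_space \<beta> \<and> \<Delta> F - (K \<odot> F + ev X) \<in> J \<and> aug X = F \<and> words_weight \<beta> X \<and>
    (\<forall>t. K * k t = k t * K \<and> K * e t = q powi wt t \<beta> *\<^sub>C (e t * K) \<and> K * f t = q powi (- wt t \<beta>) *\<^sub>C (f t * K)) \<and>
    (\<forall>a\<in>A. L a X = 0)"

text \<open>\<open>L a\<close> sends the lift of the coproduct of \<open>e t\<close> to
  \<open>- cst (kinv a)\<close> for \<open>a = t\<close> and to zero otherwise. The equation for the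
  bracket thus becomes a twisted commutator of \<open>X\<close> with \<open>kinv a\<close>, and this
  vanishes by weight for exactly the power of \<open>q\<close> chosen in
  \<open>bracket\<close>.\<close>

lemma good_bracket:
  assumes "good A J F \<beta> K X"
    and J: "\<And>j. j \<in> J \<Longrightarrow> \<Delta> (e t) * j - q powi (- wt t \<beta>) *\<^sub>C (j * \<Delta> (e t)) \<in> J'"
  shows "good A J' (bracket t F) (\<lambda>b. \<beta> b + simple_root t b) (k t * K)
    ((cst (e t) + cst (k t) * lett t) * X - q powi (- wt t \<beta>) *\<^sub>C (X * (cst (e t) + cst (k t) * lett t)))"
    (is "good _ _ _ _ _ (?e * X - ?c *\<^sub>C (X * ?e))")
proof -
  have F: "F \<in> weight_space \<beta>" and dF: "\<Delta> F - (K \<odot> F + ev X) \<in> J" and aX: "aug X = F" and wX: "words_weight \<beta> X"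
    and K: "\<And>t. K * k t = k t * K" "\<And>t. K * e t = q powi wt t \<beta> *\<^sub>C (e t * K)"
      "\<And>t. K * f t = q powi (- wt t \<beta>) *\<^sub>C (f t * K)" and LX: "\<And>a. a \<in> A \<Longrightarrow> L a X = 0"
    using assms(1) by (simp_all add: good_def)
  have br: "bracket t F = e t * F - ?c *\<^sub>C (F * e t)" by (rule bracket_weight[OF F])
  have eve: "\<Delta> (e t) = ev ?e" by (simp add: \<Delta>_e ev.simps tp_mult)
  have "\<Delta> (e t) * (K \<odot> F) - ?c *\<^sub>C ((K \<odot> F) * \<Delta> (e t)) = (k t * K) \<odot> bracket t F"
    by (simp add: \<Delta>_e br algebra_simps tp_simps K scaleC_add_right scaleC_scaleC q_minus scaleC_one)
  moreover have "\<Delta> (e t) * ev X - ?c *\<^sub>C (ev X * \<Delta> (e t)) = ev (?e * X - ?c *\<^sub>C (X * ?e))"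
    by (simp add: eve ev.simps)
  ultimately have "\<Delta> (bracket t F) - ((k t * K) \<odot> bracket t F + ev (?e * X - ?c *\<^sub>C (X * ?e))) =
      \<Delta> (e t) * (\<Delta> F - (K \<odot> F + ev X)) - ?c *\<^sub>C ((\<Delta> F - (K \<odot> F + ev X)) * \<Delta> (e t))"
    by (simp add: br \<Delta> algebra_simps scaleC_add_right scaleC_right_diff)
  then have d: "\<Delta> (bracket t F) - ((k t * K) \<odot> bracket t F + ev (?e * X - ?c *\<^sub>C (X * ?e))) \<in> J'"
    using J[OF dF] by simp
  have we: "words_weight (simple_root t) ?e"
  proof (rule words_weight_add)
    show "words_weight (simple_root t) (cst (e t))" by (simp add: words_weight_cst weight_space_simps)
    show "words_weight (simple_root t) (cst (k t) * lett t)"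
      using words_weight_mult[OF _ words_weight_lett, of "\<lambda>_. 0" "cst (k t)" t]
      by (simp add: words_weight_cst weight_space_simps)
  qed
  have w: "words_weight (\<lambda>b. \<beta> b + simple_root t b) (?e * X - ?c *\<^sub>C (X * ?e))"
    using words_weight_mult[OF we wX] words_weight_mult[OF wX we]
    by (intro words_weight_diff words_weight_scaleC) (simp_all add: add.commute)
  \<comment> \<open>For \<open>a = t\<close> the commutator of \<open>e t\<close> with
    \<open>f t\<close> gives \<open>k t - kinv t\<close>, and the derivative of
    \<open>cst (k t) * lett t\<close> removes \<open>k t\<close>.\<close>
  have Le: "L a ?e = (if t = a then - cst (kinv a) else 0)" for a
  proof -
    have 1: "L a (cst (e t)) = (if t = a then cst (k a - kinv a) else 0)"
      using D_nz[of a] by (simp add: L_cst e_f cst_simps scaleC_scaleC scaleC_one)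
    have "k t * f a = Pm a t *\<^sub>C (f a * k t)" by (simp add: k_f B_sym[of a t])
    then have "cst (k t) * cst (f a) = Pm a t *\<^sub>C (cst (f a) * cst (k t))"
      by (simp add: cst_simps(5,6)[symmetric])
    moreover have "cst (k t) * lett t * cst (f a) = cst (k t) * cst (f a) * lett t"
      by (simp add: mult.assoc cst_lett)
    ultimately have "cst (k t) * lett t * cst (f a) = cst (f a) * tau (Pm a) (cst (k t) * lett t)"
      by (simp add: tau.simps scaleC_mult mult.assoc)
    then have 2: "L a (cst (k t) * lett t) = - (if t = a then cst (k t) else 0)"
      by (simp add: L_def skew_cst_mult skew_lett)
    show ?thesis by (simp add: L_add 1 2 cst_simps)
  qed
  have L: "L a (?e * X - ?c *\<^sub>C (X * ?e)) = 0" if "a \<in> A" for a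
    unfolding L_diff L_scaleC L_mult LX[OF that] Le using words_weight_kinv[OF wX, of a] by auto
  show ?thesis
    unfolding good_def
  proof (intro conjI allI ballI)
    show "bracket t F \<in> weight_space (\<lambda>b. \<beta> b + simple_root t b)"
      unfolding br using weight_space_mult[OF weight_space_simps(5) F, of t] weight_space_mult[OF F weight_space_simps(5), of t]
      by (intro weight_space_diff weight_space_scaleC) (simp_all add: add.commute)
    show "aug (?e * X - ?c *\<^sub>C (X * ?e)) = bracket t F" by (simp add: aug.simps aX br)
    fix s
    show "k t * K * k s = k s * (k t * K)" by (metis K(1) k_k mult.assoc)
    have "k t * K * e s = q powi wt s \<beta> *\<^sub>C (k t * e s * K)" by (simp add: mult.assoc K scaleC_mult)
    then show "k t * K * e s = q powi wt s (\<lambda>b. \<beta> b + simple_root t b) *\<^sub>C (e s * (k t * K))"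
      by (simp add: k_e scaleC_mult scaleC_scaleC wt_simps q_add B_sym[of t s] mult.assoc)
    have "k t * K * f s = q powi (- wt s \<beta>) *\<^sub>C (k t * f s * K)" by (simp add: mult.assoc K scaleC_mult)
    then show "k t * K * f s = q powi (- wt s (\<lambda>b. \<beta> b + simple_root t b)) *\<^sub>C (f s * (k t * K))"
      by (simp add: k_f scaleC_mult scaleC_scaleC wt_simps q_add B_sym[of t s] mult.assoc)
        (metis add_uminus_conv_diff power_int_add q_nz)
  qed (rule d w L, assumption?)+
qed

text \<open>When \<open>L a X = 0\<close>, commuting the coproduct with that of \<open>f a\<close>
  leaves from the words only a component with the factor \<open>1 \<odot> k a\<close>.
  Multiplication by \<open>kinv a\<close>, whose coproduct is group-like, cancels this factor, so
  the shape required by \<open>good\<close> is restored.\<close>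

definition contract :: "nat \<Rightarrow> 'u \<Rightarrow> 'u" where
  "contract a u = D a *\<^sub>C ((u * f a - f a * u) * kinv a)"

text \<open>The derivation for the \<open>k a\<close> component commutes with each constituent of
  \<open>L b\<close> up to the same scalar \<open>P a b\<close>: with the derivation for
  \<open>kinv b\<close> by \<open>skew_skew\<close>, with \<open>tau\<close> by
  \<open>skew_tau\<close>, while \<open>kinv a\<close> passes \<open>f b\<close> at the same
  price.\<close>

lemma L_skew:
  assumes "L b X = 0"
  shows "L b (skew (P a) a X * cst (kinv a)) = 0"
proof -
  have "cst (kinv a) * cst (f b) = P a b *\<^sub>C (cst (f b) * cst (kinv a))"
    by (simp add: cst_simps(5,6)[symmetric] kinv_f)
  then have k: "Y * cst (kinv a) * cst (f b) = P a b *\<^sub>C (Y * cst (f b) * cst (kinv a))" for Y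
    by (simp add: mult.assoc scaleC_mult)
  have s: "skew (Pm b) b (skew (P a) a X) = P a b *\<^sub>C skew (P a) a (skew (Pm b) b X)"
    by (rule skew_skew) (simp add: B_sym[of b a] q_minus)
  have t: "tau (Pm b) (skew (P a) a X) = P a b *\<^sub>C skew (P a) a (tau (Pm b) X)"
    by (simp add: skew_tau scaleC_scaleC B_sym[of b a] q_minus scaleC_one)
  have "L b (skew (P a) a X * cst (kinv a)) = P a b *\<^sub>C (skew (P a) a (L b X) * cst (kinv a))"
    unfolding L_def tau.simps skew_mult_cst s t
    by (simp add: k scaleC_mult scaleC_right_diff skew.diff skew_scaleC skew_cst_mult skew_mult_cst
        left_diff_distrib right_diff_distrib mult.commute[of "D b"] flip: mult.assoc)
  then show ?thesis by (simp add: assms skew.zero)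
qed

text \<open>On the empty word the two derivations at \<open>a\<close> agree, so the vanishing of the
  \<open>kinv a\<close> component already determines the \<open>k a\<close> component there.\<close>

lemma aug_contract:
  assumes "L a X = 0"
  shows "aug (skew (P a) a X * cst (kinv a)) = contract a (aug X)"
proof -
  have "aug (L a X) = D a *\<^sub>C (aug X * f a - f a * aug X) - aug (skew (P a) a X)"
    by (simp add: L_def aug.simps aug_tau aug_skew[of "Pm a" a _ "P a"])
  then have "aug (skew (P a) a X) = D a *\<^sub>C (aug X * f a - f a * aug X)" using assms by (simp add: aug.zero)
  then show ?thesis by (simp add: aug.simps contract_def scaleC_mult)
qed

lemma contract_weight:
  assumes "F \<in> weight_space \<beta>"
  shows "contract a F \<in> weight_space (\<lambda>b. \<beta> b - simple_root a b)"
proof -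
  have "F * f a - f a * F \<in> weight_space (\<lambda>b. \<beta> b - simple_root a b)"
    using weight_space_mult[OF assms weight_space_simps(6)[of a]] weight_space_mult[OF weight_space_simps(6)[of a] assms]
    by (intro weight_space_diff) simp_all
  from weight_space_mult[OF this weight_space_simps(4)] show ?thesis
    by (simp add: contract_def weight_space_scaleC)
qed

lemma \<Delta>_contract:
  assumes F: "F \<in> weight_space \<beta>" and K: "K * f a = q powi (- wt a \<beta>) *\<^sub>C (f a * K)" and LX: "L a X = 0"
  shows "D a *\<^sub>C (((K \<odot> F + ev X) * \<Delta> (f a) - \<Delta> (f a) * (K \<odot> F + ev X)) * \<Delta> (kinv a)) =
    (K * kinv a) \<odot> contract a F + ev (skew (P a) a X * cst (kinv a))"
proof -
  have 1: "(K \<odot> F) * \<Delta> (f a) - \<Delta> (f a) * (K \<odot> F) = K \<odot> (F * f a - f a * F)"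
    by (simp add: \<Delta>_f algebra_simps tp_simps K weight_kinv[OF F])
  have "D a *\<^sub>C (((K \<odot> F + ev X) * \<Delta> (f a) - \<Delta> (f a) * (K \<odot> F + ev X)) * \<Delta> (kinv a)) =
     D a *\<^sub>C (((K \<odot> F) * \<Delta> (f a) - \<Delta> (f a) * (K \<odot> F)) * \<Delta> (kinv a)) +
     (D a *\<^sub>C (ev X * \<Delta> (f a) - \<Delta> (f a) * ev X)) * \<Delta> (kinv a)"
    by (simp add: algebra_simps scaleC_mult scaleC_add_right scaleC_right_diff)
  also have "(D a *\<^sub>C (ev X * \<Delta> (f a) - \<Delta> (f a) * ev X)) * \<Delta> (kinv a) = ev (skew (P a) a X * cst (kinv a))"
    by (simp add: commutator_f LX ev.simps mult.assoc \<Delta>_kinv tp_mult k_kinv)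
  also have "D a *\<^sub>C (((K \<odot> F) * \<Delta> (f a) - \<Delta> (f a) * (K \<odot> F)) * \<Delta> (kinv a)) =
     (K * kinv a) \<odot> contract a F"
    unfolding 1 \<Delta>_kinv tp_mult by (simp add: contract_def tp_scale_right)
  finally show ?thesis .
qed

lemma good_contract:
  assumes "good A J F \<beta> K X" and a: "a \<in> A"
    and J: "\<And>j. j \<in> J \<Longrightarrow> D a *\<^sub>C ((j * \<Delta> (f a) - \<Delta> (f a) * j) * \<Delta> (kinv a)) \<in> J'"
  shows "good A J' (contract a F) (\<lambda>b. \<beta> b - simple_root a b) (K * kinv a) (skew (P a) a X * cst (kinv a))"
proof -
  have F: "F \<in> weight_space \<beta>" and dF: "\<Delta> F - (K \<odot> F + ev X) \<in> J" and aX: "aug X = F" and wX: "words_weight \<beta> X"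
    and K: "\<And>t. K * k t = k t * K" "\<And>t. K * e t = q powi wt t \<beta> *\<^sub>C (e t * K)"
      "\<And>t. K * f t = q powi (- wt t \<beta>) *\<^sub>C (f t * K)" and LX: "\<And>a. a \<in> A \<Longrightarrow> L a X = 0"
    using assms(1) by (simp_all add: good_def)
  show ?thesis
    unfolding good_def
  proof (intro conjI allI ballI)
    show "contract a F \<in> weight_space (\<lambda>b. \<beta> b - simple_root a b)" by (rule contract_weight[OF F])
    have "\<Delta> (contract a F) = D a *\<^sub>C ((\<Delta> F * \<Delta> (f a) - \<Delta> (f a) * \<Delta> F) * \<Delta> (kinv a))"
      by (simp add: contract_def \<Delta>)
    then have "\<Delta> (contract a F) - ((K * kinv a) \<odot> contract a F + ev (skew (P a) a X * cst (kinv a))) =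
      D a *\<^sub>C (((\<Delta> F - (K \<odot> F + ev X)) * \<Delta> (f a) - \<Delta> (f a) * (\<Delta> F - (K \<odot> F + ev X))) * \<Delta> (kinv a))"
      unfolding \<Delta>_contract[OF F K(3) LX[OF a], symmetric]
      by (simp add: algebra_simps scaleC_add_right scaleC_right_diff)
    then show "\<Delta> (contract a F) - ((K * kinv a) \<odot> contract a F + ev (skew (P a) a X * cst (kinv a))) \<in> J'"
      using J[OF dF] by simp
    show "aug (skew (P a) a X * cst (kinv a)) = contract a F" by (simp add: aug_contract LX a aX)
    have "words_weight (\<lambda>_. 0) (cst (kinv a))" by (simp add: words_weight_cst weight_space_simps)
    from words_weight_mult[OF words_weight_skew[OF wX] this]
    show "words_weight (\<lambda>b. \<beta> b - simple_root a b) (skew (P a) a X * cst (kinv a))" by simp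
    show "L b (skew (P a) a X * cst (kinv a)) = 0" if "b \<in> A" for b by (rule L_skew[OF LX[OF that]])
    fix s
    show "K * kinv a * k s = k s * (K * kinv a)" by (metis K(1) kinv_k_comm mult.assoc)
    have "K * kinv a * e s = Pm a s *\<^sub>C (K * e s * kinv a)" by (simp add: mult.assoc kinv_e scaleC_mult)
    then show "K * kinv a * e s = q powi wt s (\<lambda>b. \<beta> b - simple_root a b) *\<^sub>C (e s * (K * kinv a))"
      using q_add[of "wt s \<beta>" "- B s a"] by (simp add: K scaleC_mult scaleC_scaleC wt_simps B_sym[of a s] mult.assoc mult.commute)
    have "K * kinv a * f s = P a s *\<^sub>C (K * f s * kinv a)" by (simp add: mult.assoc kinv_f scaleC_mult)
    then show "K * kinv a * f s = q powi (- wt s (\<lambda>b. \<beta> b - simple_root a b)) *\<^sub>C (f s * (K * kinv a))"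
      using q_add[of "- wt s \<beta>" "B s a"] by (simp add: K scaleC_mult scaleC_scaleC wt_simps B_sym[of a s] mult.assoc mult.commute)
  qed
qed

lemma good_scaleC:
  assumes "good A J F \<beta> K X" and J: "\<And>j. j \<in> J \<Longrightarrow> c *\<^sub>C j \<in> J'"
  shows "good A J' (c *\<^sub>C F) \<beta> K (c *\<^sub>C X)"
proof -
  have "\<Delta> (c *\<^sub>C F) - (K \<odot> (c *\<^sub>C F) + ev (c *\<^sub>C X)) = c *\<^sub>C (\<Delta> F - (K \<odot> F + ev X))"
    by (simp add: \<Delta> tp_linear ev.simps algebra_simps scaleC_add_right scaleC_right_diff)
  then show ?thesis
    using assms by (auto simp: good_def weight_space_scaleC words_weight_scaleC aug.simps L_scaleC)
qed

lemma good_cong: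
  "good A J F \<beta> K X \<Longrightarrow> F = F' \<Longrightarrow> (\<And>b. b < N \<Longrightarrow> \<beta> b = \<gamma> b) \<Longrightarrow> K = K' \<Longrightarrow> J \<subseteq> J' \<Longrightarrow> good A J' F' \<gamma> K' X"
  by (auto simp: good_def weight_space_def words_weight_def wt_def)

end

section \<open>Words along a chain\<close>

definition nonadj :: "nat \<Rightarrow> nat \<Rightarrow> bool" where
  "nonadj x y \<longleftrightarrow> Suc x < y \<or> Suc y < x"

text \<open>Modulo this ideal words are traces, in which letters that are not neighbours commute.
  Between words without repeated letters these are the only Serre relations, and \<open>ev\<close>
  respects them by \<open>ev_null\<close>.\<close>

inductive_set null :: "(nat word \<Rightarrow>\<^sub>0 'u::complex_algebra_1) set" where
  null_0: "0 \<in> null"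
| null_step: "X \<in> null \<Longrightarrow> nonadj x y \<Longrightarrow> X + Y * (lett x * lett y - lett y * lett x) * Z \<in> null"

lemma null_gen: "nonadj x y \<Longrightarrow> Y * (lett x * lett y - lett y * lett x) * Z \<in> null"
  using null_step[OF null_0] by simp

lemma null_add: "X \<in> null \<Longrightarrow> Y \<in> null \<Longrightarrow> X + Y \<in> null"
proof (induct rule: null.induct)
  case (null_step X x y Y' Z)
  then show ?case using null.null_step[of "X + Y" x y Y' Z] by (simp add: algebra_simps)
qed simp

lemma null_mult: "X \<in> null \<Longrightarrow> W * X \<in> null" "X \<in> null \<Longrightarrow> X * W \<in> null"
proof -
  show "X \<in> null \<Longrightarrow> W * X \<in> null"
  proof (induct rule: null.induct)
    case (null_step X x y Y Z)
    then show ?case using null.null_step[of "W * X" x y "W * Y" Z] by (simp add: distrib_left mult.assoc)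
  qed (simp add: null_0)
  show "X \<in> null \<Longrightarrow> X * W \<in> null"
  proof (induct rule: null.induct)
    case (null_step X x y Y Z)
    then show ?case using null.null_step[of "X * W" x y Y "Z * W"] by (simp add: distrib_right mult.assoc)
  qed (simp add: null_0)
qed

lemma null_scaleC: "X \<in> null \<Longrightarrow> c *\<^sub>C X \<in> null"
  using null_mult(1)[of X "c *\<^sub>C 1"] by (simp add: scaleC_mult)

lemma null_uminus: "X \<in> null \<Longrightarrow> - X \<in> null"
  using null_mult(1)[of X "- 1"] by simp

lemma null_diff: "X \<in> null \<Longrightarrow> Y \<in> null \<Longrightarrow> X - Y \<in> null"
  using null_add[of X "- Y"] null_uminus[of Y] by simp

lemma null_sum: "(\<And>i. i \<in> S \<Longrightarrow> X i \<in> null) \<Longrightarrow> (\<Sum>i\<in>S. X i) \<in> null"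
  by (induct S rule: infinite_finite_induct) (auto intro: null_0 null_add)

lemma null_map:
  assumes "X \<in> null" "\<And>X Y. F (X + Y) = F X + F Y" "F 0 = 0"
    and "\<And>x y Y Z. nonadj x y \<Longrightarrow> F (Y * (lett x * lett y - lett y * lett x) * Z) \<in> null"
  shows "F X \<in> null"
  using assms(1) by induct (simp_all add: assms null_0 null_add)

lemma null_tau: "X \<in> null \<Longrightarrow> tau \<kappa> X \<in> null"
proof (erule null_map)
  fix x y Y and Z :: "nat word \<Rightarrow>\<^sub>0 'a" assume "nonadj x y"
  have "tau \<kappa> (Y * (lett x * lett y - lett y * lett x) * Z) =
    (\<kappa> x * \<kappa> y) *\<^sub>C (tau \<kappa> Y * (lett x * lett y - lett y * lett x) * tau \<kappa> Z)"
    by (simp add: tau.simps scaleC_mult scaleC_scaleC scaleC_right_diff right_diff_distrib left_diff_distrib mult.commute)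
  then show "tau \<kappa> (Y * (lett x * lett y - lett y * lett x) * Z) \<in> null"
    using \<open>nonadj x y\<close> by (simp add: null_scaleC null_gen)
qed (simp_all add: tau.simps)

lemma nonadj_sym: "nonadj x y \<longleftrightarrow> nonadj y x" by (auto simp: nonadj_def)

lemma nonadj_neq: "nonadj x y \<Longrightarrow> x \<noteq> y" by (auto simp: nonadj_def)

text \<open>The twist is trivial on the letters that commute with \<open>a\<close>, so the
  derivation kills the generators of the ideal.\<close>

lemma null_skew:
  assumes "X \<in> null" "\<And>b. nonadj a b \<Longrightarrow> \<kappa> b = 1"
  shows "skew \<kappa> a X \<in> null"
  using assms(1)
proof (rule null_map)
  fix x y Y and Z :: "nat word \<Rightarrow>\<^sub>0 'a" assume xy: "nonadj x y"
  let ?g = "lett x * lett y - lett y * lett x :: nat word \<Rightarrow>\<^sub>0 'a"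
  have "skew \<kappa> a ?g = 0"
    using xy assms(2)[of x] assms(2)[of y] nonadj_neq[OF xy]
    by (auto simp: skew.diff skew_mult skew_lett tau.simps nonadj_sym[of x y] nonadj_sym[of a y] scaleC_one)
  then have "skew \<kappa> a (Y * ?g * Z) = Y * ?g * skew \<kappa> a Z + skew \<kappa> a Y * tau \<kappa> ?g * tau \<kappa> Z"
    by (simp only: skew_mult[of \<kappa> a "Y * ?g" Z] skew_mult[of \<kappa> a Y ?g] mult_zero_right add_0_left)
  moreover have "tau \<kappa> ?g \<in> null" using null_tau[OF null_gen[OF xy, of 1 1]] by simp
  ultimately show "skew \<kappa> a (Y * ?g * Z) \<in> null"
    by (metis null_add null_gen[OF xy] null_mult)
qed (simp_all add: skew.add skew.zero)

lemma mono_commute: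
  assumes "\<And>b. b \<in> set v \<Longrightarrow> nonadj a b"
  shows "lett a * wmono v - wmono v * lett a \<in> (null :: (nat word \<Rightarrow>\<^sub>0 'u::complex_algebra_1) set)"
    (is "?d v \<in> _")
  using assms
proof (induct v)
  case Nil show ?case by (simp add: mono_simps null_0)
next
  case (Cons b v)
  have "?d (b # v) = 1 * (lett a * lett b - lett b * lett a) * wmono v + lett b * ?d v"
    by (simp add: mono_simps algebra_simps)
  moreover have "lett b * ?d v \<in> null"
    using Cons by (intro null_mult) auto
  moreover have "1 * (lett a * lett b - lett b * lett a) * wmono v \<in> (null :: (nat word \<Rightarrow>\<^sub>0 'u) set)"
    using Cons.prems by (intro null_gen) simp
  ultimately show ?case by (metis null_add)
qed

lemma skew_list_notin: "a \<notin> set v \<Longrightarrow> skew_list \<kappa> a v = 0"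
  by (induct v) auto

lemma skew_list_split:
  "a \<notin> set u \<Longrightarrow> a \<notin> set v \<Longrightarrow> skew_list \<kappa> a (u @ a # v) = prod_list (map \<kappa> v) *\<^sub>C wmono (u @ v)"
  by (induct u) (auto simp: skew_list_notin tau_mono mono_simps scaleC_mult)

definition del :: "nat \<Rightarrow> nat list \<Rightarrow> nat list" where
  "del a = filter (\<lambda>x. x \<noteq> a)"

definition after :: "nat \<Rightarrow> nat list \<Rightarrow> nat list" where
  "after a w = tl (dropWhile (\<lambda>x. x \<noteq> a) w)"

lemma after_append: "a \<in> set u \<Longrightarrow> after a (u @ v) = after a u @ v" "a \<notin> set u \<Longrightarrow> after a (u @ v) = after a v"
  by (induct u) (auto simp: after_def)

lemma after_Cons: "after a (b # v) = (if b = a then v else after a v)"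
  by (simp add: after_def)

lemma set_after: "set (after a v) \<subseteq> set v"
  by (induct v) (auto simp: after_def)

lemma del_simps: "del a (u @ v) = del a u @ del a v" "del a [] = []" "del a (b # v) = (if b = a then del a v else b # del a v)"
  "set (del a v) = set v - {a}" "distinct v \<Longrightarrow> distinct (del a v)" "a \<notin> set v \<Longrightarrow> del a v = v"
  by (auto simp: del_def intro: filter_True)

definition before_part :: "nat \<Rightarrow> (nat word \<Rightarrow>\<^sub>0 'u) \<Rightarrow> nat word \<Rightarrow>\<^sub>0 'u::complex_algebra_1" where
  "before_part c = plift (\<lambda>w r. if c \<in> set (after (Suc c) (letters w)) then Poly_Mapping.single (Word (del (Suc c) (letters w))) r else 0)"

interpretation before_part: additive_family
  "\<lambda>w (r::'u::complex_algebra_1). if c \<in> set (after (Suc c) (letters w)) then Poly_Mapping.single (Word (del (Suc c) (letters w))) r else 0"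
  rewrites "plift (\<lambda>w r. if c \<in> set (after (Suc c) (letters w)) then Poly_Mapping.single (Word (del (Suc c) (letters w))) r else 0)
    = before_part c" for c
  by (unfold_locales, simp_all add: single_add before_part_def)

definition delete_letter :: "nat \<Rightarrow> (nat word \<Rightarrow>\<^sub>0 'u) \<Rightarrow> nat word \<Rightarrow>\<^sub>0 'u::complex_algebra_1" where
  "delete_letter a = wsubst cst (\<lambda>b. if b = a then 1 else lett b)"

interpretation delete_letter: word_subst cst "\<lambda>b. if b = a then 1 else lett b"
  rewrites "wsubst cst (\<lambda>b. if b = a then 1 else lett b) = delete_letter a" for a
  by (unfold_locales, simp_all add: algebra_hom_def cst_simps scaleC_mult cst_lett delete_letter_def)

lemma delete_letter_single:
  "delete_letter a (Poly_Mapping.single (Word w) r) = Poly_Mapping.single (Word (del a w)) (r::'u::complex_algebra_1)"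
proof -
  have "delete_letter a (wmono w) = (wmono (del a w) :: nat word \<Rightarrow>\<^sub>0 'u)"
    by (induct w) (auto simp: mono_simps del_simps delete_letter.simps)
  then show ?thesis by (simp add: single_eq_mono delete_letter.simps)
qed

lemma null_delete_letter: "X \<in> null \<Longrightarrow> delete_letter a X \<in> null"
proof (erule null_map)
  fix x y Y and Z :: "nat word \<Rightarrow>\<^sub>0 'a" assume "nonadj x y"
  then show "delete_letter a (Y * (lett x * lett y - lett y * lett x) * Z) \<in> null"
    using null_gen[of x y "delete_letter a Y" "delete_letter a Z"] null_0 nonadj_neq[of x y]
    by (auto simp: delete_letter.simps)
qed (simp_all add: delete_letter.simps)

text \<open>An exchange of two non-neighbours never reverses the order of \<open>c\<close> and
  \<open>Suc c\<close>. Both words of a generator therefore lie on the same side of the case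
  distinction, and there \<open>before_part\<close> is either zero or
  \<open>delete_letter\<close>.\<close>

lemma null_before_part: "X \<in> null \<Longrightarrow> before_part c X \<in> null"
proof (erule null_map)
  fix x y Y and Z :: "nat word \<Rightarrow>\<^sub>0 'a" assume xy: "nonadj x y"
  let ?g = "lett x * lett y - lett y * lett x :: nat word \<Rightarrow>\<^sub>0 'a"
  have base: "before_part c (Poly_Mapping.single (Word u) r * ?g * Poly_Mapping.single (Word v) s) \<in> null"
    for u v :: "nat list" and r s :: 'a
  proof -
    have g: "Poly_Mapping.single (Word u) r * ?g * Poly_Mapping.single (Word v) s =
       Poly_Mapping.single (Word (u @ x # y # v)) (r * s) - Poly_Mapping.single (Word (u @ y # x # v)) (r * s)"
      by (simp add: lett_def mult_single plus_word_def right_diff_distrib left_diff_distrib)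
    have in_eq: "c \<in> set (after (Suc c) (u @ x # y # v)) \<longleftrightarrow> c \<in> set (after (Suc c) (u @ y # x # v))"
      using xy by (cases "Suc c \<in> set u") (auto simp: after_append after_Cons nonadj_def)
    show ?thesis
    proof (cases "c \<in> set (after (Suc c) (u @ x # y # v))")
      case False
      then show ?thesis unfolding g before_part.diff before_part.single using in_eq by (simp add: null_0)
    next
      case True
      then have "before_part c (Poly_Mapping.single (Word u) r * ?g * Poly_Mapping.single (Word v) s) =
        delete_letter (Suc c) (Poly_Mapping.single (Word u) r * ?g * Poly_Mapping.single (Word v) s)"
        unfolding g before_part.diff before_part.single delete_letter.diff delete_letter_single using in_eq by simp
      then show ?thesis by (simp add: null_delete_letter null_gen xy)
    qed
  qed
  show "before_part c (Y * ?g * Z) \<in> null"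
  proof (induct Y rule: poly_mapping_additive_induct)
    case (single w r)
    show ?case
    proof (induct Z rule: poly_mapping_additive_induct)
      case (single v s) then show ?case using base[of "letters w" r "letters v" s] by simp
    qed (simp_all add: before_part.zero null_0 distrib_left before_part.add null_add)
  qed (simp_all add: before_part.zero null_0 distrib_right before_part.add null_add)
qed (simp_all add: before_part.add before_part.zero)

lemma sum_single: "(\<Sum>w\<in>Poly_Mapping.keys X. Poly_Mapping.single w (Poly_Mapping.lookup X w)) = X"
proof -
  have *: "(\<Sum>w\<in>S. Poly_Mapping.lookup (Poly_Mapping.single w (Poly_Mapping.lookup X w)) v) =
     (if v \<in> S then Poly_Mapping.lookup X v else 0)" if "finite S" for S v
    using that by (induct S) (auto simp: lookup_single when_def)
  show ?thesis
    by (rule poly_mapping_eqI) (simp add: lookup_sum * in_keys_iff)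
qed

lemma by_words:
  fixes X :: "nat word \<Rightarrow>\<^sub>0 'u::complex_algebra_1" and F :: "_ \<Rightarrow> nat word \<Rightarrow>\<^sub>0 'v::complex_algebra_1"
  assumes "\<And>w r. Word w \<in> Poly_Mapping.keys X \<Longrightarrow> F (Poly_Mapping.single (Word w) r) \<in> null"
    and add: "\<And>X Y. F (X + Y) = F X + F Y" and "F 0 = 0"
  shows "F X \<in> null"
proof -
  have "F (\<Sum>w\<in>S. Y w) = (\<Sum>w\<in>S. F (Y w))" for S Y
    by (induct S rule: infinite_finite_induct) (simp_all add: assms)
  then have "F X = (\<Sum>w\<in>Poly_Mapping.keys X. F (Poly_Mapping.single w (Poly_Mapping.lookup X w)))"
    using sum_single[of X] by metis
  then show ?thesis using assms(1) by (auto intro!: null_sum) (metis word.exhaust)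
qed

lemma by_words_eq:
  fixes X :: "nat word \<Rightarrow>\<^sub>0 'u::complex_algebra_1" and F G :: "_ \<Rightarrow> 'v::ab_group_add"
  assumes "\<And>w r. Word w \<in> Poly_Mapping.keys X \<Longrightarrow> F (Poly_Mapping.single (Word w) r) = G (Poly_Mapping.single (Word w) r)"
    and "\<And>X Y. F (X + Y) = F X + F Y" and "F 0 = 0"
    and "\<And>X Y. G (X + Y) = G X + G Y" and "G 0 = 0"
  shows "F X = G X"
proof -
  have F: "F (\<Sum>w\<in>S. Y w) = (\<Sum>w\<in>S. F (Y w))" and G: "G (\<Sum>w\<in>S. Y w) = (\<Sum>w\<in>S. G (Y w))" for S Y
    by (induct S rule: infinite_finite_induct) (simp_all add: assms)
  have "F (\<Sum>w\<in>Poly_Mapping.keys X. Poly_Mapping.single w (Poly_Mapping.lookup X w)) =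
     G (\<Sum>w\<in>Poly_Mapping.keys X. Poly_Mapping.single w (Poly_Mapping.lookup X w))"
    unfolding F G
  proof (rule sum.cong)
    fix w assume "w \<in> Poly_Mapping.keys X"
    then show "F (Poly_Mapping.single w (Poly_Mapping.lookup X w)) = G (Poly_Mapping.single w (Poly_Mapping.lookup X w))"
      using assms(1) by (cases w) simp
  qed simp
  then show ?thesis by (simp add: sum_single)
qed

lemma prod_list_one: "(\<And>b. b \<in> set v \<Longrightarrow> \<kappa> b = 1) \<Longrightarrow> prod_list (map \<kappa> v) = (1::complex)"
  by (induct v) auto

lemma prod_list_del: "\<kappa> a = 1 \<Longrightarrow> prod_list (map \<kappa> (del a v)) = prod_list (map \<kappa> v :: complex list)"
  by (induct v) (auto simp: del_simps)

lemma split_distinct: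
  assumes "distinct w" "a \<in> set w"
  obtains u v where "w = u @ a # v" "a \<notin> set u" "a \<notin> set v" "distinct u" "distinct v" "set u \<inter> set v = {}"
proof -
  from assms(2) obtain u v where w: "w = u @ a # v" by (auto simp: in_set_conv_decomp)
  with assms(1) show ?thesis by (intro that[of u v]) auto
qed

text \<open>A linear combination of the arrangements of a set of letters is determined, up to commutation of
  letters that are not neighbours, by its skew derivatives. The letter \<open>Suc c = Max S\<close> only has the
  neighbour \<open>c\<close>, so that \<open>X\<close> equals \<open>lett (Suc c) * Y - p * Y * lett (Suc c)\<close> with \<open>Y = before_part c X\<close>
  coming from the words where \<open>Suc c\<close> precedes \<open>c\<close>.\<close>

lemma chain_null:
  fixes \<kappa> :: "nat \<Rightarrow> nat \<Rightarrow> complex" and X :: "nat word \<Rightarrow>\<^sub>0 'a::complex_algebra_1"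
  assumes "finite S" "S \<noteq> {}" and keys: "\<And>w. Word w \<in> Poly_Mapping.keys X \<Longrightarrow> distinct w \<and> set w = S"
    and skew0: "\<And>a. a \<in> S \<Longrightarrow> skew (\<kappa> a) a X \<in> null"
    and \<kappa>1: "\<And>a b. nonadj a b \<Longrightarrow> \<kappa> a b = 1"
    and \<kappa>sym: "\<And>a b. \<kappa> a b = \<kappa> b a"
    and \<kappa>2: "\<And>a. a \<in> S \<Longrightarrow> Suc a \<in> S \<Longrightarrow> \<kappa> a (Suc a) * \<kappa> a (Suc a) \<noteq> 1"
  shows "X \<in> null"
  using assms(1-4) \<kappa>2
proof (induct "card S" arbitrary: S X)
  case 0 then show ?case by simp
next
  case (Suc n)
  define a where "a = Max S"
  have aS: "a \<in> S" and amax: "\<And>b. b \<in> S \<Longrightarrow> b \<le> a" using Suc by (auto simp: a_def)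
  show ?case
  proof (cases "\<exists>c. a = Suc c \<and> c \<in> S")
    case False
    then have na: "nonadj a b" if "b \<in> S" "b \<noteq> a" for b
      using that amax[of b] by (cases "a = Suc b") (auto simp: nonadj_def)
    \<comment> \<open>Here \<open>a\<close> commutes with all other letters and has trivial twist on
      them, so each word may be rewritten with \<open>a\<close> at its right end.\<close>
    have "X - skew (\<kappa> a) a X * lett a \<in> null"
    proof (rule by_words[where F = "\<lambda>X. X - skew (\<kappa> a) a X * lett a"])
      fix w and r :: 'a assume w: "Word w \<in> Poly_Mapping.keys X"
      obtain u v where uv: "w = u @ a # v" "a \<notin> set u" "a \<notin> set v"
        using split_distinct Suc(5)[OF w] aS by metis
      have v: "nonadj a b" if "b \<in> set v" for b using Suc(5)[OF w] uv that na by auto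
      have "skew (\<kappa> a) a (Poly_Mapping.single (Word w) r) = cst r * (wmono u * wmono v)"
        using uv v \<kappa>1 by (simp add: skew_single skew_list_split prod_list_one scaleC_one mono_append)
      then have "Poly_Mapping.single (Word w) r - skew (\<kappa> a) a (Poly_Mapping.single (Word w) r) * lett a =
         cst r * wmono u * (lett a * wmono v - wmono v * lett a)"
        by (simp add: uv single_eq_mono mono_append mono_simps algebra_simps)
      then show "Poly_Mapping.single (Word w) r - skew (\<kappa> a) a (Poly_Mapping.single (Word w) r) * lett a \<in> null"
        using null_mult(1)[OF mono_commute[of v a, OF v]] by simp
    qed (simp_all add: skew.add skew.zero algebra_simps)
    from null_add[OF this null_mult(2)[OF Suc(6)[OF aS], of "lett a"]] show ?thesis by simp
  next
    case True
    then obtain c where c: "a = Suc c" "c \<in> S" by auto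
    define p where "p = \<kappa> a c"
    have p2: "p * p \<noteq> 1" using Suc(7)[of c] c aS \<kappa>sym[of c a] by (simp add: p_def)
    define Y where "Y = before_part c X"
    \<comment> \<open>The words in which \<open>c\<close> precedes \<open>a\<close>: there
      \<open>a\<close> can move to the right end, as in those of \<open>Y\<close> it can move to the
      left end, without crossing \<open>c\<close>.\<close>
    define Z where "Z = delete_letter a X - before_part c X"
    have na: "nonadj a b" if "b \<in> S" "b \<noteq> a" "b \<noteq> c" for b
      using that amax[of b] c by (auto simp: nonadj_def)
    have side: "c \<in> set (after a w) \<longleftrightarrow> c \<in> set v" if "w = u @ a # v" "a \<notin> set u" for w u v
      using that by (simp add: after_append after_Cons)
    have X: "X - (lett a * Y + Z * lett a) \<in> null"
      unfolding Y_def Z_def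
    proof (rule by_words[where F = "\<lambda>X. X - (lett a * before_part c X + (delete_letter a X - before_part c X) * lett a)"])
      fix w and r :: 'a assume w: "Word w \<in> Poly_Mapping.keys X"
      obtain u v where uv: "w = u @ a # v" "a \<notin> set u" "a \<notin> set v" "set u \<inter> set v = {}"
        using split_distinct Suc(5)[OF w] aS by metis
      have S: "set u \<subseteq> S" "set v \<subseteq> S" using Suc(5)[OF w] uv by auto
      let ?x = "Poly_Mapping.single (Word w) r"
      have x: "?x = cst r * (wmono u * (lett a * wmono v))"
        by (simp add: uv single_eq_mono mono_append mono_simps mult.assoc)
      have dl: "delete_letter a ?x = cst r * (wmono u * wmono v)"
        using uv by (simp add: delete_letter_single del_simps) (simp add: single_eq_mono mono_append)
      show "?x - (lett a * before_part c ?x + (delete_letter a ?x - before_part c ?x) * lett a) \<in> null"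
      proof (cases "c \<in> set v")
        case True
        then have bp: "before_part c ?x = cst r * (wmono u * wmono v)"
          using side[OF uv(1,2)] dl by (simp add: before_part.single c delete_letter_single)
        have "nonadj a b" if "b \<in> set u" for b using na S uv that True by (cases "b = c") auto
        then have "- (lett a * wmono u - wmono u * lett a) \<in> (null :: (nat word \<Rightarrow>\<^sub>0 'a) set)"
          by (intro null_uminus mono_commute)
        then have "cst r * (wmono u * lett a - lett a * wmono u) * wmono v \<in> null"
          by (intro null_mult) simp
        moreover have "lett a * (cst r * Q) = cst r * (lett a * Q)" for Q
          by (simp add: mult.assoc(1)[symmetric] cst_lett)
        ultimately show ?thesis unfolding bp dl unfolding x by (simp add: algebra_simps)
      next
        case False
        then have bp: "before_part c ?x = 0"
          using side[OF uv(1,2)] by (simp add: before_part.single c)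
        have "nonadj a b" if "b \<in> set v" for b using na S uv that False by (cases "b = c") auto
        then have "cst r * wmono u * (lett a * wmono v - wmono v * lett a) \<in> null"
          by (intro null_mult mono_commute)
        then show ?thesis unfolding bp dl unfolding x by (simp add: algebra_simps)
      qed
    qed (simp_all add: before_part.add before_part.zero delete_letter.simps algebra_simps)
    \<comment> \<open>Deleting \<open>a\<close> costs the twists of the letters to its right. Only
      \<open>c\<close> has a non-trivial twist, and it stands to the right of \<open>a\<close>
      exactly in the words that make up \<open>Y\<close>.\<close>
    have "skew (\<kappa> a) a X = p *\<^sub>C Y + Z"
      unfolding Y_def Z_def
    proof (rule by_words_eq[where F = "skew (\<kappa> a) a" and G = "\<lambda>X. p *\<^sub>C before_part c X + (delete_letter a X - before_part c X)"])
      fix w and r :: 'a assume w: "Word w \<in> Poly_Mapping.keys X"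
      obtain u v where uv: "w = u @ a # v" "a \<notin> set u" "a \<notin> set v" "set u \<inter> set v = {}" "distinct v"
        using split_distinct Suc(5)[OF w] aS by metis
      have S: "set u \<subseteq> S" "set v \<subseteq> S" using Suc(5)[OF w] uv by auto
      let ?x = "Poly_Mapping.single (Word w) r"
      have dl: "delete_letter a ?x = cst r * wmono (u @ v)"
        using uv by (simp add: delete_letter_single del_simps) (simp add: single_eq_mono)
      have bp: "before_part c ?x = (if c \<in> set v then cst r * wmono (u @ v) else 0)"
        using side[OF uv(1,2)] dl by (simp add: before_part.single c delete_letter_single)
      have "prod_list (map (\<kappa> a) v) = (if c \<in> set v then p else 1)"
      proof (cases "c \<in> set v")
        case True
        then obtain v1 v2 where v: "v = v1 @ c # v2" "c \<notin> set v1" "c \<notin> set v2" using uv(5) split_distinct by metis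
        have "prod_list (map (\<kappa> a) v1) = 1" "prod_list (map (\<kappa> a) v2) = 1"
          using v S uv(3) by (auto intro!: prod_list_one \<kappa>1 na)
        then show ?thesis by (simp add: v p_def)
      next
        case False
        then show ?thesis using S uv(3) by (auto intro!: prod_list_one \<kappa>1 na)
      qed
      then show "skew (\<kappa> a) a ?x = p *\<^sub>C before_part c ?x + (delete_letter a ?x - before_part c ?x)"
        unfolding dl bp using uv by (simp add: skew_single skew_list_split scaleC_mult scaleC_one)
    qed (simp_all add: before_part.add before_part.zero delete_letter.simps algebra_simps scaleC_add_right skew.add skew.zero)
    then have pYZ: "p *\<^sub>C Y + Z \<in> null" using Suc(6)[OF aS] by simp
    have keysY: "distinct w \<and> set w = S - {a}" if "Word w \<in> Poly_Mapping.keys Y" for w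
    proof -
      have "Y = (\<Sum>v\<in>Poly_Mapping.keys X. before_part c (Poly_Mapping.single v (Poly_Mapping.lookup X v)))"
        unfolding Y_def using before_part.sum sum_single[of X] by metis
      then have "Word w \<in> (\<Union>v\<in>Poly_Mapping.keys X. Poly_Mapping.keys (before_part c (Poly_Mapping.single v (Poly_Mapping.lookup X v))))"
        using that keys_sum[of "\<lambda>v. before_part c (Poly_Mapping.single v (Poly_Mapping.lookup X v))" "Poly_Mapping.keys X"]
        by (metis subsetD)
      then obtain v where v: "Word v \<in> Poly_Mapping.keys X"
          "Word w \<in> Poly_Mapping.keys (before_part c (Poly_Mapping.single (Word v) (Poly_Mapping.lookup X (Word v))))"
        by (elim UN_E) (metis word.exhaust)
      then have "w = del a v" by (auto simp: before_part.single c split: if_splits)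
      then show ?thesis using Suc(5)[OF v(1)] by (simp add: del_simps)
    qed
    have "Y \<in> null"
    proof (rule Suc(1)[of "S - {a}"])
      show "n = card (S - {a})" using Suc(2) aS Suc(3) by simp
      show "finite (S - {a})" "S - {a} \<noteq> {}" using Suc(3) c by auto
      show "distinct w \<and> set w = S - {a}" if "Word w \<in> Poly_Mapping.keys Y" for w by (rule keysY[OF that])
      show "\<kappa> b (Suc b) * \<kappa> b (Suc b) \<noteq> 1" if "b \<in> S - {a}" "Suc b \<in> S - {a}" for b using Suc(7) that by simp
      fix b assume b: "b \<in> S - {a}"
      then have bS: "b \<in> S" "b \<noteq> a" by auto
      show "skew (\<kappa> b) b Y \<in> null"
      proof (cases "b = c")
        case False
        \<comment> \<open>Since \<open>b\<close> is no neighbour of \<open>a\<close>, deleting it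
          involves no twist from \<open>a\<close>, and it does not affect the order of
          \<open>a\<close> and \<open>c\<close>.\<close>
        have "skew (\<kappa> b) b (before_part c X) = before_part c (skew (\<kappa> b) b X)"
        proof (rule by_words_eq[where F = "\<lambda>X. skew (\<kappa> b) b (before_part c X)" and G = "\<lambda>X. before_part c (skew (\<kappa> b) b X)"])
          fix w and r :: 'a assume w: "Word w \<in> Poly_Mapping.keys X"
          obtain u v where uv: "w = u @ b # v" "b \<notin> set u" "b \<notin> set v"
            using split_distinct Suc(5)[OF w] bS by metis
          let ?x = "Poly_Mapping.single (Word w) r"
          have 1: "skew (\<kappa> b) b ?x = Poly_Mapping.single (Word (u @ v)) (prod_list (map (\<kappa> b) v) *\<^sub>C r)"
            using uv by (simp add: skew_single skew_list_split single_eq_mono[of "Word (u @ v)"] cst_simps scaleC_mult)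
          have "\<kappa> b a = 1" using na[of b] bS False \<kappa>1 \<kappa>sym by metis
          then have 2: "skew (\<kappa> b) b (Poly_Mapping.single (Word (del a w)) r) =
             Poly_Mapping.single (Word (del a (u @ v))) (prod_list (map (\<kappa> b) v) *\<^sub>C r)"
            using uv bS by (simp add: skew_single del_simps skew_list_split prod_list_del
                single_eq_mono[of "Word (del a u @ del a v)"] cst_simps scaleC_mult)
          have "c \<in> set (after a w) \<longleftrightarrow> c \<in> set (after a (u @ v))"
            using uv bS False by (cases "a \<in> set u") (auto simp: after_append after_Cons)
          then show "skew (\<kappa> b) b (before_part c ?x) = before_part c (skew (\<kappa> b) b ?x)"
            unfolding 1 using 2 by (simp add: before_part.single c(1)[symmetric] skew.zero)
        qed (simp_all add: before_part.add before_part.zero skew.add skew.zero)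
        then show ?thesis unfolding Y_def
          using null_before_part[OF Suc(6)[OF bS(1)]] by simp
      next
        case True
        have \<kappa>c: "\<kappa> c a = p" by (simp add: p_def \<kappa>sym)
        \<comment> \<open>The derivative at \<open>c\<close> meets the twist \<open>p\<close> of
          \<open>a\<close> exactly in the words of \<open>Z\<close>. Together with the relation
          \<open>p *\<^sub>C Y + Z \<in> null\<close> just obtained, this leaves the factor
          \<open>1 - p * p\<close> on the derivative of \<open>Y\<close>, and that is the reason for
          the hypothesis on squares.\<close>
        have "delete_letter a (skew (\<kappa> c) c X) = skew (\<kappa> c) c (before_part c X) +
          p *\<^sub>C skew (\<kappa> c) c (delete_letter a X - before_part c X)"
        proof (rule by_words_eq[where F = "\<lambda>X. delete_letter a (skew (\<kappa> c) c X)" and G =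
              "\<lambda>X. skew (\<kappa> c) c (before_part c X) + p *\<^sub>C skew (\<kappa> c) c (delete_letter a X - before_part c X)"])
          fix w and r :: 'a assume w: "Word w \<in> Poly_Mapping.keys X"
          obtain u v where uv: "w = u @ c # v" "c \<notin> set u" "c \<notin> set v" "set u \<inter> set v = {}" "distinct v"
            using split_distinct Suc(5)[OF w] c(2) by metis
          have ac: "a \<noteq> c" using c by simp
          have auv: "a \<in> set u \<and> a \<notin> set v \<or> a \<notin> set u \<and> a \<in> set v" using uv Suc(5)[OF w] aS ac by auto
          let ?x = "Poly_Mapping.single (Word w) r"
          have 1: "delete_letter a (skew (\<kappa> c) c ?x) = cst r * (prod_list (map (\<kappa> c) v) *\<^sub>C wmono (del a u @ del a v))"
            using uv by (simp add: skew_single skew_list_split single_eq_mono[of "Word _", symmetric] delete_letter.simps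
                wmono_def delete_letter_single del_simps)
          have 2: "skew (\<kappa> c) c (delete_letter a ?x) = cst r * (prod_list (map (\<kappa> c) (del a v)) *\<^sub>C wmono (del a u @ del a v))"
            using uv ac by (simp add: delete_letter_single skew_single del_simps skew_list_split)
          show "delete_letter a (skew (\<kappa> c) c ?x) = skew (\<kappa> c) c (before_part c ?x) +
            p *\<^sub>C skew (\<kappa> c) c (delete_letter a ?x - before_part c ?x)"
          proof (cases "a \<in> set u")
            case True
            then have "before_part c ?x = delete_letter a ?x"
              using uv ac by (simp add: before_part.single c(1)[symmetric] delete_letter_single after_append)
            moreover have "del a v = v" using True auv by (simp add: del_simps)
            ultimately show ?thesis using 1 2 by (simp add: skew.zero)
          next
            case False
            then have "c \<notin> set (after a w)"
              using uv ac set_after[of a v] by (auto simp: after_append after_Cons)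
            then have "before_part c ?x = 0" by (simp add: before_part.single c(1)[symmetric])
            moreover have "prod_list (map (\<kappa> c) v) = p * prod_list (map (\<kappa> c) (del a v))"
            proof -
              have av: "a \<in> set v" using False auv by simp
              obtain v1 v2 where v: "v = v1 @ a # v2" "a \<notin> set v1" "a \<notin> set v2" using uv(5) av split_distinct by metis
              then show ?thesis by (simp add: del_simps \<kappa>c)
            qed
            ultimately show ?thesis using 1 2 by (simp add: skew.zero scaleC_mult scaleC_scaleC)
          qed
        qed (simp_all add: before_part.add before_part.zero skew.add skew.zero delete_letter.simps algebra_simps
            scaleC_add_right skew.diff scaleC_right_diff)
        moreover have "delete_letter a (skew (\<kappa> c) c X) \<in> null"
          using null_delete_letter Suc(6) c by blast
        ultimately have 1: "skew (\<kappa> c) c Y + p *\<^sub>C skew (\<kappa> c) c Z \<in> null" by (simp add: Y_def Z_def)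
        have "skew (\<kappa> c) c (p *\<^sub>C Y + Z) \<in> null" by (rule null_skew[OF pYZ]) (rule \<kappa>1)
        then have "p *\<^sub>C (p *\<^sub>C skew (\<kappa> c) c Y + skew (\<kappa> c) c Z) \<in> null"
          by (simp add: null_scaleC skew.add skew_scaleC)
        from null_diff[OF 1 this] have "(1 - p * p) *\<^sub>C skew (\<kappa> c) c Y \<in> null"
          by (simp add: scaleC_add_right scaleC_scaleC complex_vector.scale_left_diff_distrib scaleC_one)
        from null_scaleC[OF this, of "1 / (1 - p * p)"] show ?thesis
          using p2 True by (simp add: scaleC_scaleC scaleC_one)
      qed
    qed
    then have "lett a * Y - p *\<^sub>C (Y * lett a) \<in> null"
      by (intro null_diff null_scaleC null_mult(1)[of Y] null_mult(2)[of Y])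
    moreover have "(p *\<^sub>C Y + Z) * lett a \<in> null" using pYZ by (rule null_mult)
    ultimately have "(X - (lett a * Y + Z * lett a)) + (lett a * Y - p *\<^sub>C (Y * lett a)) + (p *\<^sub>C Y + Z) * lett a \<in> null"
      using X by (intro null_add)
    then show ?thesis by (simp add: algebra_simps scaleC_mult)
  qed
qed

section \<open>Components of a lift by letter content\<close>

lemma aug_lookup: "aug X = Poly_Mapping.lookup X 0"
proof (induct X rule: poly_mapping_additive_induct)
  case (single w r)
  then show ?case
    using aug.wsingle[of "letters w" r] by (cases w) (auto simp: lookup_single when_def zero_word_def neq_Nil_conv)
qed (simp_all add: aug.simps lookup_add)

definition part :: "(nat list \<Rightarrow> bool) \<Rightarrow> (nat word \<Rightarrow>\<^sub>0 'u) \<Rightarrow> nat word \<Rightarrow>\<^sub>0 'u::complex_algebra_1" where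
  "part Q = plift (\<lambda>w r. if Q (letters w) then Poly_Mapping.single w r else 0)"

interpretation part: additive_family "\<lambda>(w::nat word) (r::'u::complex_algebra_1). if Q (letters w) then Poly_Mapping.single w r else 0"
  rewrites "plift (\<lambda>(w::nat word) (r::'u::complex_algebra_1). if Q (letters w) then Poly_Mapping.single w r else 0) = part Q" for Q
  by (unfold_locales, simp_all add: single_add part_def)

lemma lookup_part: "Poly_Mapping.lookup (part Q X) w = (if Q (letters w) then Poly_Mapping.lookup X w else 0)"
  by (induct X rule: poly_mapping_additive_induct)
    (auto simp: part.zero part.add part.single lookup_add lookup_single when_def)

lemma part_keys: "Word w \<in> Poly_Mapping.keys (part Q X) \<Longrightarrow> Q w"
  by (auto simp: in_keys_iff lookup_part split: if_splits)

lemma part_cst_mult: "part Q (cst r * X) = cst r * part Q X"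
  by (induct X rule: poly_mapping_additive_induct)
    (simp_all add: part.zero part.add part.single distrib_left, simp add: cst_def mult_single part.single)

lemma part_mult_cst: "part Q (X * cst r) = part Q X * cst r"
  by (induct X rule: poly_mapping_additive_induct)
    (simp_all add: part.zero part.add part.single distrib_right, simp add: cst_def mult_single part.single)

lemma part_scaleC: "part Q (c *\<^sub>C X) = c *\<^sub>C part Q X"
  by (rule poly_mapping_eqI) (simp add: lookup_part)

lemma part_tau: "part Q (tau \<kappa> X) = tau \<kappa> (part Q X)"
  by (rule poly_mapping_eqI) (simp add: lookup_part lookup_tau)

lemma part_disjoint:
  assumes "\<And>w. Q w \<longleftrightarrow> R w \<or> R' w" "\<And>w. \<not> (R w \<and> R' w)"
  shows "part Q X = part R X + part R' X"
  by (rule poly_mapping_eqI) (use assms in \<open>auto simp: lookup_part lookup_add\<close>)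

lemma part_one: "part (\<lambda>w. w = v) X = Poly_Mapping.single (Word v) (Poly_Mapping.lookup X (Word v))"
proof (rule poly_mapping_eqI)
  fix k show "Poly_Mapping.lookup (part (\<lambda>w. w = v) X) k =
      Poly_Mapping.lookup (Poly_Mapping.single (Word v) (Poly_Mapping.lookup X (Word v))) k"
    by (cases k) (auto simp: lookup_part lookup_single when_def)
qed

definition arrangement :: "nat set \<Rightarrow> nat list \<Rightarrow> bool" where
  "arrangement S w \<longleftrightarrow> distinct w \<and> set w = S"

lemma keys_skew_list:
  "Word v \<in> Poly_Mapping.keys (skew_list \<kappa> a w :: nat word \<Rightarrow>\<^sub>0 'u::complex_algebra_1) \<Longrightarrow> \<exists>x y. v = x @ y \<and> w = x @ a # y"
proof (induct w arbitrary: v)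
  case Nil then show ?case by simp
next
  case (Cons b w)
  have "skew_list \<kappa> a (b # w) = lett b * skew_list \<kappa> a w + (if b = a then tau \<kappa> (wmono w) else 0 :: nat word \<Rightarrow>\<^sub>0 'u)"
    by simp
  then consider "Word v \<in> Poly_Mapping.keys (lett b * skew_list \<kappa> a w :: nat word \<Rightarrow>\<^sub>0 'u)"
    | "b = a" "Word v \<in> Poly_Mapping.keys (tau \<kappa> (wmono w) :: nat word \<Rightarrow>\<^sub>0 'u)"
    using Cons(2) Poly_Mapping.keys_add[of "lett b * skew_list \<kappa> a w :: nat word \<Rightarrow>\<^sub>0 'u"
        "if b = a then tau \<kappa> (wmono w) else 0"] by (auto split: if_splits)
  then show ?case
  proof cases
    case 1
    have "Poly_Mapping.keys (lett b * skew_list \<kappa> a w :: nat word \<Rightarrow>\<^sub>0 'u) \<subseteq>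
      {x + y | x y. x \<in> Poly_Mapping.keys (lett b :: nat word \<Rightarrow>\<^sub>0 'u) \<and> y \<in> Poly_Mapping.keys (skew_list \<kappa> a w :: nat word \<Rightarrow>\<^sub>0 'u)}"
      by (rule keys_mult)
    with 1 obtain u where u: "Word v = Word [b] + u" "u \<in> Poly_Mapping.keys (skew_list \<kappa> a w :: nat word \<Rightarrow>\<^sub>0 'u)"
      by (auto simp: lett_def split: if_splits)
    obtain u' where u': "u = Word u'" by (cases u)
    from Cons(1)[of u'] u u' obtain x y where "u' = x @ y" "w = x @ a # y" by auto
    with u u' have "v = (b # x) @ y" "b # w = (b # x) @ a # y" by (simp_all add: plus_word_def)
    then show ?thesis by blast
  next
    case 2
    then have "v = w" by (auto simp: lookup_tau in_keys_iff wmono_def lookup_single when_def split: if_splits)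
    then show ?thesis using 2 by (intro exI[of _ "[]"] exI[of _ w]) simp
  qed
qed

lemma part_skew:
  assumes "\<And>x y. Q (x @ a # y) \<longleftrightarrow> R (x @ y)"
  shows "skew \<kappa> a (part Q X) = part R (skew \<kappa> a (X :: nat word \<Rightarrow>\<^sub>0 'u::complex_algebra_1))"
proof (induct X rule: poly_mapping_additive_induct)
  case (single w r)
  have k: "\<exists>x y. v = x @ y \<and> letters w = x @ a # y"
    if "Word v \<in> Poly_Mapping.keys (skew \<kappa> a (Poly_Mapping.single w r) :: nat word \<Rightarrow>\<^sub>0 'u)" for v
  proof (rule keys_skew_list)
    have "Poly_Mapping.lookup (cst r * X) k = r * Poly_Mapping.lookup X k" for X and k
      by (induct X rule: poly_mapping_additive_induct)
        (auto simp: cst_def mult_single lookup_single when_def distrib_left lookup_add)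
    then show "Word v \<in> Poly_Mapping.keys (skew_list \<kappa> a (letters w) :: nat word \<Rightarrow>\<^sub>0 'u)"
      using that by (cases w) (auto simp: skew_single in_keys_iff)
  qed
  have "part R (skew \<kappa> a (Poly_Mapping.single w r)) = (if Q (letters w) then skew \<kappa> a (Poly_Mapping.single w r) else 0)"
  proof (rule poly_mapping_eqI)
    fix l :: "nat word"
    obtain v where l: "l = Word v" by (cases l)
    show "Poly_Mapping.lookup (part R (skew \<kappa> a (Poly_Mapping.single w r))) l =
        Poly_Mapping.lookup (if Q (letters w) then skew \<kappa> a (Poly_Mapping.single w r) else 0) l"
      using k[of v] assms by (cases "Word v \<in> Poly_Mapping.keys (skew \<kappa> a (Poly_Mapping.single w r) :: nat word \<Rightarrow>\<^sub>0 'u)")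
        (auto simp: lookup_part l in_keys_iff)
  qed
  then show ?case by (simp add: part.single skew.zero)
qed (simp_all add: part.zero part.add skew.zero skew.add)

lemma part_skew_arrangement:
  assumes "a \<in> S"
  shows "skew \<kappa> a (part (arrangement S) X) = part (arrangement (S - {a})) (skew \<kappa> a X)"
proof -
  have "skew \<kappa> a (part (arrangement S) X) = part (\<lambda>w. arrangement S (a # w)) (skew \<kappa> a X)"
    by (rule part_skew) (auto simp: arrangement_def)
  also have "(\<lambda>w. arrangement S (a # w)) = arrangement (S - {a})"
    using assms by (auto simp: arrangement_def fun_eq_iff)
  finally show ?thesis .
qed

lemma part_sum:
  assumes "finite F" "\<And>S T w. S \<in> F \<Longrightarrow> T \<in> F \<Longrightarrow> Q S w \<Longrightarrow> Q T w \<Longrightarrow> S = T"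
  shows "part (\<lambda>w. \<exists>S\<in>F. Q S w) X = (\<Sum>S\<in>F. part (Q S) X)"
  using assms
proof (induct F)
  case empty
  show ?case by (rule poly_mapping_eqI) (simp add: lookup_part)
next
  case (insert S F)
  have "part (\<lambda>w. \<exists>T\<in>insert S F. Q T w) X = part (Q S) X + part (\<lambda>w. \<exists>T\<in>F. Q T w) X"
    by (rule part_disjoint) (use insert in auto)
  then show ?case using insert by simp
qed

section \<open>Weights of words and error terms\<close>

context coproduct_data
begin

definition word_weight :: "nat list \<Rightarrow> nat \<Rightarrow> int" where
  "word_weight w b = int (count_list w b)"

lemma wt_word_weight: "wt a (word_weight w) = sum_list (map (B a) w)"
proof (induct w)
  case Nil then show ?case by (simp add: word_weight_def wt_def)
next
  case (Cons b w)
  have "word_weight (b # w) = (\<lambda>c. simple_root b c + word_weight w c)"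
    by (auto simp: word_weight_def simple_root_def fun_eq_iff)
  then show ?case using Cons by (simp add: wt_simps)
qed

lemma prod_list_q: "prod_list (map (P a) w) = q powi wt a (word_weight w)"
  by (induct w) (simp_all add: wt_word_weight q_add)

lemma words_weight_lookup:
  "words_weight \<beta> X \<longleftrightarrow> (\<forall>w. Poly_Mapping.lookup X (Word w) \<in> weight_space (\<lambda>b. \<beta> b - word_weight w b))"
proof -
  have l: "Poly_Mapping.lookup (cst r * X) v = r * Poly_Mapping.lookup X v"
    "Poly_Mapping.lookup (X * cst r) v = Poly_Mapping.lookup X v * r" for r :: 'u and X v
    by (induct X rule: poly_mapping_additive_induct)
      (auto simp: cst_def mult_single lookup_single when_def distrib_left distrib_right lookup_add)
  have "cst (k a) * tau (P a) X = q powi wt a \<beta> *\<^sub>C (X * cst (k a)) \<longleftrightarrow>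
     (\<forall>w. k a * Poly_Mapping.lookup X (Word w) =
        q powi wt a (\<lambda>b. \<beta> b - word_weight w b) *\<^sub>C (Poly_Mapping.lookup X (Word w) * k a))" for a
  proof -
    have "cst (k a) * tau (P a) X = q powi wt a \<beta> *\<^sub>C (X * cst (k a)) \<longleftrightarrow>
      (\<forall>w. q powi wt a (word_weight w) *\<^sub>C (k a * Poly_Mapping.lookup X (Word w)) =
        q powi wt a \<beta> *\<^sub>C (Poly_Mapping.lookup X (Word w) * k a))"
      unfolding poly_mapping_eq_iff fun_eq_iff
      by (simp add: l lookup_tau prod_list_q scaleC_mult) (metis word.exhaust word.sel)
    also have "\<dots> \<longleftrightarrow> (\<forall>w. k a * Poly_Mapping.lookup X (Word w) =
        q powi wt a (\<lambda>b. \<beta> b - word_weight w b) *\<^sub>C (Poly_Mapping.lookup X (Word w) * k a))"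
    proof (intro iff_allI)
      fix w
      have "q powi m *\<^sub>C u = q powi n *\<^sub>C v \<longleftrightarrow> u = q powi (n - m) *\<^sub>C v" for m n and u v :: 'u
      proof
        assume "q powi m *\<^sub>C u = q powi n *\<^sub>C v"
        then have "q powi (- m) *\<^sub>C q powi m *\<^sub>C u = q powi (- m) *\<^sub>C q powi n *\<^sub>C v" by simp
        then show "u = q powi (n - m) *\<^sub>C v"
          using q_add[of n "- m"] by (simp add: scaleC_scaleC q_minus scaleC_one mult.commute)
      next
        assume "u = q powi (n - m) *\<^sub>C v"
        then show "q powi m *\<^sub>C u = q powi n *\<^sub>C v"
          using q_add[of m "n - m"] by (simp add: scaleC_scaleC)
      qed
      then show "(q powi wt a (word_weight w) *\<^sub>C (k a * Poly_Mapping.lookup X (Word w)) =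
          q powi wt a \<beta> *\<^sub>C (Poly_Mapping.lookup X (Word w) * k a)) =
        (k a * Poly_Mapping.lookup X (Word w) =
          q powi wt a (\<lambda>b. \<beta> b - word_weight w b) *\<^sub>C (Poly_Mapping.lookup X (Word w) * k a))"
        by (simp add: wt_simps)
    qed
    finally show ?thesis .
  qed
  then show ?thesis unfolding words_weight_def weight_space_def mem_Collect_eq by auto
qed

lemma words_weight_part: "words_weight \<beta> X \<Longrightarrow> words_weight \<beta> (part Q X)"
  by (simp add: words_weight_lookup lookup_part weight_space_simps)

text \<open>Sums of \<open>u \<odot> v\<close> of total weight \<open>\<tau>\<close> such that the weight of \<open>v\<close> is not bounded by \<open>\<zeta>\<close>. They do
  not contribute to the coproducts modulo the left ideal generated by the \<open>1 \<otimes> x\<^sup>+\<close>.\<close>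

definition junk :: "(nat \<Rightarrow> int) \<Rightarrow> (nat \<Rightarrow> int) \<Rightarrow> 'b set" where
  "junk \<tau> \<zeta> = complex_vector.span {u \<odot> v | u v. \<exists>\<beta> \<gamma>. u \<in> weight_space \<beta> \<and> v \<in> weight_space \<gamma> \<and>
     (\<forall>b<N. \<beta> b + \<gamma> b = \<tau> b) \<and> (\<exists>b<N. \<gamma> b > \<zeta> b)}"

lemma junkI:
  assumes "u \<in> weight_space \<beta>" "v \<in> weight_space \<gamma>" "\<And>b. b < N \<Longrightarrow> \<beta> b + \<gamma> b = \<tau> b" "b < N" "\<gamma> b > \<zeta> b"
  shows "u \<odot> v \<in> junk \<tau> \<zeta>"
  unfolding junk_def using assms by (intro complex_vector.span_base) blast

lemma junk_add: "X \<in> junk \<tau> \<zeta> \<Longrightarrow> Y \<in> junk \<tau> \<zeta> \<Longrightarrow> X + Y \<in> junk \<tau> \<zeta>"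
  and junk_diff: "X \<in> junk \<tau> \<zeta> \<Longrightarrow> Y \<in> junk \<tau> \<zeta> \<Longrightarrow> X - Y \<in> junk \<tau> \<zeta>"
  and junk_scaleC: "X \<in> junk \<tau> \<zeta> \<Longrightarrow> c *\<^sub>C X \<in> junk \<tau> \<zeta>"
  and junk_0: "0 \<in> junk \<tau> \<zeta>"
  unfolding junk_def
  by (simp_all add: complex_vector.span_add complex_vector.span_diff complex_vector.span_scale complex_vector.span_zero)

lemma junk_sum: "(\<And>i. i \<in> S \<Longrightarrow> X i \<in> junk \<tau> \<zeta>) \<Longrightarrow> (\<Sum>i\<in>S. X i) \<in> junk \<tau> \<zeta>"
  by (induct S rule: infinite_finite_induct) (auto intro: junk_0 junk_add)

lemma junk_induct [consumes 1, case_names tensor zero add scale]: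
  assumes "X \<in> junk \<tau> \<zeta>"
    and "\<And>u v \<beta> \<gamma> b. u \<in> weight_space \<beta> \<Longrightarrow> v \<in> weight_space \<gamma> \<Longrightarrow> (\<And>b. b < N \<Longrightarrow> \<beta> b + \<gamma> b = \<tau> b) \<Longrightarrow>
      b < N \<Longrightarrow> \<gamma> b > \<zeta> b \<Longrightarrow> R (u \<odot> v)"
    and "R 0" "\<And>X Y. R X \<Longrightarrow> R Y \<Longrightarrow> R (X + Y)" "\<And>c X. R X \<Longrightarrow> R (c *\<^sub>C X)"
  shows "R X"
  using assms(1) unfolding junk_def
proof (induct rule: complex_vector.span_induct_alt)
  case base show ?case by (rule assms(3))
next
  case (step c x y)
  then obtain u v \<beta> \<gamma> b where "x = u \<odot> v" "u \<in> weight_space \<beta>" "v \<in> weight_space \<gamma>"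
     "\<forall>b<N. \<beta> b + \<gamma> b = \<tau> b" "b < N" "\<gamma> b > \<zeta> b" by blast
  then show ?case using assms(2)[of u \<beta> v \<gamma> b] assms(4,5) step by simp
qed

lemma junk_mult:
  assumes "X \<in> junk \<tau> \<zeta>" "u \<in> weight_space \<beta>" "v \<in> weight_space \<gamma>"
    and "\<And>b. b < N \<Longrightarrow> \<tau>' b = \<tau> b + \<beta> b + \<gamma> b" "\<And>b. b < N \<Longrightarrow> \<zeta>' b \<le> \<zeta> b + \<gamma> b"
  shows "X * (u \<odot> v) \<in> junk \<tau>' \<zeta>'" "(u \<odot> v) * X \<in> junk \<tau>' \<zeta>'"
proof -
  show "X * (u \<odot> v) \<in> junk \<tau>' \<zeta>'" using assms(1)
  proof (induct rule: junk_induct)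
    case (tensor u' v' \<beta>' \<gamma>' b)
    have "(u' * u) \<odot> (v' * v) \<in> junk \<tau>' \<zeta>'"
      by (rule junkI[OF weight_space_mult[OF tensor(1) assms(2)] weight_space_mult[OF tensor(2) assms(3)] _ tensor(4)])
        (use assms(4) tensor(3) assms(5)[OF tensor(4)] tensor(5) in \<open>force+\<close>)
    then show ?case by (simp add: tp_mult)
  qed (simp_all add: junk_0 distrib_right junk_add scaleC_mult junk_scaleC)
  show "(u \<odot> v) * X \<in> junk \<tau>' \<zeta>'" using assms(1)
  proof (induct rule: junk_induct)
    case (tensor u' v' \<beta>' \<gamma>' b)
    have "(u * u') \<odot> (v * v') \<in> junk \<tau>' \<zeta>'"
      by (rule junkI[OF weight_space_mult[OF assms(2) tensor(1)] weight_space_mult[OF assms(3) tensor(2)] _ tensor(4)])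
        (use assms(4) tensor(3) assms(5)[OF tensor(4)] tensor(5) in \<open>force+\<close>)
    then show ?case by (simp add: tp_mult)
  qed (simp_all add: junk_0 distrib_left junk_add scaleC_mult junk_scaleC)
qed

lemma junk_mono:
  assumes "X \<in> junk \<tau> \<zeta>" "\<And>b. b < N \<Longrightarrow> \<tau>' b = \<tau> b" "\<And>b. b < N \<Longrightarrow> \<zeta>' b \<le> \<zeta> b"
  shows "X \<in> junk \<tau>' \<zeta>'"
  using junk_mult(1)[OF assms(1) weight_space_simps(2) weight_space_simps(2), of \<tau>' \<zeta>'] assms(2,3) by (simp add: tp_one)

lemma ev_single: "ev (Poly_Mapping.single (Word w) r) = r \<odot> prod_list (map e w)"
proof -
  have "prod_list (map (\<lambda>b. 1 \<odot> e b) w) = 1 \<odot> prod_list (map e w)"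
    by (induct w) (simp_all add: tp_one tp_mult)
  then show ?thesis by (simp add: ev.wsingle tp_mult)
qed

lemma weight_word: "prod_list (map e w) \<in> weight_space (word_weight w)"
proof (induct w)
  case Nil then show ?case by (simp add: word_weight_def weight_space_simps)
next
  case (Cons b w)
  have "word_weight (b # w) = (\<lambda>c. simple_root b c + word_weight w c)"
    by (auto simp: word_weight_def simple_root_def fun_eq_iff)
  then show ?case using weight_space_mult[OF weight_space_simps(5) Cons] by simp
qed

lemma ev_sum: "ev X = (\<Sum>w\<in>Poly_Mapping.keys X. Poly_Mapping.lookup X w \<odot> prod_list (map e (letters w)))"
proof -
  have "ev (\<Sum>w\<in>S. Y w) = (\<Sum>w\<in>S. ev (Y w))" for S and Y :: "nat word \<Rightarrow> nat word \<Rightarrow>\<^sub>0 'u"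
    by (induct S rule: infinite_finite_induct) (simp_all add: ev.simps)
  then have "ev X = (\<Sum>w\<in>Poly_Mapping.keys X. ev (Poly_Mapping.single w (Poly_Mapping.lookup X w)))"
    using sum_single[of X] by metis
  also have "\<dots> = (\<Sum>w\<in>Poly_Mapping.keys X. Poly_Mapping.lookup X w \<odot> prod_list (map e (letters w)))"
  proof (rule sum.cong)
    fix w show "ev (Poly_Mapping.single w (Poly_Mapping.lookup X w)) = Poly_Mapping.lookup X w \<odot> prod_list (map e (letters w))"
      by (cases w) (simp add: ev_single)
  qed simp
  finally show ?thesis .
qed

lemma ev_junk:
  assumes "words_weight \<beta> X" and out: "\<And>b. b \<ge> N \<Longrightarrow> e b = 0"
    and "\<And>w. Word w \<in> Poly_Mapping.keys X \<Longrightarrow> set w \<subseteq> {..<N} \<Longrightarrow> \<exists>b<N. int (count_list w b) > \<zeta> b"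
  shows "ev X \<in> junk \<beta> \<zeta>"
  unfolding ev_sum
proof (rule junk_sum)
  fix l assume l: "l \<in> Poly_Mapping.keys X"
  obtain w where w: "l = Word w" by (cases l)
  show "Poly_Mapping.lookup X l \<odot> prod_list (map e (letters l)) \<in> junk \<beta> \<zeta>"
  proof (cases "set w \<subseteq> {..<N}")
    case True
    then obtain b where "b < N" "int (count_list w b) > \<zeta> b" using assms(3) l w by auto
    then show ?thesis
      using junkI[of "Poly_Mapping.lookup X (Word w)" "\<lambda>b. \<beta> b - word_weight w b" "prod_list (map e w)" "word_weight w" \<beta> b \<zeta>]
        assms(1) weight_word by (simp add: words_weight_lookup w word_weight_def)
  next
    case False
    then obtain b where "b \<in> set w" "b \<ge> N" by (auto simp: subset_iff not_less)
    then have "prod_list (map e w) = 0" using out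
      by (induct w) auto
    then show ?thesis by (simp add: w junk_0)
  qed
qed

text \<open>Words only raise second weights, so a bound survives multiplication by an evaluated lift
  on either side. Loss can only come from a second factor of negative weight, as in
  \<open>junk_mult\<close>.\<close>

lemma junk_mult_ev:
  assumes "X \<in> junk \<tau> \<zeta>" "words_weight \<beta> Y" "\<And>b. b < N \<Longrightarrow> \<tau>' b = \<tau> b + \<beta> b"  "\<And>b. b < N \<Longrightarrow> \<zeta>' b \<le> \<zeta> b"
  shows "X * ev Y \<in> junk \<tau>' \<zeta>'" "ev Y * X \<in> junk \<tau>' \<zeta>'"
proof -
  have w: "Poly_Mapping.lookup Y l \<in> weight_space (\<lambda>b. \<beta> b - word_weight (letters l) b)" for l
    using assms(2) by (cases l) (simp add: words_weight_lookup)
  have ge: "\<zeta>' b \<le> \<zeta> b + word_weight v b" if "b < N" for b v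
    using assms(4)[OF that] by (simp add: word_weight_def)
  show "X * ev Y \<in> junk \<tau>' \<zeta>'" "ev Y * X \<in> junk \<tau>' \<zeta>'"
    unfolding ev_sum sum_distrib_left sum_distrib_right
    by (auto intro!: junk_sum junk_mult[OF assms(1) w weight_word] simp: assms(3) ge)
qed

text \<open>In degree zero \<open>L c X = 0\<close> identifies the coefficient of \<open>e\<^sub>c\<close> with \<open>D\<^sub>c [F, f\<^sub>c]\<close>.\<close>

lemma shift_formula:
  assumes g: "good A {\<Omega> + j | j. j \<in> junk (\<lambda>_. 0) (simple_root c)} F (\<lambda>_. 0) 1 X" and c: "c \<in> A" "c < N"
    and out: "\<And>b. b \<ge> N \<Longrightarrow> e b = 0"
  shows "\<Delta> F - (1 \<odot> F + F \<odot> 1 + \<Omega> + (D c *\<^sub>C (F * f c - f c * F)) \<odot> e c) \<in> junk (\<lambda>_. 0) (simple_root c)"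
proof -
  have aX: "aug X = F" and wX: "words_weight (\<lambda>_. 0) X" and Lc: "L c X = 0"
    using g c by (auto simp: good_def)
  obtain j where j: "\<Delta> F - (1 \<odot> F + ev X) = \<Omega> + j" "j \<in> junk (\<lambda>_. 0) (simple_root c)"
    using g by (auto simp: good_def)
  have X0: "X = part (\<lambda>w. w = []) X + (part (\<lambda>w. w = [c]) X + part (\<lambda>w. w \<noteq> [] \<and> w \<noteq> [c]) X)"
    by (rule poly_mapping_eqI) (auto simp: lookup_part lookup_add)
  have X1: "part (\<lambda>w. w = []) X = cst F"
    unfolding part_one using aX by (simp add: aug_lookup cst_def zero_word_def)
  have X2: "Poly_Mapping.lookup X (Word [c]) = D c *\<^sub>C (F * f c - f c * F)"
  proof -
    have "aug (L c X) = D c *\<^sub>C (F * f c - f c * F) - aug (skew (Pm c) c X)"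
      by (simp add: L_def aug.simps aug_tau aX)
    then have "aug (skew (Pm c) c X) = D c *\<^sub>C (F * f c - f c * F)" using Lc by (simp add: aug.zero)
    moreover have "aug (skew (Pm c) c Y) = Poly_Mapping.lookup Y (Word [c])" for Y :: "nat word \<Rightarrow>\<^sub>0 'u"
    proof (induct Y rule: poly_mapping_additive_induct)
      case (single w r)
      obtain v where w: "w = Word v" by (cases w)
      show ?case
      proof (cases v)
        case (Cons b v')
        then have "Poly_Mapping.single w r = cst r * (lett b * wmono v')" by (simp add: w single_eq_mono mono_simps)
        then have "aug (skew (Pm c) c (Poly_Mapping.single w r)) = (if b = c then r * aug (wmono v') else 0)"
          by (simp add: skew_cst_mult skew_lett_mult aug.simps aug_tau)
        moreover have "aug (wmono v' :: nat word \<Rightarrow>\<^sub>0 'u) = (if v' = [] then 1 else 0)"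
          by (cases v') (auto simp: mono_simps aug.simps)
        ultimately show ?thesis by (simp add: w Cons lookup_single when_def mono_simps aug.one)
      qed (simp add: w skew_single aug.simps lookup_single cst_simps)
    qed (simp_all add: skew.zero skew.add aug.simps lookup_add)
    ultimately show ?thesis by simp
  qed
  have "ev (part (\<lambda>w. w = [c]) X) = (D c *\<^sub>C (F * f c - f c * F)) \<odot> e c"
    unfolding part_one ev_single X2 by simp
  then have "ev X = F \<odot> 1 + ((D c *\<^sub>C (F * f c - f c * F)) \<odot> e c + ev (part (\<lambda>w. w \<noteq> [] \<and> w \<noteq> [c]) X))"
    using arg_cong[OF X0, of ev] by (simp only: ev.add X1 ev.cst)
  moreover have rest: "ev (part (\<lambda>w. w \<noteq> [] \<and> w \<noteq> [c]) X) \<in> junk (\<lambda>_. 0) (simple_root c)"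
  proof (rule ev_junk[OF words_weight_part[OF wX] out])
    fix w assume "Word w \<in> Poly_Mapping.keys (part (\<lambda>w. w \<noteq> [] \<and> w \<noteq> [c]) X)" and wN: "set w \<subseteq> {..<N}"
    then have w: "w \<noteq> []" "w \<noteq> [c]" using part_keys by blast+
    show "\<exists>b<N. simple_root c b < int (count_list w b)"
    proof (cases "\<exists>b\<in>set w. b \<noteq> c")
      case True
      then obtain b where b: "b \<in> set w" "b \<noteq> c" by auto
      then have "count_list w b \<noteq> 0" by (simp add: count_list_0_iff)
      then show ?thesis using b wN by (intro exI[of _ b]) (auto simp: simple_root_def)
    next
      case False
      then have "count_list w c = length w" by (induct w) auto
      moreover have "length w > 1" using w False by (cases w rule: list.exhaust; cases "tl w") auto
      ultimately show ?thesis using c by (intro exI[of _ c]) (simp add: simple_root_def)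
    qed
  qed
  ultimately show ?thesis using j junk_add[OF j(2) rest] by (simp add: algebra_simps)
qed

end

section \<open>Coproducts of the shift elements\<close>

text \<open>The nodes \<open>0, \<dots>, N - 1\<close> form a chain; those below \<open>r\<close> are not fixed by the diagram automorphism,
  the others are fixed. \<open>z\<close> is \<open>e\<^sub>\<epsilon>\<^sup>+\<close>, \<open>xp a m\<close> and \<open>xm a m\<close> are \<open>x\<^sup>\<plusminus>\<^bsub>a,m\<^esub>\<close> for \<open>m \<ge> 0\<close>, and
  \<open>psi a m\<close> is \<open>k\<^sub>a\<^sup>-\<^sup>1 \<phi>\<^sup>+\<^bsub>a,m\<^esub>\<close>.\<close>

locale loop_chain = coproduct_data N B q D e f k kinv tp \<Delta>
  for N and B :: "nat \<Rightarrow> nat \<Rightarrow> int" and q and D :: "nat \<Rightarrow> complex"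
    and e f k kinv :: "nat \<Rightarrow> 'u::complex_algebra_1"
    and tp :: "'u \<Rightarrow> 'u \<Rightarrow> 'b::complex_algebra_1"  (infixr "\<odot>" 72) and \<Delta> :: "'u \<Rightarrow> 'b" +
  fixes r M :: nat and z kz :: 'u and path :: "nat list" and xp xm psi :: "nat \<Rightarrow> nat \<Rightarrow> 'u"
    and C1 C2 C3 :: "nat \<Rightarrow> complex"
  assumes e_out: "b \<ge> N \<Longrightarrow> e b = 0"
    and B_nonadj: "nonadj a b \<Longrightarrow> B a b = 0"
    and P_adj: "Suc a < N \<Longrightarrow> P a (Suc a) * P a (Suc a) \<noteq> 1"
    and e_comm: "nonadj a b \<Longrightarrow> e a * e b = e b * e a"
    and r_pos: "0 < r" and r_le: "r \<le> N" and M: "1 < M"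
    and z_weight: "z \<in> weight_space (\<lambda>b. - simple_root 0 b - (\<Sum>t\<leftarrow>path. simple_root t b))"
    and z_f: "z * f a = f a * z"
    and \<Delta>_z: "\<Delta> z = z \<odot> 1 + kz \<odot> z"
    and kz: "kz = kinv 0 * prod_list (map kinv path)"
    and xm_path: "\<exists>c. xm 0 1 = c *\<^sub>C (fold bracket path z * k 0)"
    and xp_0: "xp a 0 = e a"
    and xp_weight: "xp a m \<in> weight_space (simple_root a)"
    and xm_weight: "xm a m \<in> weight_space (\<lambda>b. - simple_root a b)"
    and psi_weight: "psi a m \<in> weight_space (\<lambda>_. 0)"
    and psi_0: "psi a 0 = 1"
    and psi_comm: "psi a m * psi a n = psi a n * psi a m"
    and xp_f: "a \<noteq> b \<Longrightarrow> xp a m * f b = f b * xp a m"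
    and xp_xm: "a < r \<Longrightarrow> xp a m * xm a 1 - xm a 1 * xp a m = (1 / D a) *\<^sub>C (k a * psi a (Suc m))"
    and xp_xm_fixed: "r \<le> a \<Longrightarrow> a < N \<Longrightarrow> e a * xm a M - xm a M * e a = (1 / D a) *\<^sub>C (k a * psi a M)"
    and C1_nz: "a < r \<Longrightarrow> C1 a \<noteq> 0"
    and psi_xp: "a < r \<Longrightarrow> psi a 1 * xp a m - xp a m * psi a 1 = C1 a *\<^sub>C xp a (Suc m)"
    and psi_f: "a < r \<Longrightarrow> psi a 1 * f a - f a * psi a 1 = - C1 a *\<^sub>C xm a 1"
    and C2_nz: "Suc a < r \<Longrightarrow> C2 a \<noteq> 0"
    and psi_f_Suc: "Suc a < r \<Longrightarrow> psi a 1 * f (Suc a) - f (Suc a) * psi a 1 = - C2 a *\<^sub>C xm (Suc a) 1"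
    and psi_f_fixed: "r \<le> b \<Longrightarrow> 1 \<le> n \<Longrightarrow> n < M \<Longrightarrow> psi (r - 1) n * f b = f b * psi (r - 1) n"
    and psi_fixed: "r \<le> a \<Longrightarrow> 1 \<le> n \<Longrightarrow> n < M \<Longrightarrow> psi a n = 0"
    and C3_nz: "r \<le> Suc a \<Longrightarrow> Suc a < N \<Longrightarrow> C3 a \<noteq> 0"
    and psi_f_M: "r \<le> Suc a \<Longrightarrow> Suc a < N \<Longrightarrow> psi a M * f (Suc a) - f (Suc a) * psi a M = - C3 a *\<^sub>C xm (Suc a) M"
begin

lemma prod_kinv_comm:
  "prod_list (map kinv ts) * e s = q powi (- (\<Sum>t\<leftarrow>ts. B s t)) *\<^sub>C (e s * prod_list (map kinv ts))"
  "prod_list (map kinv ts) * f s = q powi (\<Sum>t\<leftarrow>ts. B s t) *\<^sub>C (f s * prod_list (map kinv ts))"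
  "prod_list (map kinv ts) * k s = k s * prod_list (map kinv ts)"
proof (induct ts)
  case Nil { case 1 then show ?case by (simp add: scaleC_one) next case 2 then show ?case by (simp add: scaleC_one) next case 3 then show ?case by simp }
next
  case (Cons t ts)
  { case 1
    have "kinv t * (prod_list (map kinv ts) * e s) = q powi (- (\<Sum>t\<leftarrow>ts. B s t)) *\<^sub>C (kinv t * e s * prod_list (map kinv ts))"
      by (simp add: Cons scaleC_mult mult.assoc)
    then show ?case using q_add[of "- B s t" "- (\<Sum>t\<leftarrow>ts. B s t)"]
      by (simp add: kinv_e scaleC_mult scaleC_scaleC mult.assoc B_sym[of t s] mult.commute)
  next
    case 2
    have "kinv t * (prod_list (map kinv ts) * f s) = q powi (\<Sum>t\<leftarrow>ts. B s t) *\<^sub>C (kinv t * f s * prod_list (map kinv ts))"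
      by (simp add: Cons scaleC_mult mult.assoc)
    then show ?case using q_add[of "\<Sum>t\<leftarrow>ts. B s t" "B s t"]
      by (simp add: kinv_f scaleC_mult scaleC_scaleC mult.assoc B_sym[of t s] add.commute)
  next
    case 3
    have "kinv t * (prod_list (map kinv ts) * k s) = kinv t * k s * prod_list (map kinv ts)"
      by (simp add: Cons mult.assoc)
    then show ?case by (simp add: kinv_k_comm mult.assoc) }
qed

text \<open>The element \<open>z\<close> commutes with every \<open>f a\<close>, so the constant
  lift solves all equations at once.\<close>

lemma good_z: "good UNIV {0} z (\<lambda>b. - simple_root 0 b - (\<Sum>t\<leftarrow>path. simple_root t b)) kz (cst z)"
  unfolding good_def
proof (intro conjI allI ballI)
  show "z \<in> weight_space (\<lambda>b. - simple_root 0 b - (\<Sum>t\<leftarrow>path. simple_root t b))" by (rule z_weight)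
  show "words_weight (\<lambda>b. - simple_root 0 b - (\<Sum>t\<leftarrow>path. simple_root t b)) (cst z)"
    by (simp add: words_weight_cst z_weight)
  show "\<Delta> z - (kz \<odot> z + ev (cst z)) \<in> {0}" by (simp add: \<Delta>_z ev.simps)
  show "L a (cst z) = 0" for a by (simp add: L_cst z_f cst_simps)
  show "aug (cst z) = z" by (simp add: aug.simps)
  fix s
  have wt: "wt s (\<lambda>b. - simple_root 0 b - (\<Sum>t\<leftarrow>path. simple_root t b)) = - B s 0 - (\<Sum>t\<leftarrow>path. B s t)"
    by (simp add: wt_diff wt_sum_list wt_minus wt_simple_root)
  show "kz * k s = k s * kz" by (simp add: kz mult.assoc prod_kinv_comm(3)) (simp add: mult.assoc[symmetric] kinv_k_comm)
  have "kz * e s = q powi (- (\<Sum>t\<leftarrow>path. B s t)) *\<^sub>C (kinv 0 * e s * prod_list (map kinv path))"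
    by (simp add: kz mult.assoc prod_kinv_comm(1) scaleC_mult)
  then show "kz * e s = q powi wt s (\<lambda>b. - simple_root 0 b - (\<Sum>t\<leftarrow>path. simple_root t b)) *\<^sub>C (e s * kz)"
    using q_add[of "- B s 0" "- (\<Sum>t\<leftarrow>path. B s t)"]
    by (simp add: kz kinv_e scaleC_mult scaleC_scaleC mult.assoc wt B_sym[of 0 s] mult.commute)
  have "kz * f s = q powi (\<Sum>t\<leftarrow>path. B s t) *\<^sub>C (kinv 0 * f s * prod_list (map kinv path))"
    by (simp add: kz mult.assoc prod_kinv_comm(2) scaleC_mult)
  then show "kz * f s = q powi (- wt s (\<lambda>b. - simple_root 0 b - (\<Sum>t\<leftarrow>path. simple_root t b))) *\<^sub>C (f s * kz)"
    using q_add[of "\<Sum>t\<leftarrow>path. B s t" "B s 0"]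
    by (simp add: kz kinv_f scaleC_mult scaleC_scaleC mult.assoc wt B_sym[of 0 s] add.commute)
qed

lemma good_fold:
  assumes "good UNIV {0} F \<beta> K X"
  shows "\<exists>Y. good UNIV {0} (fold bracket ts F) (\<lambda>b. \<beta> b + (\<Sum>t\<leftarrow>ts. simple_root t b)) (prod_list (map k (rev ts)) * K) Y"
  using assms
proof (induct ts arbitrary: F \<beta> K X)
  case Nil then show ?case by auto
next
  case (Cons t ts)
  from good_bracket[OF Cons(2), of t "{0}"] obtain Y where "good UNIV {0} (bracket t F) (\<lambda>b. \<beta> b + simple_root t b) (k t * K) Y"
    by auto
  from Cons(1)[OF this] show ?case by (simp add: add.assoc mult.assoc)
qed

lemma good_xm_0: "\<exists>X. good UNIV {0} (xm 0 1 * kinv 0) (\<lambda>b. - simple_root 0 b) (kinv 0) X"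
proof -
  have "prod_list (map k (rev ts)) * kinv 0 = kinv 0 * prod_list (map k (rev ts))" for ts
  proof (induct ts)
    case (Cons t ts)
    have "prod_list (map k (rev (t # ts))) * kinv 0 = prod_list (map k (rev ts)) * (kinv 0 * k t)"
      by (simp add: mult.assoc kinv_k_comm)
    also have "\<dots> = kinv 0 * prod_list (map k (rev ts)) * k t" by (simp add: mult.assoc[symmetric] Cons)
    finally show ?case by (simp add: mult.assoc)
  qed simp
  then have "prod_list (map k (rev path)) * kz = kinv 0 * (prod_list (map k (rev path)) * prod_list (map kinv path))"
    by (simp add: kz mult.assoc[symmetric])
  \<comment> \<open>The factors \<open>k t\<close> collected by the brackets cancel those of
    \<open>kz\<close>. What remains is the factor expected for the weight of
    \<open>xm 0 1\<close>.\<close>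
  then have K: "prod_list (map k (rev path)) * kz = kinv 0" by (simp add: prod_k_kinv)
  from good_fold[OF good_z, of path] obtain Y
    where Y: "good UNIV {0} (fold bracket path z) (\<lambda>b. - simple_root 0 b) (kinv 0) Y"
    by (auto simp: K)
  obtain c where "xm 0 1 = c *\<^sub>C (fold bracket path z * k 0)" using xm_path by auto
  then have "xm 0 1 * kinv 0 = c *\<^sub>C fold bracket path z" by (simp add: scaleC_mult mult.assoc k_kinv)
  then show ?thesis using good_scaleC[OF Y, of c "{0}"] by auto
qed

text \<open>Multiplication by \<open>kinv a\<close> turns the ordinary commutator of the Drinfeld
  relations into the q-commutator computed by \<open>bracket\<close>, and strips \<psi> of the
  factor \<open>k a\<close>.\<close>

lemma q_commutator:
  assumes "u \<in> weight_space (simple_root a)" "\<psi> \<in> weight_space (\<lambda>_. 0)"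
    and "u * v - v * u = (1 / D a) *\<^sub>C (k a * \<psi>)"
  shows "u * (v * kinv a) - P a a *\<^sub>C ((v * kinv a) * u) = (1 / D a) *\<^sub>C \<psi>"
proof -
  have "P a a *\<^sub>C ((v * kinv a) * u) = v * u * kinv a"
    by (simp add: mult.assoc weight_kinv[OF assms(1)] wt_simps scaleC_mult scaleC_scaleC q_minus scaleC_one)
  then have "u * (v * kinv a) - P a a *\<^sub>C ((v * kinv a) * u) = (u * v - v * u) * kinv a"
    by (simp add: left_diff_distrib mult.assoc)
  also have "\<dots> = (1 / D a) *\<^sub>C (\<psi> * (k a * kinv a))"
    unfolding assms(3) using weight_k[OF assms(2), of a] by (simp add: scaleC_mult wt_simps scaleC_one mult.assoc)
  finally show ?thesis by (simp add: k_kinv)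
qed

lemma bracket_xm:
  assumes "v \<in> weight_space (\<lambda>b. - simple_root a b)" "\<psi> \<in> weight_space (\<lambda>_. 0)"
    and "e a * v - v * e a = (1 / D a) *\<^sub>C (k a * \<psi>)"
  shows "bracket a (v * kinv a) = (1 / D a) *\<^sub>C \<psi>"
  using bracket_weight[OF weight_space_mult[OF assms(1) weight_space_simps(4)], of a]
    q_commutator[OF weight_space_simps(5) assms(2,3)]
  by (simp add: wt_simps)

lemma good_psi_of_xm:
  assumes g: "good A J (v * kinv a) (\<lambda>b. - simple_root a b) (kinv a) X"
    and v: "v \<in> weight_space (\<lambda>b. - simple_root a b)" "\<psi> \<in> weight_space (\<lambda>_. 0)"
     "e a * v - v * e a = (1 / D a) *\<^sub>C (k a * \<psi>)"
    and J: "\<And>j. j \<in> J \<Longrightarrow> D a *\<^sub>C (\<Delta> (e a) * j - P a a *\<^sub>C (j * \<Delta> (e a))) \<in> J'"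
  shows "\<exists>Y. good A J' \<psi> (\<lambda>_. 0) 1 Y"
proof -
  define J'' where "J'' = {\<Delta> (e a) * j - P a a *\<^sub>C (j * \<Delta> (e a)) | j. j \<in> J}"
  have "\<exists>Y. good A J'' (bracket a (v * kinv a)) (\<lambda>b. - simple_root a b + simple_root a b) (k a * kinv a) Y"
    by (rule exI, rule good_bracket[OF g]) (auto simp: J''_def wt_simps)
  then obtain Y where "good A J'' ((1 / D a) *\<^sub>C \<psi>) (\<lambda>b. 0) 1 Y"
    by (auto simp: bracket_xm[OF v] k_kinv)
  from good_scaleC[OF this, of "D a" J'] J show ?thesis
    using D_nz[of a] by (auto simp: J''_def scaleC_scaleC scaleC_one)
qed

text \<open>The two assertions alternate along the chain: the bracket with \<open>e a\<close> leads
  from \<open>xm a 1 * kinv a\<close> to \<open>psi a 1\<close>, and contraction with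
  \<open>f (Suc a)\<close> leads on to \<open>xm (Suc a) 1 * kinv (Suc a)\<close>. Up to this point
  everything is exact, with error set \<open>{0}\<close>.\<close>

lemma good_psi:
  assumes "a < r"
  shows "\<exists>X. good UNIV {0} (xm a 1 * kinv a) (\<lambda>b. - simple_root a b) (kinv a) X"
    and "\<exists>X. good UNIV {0} (psi a 1) (\<lambda>_. 0) 1 X"
proof -
  have step: "\<exists>X. good UNIV {0} (psi a 1) (\<lambda>_. 0) 1 X"
    if "good UNIV {0} (xm a 1 * kinv a) (\<lambda>b. - simple_root a b) (kinv a) X" "a < r" for a X
    using good_psi_of_xm[OF that(1) xm_weight psi_weight[of a 1], of "{0}"] xp_xm[OF that(2), of 0]
    by (simp add: xp_0)
  have "\<exists>X. good UNIV {0} (xm a 1 * kinv a) (\<lambda>b. - simple_root a b) (kinv a) X"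
    using assms
  proof (induct a)
    case 0 show ?case by (rule good_xm_0)
  next
    case (Suc a)
    then obtain X where "good UNIV {0} (xm a 1 * kinv a) (\<lambda>b. - simple_root a b) (kinv a) X" by auto
    from step[OF this] Suc obtain Y where "good UNIV {0} (psi a 1) (\<lambda>_. 0) 1 Y" by auto
    from good_contract[OF this, of "Suc a" "{0}"]
    obtain Y' where "good UNIV {0} (contract (Suc a) (psi a 1)) (\<lambda>b. - simple_root (Suc a) b) (kinv (Suc a)) Y'" by auto
    moreover have "contract (Suc a) (psi a 1) = (- D (Suc a) * C2 a) *\<^sub>C (xm (Suc a) 1 * kinv (Suc a))"
      by (simp only: contract_def psi_f_Suc[OF Suc(2)] scaleC_mult scaleC_scaleC) simp
    then obtain c where "c \<noteq> 0" "contract (Suc a) (psi a 1) = c *\<^sub>C (xm (Suc a) 1 * kinv (Suc a))"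
      using D_nz[of "Suc a"] C2_nz[OF Suc(2)] by (metis mult_eq_0_iff neg_equal_0_iff_equal)
    ultimately show ?case
      using good_scaleC[of UNIV "{0}" _ _ _ Y' "1 / c" "{0}"] by (fastforce simp: scaleC_scaleC scaleC_one)
  qed
  then show "\<exists>X. good UNIV {0} (xm a 1 * kinv a) (\<lambda>b. - simple_root a b) (kinv a) X" .
  then show "\<exists>X. good UNIV {0} (psi a 1) (\<lambda>_. 0) 1 X" using step assms by auto
qed

lemma shift_nonfixed:
  assumes "a < r"
  shows "\<Delta> (psi a 1) - (1 \<odot> psi a 1 + psi a 1 \<odot> 1 + (D a *\<^sub>C (psi a 1 * f a - f a * psi a 1)) \<odot> e a)
    \<in> junk (\<lambda>_. 0) (simple_root a)"
proof -
  obtain X where "good UNIV {0} (psi a 1) (\<lambda>_. 0) 1 X" using good_psi(2)[OF assms] by auto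
  then have "good UNIV {0 + j | j. j \<in> junk (\<lambda>_. 0) (simple_root a)} (psi a 1) (\<lambda>_. 0) 1 X"
    by (rule good_cong) (auto simp: junk_0)
  from shift_formula[OF this] show ?thesis using assms r_le e_out by simp
qed

lemma ev_null: "X \<in> null \<Longrightarrow> ev X = 0"
proof (induct rule: null.induct)
  case (null_step X x y Y Z)
  have "ev (lett x * lett y - lett y * lett x) = 0"
    using e_comm[OF null_step(3)] by (simp add: ev.simps tp_mult)
  then have "ev (Y * (lett x * lett y - lett y * lett x) * Z) = 0" by (simp only: ev.mult mult_zero_right mult_zero_left)
  then show ?case using null_step by (simp add: ev.add)
qed (simp add: ev.zero)

lemma Pm_nonadj: "nonadj a b \<Longrightarrow> Pm a b = 1"
  by (simp add: B_nonadj)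

lemma Pm_adj: "Suc a < N \<Longrightarrow> Pm a (Suc a) * Pm a (Suc a) \<noteq> 1"
  using P_adj[of a] q_minus(1)[of "B a (Suc a)"] by (metis mult.assoc mult.left_commute mult_1_right)

declare One_nat_def [simp del]

section \<open>Leading terms at the last node that is not fixed\<close>

definition i0 :: nat where
  "i0 = r - 1"

text \<open>One unit of room at every node from \<open>s\<close> on: each later commutation with an
  element of weight - \<alpha>_b in the second factor uses up the unit at \<open>b\<close>.\<close>

definition zeta :: "nat \<Rightarrow> nat \<Rightarrow> int" where
  "zeta s b = (if s \<le> b \<and> b < N then 1 else 0)"

definition comm :: "'c::complex_algebra_1 \<Rightarrow> 'c \<Rightarrow> 'c" where
  "comm x y = x * y - y * x"

lemma comm_simps:
  "comm (x + y) w = comm x w + comm y w" "comm w (x + y) = comm w x + comm w y"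
  "comm (c *\<^sub>C x) w = c *\<^sub>C comm x w" "comm w (c *\<^sub>C x) = c *\<^sub>C comm w x"
  "comm 0 w = 0" "comm w 0 = 0"
  by (simp_all add: comm_def algebra_simps scaleC_mult scaleC_right_diff)

lemma comm_sum: "comm w (\<Sum>j\<in>S. X j) = (\<Sum>j\<in>S. comm w (X j))"
  by (induct S rule: infinite_finite_induct) (simp_all add: comm_simps)

lemma i0_lt: "i0 < r" "i0 < N" "Suc i0 = r"
  using r_pos r_le by (auto simp: i0_def)

lemma psi_f_i0: "r \<le> b \<Longrightarrow> 1 \<le> n \<Longrightarrow> n < M \<Longrightarrow> psi i0 n * f b = f b * psi i0 n"
  unfolding i0_def by (rule psi_f_fixed)

lemma null_comm: "Z \<in> null \<Longrightarrow> comm Z W \<in> null"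
  by (metis comm_def null_diff null_mult)

lemma H_f: "comm (psi i0 1) (f i0) = - C1 i0 *\<^sub>C xm i0 1" "r \<le> b \<Longrightarrow> comm (psi i0 1) (f b) = 0"
  using psi_f[OF i0_lt(1)] psi_f_i0[of b 1] M by (simp_all add: comm_def)

context
  fixes Y
  assumes Y: "good UNIV {0} (psi i0 1) (\<lambda>_. 0) 1 Y"
begin

lemma skew_Y:
  "skew (Pm a) a Y = D a *\<^sub>C (Y * cst (f a) - cst (f a) * tau (Pm a) Y)"
proof -
  have "L a Y = 0" using Y by (simp add: good_def)
  then show ?thesis by (simp add: L_def)
qed

text \<open>The equation for \<open>Y\<close> respects letter content. It is a recursion that
  expresses all derivatives of one component by components with one letter less, and
  \<open>chain_null\<close> makes it effective.\<close>

lemma skew_arrangement: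
  assumes "a \<in> S"
  shows "skew (Pm a) a (part (arrangement S) Y) = D a *\<^sub>C (part (arrangement (S - {a})) Y * cst (f a)
    - cst (f a) * tau (Pm a) (part (arrangement (S - {a})) Y))"
  unfolding part_skew_arrangement[OF assms] skew_Y
  by (simp only: part_scaleC part.diff part_mult_cst part_cst_mult part_tau)

lemma part_empty: "part (arrangement {}) Y = cst (psi i0 1)"
proof -
  have "arrangement {} = (\<lambda>w. w = [])" by (auto simp: arrangement_def fun_eq_iff)
  then show ?thesis using Y by (simp add: part_one good_def aug_lookup cst_def zero_word_def)
qed

lemma part_i0: "part (arrangement {i0}) Y = cst ((- D i0 * C1 i0) *\<^sub>C xm i0 1) * lett i0"
proof -
  have "arrangement {i0} = (\<lambda>w. w = [i0])"
  proof (rule ext)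
    fix w show "arrangement {i0} w = (w = [i0])"
      by (cases w; cases "tl w") (auto simp: arrangement_def)
  qed
  then obtain R where R: "part (arrangement {i0}) Y = cst R * lett i0"
    by (simp add: part_one single_eq_mono mono_simps)
  have "cst R = skew (Pm i0) i0 (part (arrangement {i0}) Y)"
    by (simp add: R skew_cst_mult skew_lett)
  also have "\<dots> = D i0 *\<^sub>C cst (comm (psi i0 1) (f i0))"
    unfolding skew_arrangement[OF singletonI] by (simp add: part_empty tau.simps cst_simps comm_def)
  finally have "aug (cst R) = aug (D i0 *\<^sub>C cst (comm (psi i0 1) (f i0)))" by simp
  then show ?thesis by (simp add: R aug.simps H_f scaleC_scaleC)
qed

lemma null_f_step: "Z \<in> null \<Longrightarrow> c *\<^sub>C (Z * cst u - cst u * tau \<kappa> Z) \<in> null"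
  by (intro null_scaleC null_diff null_mult null_tau)

text \<open>The recursion starts from \<open>psi i0 1\<close>, which commutes with
  \<open>f a\<close> for every fixed \<open>a\<close>; so all derivatives vanish, letter by
  letter.\<close>

lemma fixed_part_null:
  assumes "S \<subseteq> {r..<N}" "S \<noteq> {}"
  shows "part (arrangement S) Y \<in> null"
  using assms
proof (induct "card S" arbitrary: S)
  case 0 then show ?case by (simp add: finite_subset)
next
  case (Suc n)
  show ?case
  proof (rule chain_null[where S = S and \<kappa> = Pm])
    show "finite S" "S \<noteq> {}" using Suc finite_subset by auto
    show "distinct w \<and> set w = S" if "Word w \<in> Poly_Mapping.keys (part (arrangement S) Y)" for w
      using part_keys[OF that] by (simp add: arrangement_def)
    show "Pm a b = 1" if "nonadj a b" for a b using that by (rule Pm_nonadj)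
    show "Pm a b = Pm b a" for a b by (simp add: B_sym[of a b])
    show "Pm a (Suc a) * Pm a (Suc a) \<noteq> 1" if "a \<in> S" "Suc a \<in> S" for a using that Suc(3) by (intro Pm_adj) auto
    fix a assume a: "a \<in> S"
    show "skew (Pm a) a (part (arrangement S) Y) \<in> null"
    proof (cases "S - {a} = {}")
      case True
      have "comm (psi i0 1) (f a) = 0" using a Suc(3) by (intro H_f) auto
      then show ?thesis
        unfolding skew_arrangement[OF a] True part_empty tau.cst
        by (simp add: cst_simps(5)[symmetric] cst_simps(4)[symmetric] comm_def cst_simps(1) null_0)
    next
      case False
      have "n = card (S - {a})" using Suc(2) a by simp
      then show ?thesis unfolding skew_arrangement[OF a]
        using Suc(1)[of "S - {a}"] Suc(3) False by (intro null_f_step) auto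
    qed
  qed
qed

text \<open>The recursion now starts from \<open>xm i0 1\<close> at the letter \<open>i0\<close>,
  and adding fixed letters amounts to twisted commutators of this coefficient with the
  \<open>f a\<close>. Commuting with \<open>xp i0 n\<close> replaces \<open>xm i0 1\<close> by a
  multiple of \<open>k i0 * psi i0 (Suc n)\<close>, which such a twisted commutator kills as long as
  \<open>Suc n < M\<close>. Deleting \<open>i0\<close> itself leads back to
  \<open>fixed_part_null\<close>.\<close>

lemma commutator_part_null:
  assumes "S \<subseteq> {r..<N}" "S \<noteq> {}" and n: "Suc n < M"
  shows "comm (part (arrangement (insert i0 S)) Y) (cst (xp i0 n)) \<in> null"
  using assms(1,2)
proof (induct "card S" arbitrary: S)
  case 0 then show ?case by (simp add: finite_subset)
next
  case (Suc l)
  let ?x = "xp i0 n"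
  have i0S: "i0 \<notin> S" using Suc(3) i0_lt by auto
  have part_comm: "comm (part Q Y) (cst ?x) = part Q (comm Y (cst ?x))" for Q
    by (simp add: comm_def part.diff part_mult_cst part_cst_mult)
  have skew_comm: "skew \<kappa> a (comm Z (cst ?x)) = comm (skew \<kappa> a Z) (cst ?x)" for \<kappa> a Z
    by (simp add: comm_def skew.diff skew_mult_cst skew_cst_mult)
  show ?case
  proof (rule chain_null[where S = "insert i0 S" and \<kappa> = Pm])
    show "finite (insert i0 S)" "insert i0 S \<noteq> {}" using Suc finite_subset by auto
    show "distinct w \<and> set w = insert i0 S"
      if "Word w \<in> Poly_Mapping.keys (comm (part (arrangement (insert i0 S)) Y) (cst ?x))" for w
      using that part_keys unfolding part_comm by (metis arrangement_def)
    show "Pm a b = 1" if "nonadj a b" for a b using that by (rule Pm_nonadj)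
    show "Pm a b = Pm b a" for a b by (simp add: B_sym[of a b])
    show "Pm a (Suc a) * Pm a (Suc a) \<noteq> 1" if "a \<in> insert i0 S" "Suc a \<in> insert i0 S" for a
      using that Suc(3) i0_lt by (intro Pm_adj) auto
    fix a assume a: "a \<in> insert i0 S"
    let ?Y' = "part (arrangement (insert i0 S - {a})) Y"
    have sk: "skew (Pm a) a (comm (part (arrangement (insert i0 S)) Y) (cst ?x)) =
      comm (D a *\<^sub>C (?Y' * cst (f a) - cst (f a) * tau (Pm a) ?Y')) (cst ?x)"
      unfolding skew_comm skew_arrangement[OF a] ..
    show "skew (Pm a) a (comm (part (arrangement (insert i0 S)) Y) (cst ?x)) \<in> null"
    proof (cases "a = i0")
      case True
      then have "?Y' \<in> null" using fixed_part_null[OF Suc(3,4)] i0S by simp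
      then show ?thesis
        unfolding sk by (intro null_comm null_f_step)
    next
      case False
      then have aS: "a \<in> S" "r \<le> a" using a Suc(3) by auto
      have xf: "cst ?x * cst (f a) = cst (f a) * cst ?x"
        using xp_f[of i0 a n] False by (simp add: cst_simps(5)[symmetric])
      show ?thesis
      proof (cases "S - {a} = {}")
        case True
        then have "insert i0 S - {a} = {i0}" using False aS by auto
        then obtain \<rho> where Y': "?Y' = cst (\<rho> *\<^sub>C xm i0 1) * lett i0" using part_i0 by metis
        define u where "u = xm i0 1 * f a - Pm a i0 *\<^sub>C (f a * xm i0 1)"
        have "?Y' * cst (f a) - cst (f a) * tau (Pm a) ?Y' = \<rho> *\<^sub>C (cst u * lett i0)"
          unfolding Y' u_def
          by (simp add: tau.simps cst_simps scaleC_mult scaleC_right_diff scaleC_scaleC algebra_simps cst_lett mult.commute)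
        moreover have "comm (cst u * lett i0) (cst ?x) = cst (comm u ?x) * lett i0"
          by (simp add: comm_def cst_simps algebra_simps mult.assoc cst_lett)
        \<comment> \<open>Moving \<open>?x\<close> past \<open>xm i0 1\<close> produces
          \<open>w\<close>. In degrees below \<open>M\<close> the series coefficient in
          \<open>w\<close> commutes with \<open>f a\<close>, so only \<open>k i0\<close> contributes
          a power of \<open>q\<close>, and the two occurrences of \<open>w\<close> cancel.\<close>
        moreover have "comm u ?x = 0"
        proof -
          define w where "w = (1 / D i0) *\<^sub>C (k i0 * psi i0 (Suc n))"
          have w: "xm i0 1 * ?x = ?x * xm i0 1 - w"
            using xp_xm[OF i0_lt(1), of n] by (simp add: w_def algebra_simps)
          have x: "?x * f a = f a * ?x" using xp_f[of i0 a n] False by simp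
          have "k i0 * psi i0 (Suc n) * f a = Pm a i0 *\<^sub>C (f a * (k i0 * psi i0 (Suc n)))"
            using psi_f_i0[OF aS(2), of "Suc n"] n by (simp add: mult.assoc) (simp add: mult.assoc[symmetric] k_f B_sym[of i0 a] scaleC_mult)
          then have wf: "w * f a = Pm a i0 *\<^sub>C (f a * w)" by (simp add: w_def scaleC_mult scaleC_scaleC mult.commute)
          have "u * ?x = xm i0 1 * ?x * f a - Pm a i0 *\<^sub>C (f a * (xm i0 1 * ?x))"
            by (simp add: u_def left_diff_distrib mult.assoc x scaleC_mult)
          also have "\<dots> = ?x * xm i0 1 * f a - Pm a i0 *\<^sub>C (f a * ?x * xm i0 1)"
            unfolding w by (simp add: left_diff_distrib right_diff_distrib wf scaleC_right_diff mult.assoc)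
          also have "\<dots> = ?x * u"
            by (simp add: u_def right_diff_distrib scaleC_mult mult.assoc) (simp add: mult.assoc[symmetric] x)
          finally show ?thesis by (simp add: comm_def)
        qed
        ultimately have "comm (D a *\<^sub>C (?Y' * cst (f a) - cst (f a) * tau (Pm a) ?Y')) (cst ?x) = 0"
          by (simp only: comm_simps cst_simps(1) mult_zero_left complex_vector.scale_zero_right)
        then show ?thesis unfolding sk by (simp add: null_0)
      next
        case ne: False
        define Z where "Z = comm ?Y' (cst ?x)"
        have ins: "insert i0 S - {a} = insert i0 (S - {a})" using False by auto
        have "l = card (S - {a})" "S - {a} \<subseteq> {r..<N}" using Suc(2,3) aS by auto
        from Suc(1)[OF this ne] have "Z \<in> null" by (simp only: Z_def ins)
        moreover have "comm (?Y' * cst (f a) - cst (f a) * tau (Pm a) ?Y') (cst ?x) = Z * cst (f a) - cst (f a) * tau (Pm a) Z"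
        proof -
          have 1: "A * (cst (f a) * cst ?x) = A * (cst ?x * cst (f a))" for A by (simp add: xf)
          have 2: "cst ?x * (cst (f a) * A) = cst (f a) * (cst ?x * A)" for A by (simp add: mult.assoc[symmetric] xf)
          show ?thesis
            by (simp add: comm_def Z_def tau.mult tau.diff tau.cst left_diff_distrib right_diff_distrib mult.assoc 1 2)
        qed
        ultimately show ?thesis unfolding sk comm_simps(3) by (simp only: null_f_step)
      qed
    qed
  qed
qed

text \<open>Words are sorted by content. Those in fixed letters evaluate to zero; \<open>V\<close>
  takes the arrangements of \<open>i0\<close> with at least one fixed letter; \<open>W\<close> takes
  the words that repeat a letter or contain one below \<open>i0\<close> and so exceed
  \<open>zeta i0\<close>. The part \<open>V\<close> exceeds merely \<open>zeta r\<close>, which is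
  why its exact commutation with \<open>xp i0 n \<odot> 1\<close> is recorded.\<close>

lemma ev_Y:
  obtains V W where
    "ev Y = psi i0 1 \<odot> 1 + ((- D i0 * C1 i0) *\<^sub>C xm i0 1) \<odot> e i0 + V + W"
    "V \<in> junk (\<lambda>_. 0) (zeta r)" "W \<in> junk (\<lambda>_. 0) (zeta i0)"
    "\<And>n. Suc n < M \<Longrightarrow> comm V (xp i0 n \<odot> 1) = 0"
proof -
  define F where "F = Pow {r..<N} - {{}}"
  have F: "finite F" by (simp add: F_def)
  define Q3 where "Q3 = (\<lambda>w. \<exists>S\<in>F. arrangement S w)"
  define Q4 where "Q4 = (\<lambda>w. \<exists>S\<in>F. arrangement (insert i0 S) w)"
  define Q5 where "Q5 = (\<lambda>w. \<not> arrangement {} w \<and> \<not> arrangement {i0} w \<and> \<not> Q3 w \<and> \<not> Q4 w)"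
  have i0F: "i0 \<notin> S" if "S \<in> F" for S using that i0_lt by (auto simp: F_def)
  have wY: "words_weight (\<lambda>_. 0) Y" using Y by (simp add: good_def)
  have "Y = part (arrangement {}) Y + part (arrangement {i0}) Y + part Q3 Y + part Q4 Y + part Q5 Y"
  proof (rule poly_mapping_eqI)
    fix l :: "nat word"
    have "\<not> (arrangement {i0} w \<and> Q3 w)" "\<not> (arrangement {i0} w \<and> Q4 w)" "\<not> (Q3 w \<and> Q4 w)"
      "\<not> (arrangement {} w \<and> Q3 w)" "\<not> (arrangement {} w \<and> Q4 w)" "\<not> (arrangement {} w \<and> arrangement {i0} w)" for w
      using i0F by (auto simp: Q3_def Q4_def arrangement_def) (auto simp: F_def)
    then show "Poly_Mapping.lookup Y l =
      Poly_Mapping.lookup (part (arrangement {}) Y + part (arrangement {i0}) Y + part Q3 Y + part Q4 Y + part Q5 Y) l"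
      by (cases "arrangement {} (letters l)"; cases "arrangement {i0} (letters l)"; cases "Q3 (letters l)"; cases "Q4 (letters l)")
        (auto simp: lookup_part lookup_add Q5_def)
  qed
  then have "ev Y = ev (part (arrangement {}) Y) + ev (part (arrangement {i0}) Y) + ev (part Q3 Y) + ev (part Q4 Y) + ev (part Q5 Y)"
    by (metis ev.add)
  moreover have "part Q3 Y \<in> null"
  proof -
    have "part Q3 Y = (\<Sum>S\<in>F. part (arrangement S) Y)"
      unfolding Q3_def by (rule part_sum[OF F]) (auto simp: arrangement_def)
    then show ?thesis using fixed_part_null by (auto simp: F_def intro!: null_sum)
  qed
  then have "ev (part Q3 Y) = 0" by (rule ev_null)
  moreover have "ev (part (arrangement {i0}) Y) = ((- D i0 * C1 i0) *\<^sub>C xm i0 1) \<odot> e i0"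
    by (simp only: part_i0 ev.mult ev.cst ev.lett tp_mult mult_1_left mult_1_right)
  ultimately have 1: "ev Y = psi i0 1 \<odot> 1 + ((- D i0 * C1 i0) *\<^sub>C xm i0 1) \<odot> e i0 + ev (part Q4 Y) + ev (part Q5 Y)"
    by (simp only: part_empty ev.cst add_0_right)
  have 2: "ev (part Q4 Y) \<in> junk (\<lambda>_. 0) (zeta r)"
  proof (rule ev_junk[OF words_weight_part[OF wY] e_out])
    fix w assume "Word w \<in> Poly_Mapping.keys (part Q4 Y)"
    then have "Q4 w" by (rule part_keys)
    then have "i0 \<in> set w" by (auto simp: Q4_def arrangement_def)
    then have "count_list w i0 \<noteq> 0" by (simp add: count_list_0_iff)
    then show "\<exists>b<N. zeta r b < int (count_list w b)" using i0_lt by (intro exI[of _ i0]) (simp add: zeta_def)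
  qed
  have 3: "ev (part Q5 Y) \<in> junk (\<lambda>_. 0) (zeta i0)"
  proof (rule ev_junk[OF words_weight_part[OF wY] e_out])
    fix w assume "Word w \<in> Poly_Mapping.keys (part Q5 Y)" and wN: "set w \<subseteq> {..<N}"
    then have w: "Q5 w" using part_keys by blast
    show "\<exists>b<N. zeta i0 b < int (count_list w b)"
    proof (cases "distinct w")
      case False
      then obtain xs ys zs y where "w = xs @ [y] @ ys @ [y] @ zs" using not_distinct_decomp by blast
      then show ?thesis using wN by (intro exI[of _ y]) (auto simp: zeta_def)
    next
      case True
      have "\<not> set w \<subseteq> {i0..<N}"
      proof
        assume sub: "set w \<subseteq> {i0..<N}"
        show False
        proof (cases "i0 \<in> set w")
          case True
          have "set w - {i0} \<subseteq> {r..<N}" using sub i0_lt by force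
          then have "set w - {i0} \<in> F \<or> set w - {i0} = {}" by (auto simp: F_def)
          moreover have "arrangement (insert i0 (set w - {i0})) w" using \<open>distinct w\<close> True by (auto simp: arrangement_def)
          ultimately show False using w unfolding Q5_def Q4_def by metis
        next
          case False
          have "set w \<subseteq> {r..<N}"
          proof
            fix x assume "x \<in> set w"
            then show "x \<in> {r..<N}" using sub False i0_lt by (cases "x = i0") force+
          qed
          then have "set w \<in> F \<or> set w = {}" by (auto simp: F_def)
          then show False using w \<open>distinct w\<close> by (auto simp: Q5_def Q3_def arrangement_def)
        qed
      qed
      then obtain b where b: "b \<in> set w" "b < i0" "b < N" using wN by force
      then have "count_list w b \<noteq> 0" by (simp add: count_list_0_iff)
      then show ?thesis using b by (intro exI[of _ b]) (simp add: zeta_def)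
    qed
  qed
  have 4: "comm (ev (part Q4 Y)) (xp i0 n \<odot> 1) = 0" if "Suc n < M" for n
  proof -
    have "part Q4 Y = (\<Sum>S\<in>F. part (arrangement (insert i0 S)) Y)"
      unfolding Q4_def
    proof (rule part_sum[OF F])
      fix S T w assume "S \<in> F" "T \<in> F" "arrangement (insert i0 S) w" "arrangement (insert i0 T) w"
      then show "S = T" using i0F insert_ident unfolding arrangement_def by metis
    qed
    then have "comm (part Q4 Y) (cst (xp i0 n)) = (\<Sum>S\<in>F. comm (part (arrangement (insert i0 S)) Y) (cst (xp i0 n)))"
      by (simp add: comm_def sum_distrib_left sum_distrib_right sum_subtractf)
    then have "comm (part Q4 Y) (cst (xp i0 n)) \<in> null"
      using commutator_part_null that by (auto simp: F_def intro!: null_sum)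
    from ev_null[OF this] show ?thesis by (simp add: comm_def ev.simps)
  qed
  show ?thesis by (rule that[OF 1 2 3 4])
qed

end

lemma junk_comm:
  assumes "X \<in> junk \<tau> \<zeta>" "u \<in> weight_space \<beta>" "v \<in> weight_space \<gamma>"
    and "\<And>b. b < N \<Longrightarrow> \<tau>' b = \<tau> b + \<beta> b + \<gamma> b" "\<And>b. b < N \<Longrightarrow> \<zeta>' b \<le> \<zeta> b + \<gamma> b"
  shows "comm X (u \<odot> v) \<in> junk \<tau>' \<zeta>'"
  unfolding comm_def using junk_mult[OF assms] by (intro junk_diff)

text \<open>The coefficient of u^n in x^+(u) \<odot> 1 + \<phi>^+(u) \<odot> x^+(u), where x^+(u)
  collects the degrees from zero on.\<close>

definition xp_main :: "nat \<Rightarrow> 'b" where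
  "xp_main n = xp i0 n \<odot> 1 + (\<Sum>j\<le>n. (k i0 * psi i0 (n - j)) \<odot> xp i0 j)"

lemma k_psi_weight: "k a * psi b n \<in> weight_space (\<lambda>_. 0)"
  using weight_space_mult[OF weight_space_simps(3) psi_weight] by simp

lemma psi_k: "psi a n * k b = k b * psi a n"
  using weight_k[OF psi_weight, of b a n] by (simp add: wt_simps scaleC_one)

lemma psi_kinv: "psi a n * kinv b = kinv b * psi a n"
  using weight_kinv[OF psi_weight, of b a n] by (simp add: wt_simps scaleC_one)

text \<open>The commutator with \<open>psi i0 1\<close> raises the degree. Most cross terms are
  errors because a second factor \<open>xp i0 j\<close> contributes the missing unit at
  \<open>i0\<close>. The factor \<open>xp i0 n \<odot> 1\<close> contributes none, and there the
  exact vanishing of its commutator with \<open>V\<close> is decisive; it also limits the induction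
  to degrees below \<open>M\<close>.\<close>

lemma xp_coproduct:
  assumes "n < M"
  shows "\<Delta> (xp i0 n) - xp_main n \<in> junk (simple_root i0) (zeta i0)"
  using assms
proof (induct n)
  case 0
  show ?case by (simp add: xp_main_def xp_0 psi_0 \<Delta>_e junk_0)
next
  case (Suc n)
  define j where "j = \<Delta> (xp i0 n) - xp_main n"
  have j: "j \<in> junk (simple_root i0) (zeta i0)" using Suc by (simp add: j_def)
  obtain Y where Y: "good UNIV {0} (psi i0 1) (\<lambda>_. 0) 1 Y" using good_psi(2)[OF i0_lt(1)] by auto
  obtain V W where VW: "ev Y = psi i0 1 \<odot> 1 + ((- D i0 * C1 i0) *\<^sub>C xm i0 1) \<odot> e i0 + V + W"
    "V \<in> junk (\<lambda>_. 0) (zeta r)" "W \<in> junk (\<lambda>_. 0) (zeta i0)"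
    "\<And>n. Suc n < M \<Longrightarrow> comm V (xp i0 n \<odot> 1) = 0"
    using ev_Y[OF Y] by metis
  let ?c = "C1 i0" and ?H = "psi i0 1" 
  define R where "R = (- D i0 * C1 i0) *\<^sub>C xm i0 1"
  have dH: "\<Delta> ?H = 1 \<odot> ?H + ev Y" and wY: "words_weight (\<lambda>_. 0) Y" using Y by (simp_all add: good_def)
  have Hx: "comm ?H (xp i0 m) = ?c *\<^sub>C xp i0 (Suc m)" for m
    using psi_xp[OF i0_lt(1)] by (simp add: comm_def)
  have "comm (\<Delta> ?H) (\<Delta> (xp i0 n)) = ?c *\<^sub>C \<Delta> (xp i0 (Suc n))"
    using arg_cong[OF Hx[of n], of \<Delta>] by (simp add: comm_def \<Delta>)
  moreover have "comm (\<Delta> ?H) (\<Delta> (xp i0 n)) = comm (\<Delta> ?H) (xp_main n) + comm (\<Delta> ?H) j"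
    by (simp add: j_def comm_def algebra_simps)
  moreover have "comm (\<Delta> ?H) j \<in> junk (simple_root i0) (zeta i0)"
  proof -
    have "(1 \<odot> ?H) * j \<in> junk (simple_root i0) (zeta i0)" "j * (1 \<odot> ?H) \<in> junk (simple_root i0) (zeta i0)"
      by (rule junk_mult[OF j weight_space_simps(2) psi_weight]; simp)+
    moreover have "ev Y * j \<in> junk (simple_root i0) (zeta i0)" "j * ev Y \<in> junk (simple_root i0) (zeta i0)"
      by (rule junk_mult_ev[OF j wY]; simp)+
    moreover have "comm (\<Delta> ?H) j = ((1 \<odot> ?H) * j - j * (1 \<odot> ?H)) + (ev Y * j - j * ev Y)"
      by (simp add: dH comm_def algebra_simps)
    ultimately show ?thesis by (simp only: junk_add junk_diff)
  qed
  moreover have "comm (\<Delta> ?H) (xp_main n) - ?c *\<^sub>C xp_main (Suc n) \<in> junk (simple_root i0) (zeta i0)"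
  proof -
    let ?t = "\<lambda>j. (k i0 * psi i0 (n - j)) \<odot> xp i0 j"
    \<comment> \<open>This is the summand of index zero in \<open>xp_main (Suc n)\<close>; the other
      summands arise from those of \<open>xp_main n\<close> by raising the second factor.\<close>
    have x1: "comm (R \<odot> e i0) (xp i0 n \<odot> 1) = ?c *\<^sub>C ((k i0 * psi i0 (Suc n)) \<odot> xp i0 0)"
    proof -
      have "comm (R \<odot> e i0) (xp i0 n \<odot> 1) = comm R (xp i0 n) \<odot> e i0"
        by (simp add: comm_def tp_simps algebra_simps)
      also have "comm R (xp i0 n) = (D i0 * ?c) *\<^sub>C (xp i0 n * xm i0 1 - xm i0 1 * xp i0 n)"
        by (simp add: R_def comm_def scaleC_mult scaleC_right_diff)
      also have "\<dots> = ?c *\<^sub>C (k i0 * psi i0 (Suc n))"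
        unfolding xp_xm[OF i0_lt(1)] using D_nz[of i0] by (simp add: scaleC_scaleC)
      finally show ?thesis by (simp add: tp_linear xp_0)
    qed
    have t1: "comm (1 \<odot> ?H) (?t j) = ?c *\<^sub>C ((k i0 * psi i0 (n - j)) \<odot> xp i0 (Suc j))" for j
    proof -
      have "comm (1 \<odot> ?H) (?t j) = (k i0 * psi i0 (n - j)) \<odot> comm ?H (xp i0 j)"
        by (simp add: comm_def tp_simps)
      then show ?thesis by (simp add: Hx tp_linear)
    qed
    have t2: "comm (?H \<odot> 1) (?t j) = 0" for j
    proof -
      have "?H * (k i0 * psi i0 (n - j)) = k i0 * psi i0 (n - j) * ?H"
        by (simp add: mult.assoc[symmetric] psi_k) (simp add: mult.assoc psi_comm)
      then show ?thesis by (simp add: comm_def tp_mult)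
    qed
    have t3: "comm (R \<odot> e i0) (?t j) \<in> junk (simple_root i0) (zeta i0)" for j
    proof (rule junk_comm[OF _ k_psi_weight xp_weight])
      show "R \<odot> e i0 \<in> junk (\<lambda>_. 0) (zeta r)"
        unfolding R_def by (rule junkI[OF weight_space_scaleC[OF xm_weight] weight_space_simps(5), of _ i0])
          (use i0_lt in \<open>auto simp: zeta_def simple_root_def\<close>)
      show "zeta i0 b \<le> zeta r b + simple_root i0 b" for b using i0_lt by (auto simp: zeta_def simple_root_def)
    qed simp
    have t4: "comm V (?t j) \<in> junk (simple_root i0) (zeta i0)" for j
    proof (rule junk_comm[OF VW(2) k_psi_weight xp_weight])
      show "zeta i0 b \<le> zeta r b + simple_root i0 b" for b using i0_lt by (auto simp: zeta_def simple_root_def)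
    qed simp
    have t5: "comm W (?t j) \<in> junk (simple_root i0) (zeta i0)" for j
      by (rule junk_comm[OF VW(3) k_psi_weight xp_weight]) (simp_all add: simple_root_def)
    have x5: "comm W (xp i0 n \<odot> 1) \<in> junk (simple_root i0) (zeta i0)"
      by (rule junk_comm[OF VW(3) xp_weight weight_space_simps(2)]) simp_all
    have c0: "comm (1 \<odot> ?H) (xp i0 n \<odot> 1) = 0" "comm (?H \<odot> 1) (xp i0 n \<odot> 1) = ?c *\<^sub>C (xp i0 (Suc n) \<odot> 1)"
      using Hx[of n] by (simp_all add: comm_def tp_simps flip: tp_scale_left tp_diff_left)
    have main': "xp_main (Suc n) = xp i0 (Suc n) \<odot> 1 + ((k i0 * psi i0 (Suc n)) \<odot> xp i0 0
        + (\<Sum>j\<le>n. (k i0 * psi i0 (n - j)) \<odot> xp i0 (Suc j)))"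
      unfolding xp_main_def sum.atMost_Suc_shift by simp
    have "comm (\<Delta> ?H) (xp_main n) - ?c *\<^sub>C xp_main (Suc n) =
       (\<Sum>j\<le>n. comm (R \<odot> e i0) (?t j)) + (\<Sum>j\<le>n. comm V (?t j)) + (\<Sum>j\<le>n. comm W (?t j)) + comm W (xp i0 n \<odot> 1)"
      unfolding dH VW(1) main' R_def[symmetric] unfolding xp_main_def
      by (simp add: comm_simps comm_sum c0 x1 t1 t2 VW(4)[OF Suc(2)] scaleC_add_right complex_vector.scale_sum_right sum.distrib
          del: complex_vector.scale_minus_left)
    then show ?thesis using t3 t4 t5 x5 by (simp only: junk_add junk_sum)
  qed
  ultimately have "?c *\<^sub>C (\<Delta> (xp i0 (Suc n)) - xp_main (Suc n)) \<in> junk (simple_root i0) (zeta i0)"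
    using junk_add by (fastforce simp: scaleC_right_diff algebra_simps)
  from junk_scaleC[OF this, of "1 / ?c"] show ?case using C1_nz[OF i0_lt(1)] by (simp add: scaleC_scaleC scaleC_one)
qed

end

section \<open>Passage to the fixed nodes\<close>

context loop_chain
begin

declare One_nat_def [simp del]

text \<open>The inner terms of the coefficient of u^M in the tensor square of the series of the
  \<open>psi a m\<close>; the two outer terms are \<open>1 \<odot> psi a M\<close> and
  \<open>psi a M \<odot> 1\<close>.\<close>

definition Omega :: "nat \<Rightarrow> 'b" where
  "Omega a = (\<Sum>j<M - 1. psi a (M - 1 - j) \<odot> psi a (Suc j))"

definition qcomm :: "complex \<Rightarrow> 'c::complex_algebra_1 \<Rightarrow> 'c \<Rightarrow> 'c" where
  "qcomm p x y = x * y - p *\<^sub>C (y * x)"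

lemma qcomm_simps:
  "qcomm p (x + y) w = qcomm p x w + qcomm p y w" "qcomm p w (x + y) = qcomm p w x + qcomm p w y"
  by (simp_all add: qcomm_def algebra_simps scaleC_mult scaleC_add_right)

lemma qcomm_sum: "qcomm p (\<Sum>j\<in>S. X j) w = (\<Sum>j\<in>S. qcomm p (X j) w)"
  by (induct S rule: infinite_finite_induct) (simp_all add: qcomm_simps, simp_all add: qcomm_def)

text \<open>\<open>psi i0 M\<close> is a q-commutator of \<open>xp i0 (M - 1)\<close>, known up to
  \<open>zeta i0\<close>, with \<open>xm i0 1 * kinv i0\<close>, known exactly. Only the words of
  the latter in fixed letters stay within the bound; their commutator with the constant
  \<open>xp i0 (M - 1)\<close> is the new lift. Since this constant is known to commute with
  \<open>f a\<close> for \<open>a \<noteq> i0\<close> only, the equation is retained at the fixed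
  nodes.\<close>

lemma good_psi_M:
  assumes "r < N"
  shows "\<exists>X. good {r..<N} {Omega i0 + j | j. j \<in> junk (\<lambda>_. 0) (zeta r)} (psi i0 M) (\<lambda>_. 0) 1 X"
proof -
  define n where "n = M - 1"
  have n: "n < M" "Suc n = M" using M by (auto simp: n_def)
  define x where "x = xp i0 n"
  define F where "F = xm i0 1 * kinv i0"
  define p where "p = P i0 i0"
  obtain X where X: "good UNIV {0} F (\<lambda>b. - simple_root i0 b) (kinv i0) X"
    using good_psi(1)[OF i0_lt(1)] by (auto simp: F_def)
  have dF: "\<Delta> F = kinv i0 \<odot> F + ev X" and wX: "words_weight (\<lambda>b. - simple_root i0 b) X" and aX: "aug X = F"
    and LX: "L a X = 0" and F: "F \<in> weight_space (\<lambda>b. - simple_root i0 b)" for a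
    using X by (simp_all add: good_def)
  define Q where "Q w \<longleftrightarrow> set w \<subseteq> {r..<N}" for w
  define X1 where "X1 = part Q X"
  define X2 where "X2 = part (\<lambda>w. \<not> Q w) X"
  have X12: "X = X1 + X2" unfolding X1_def X2_def by (rule poly_mapping_eqI) (simp add: lookup_part lookup_add)
  have w1: "words_weight (\<lambda>b. - simple_root i0 b) X1" and w2: "words_weight (\<lambda>b. - simple_root i0 b) X2"
    unfolding X1_def X2_def by (rule words_weight_part[OF wX])+
  have X2: "ev X2 \<in> junk (\<lambda>b. - simple_root i0 b) (zeta r)"
  proof (rule ev_junk[OF w2 e_out])
    fix w assume "Word w \<in> Poly_Mapping.keys X2" and wN: "set w \<subseteq> {..<N}"
    then have "\<not> Q w" unfolding X2_def by (blast dest: part_keys)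
    then obtain b where b: "b \<in> set w" "b < r" "b < N" using wN by (force simp: Q_def)
    then have "count_list w b \<noteq> 0" by (simp add: count_list_0_iff)
    then show "\<exists>b<N. zeta r b < int (count_list w b)" using b by (intro exI[of _ b]) (simp add: zeta_def)
  qed
  have qx: "qcomm p (xp i0 j) F = (1 / D i0) *\<^sub>C psi i0 (Suc j)" for j
    using q_commutator[OF xp_weight psi_weight xp_xm[OF i0_lt(1)]] by (simp add: qcomm_def p_def F_def)
  define X' where "X' = D i0 *\<^sub>C (cst x * X1 - p *\<^sub>C (X1 * cst x))"
  have psiM: "psi i0 M = D i0 *\<^sub>C qcomm p x F"
    using qx[of n] D_nz[of i0] n by (simp add: x_def scaleC_scaleC scaleC_one)
  define j where "j = \<Delta> x - xp_main n"
  have j: "j \<in> junk (simple_root i0) (zeta i0)" unfolding j_def x_def by (rule xp_coproduct[OF n(1)])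
  let ?t = "\<lambda>j. (k i0 * psi i0 (n - j)) \<odot> xp i0 j"
  have zr: "zeta r b \<le> zeta i0 b" "zeta r b \<le> zeta i0 b - simple_root i0 b" "zeta r b \<le> zeta r b + simple_root i0 b" "0 \<le> simple_root i0 b" for b
    using i0_lt by (auto simp: zeta_def simple_root_def)
  \<comment> \<open>The second factor \<open>F\<close> has weight - \<alpha>_i0 and uses up the unit
    of room at \<open>i0\<close>: the bound \<open>zeta i0\<close> drops to
    \<open>zeta r\<close>.\<close>
  have j1: "qcomm p j (\<Delta> F) \<in> junk (\<lambda>_. 0) (zeta r)"
  proof -
    have "j * (kinv i0 \<odot> F) \<in> junk (\<lambda>_. 0) (zeta r)" "(kinv i0 \<odot> F) * j \<in> junk (\<lambda>_. 0) (zeta r)"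
      by (rule junk_mult[OF j weight_space_simps(4) F]; simp add: zr)+
    moreover have "j * ev X \<in> junk (\<lambda>_. 0) (zeta r)" "ev X * j \<in> junk (\<lambda>_. 0) (zeta r)"
      by (rule junk_mult_ev[OF j wX]; simp add: zr)+
    ultimately show ?thesis unfolding dF qcomm_simps
      by (simp add: qcomm_def junk_add junk_diff junk_scaleC)
  qed
  have j2: "qcomm p (x \<odot> 1) (ev X2) \<in> junk (\<lambda>_. 0) (zeta r)"
    unfolding qcomm_def x_def
    by (intro junk_diff junk_scaleC junk_mult[OF X2 xp_weight weight_space_simps(2)]) simp_all
  have j3: "qcomm p (?t j) (ev X2) \<in> junk (\<lambda>_. 0) (zeta r)" for j
    unfolding qcomm_def
    by (intro junk_diff junk_scaleC junk_mult[OF X2 k_psi_weight xp_weight]) (simp_all add: zr)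
  have j4: "qcomm p (?t j) (ev X1) \<in> junk (\<lambda>_. 0) (zeta r)" for j
  proof -
    have t: "?t j \<in> junk (simple_root i0) (zeta r)"
      by (rule junkI[OF k_psi_weight[of i0 i0 "n - j"] xp_weight[of i0 j], of _ i0]) (use i0_lt in \<open>auto simp: zeta_def simple_root_def\<close>)
    show ?thesis unfolding qcomm_def
      by (intro junk_diff junk_scaleC junk_mult_ev[OF t w1]) simp_all
  qed
  have m1: "qcomm p (x \<odot> 1) (kinv i0 \<odot> F) = 0"
    using weight_kinv[OF xp_weight[of i0 n], of i0]
    by (simp add: qcomm_def x_def p_def tp_mult wt_simps tp_linear scaleC_scaleC q_minus scaleC_one)
  have m2: "D i0 *\<^sub>C qcomm p (x \<odot> 1) (ev X1) = ev X'"
    by (simp add: X'_def qcomm_def ev.simps)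
  have m3: "qcomm p (?t j) (kinv i0 \<odot> F) = (1 / D i0) *\<^sub>C (psi i0 (n - j) \<odot> psi i0 (Suc j))" for j
  proof -
    have "k i0 * psi i0 (n - j) * kinv i0 = psi i0 (n - j)" "kinv i0 * (k i0 * psi i0 (n - j)) = psi i0 (n - j)"
      by (simp_all add: mult.assoc psi_kinv) (simp_all add: mult.assoc[symmetric] k_kinv kinv_k)
    then have "qcomm p (?t j) (kinv i0 \<odot> F) = psi i0 (n - j) \<odot> qcomm p (xp i0 j) F"
      by (simp add: qcomm_def tp_mult tp_linear)
    then show ?thesis by (simp add: qx tp_linear)
  qed
  have sum: "(\<Sum>j\<le>n. psi i0 (n - j) \<odot> psi i0 (Suc j)) = 1 \<odot> psi i0 M + Omega i0"
    unfolding Omega_def n_def[symmetric] lessThan_Suc_atMost[symmetric] sum.lessThan_Suc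
    by (simp only: diff_self_eq_0 psi_0 n(2) add.commute)
  have "\<Delta> (psi i0 M) = D i0 *\<^sub>C qcomm p (xp_main n) (\<Delta> F) + D i0 *\<^sub>C qcomm p j (\<Delta> F)"
    unfolding psiM j_def by (simp add: \<Delta> qcomm_def algebra_simps scaleC_add_right scaleC_right_diff)
  also have "qcomm p (xp_main n) (\<Delta> F) = qcomm p (x \<odot> 1) (ev X1) + (\<Sum>j\<le>n. (1 / D i0) *\<^sub>C (psi i0 (n - j) \<odot> psi i0 (Suc j)))
      + (qcomm p (x \<odot> 1) (ev X2) + (\<Sum>j\<le>n. qcomm p (?t j) (ev X1)) + (\<Sum>j\<le>n. qcomm p (?t j) (ev X2)))"
    unfolding dF X12 ev.add xp_main_def x_def[symmetric]
    by (simp add: qcomm_simps qcomm_sum m1 m3 sum.distrib algebra_simps)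
  also have "D i0 *\<^sub>C \<dots> = ev X' + (\<Sum>j\<le>n. psi i0 (n - j) \<odot> psi i0 (Suc j))
      + D i0 *\<^sub>C (qcomm p (x \<odot> 1) (ev X2) + (\<Sum>j\<le>n. qcomm p (?t j) (ev X1)) + (\<Sum>j\<le>n. qcomm p (?t j) (ev X2)))"
    using D_nz[of i0] by (simp only: scaleC_add_right m2 complex_vector.scale_sum_right scaleC_scaleC) (simp add: scaleC_one)
  finally have "\<Delta> (psi i0 M) - (1 \<odot> psi i0 M + ev X') = Omega i0 +
     (D i0 *\<^sub>C (qcomm p (x \<odot> 1) (ev X2) + (\<Sum>j\<le>n. qcomm p (?t j) (ev X1)) + (\<Sum>j\<le>n. qcomm p (?t j) (ev X2)))
      + D i0 *\<^sub>C qcomm p j (\<Delta> F))"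
    unfolding sum by (simp add: algebra_simps)
  moreover have "D i0 *\<^sub>C (qcomm p (x \<odot> 1) (ev X2) + (\<Sum>j\<le>n. qcomm p (?t j) (ev X1)) + (\<Sum>j\<le>n. qcomm p (?t j) (ev X2)))
      + D i0 *\<^sub>C qcomm p j (\<Delta> F) \<in> junk (\<lambda>_. 0) (zeta r)"
    by (intro junk_add junk_scaleC junk_sum j1 j2 j3 j4)
  ultimately have d: "\<Delta> (psi i0 M) - (1 \<odot> psi i0 M + ev X') \<in> {Omega i0 + j | j. j \<in> junk (\<lambda>_. 0) (zeta r)}"
    by blast
  have "good {r..<N} {Omega i0 + j | j. j \<in> junk (\<lambda>_. 0) (zeta r)} (psi i0 M) (\<lambda>_. 0) 1 X'"
    unfolding good_def
  proof (intro conjI allI ballI)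
    show "\<Delta> (psi i0 M) - (1 \<odot> psi i0 M + ev X') \<in> {Omega i0 + j | j. j \<in> junk (\<lambda>_. 0) (zeta r)}" by (rule d)
    have "aug X1 = F" using aX by (simp add: aug_lookup X1_def lookup_part Q_def zero_word_def)
    then show "aug X' = psi i0 M" by (simp add: X'_def aug.simps psiM qcomm_def)
    have "words_weight (simple_root i0) (cst x)" by (simp add: words_weight_cst x_def xp_weight)
    from words_weight_mult[OF this w1] words_weight_mult[OF w1 this] show "words_weight (\<lambda>_. 0) X'"
      unfolding X'_def by (intro words_weight_scaleC words_weight_diff) simp_all
    fix a assume a: "a \<in> {r..<N}"
    have "skew (Pm a) a (part Q X) = part Q (skew (Pm a) a X)"
      by (rule part_skew) (use a in \<open>auto simp: Q_def\<close>)
    then have "L a X1 = part Q (L a X)"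
      by (simp add: L_def X1_def part.diff part_scaleC part_mult_cst part_cst_mult part_tau)
    then have "L a X1 = 0" by (simp add: LX part.zero)
    moreover have "L a (cst x) = 0"
      using a i0_lt xp_f[of i0 a n] by (auto simp: L_cst x_def cst_simps)
    ultimately show "L a X' = 0" by (simp add: X'_def L_scaleC L_diff L_mult)
  qed (simp_all add: psi_weight wt_zero scaleC_one)
  then show ?thesis by blast
qed

lemma Omega_fixed: "r \<le> a \<Longrightarrow> Omega a = 0"
  unfolding Omega_def using M by (intro sum.neutral) (auto simp: psi_fixed)

lemma Omega_f:
  assumes "i0 \<le> a" "r \<le> b"
  shows "Omega a * \<Delta> (f b) = \<Delta> (f b) * Omega a"
proof (cases "r \<le> a")
  case True then show ?thesis by (simp add: Omega_fixed)
next
  case False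
  then have a: "a = i0" using assms i0_lt by simp
  have "(psi i0 (M - 1 - j) \<odot> psi i0 (Suc j)) * \<Delta> (f b) = \<Delta> (f b) * (psi i0 (M - 1 - j) \<odot> psi i0 (Suc j))" if "j < M - 1" for j
    using psi_f_i0[OF assms(2), of "M - 1 - j"] psi_f_i0[OF assms(2), of "Suc j"] that
    by (simp add: \<Delta>_f distrib_left distrib_right tp_mult psi_kinv)
  then show ?thesis unfolding a Omega_def sum_distrib_left sum_distrib_right by (intro sum.cong) auto
qed

text \<open>Contraction with \<open>f b\<close> for \<open>b = Suc a\<close> lowers the bound at
  \<open>b\<close> to zero. The bracket with \<open>e b\<close> does not restore it, because
  \<open>e b \<odot> 1\<close> leaves second weights alone. \<open>Omega a\<close> commutes with the
  coproduct of \<open>f b\<close> and drops out, and \<open>Omega b\<close> vanishes for a fixed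
  \<open>b\<close>.\<close>

lemma good_fixed_step:
  assumes g: "good {r..<N} {Omega a + j | j. j \<in> junk (\<lambda>_. 0) (zeta (Suc a))} (psi a M) (\<lambda>_. 0) 1 X"
    and a: "i0 \<le> a" "Suc a < N"
  shows "\<exists>X. good {r..<N} {Omega (Suc a) + j | j. j \<in> junk (\<lambda>_. 0) (zeta (Suc (Suc a)))} (psi (Suc a) M) (\<lambda>_. 0) 1 X"
proof -
  define b where "b = Suc a"
  have b: "b \<in> {r..<N}" "r \<le> b" using a i0_lt by (auto simp: b_def)
  have z: "zeta (Suc b) c \<le> zeta b c" "zeta (Suc b) c \<le> zeta b c - simple_root b c" "0 \<le> simple_root b c" for c
    using b by (auto simp: zeta_def simple_root_def)
  let ?J = "junk (\<lambda>c. - simple_root b c) (zeta (Suc b))"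
  have "\<exists>Y. good {r..<N} ?J (contract b (psi a M)) (\<lambda>c. 0 - simple_root b c) (1 * kinv b) Y"
  proof (rule exI, rule good_contract[OF g b(1)])
    fix i assume "i \<in> {Omega a + j | j. j \<in> junk (\<lambda>_. 0) (zeta (Suc a))}"
    then obtain j where j: "i = Omega a + j" "j \<in> junk (\<lambda>_. 0) (zeta b)" by (auto simp: b_def)
    have "i * \<Delta> (f b) - \<Delta> (f b) * i = j * \<Delta> (f b) - \<Delta> (f b) * j"
      using Omega_f[OF a(1) b(2)] by (simp add: j distrib_left distrib_right)
    moreover have "j * (f b \<odot> kinv b) \<in> ?J" "(f b \<odot> kinv b) * j \<in> ?J"
      by (rule junk_mult[OF j(2) weight_space_simps(6,4)]; simp add: z)+
    moreover have "j * (1 \<odot> f b) \<in> ?J" "(1 \<odot> f b) * j \<in> ?J"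
      by (rule junk_mult[OF j(2) weight_space_simps(2,6)]; simp add: z)+
    ultimately have *: "i * \<Delta> (f b) - \<Delta> (f b) * i \<in> ?J"
      by (simp add: \<Delta>_f distrib_left distrib_right junk_add junk_diff)
    show "D b *\<^sub>C ((i * \<Delta> (f b) - \<Delta> (f b) * i) * \<Delta> (kinv b)) \<in> ?J"
      unfolding \<Delta>_kinv by (intro junk_scaleC junk_mult(1)[OF * weight_space_simps(4,4)]) simp_all
  qed
  moreover have "contract b (psi a M) = (- D b * C3 a) *\<^sub>C (xm b M * kinv b)"
    using psi_f_M[of a] b a by (simp only: contract_def b_def scaleC_mult) (simp add: scaleC_scaleC scaleC_mult)
  then obtain c where c: "c \<noteq> 0" "contract b (psi a M) = c *\<^sub>C (xm b M * kinv b)"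
    using D_nz[of b] C3_nz[of a] b a by (metis b_def mult_eq_0_iff neg_equal_0_iff_equal)
  ultimately obtain Y where "good {r..<N} ?J (c *\<^sub>C (xm b M * kinv b)) (\<lambda>c. - simple_root b c) (kinv b) Y" by auto
  from good_scaleC[OF this, of "1 / c" ?J]
  have "good {r..<N} ?J (xm b M * kinv b) (\<lambda>c. - simple_root b c) (kinv b) ((1 / c) *\<^sub>C Y)"
    using c by (simp add: scaleC_scaleC scaleC_one junk_scaleC)
  then have "\<exists>Y. good {r..<N} {Omega b + j | j. j \<in> junk (\<lambda>_. 0) (zeta (Suc b))} (psi b M) (\<lambda>_. 0) 1 Y"
  proof (rule good_psi_of_xm[OF _ xm_weight psi_weight xp_xm_fixed])
    fix j assume j: "j \<in> ?J"
    have "j * (e b \<odot> 1) \<in> junk (\<lambda>_. 0) (zeta (Suc b))" "(e b \<odot> 1) * j \<in> junk (\<lambda>_. 0) (zeta (Suc b))"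
      by (rule junk_mult[OF j weight_space_simps(5,2)]; simp add: z)+
    moreover have "j * (k b \<odot> e b) \<in> junk (\<lambda>_. 0) (zeta (Suc b))" "(k b \<odot> e b) * j \<in> junk (\<lambda>_. 0) (zeta (Suc b))"
      by (rule junk_mult[OF j weight_space_simps(3,5)]; simp add: z)+
    ultimately have "\<Delta> (e b) * j \<in> junk (\<lambda>_. 0) (zeta (Suc b))" "j * \<Delta> (e b) \<in> junk (\<lambda>_. 0) (zeta (Suc b))"
      by (simp_all add: \<Delta>_e distrib_left distrib_right junk_add)
    then have "D b *\<^sub>C (\<Delta> (e b) * j - P b b *\<^sub>C (j * \<Delta> (e b))) \<in> junk (\<lambda>_. 0) (zeta (Suc b))"
      by (simp only: junk_diff junk_scaleC)
    then show "D b *\<^sub>C (\<Delta> (e b) * j - P b b *\<^sub>C (j * \<Delta> (e b))) \<in> {Omega b + j | j. j \<in> junk (\<lambda>_. 0) (zeta (Suc b))}"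
      using Omega_fixed[OF b(2)] by simp
  qed (use b in auto)
  then show ?thesis by (simp add: b_def)
qed

lemma good_fixed:
  assumes "i0 \<le> a" "Suc a < N"
  shows "\<exists>X. good {r..<N} {Omega a + j | j. j \<in> junk (\<lambda>_. 0) (zeta (Suc a))} (psi a M) (\<lambda>_. 0) 1 X"
  using assms
proof (induct a rule: dec_induct)
  case base then show ?case using good_psi_M i0_lt by simp
next
  case (step a) then show ?case using good_fixed_step[of a] by auto
qed

lemma shift_fixed:
  assumes "r \<le> Suc a" "Suc a < N"
  shows "\<Delta> (psi a M) - (1 \<odot> psi a M + psi a M \<odot> 1 + Omega a +
      (D (Suc a) *\<^sub>C (psi a M * f (Suc a) - f (Suc a) * psi a M)) \<odot> e (Suc a)) \<in> junk (\<lambda>_. 0) (simple_root (Suc a))"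
proof -
  have "i0 \<le> a" using assms i0_lt by simp
  then obtain X where "good {r..<N} {Omega a + j | j. j \<in> junk (\<lambda>_. 0) (zeta (Suc a))} (psi a M) (\<lambda>_. 0) 1 X"
    using good_fixed assms by blast
  \<comment> \<open>The unit of room at \<open>Suc a\<close> is still available here, so the term
    with \<open>e (Suc a)\<close> can be read off by \<open>shift_formula\<close>.\<close>
  moreover have "junk (\<lambda>_. 0) (zeta (Suc a)) \<subseteq> junk (\<lambda>_. 0) (simple_root (Suc a))"
    by (intro subsetI, erule junk_mono) (use assms in \<open>simp_all add: zeta_def simple_root_def\<close>)
  ultimately have "good {r..<N} {Omega a + j | j. j \<in> junk (\<lambda>_. 0) (simple_root (Suc a))} (psi a M) (\<lambda>_. 0) 1 X"
    by (elim good_cong) auto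
  from shift_formula[OF this] show ?thesis using assms e_out by simp
qed

end

section \<open>The chain of orbits of the diagram automorphism\<close>

lemma adjacent_sym: "adjacent X i j \<longleftrightarrow> adjacent X j i"
  by (cases X) (auto simp: insert_commute)

lemma cartan_sym: "cartan X i j = cartan X j i"
  by (simp add: cartan_def adjacent_sym[of X i j])

locale datum =
  fixes T :: twisted_datum
  assumes datum: "twisted_datum T"
begin

abbreviation "X \<equiv> type_of T"
abbreviation "\<sigma> \<equiv> aut T"
abbreviation "M \<equiv> aut_order T"

lemma
  aut_bij: "bij_betw \<sigma> (II T) (II T)" and
  aut_cartan: "i \<in> II T \<Longrightarrow> j \<in> II T \<Longrightarrow> cartan X (\<sigma> i) (\<sigma> j) = cartan X i j" and
  aut_nontrivial: "\<exists>i\<in>II T. \<sigma> i \<noteq> i" and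
  M_cases: "M = 2 \<or> M = 3" and
  aut_pow_M: "i \<in> II T \<Longrightarrow> (\<sigma> ^^ M) i = i" and
  qq_nz: "qq T \<noteq> 0" and qq_root: "n > 0 \<Longrightarrow> qq T ^ n \<noteq> 1"
  using datum by (auto simp: twisted_datum_def)

lemma aut_in: "i \<in> II T \<Longrightarrow> \<sigma> i \<in> II T"
  using aut_bij by (auto simp: bij_betw_def)

lemma aut_inj: "i \<in> II T \<Longrightarrow> j \<in> II T \<Longrightarrow> \<sigma> i = \<sigma> j \<longleftrightarrow> i = j"
  using aut_bij by (auto simp: bij_betw_def inj_on_def)

lemma aut_pow_in: "i \<in> II T \<Longrightarrow> (\<sigma> ^^ s) i \<in> II T"
  by (induct s) (auto simp: aut_in)

lemma finite_II: "finite (II T)" by (cases X) auto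

lemma M_bounds: "1 < M" "2 \<le> M" using M_cases by auto

lemma aut_pow_cartan: "i \<in> II T \<Longrightarrow> j \<in> II T \<Longrightarrow> cartan X ((\<sigma> ^^ s) i) ((\<sigma> ^^ s) j) = cartan X i j"
  by (induct s) (auto simp: aut_cartan aut_pow_in)

text \<open>As the M-th power of \<sigma> is the identity, invariance of the Cartan matrix matches
  the summand for \<open>s\<close> with the one for \<open>M - s\<close> after exchanging
  \<open>i\<close> and \<open>j\<close>.\<close>

lemma bform_sym:
  assumes "i \<in> II T" "j \<in> II T"
  shows "bform T i j = bform T j i"
proof -
  have 2: "(\<sigma> ^^ s) ((\<sigma> ^^ t) k) = (\<sigma> ^^ (s + t)) k" for s t k by (simp add: funpow_add)
  have sw: "cartan X i ((\<sigma> ^^ s) j) = cartan X j ((\<sigma> ^^ t) i)" if "s + t = M" for s t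
  proof -
    have "cartan X i ((\<sigma> ^^ s) j) = cartan X ((\<sigma> ^^ t) i) ((\<sigma> ^^ t) ((\<sigma> ^^ s) j))"
      using assms by (simp add: aut_pow_cartan aut_pow_in)
    then show ?thesis using assms that by (simp add: 2 add.commute aut_pow_M cartan_sym)
  qed
  have M: "cartan X i ((\<sigma> ^^ M) j) = cartan X j ((\<sigma> ^^ M) i)"
    using assms by (simp add: aut_pow_M cartan_sym)
  show ?thesis
  proof (cases "M = 2")
    case True
    then show ?thesis using sw[of 1 1] M by (simp add: bform_def numeral_2_eq_2)
  next
    case False
    then have "M = 3" using M_cases by simp
    then show ?thesis using sw[of 1 2] sw[of 2 1] M by (simp add: bform_def numeral_3_eq_3 numeral_2_eq_2)
  qed
qed

text \<open>\<sigma> maps neighbour sets to neighbour sets, so the number of neighbours is an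
  invariant of nodes. The automorphisms of each type are found from this.\<close>

definition nbrs :: "nat \<Rightarrow> nat set" where
  "nbrs i = {j \<in> II T. j \<noteq> i \<and> adjacent X i j}"

lemma nbrs_aut: "i \<in> II T \<Longrightarrow> nbrs (\<sigma> i) = \<sigma> ` nbrs i"
proof -
  assume i: "i \<in> II T"
  have n: "j \<in> nbrs k \<longleftrightarrow> cartan X k j = - 1" if "j \<in> II T" for j k
    using that by (auto simp: nbrs_def cartan_def)
  show "nbrs (\<sigma> i) = \<sigma> ` nbrs i"
  proof (intro equalityI subsetI)
    fix y assume y: "y \<in> nbrs (\<sigma> i)"
    then have "y \<in> II T" by (simp add: nbrs_def)
    then obtain j where j: "j \<in> II T" "y = \<sigma> j" using aut_bij by (auto simp: bij_betw_def)
    then show "y \<in> \<sigma> ` nbrs i" using y i n aut_cartan[OF i j(1)] aut_in by auto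
  next
    fix y assume "y \<in> \<sigma> ` nbrs i"
    then obtain j where j: "y = \<sigma> j" "j \<in> nbrs i" by auto
    then have "j \<in> II T" by (simp add: nbrs_def)
    then show "y \<in> nbrs (\<sigma> i)" using j i n aut_cartan[of i j] aut_in by auto
  qed
qed

lemma card_nbrs_aut: "i \<in> II T \<Longrightarrow> card (nbrs (\<sigma> i)) = card (nbrs i)"
  unfolding nbrs_aut
  by (rule card_image) (use aut_inj in \<open>auto simp: inj_on_def nbrs_def\<close>)

lemma nbrs_aut_in: "i \<in> II T \<Longrightarrow> j \<in> nbrs i \<Longrightarrow> \<sigma> j \<in> nbrs (\<sigma> i)"
  by (simp add: nbrs_aut)

lemma aut_pow_add: "(\<sigma> ^^ s) ((\<sigma> ^^ t) i) = (\<sigma> ^^ (s + t)) i"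
  by (simp add: funpow_add)

lemma aut_pow_mult_M: "i \<in> II T \<Longrightarrow> (\<sigma> ^^ (M * t)) i = i"
  by (induct t) (simp_all add: funpow_add aut_pow_M)

lemma aut_pow_mod: "i \<in> II T \<Longrightarrow> (\<sigma> ^^ s) i = (\<sigma> ^^ (s mod M)) i"
  using aut_pow_mult_M[of i "s div M"] aut_pow_add[of "s mod M" "M * (s div M)" i] by simp

lemma orbit_aut: "i \<in> II T \<Longrightarrow> (\<lambda>s. (\<sigma> ^^ s) (\<sigma> i)) ` {..<M} = (\<lambda>s. (\<sigma> ^^ s) i) ` {..<M}"
proof -
  assume i: "i \<in> II T"
  have M: "0 < M" using M_bounds by simp
  have a: "(\<sigma> ^^ s) (\<sigma> i) = (\<sigma> ^^ (Suc s mod M)) i" for s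
    using aut_pow_mod[OF i, of "Suc s"] by (simp add: funpow_swap1)
  show ?thesis
  proof (intro equalityI subsetI)
    fix y assume "y \<in> (\<lambda>s. (\<sigma> ^^ s) (\<sigma> i)) ` {..<M}"
    then show "y \<in> (\<lambda>s. (\<sigma> ^^ s) i) ` {..<M}" using a M by auto
  next
    fix y assume "y \<in> (\<lambda>s. (\<sigma> ^^ s) i) ` {..<M}"
    then obtain s where s: "s < M" "y = (\<sigma> ^^ s) i" by auto
    have "Suc ((s + (M - 1)) mod M) mod M = s"
      using s M by (simp add: mod_Suc_eq)
    then have "y = (\<sigma> ^^ ((s + (M - 1)) mod M)) (\<sigma> i)" using a s by simp
    then show "y \<in> (\<lambda>s. (\<sigma> ^^ s) (\<sigma> i)) ` {..<M}" using M by auto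
  qed
qed

lemma rep_aut: "i \<in> II T \<Longrightarrow> rep T (\<sigma> i) = rep T i"
  by (simp add: rep_def orbit_aut)

lemma rep_aut_pow: "i \<in> II T \<Longrightarrow> rep T ((\<sigma> ^^ s) i) = rep T i"
  by (induct s) (simp_all add: rep_aut aut_pow_in)

lemma rep_pow: "\<exists>s<M. rep T i = (\<sigma> ^^ s) i"
proof -
  have "rep T i \<in> (\<lambda>s. (\<sigma> ^^ s) i) ` {..<M}"
    unfolding rep_def using M_bounds(1) by (intro Min_in) (auto simp: lessThan_empty_iff)
  then show ?thesis by auto
qed

lemma rep_in: "i \<in> II T \<Longrightarrow> rep T i \<in> II T"
  using rep_pow[of i] aut_pow_in by auto

lemma rep_rep: "i \<in> II T \<Longrightarrow> rep T (rep T i) = rep T i"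
  using rep_pow[of i] rep_aut_pow[of i] by auto

lemma node_of_rep:
  assumes "i \<in> II T"
  obtains s where "i = (\<sigma> ^^ s) (rep T i)"
proof -
  obtain s where s: "s < M" "rep T i = (\<sigma> ^^ s) i" using rep_pow by auto
  then have "(\<sigma> ^^ (M - s)) (rep T i) = i" using assms by (simp add: aut_pow_add aut_pow_M)
  then show ?thesis using that by metis
qed

end

text \<open>The orbits form a chain, with the orbits of size one at its end.\<close>

locale chain_cartan = datum T for T :: twisted_datum +
  fixes L :: "nat list" and r :: nat
  assumes distinct_L: "distinct L" and set_L: "set L = rep T ` II T"
    and r_bounds: "1 \<le> r" "r \<le> length L"
    and fixed_iff: "a < length L \<Longrightarrow> \<sigma> (L ! a) = L ! a \<longleftrightarrow> r \<le> a"
    and cartan_self: "a < r \<Longrightarrow> 1 \<le> s \<Longrightarrow> s < M \<Longrightarrow>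
      cartan X (L ! a) ((\<sigma> ^^ s) (L ! a)) = 0 \<or> M = 2 \<and> cartan X (L ! a) ((\<sigma> ^^ s) (L ! a)) = - 1"
    and cartan_adj: "Suc a < length L \<Longrightarrow> cartan X (L ! a) (L ! Suc a) = - 1"
    and cartan_adj': "Suc a < r \<Longrightarrow> 1 \<le> s \<Longrightarrow> s < M \<Longrightarrow> cartan X (L ! a) ((\<sigma> ^^ s) (L ! Suc a)) = 0"
    and cartan_far: "a < length L \<Longrightarrow> b < length L \<Longrightarrow> Suc a < b \<or> Suc b < a \<Longrightarrow> s < M \<Longrightarrow>
      cartan X (L ! a) ((\<sigma> ^^ s) (L ! b)) = 0"
begin

abbreviation "N \<equiv> length L"

lemma L_in: "a < N \<Longrightarrow> L ! a \<in> II T"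
  using nth_mem[of a L] rep_in unfolding set_L by auto

lemma rep_L: "a < N \<Longrightarrow> rep T (L ! a) = L ! a"
  using nth_mem[of a L] rep_rep unfolding set_L by auto

lemma fixed_pow: "a < N \<Longrightarrow> r \<le> a \<Longrightarrow> (\<sigma> ^^ s) (L ! a) = L ! a"
  by (induct s) (auto simp: fixed_iff)

lemma bform_split: "j \<in> II T \<Longrightarrow> bform T i j = cartan X i j + (\<Sum>s = 1..<M. cartan X i ((\<sigma> ^^ s) j))"
proof -
  assume j: "j \<in> II T"
  have "{1..M} = insert M {1..<M}" using M_bounds by auto
  then show ?thesis by (simp add: bform_def aut_pow_M[OF j])
qed

lemma cartan_refl: "cartan X i i = 2" by (simp add: cartan_def)

lemma bform_fixed: "a < N \<Longrightarrow> b < N \<Longrightarrow> r \<le> b \<Longrightarrow> bform T (L ! a) (L ! b) = int M * cartan X (L ! a) (L ! b)"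
  by (simp add: bform_def fixed_pow)

lemma bform_self: "a < N \<Longrightarrow> bform T (L ! a) (L ! a) =
    (if r \<le> a then 2 * int M else if M = 2 then 2 + cartan X (L ! a) (\<sigma> (L ! a)) else 2)"
proof (cases "r \<le> a")
  case False
  assume a: "a < N"
  have "(\<Sum>s = 1..<M. cartan X (L ! a) ((\<sigma> ^^ s) (L ! a))) = (if M = 2 then cartan X (L ! a) (\<sigma> (L ! a)) else 0)"
  proof (cases "M = 2")
    case True
    have "{1..<2} = {1::nat}" by auto
    with True show ?thesis by simp
  next
    case F: False
    then show ?thesis using cartan_self[of a] False by (simp add: sum.neutral)
  qed
  then show ?thesis using False a by (simp add: bform_split[OF L_in] cartan_refl)
qed (simp add: bform_fixed cartan_refl)

lemma bform_adj: "Suc a < N \<Longrightarrow> bform T (L ! a) (L ! Suc a) = (if r \<le> Suc a then - int M else - 1)"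
proof (cases "r \<le> Suc a")
  case False
  assume a: "Suc a < N"
  have "(\<Sum>s = 1..<M. cartan X (L ! a) ((\<sigma> ^^ s) (L ! Suc a))) = 0"
    using False cartan_adj'[of a] by (intro sum.neutral) auto
  then show ?thesis using False a cartan_adj[of a] bform_split[OF L_in[OF a], of "L ! a"] by simp
qed (simp add: bform_fixed cartan_adj)

lemma bform_adj_sym: "Suc a < N \<Longrightarrow> bform T (L ! Suc a) (L ! a) = (if r \<le> Suc a then - int M else - 1)"
  using bform_sym[OF L_in L_in, of a "Suc a"] by (simp add: bform_adj)

lemma bform_far: "a < N \<Longrightarrow> b < N \<Longrightarrow> Suc a < b \<or> Suc b < a \<Longrightarrow> bform T (L ! a) (L ! b) = 0"
  using cartan_far[of a b] cartan_far[of a b 0] M_bounds by (simp add: bform_split[OF L_in] sum.neutral)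

lemma bform_self_pos: "a < N \<Longrightarrow> bform T (L ! a) (L ! a) > 0"
  using cartan_self[of a 1] M_bounds by (auto simp: bform_self)

lemma row_sum:
  assumes "b < N"
  shows "(\<Sum>a<N. v a * bform T (L ! a) (L ! b)) =
     (if b = 0 then 0 else v (b - 1) * bform T (L ! (b - 1)) (L ! b)) + v b * bform T (L ! b) (L ! b) +
     (if Suc b < N then v (Suc b) * bform T (L ! Suc b) (L ! b) else 0)" (is "?l = ?r")
proof -
  have "?l = (\<Sum>a\<in>{..<N} \<inter> {b - 1, b, Suc b}. v a * bform T (L ! a) (L ! b))"
  proof (rule sum.mono_neutral_right)
    show "\<forall>i\<in>{..<N} - {..<N} \<inter> {b - 1, b, Suc b}. v i * bform T (L ! i) (L ! b) = 0"
    proof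
      fix i assume "i \<in> {..<N} - {..<N} \<inter> {b - 1, b, Suc b}"
      then have "i < N" "Suc i < b \<or> Suc b < i" by auto
      then show "v i * bform T (L ! i) (L ! b) = 0" using assms bform_far by simp
    qed
  qed auto
  also have "{..<N} \<inter> {b - 1, b, Suc b} = (if b = 0 then {} else {b - 1}) \<union> ({b} \<union> (if Suc b < N then {Suc b} else {}))"
    using assms by (cases b) auto
  also have "(\<Sum>a\<in>\<dots>. v a * bform T (L ! a) (L ! b)) = ?r"
    by (cases b; cases "Suc b < N") (simp_all add: sum.insert_if)
  finally show ?thesis .
qed

end


text \<open>The weight of \<open>e\<^sub>\<epsilon>\<^sup>+\<close> and a vector that certifies the nondegeneracy of \<open>bform\<close>.\<close>

locale chain_datum = chain_cartan +
  fixes path :: "nat list" and v :: "nat \<Rightarrow> int"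
  assumes root_path: "root_path T = (L ! 0, map ((!) L) path)" and path_in: "set path \<subseteq> {..<N}"
    and Eps_right: "b < N \<Longrightarrow> bform T (L ! b) (L ! b) * affine_cartan T (Orbit (L ! b)) Eps =
      - 2 * (bform T (L ! b) (L ! 0) + (\<Sum>t\<leftarrow>path. bform T (L ! b) (L ! t)))"
    and Eps_left: "b < N \<Longrightarrow> two_d T Eps * affine_cartan T Eps (Orbit (L ! b)) =
      - 2 * (bform T (L ! b) (L ! 0) + (\<Sum>t\<leftarrow>path. bform T (L ! b) (L ! t)))"
    and v_pos: "b < N \<Longrightarrow> v b > 0"
    and row_pos: "b < N \<Longrightarrow> (\<Sum>a<N. v a * bform T (L ! a) (L ! b)) > 0"
begin

lemma bform_nonpos: "a < N \<Longrightarrow> b < N \<Longrightarrow> a \<noteq> b \<Longrightarrow> bform T (L ! a) (L ! b) \<le> 0"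
proof -
  assume a: "a < N" "b < N" "a \<noteq> b"
  consider "b = Suc a" | "a = Suc b" | "Suc a < b \<or> Suc b < a" using a(3) by linarith
  then show ?thesis
    by cases (use a in \<open>auto simp: bform_adj bform_adj_sym bform_far\<close>)
qed

text \<open>A maximum principle for a matrix with non-positive off-diagonal entries: at a position
  where the quotient of \<open>y\<close> by \<open>v\<close> attains its maximum \<open>t\<close>,
  the row sum of \<open>y\<close> is at least \<open>t\<close> times that of \<open>v\<close>. The
  former is zero and the latter positive, so \<open>t \<le> 0\<close>.\<close>

lemma max_ratio:
  fixes y :: "nat \<Rightarrow> int"
  assumes "\<And>b. b < N \<Longrightarrow> (\<Sum>a<N. y a * bform T (L ! a) (L ! b)) = 0" and "b < N"
  shows "y b \<le> 0"
proof -
  define R where "R = (\<lambda>a. real_of_int (y a) / v a) ` {..<N}"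
  have R: "finite R" "R \<noteq> {}" using assms(2) by (auto simp: R_def)
  define t where "t = Max R"
  obtain c where c: "c < N" "t = y c / v c" using Max_in[OF R] by (auto simp: R_def t_def)
  have le: "real_of_int (y a) \<le> t * v a" if "a < N" for a
  proof -
    have "y a / v a \<le> t" unfolding t_def using R that by (intro Max_ge) (auto simp: R_def)
    then show ?thesis using v_pos[OF that] by (simp add: field_simps)
  qed
  have "t * v a * bform T (L ! a) (L ! c) \<le> real_of_int (y a) * bform T (L ! a) (L ! c)" if "a < N" for a
  proof (cases "a = c")
    case True then show ?thesis using c v_pos[OF c(1)] by simp
  next
    case False
    then show ?thesis using le[OF that] bform_nonpos[OF that c(1)]
      by (intro mult_right_mono_neg) auto
  qed
  then have "(\<Sum>a<N. t * v a * bform T (L ! a) (L ! c)) \<le> (\<Sum>a<N. real_of_int (y a) * bform T (L ! a) (L ! c))"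
    by (intro sum_mono) auto
  also have "\<dots> = real_of_int (\<Sum>a<N. y a * bform T (L ! a) (L ! c))" by simp
  also have "\<dots> = 0" using assms(1)[OF c(1)] by simp
  finally have "t * real_of_int (\<Sum>a<N. v a * bform T (L ! a) (L ! c)) \<le> 0"
    by (simp add: sum_distrib_left mult.assoc)
  moreover have "real_of_int (\<Sum>a<N. v a * bform T (L ! a) (L ! c)) > 0" using row_pos[OF c(1)] by (simp only: of_int_0_less_iff)
  ultimately have "t \<le> 0" by (meson mult_pos_pos not_le)
  then have "t * v b \<le> 0" using v_pos[OF assms(2)] by (simp add: mult_nonpos_nonneg)
  then show ?thesis using le[OF assms(2)] by linarith
qed

lemma bform_nondegenerate:
  fixes y :: "nat \<Rightarrow> int"
  assumes "\<And>b. b < N \<Longrightarrow> (\<Sum>a<N. y a * bform T (L ! a) (L ! b)) = 0" and "b < N"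
  shows "y b = 0"
proof -
  have "(\<Sum>a<N. - y a * bform T (L ! a) (L ! b)) = 0" if "b < N" for b
    using assms(1)[OF that] by (simp add: sum_negf)
  then show ?thesis using max_ratio[of y b] max_ratio[of "\<lambda>a. - y a" b] assms by force
qed

end

context chain_cartan
begin

lemma upt_sum:
  assumes "d \<le> N" "b < N"
  shows "(\<Sum>t\<leftarrow>[c..<d]. bform T (L ! b) (L ! t)) = (\<Sum>a<N. (if c \<le> a \<and> a < d then 1 else 0) * bform T (L ! a) (L ! b))"
proof -
  have "(\<Sum>a<N. (if c \<le> a \<and> a < d then 1 else 0) * bform T (L ! a) (L ! b)) = (\<Sum>a\<in>{c..<d}. bform T (L ! a) (L ! b))"
    using assms by (intro sum.mono_neutral_cong_right) auto
  also have "\<dots> = (\<Sum>a\<in>{c..<d}. bform T (L ! b) (L ! a))"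
    using assms by (intro sum.cong) (auto simp: bform_sym L_in)
  finally show ?thesis by (simp add: interv_sum_list_conv_sum_set_nat)
qed

end

section \<open>Chain, root path and certificate for each type\<close>

context datum
begin

text \<open>An end node goes to an end node. The image of node 1 then determines all others, since
  neighbours go to neighbours and injectivity forbids turning back. If node 1 were fixed, \<sigma>
  would be the identity; a reflection in turn excludes order 3.\<close>

lemma chain_A_aux:
  assumes X: "X = Type_A m"
  shows "m \<ge> 2" and "M = 2" and "1 \<le> i \<Longrightarrow> i \<le> m \<Longrightarrow> \<sigma> i = m + 1 - i"
proof -
  show m: "m \<ge> 2" using datum by (simp add: twisted_datum_def X)
  have I: "II T = {1..m}" by (simp add: X)
  have nb: "nbrs i = {j. 1 \<le> j \<and> j \<le> m \<and> (j = Suc i \<or> i = Suc j)}" for i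
    by (auto simp: nbrs_def X)
  have "nbrs 1 = {2}" using m by (auto simp: nb)
  then have "card (nbrs (\<sigma> 1)) = 1" using card_nbrs_aut[of 1] m by (simp add: X)
  moreover have s1: "1 \<le> \<sigma> 1" "\<sigma> 1 \<le> m" using aut_in[of 1] m by (auto simp: X)
  moreover have "nbrs i = {i - 1, Suc i}" if "1 < i" "i < m" for i using that by (auto simp: nb)
  ultimately have "\<sigma> 1 = 1 \<or> \<sigma> 1 = m" by (cases "1 < \<sigma> 1 \<and> \<sigma> 1 < m") auto
  have step: "\<sigma> (Suc i) = Suc (\<sigma> i) \<or> \<sigma> i = Suc (\<sigma> (Suc i))" if "1 \<le> i" "Suc i \<le> m" for i
    using nbrs_aut_in[of i "Suc i"] that by (simp add: nb I)
  have inj: "\<sigma> i \<noteq> \<sigma> j" if "1 \<le> i" "i < j" "j \<le> m" for i j using aut_inj[of i j] that by (simp add: I)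
  have in1: "1 \<le> \<sigma> i \<and> \<sigma> i \<le> m" if "1 \<le> i" "i \<le> m" for i using aut_in[of i] that by (auto simp: X)
  have up: "\<sigma> (Suc i) = Suc i" if "\<sigma> 1 = 1" "Suc i \<le> m" for i
    using that(2)
  proof (induct i rule: less_induct)
    case (less i)
    show ?case
    proof (cases i)
      case 0 then show ?thesis using that by simp
    next
      case (Suc k)
      have 1: "\<sigma> i = i" using less(1)[of k] less(2) Suc by simp
      have "\<sigma> (Suc i) = Suc i \<or> i = Suc (\<sigma> (Suc i))" using step[of i] less(2) Suc 1 by simp
      moreover have "i \<noteq> Suc (\<sigma> (Suc i))"
      proof
        assume a: "i = Suc (\<sigma> (Suc i))"
        then have k: "\<sigma> (Suc i) = k" using Suc by simp
        moreover have "1 \<le> k" using in1[of "Suc i"] less(2) k by simp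
        then obtain l where "k = Suc l" by (cases k) auto
        then have "\<sigma> k = k" using less(1)[of l] less(2) Suc by simp
        ultimately show False using inj[of k "Suc i"] \<open>1 \<le> k\<close> Suc less(2) by simp
      qed
      ultimately show ?thesis by simp
    qed
  qed
  have "\<sigma> 1 \<noteq> 1"
  proof
    assume "\<sigma> 1 = 1"
    then have "\<sigma> i = i" if "i \<in> II T" for i using up[of "i - 1"] that by (simp add: I)
    then show False using aut_nontrivial by auto
  qed
  then have sm: "\<sigma> 1 = m" using \<open>\<sigma> 1 = 1 \<or> \<sigma> 1 = m\<close> by simp
  have down: "\<sigma> (Suc i) = m - i" if "Suc i \<le> m" for i
    using that
  proof (induct i rule: less_induct)
    case (less i)
    show ?case
    proof (cases i)
      case 0 then show ?thesis using sm by simp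
    next
      case (Suc k)
      have 1: "\<sigma> i = m - k" using less(1)[of k] less(2) Suc by simp
      have "\<sigma> (Suc i) = Suc (m - k) \<or> m - k = Suc (\<sigma> (Suc i))" using step[of i] less(2) Suc 1 by simp
      moreover have "\<sigma> (Suc i) \<noteq> Suc (m - k)"
      proof
        assume a: "\<sigma> (Suc i) = Suc (m - k)"
        then have "1 \<le> k" using in1[of "Suc i"] less(2) Suc by (cases k) auto
        then obtain l where l: "k = Suc l" by (cases k) auto
        then have "\<sigma> k = Suc (m - k)" using less(1)[of l] less(2) Suc by simp
        then show False using inj[of k "Suc i"] a \<open>1 \<le> k\<close> Suc less(2) by simp
      qed
      ultimately show ?thesis using Suc less(2) by simp
    qed
  qed
  show s: "\<sigma> i = m + 1 - i" if "1 \<le> i" "i \<le> m" for i using down[of "i - 1"] that by simp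
  show "M = 2"
  proof (rule ccontr)
    assume "M \<noteq> 2"
    then have "(\<sigma> ^^ 3) 1 = 1" using M_cases aut_pow_M[of 1] m by (auto simp: X)
    then show False using s[of 1] s[of m] m by (simp add: numeral_3_eq_3)
  qed
qed

end

context datum
begin

lemma chain_A:
  assumes X: "X = Type_A m"
  shows "\<exists>L r path v. chain_datum T L r path v"
proof -
  note A = chain_A_aux[OF X]
  define n where "n = Suc m div 2"
  define L where "L = [1..<Suc n]"
  have N: "length L = n" by (simp add: L_def)
  have L: "L ! a = Suc a" if "a < n" for a using that by (simp add: L_def del: upt_Suc)
  have n1: "1 \<le> n" using A(1) by (simp add: n_def)
  have mn: "m = 2 * n \<and> even m \<or> m = 2 * n - 1 \<and> odd m" unfolding n_def by presburger
  have rep: "rep T i = min i (m + 1 - i)" if "1 \<le> i" "i \<le> m" for i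
  proof -
    have "{..<2::nat} = {0, 1}" by auto
    then show ?thesis using A(3)[OF that] by (simp add: rep_def A(2))
  qed
  have setL: "set L = rep T ` II T"
  proof (intro equalityI subsetI)
    fix i assume "i \<in> set L"
    then have i: "1 \<le> i" "i \<le> n" by (auto simp: L_def)
    then have "rep T i = i" "i \<in> II T" using rep[of i] mn by (auto simp: X min_def)
    then show "i \<in> rep T ` II T" by (metis image_eqI)
  next
    fix i assume "i \<in> rep T ` II T"
    then obtain j where j: "1 \<le> j" "j \<le> m" "i = min j (m + 1 - j)" using rep by (auto simp: X)
    then show "i \<in> set L" using mn by (auto simp: L_def min_def)
  qed
  define r where "r = (if even m then n else n - 1)"
  have sg: "\<sigma> (L ! a) = m - a" if "a < n" for a using A(3)[of "L ! a"] L[OF that] that mn by auto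
  have fixed: "\<sigma> (L ! a) = L ! a \<longleftrightarrow> r \<le> a" if "a < n" for a
    using sg[OF that] L[OF that] that mn by (auto simp: r_def)
  have rm: "2 * r \<le> m" "r \<le> n" "2 * n \<le> Suc m" using mn by (auto simp: r_def)
  have car: "cartan X i j = (if i = j then 2 else if j = Suc i \<or> i = Suc j then - 1 else 0)" for i j
    by (simp add: cartan_def X)
  have s1: "s = 1" if "1 \<le> s" "s < M" for s using that A(2) by simp
  have s01: "s = 0 \<or> s = 1" if "s < M" for s using that A(2) by auto
  interpret chain_cartan T L r
  proof
    show "distinct L" by (simp add: L_def)
    show "set L = rep T ` II T" by (rule setL)
    show "1 \<le> r" "r \<le> length L" using A(1) mn by (auto simp: r_def N)
    show "\<sigma> (L ! a) = L ! a \<longleftrightarrow> r \<le> a" if "a < length L" for a using fixed that by (simp add: N)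
    show "cartan X (L ! a) ((\<sigma> ^^ s) (L ! a)) = 0 \<or> M = 2 \<and> cartan X (L ! a) ((\<sigma> ^^ s) (L ! a)) = - 1"
      if "a < r" "1 \<le> s" "s < M" for a s
    proof -
      have "a < n" "Suc a \<noteq> m - a" using that(1) rm by linarith+
      then show ?thesis using s1[OF that(2,3)] A(2) sg[of a] L[of a] by (simp add: car)
    qed
    show "cartan X (L ! a) (L ! Suc a) = - 1" if "Suc a < length L" for a
      using that by (simp add: N L car)
    show "cartan X (L ! a) ((\<sigma> ^^ s) (L ! Suc a)) = 0" if "Suc a < r" "1 \<le> s" "s < M" for a s
    proof -
      have "Suc a < n" "Suc (Suc a) < m - Suc a" using that(1) rm by linarith+
      then show ?thesis using s1[OF that(2,3)] sg[of "Suc a"] L[of a] by (simp add: car)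
    qed
    show "cartan X (L ! a) ((\<sigma> ^^ s) (L ! b)) = 0"
      if "a < length L" "b < length L" "Suc a < b \<or> Suc b < a" "s < M" for a b s
    proof -
      have ab: "a < n" "b < n" using that by (simp_all add: N)
      have "Suc (Suc a) < m - b" using that(3) ab rm by linarith
      then show ?thesis using s01[OF that(4)] that(3) ab sg[OF ab(2)] by (auto simp: L car)
    qed
  qed
  have self: "bform T (L ! a) (L ! a) = (if r \<le> a then 4 else if even m \<and> Suc a = n then 1 else 2)" if "a < n" for a
  proof (cases "r \<le> a")
    case False
    have "Suc a \<noteq> m - a" "Suc a \<noteq> Suc (m - a)" using False rm by linarith+
    moreover have "m - a = Suc (Suc a) \<longleftrightarrow> even m \<and> Suc a = n"
    proof (cases "even m")
      case True
      then have "m = 2 * n" using mn by auto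
      then have "m - a = Suc (Suc a) \<longleftrightarrow> Suc a = n" using that by linarith
      then show ?thesis using True by simp
    next
      case odd: False
      then have "m = 2 * n - 1" "r = n - 1" using mn by (auto simp: r_def)
      then have "m - a \<noteq> Suc (Suc a)" using False that by linarith
      then show ?thesis using odd by simp
    qed
    ultimately show ?thesis using False that sg[OF that] L[OF that] bform_self[of a] by (simp add: N A(2) car)
  qed (use that in \<open>simp add: bform_self N A(2)\<close>)
  have adj: "bform T (L ! a) (L ! Suc a) = (if r \<le> Suc a then - 2 else - 1)"
    "bform T (L ! Suc a) (L ! a) = (if r \<le> Suc a then - 2 else - 1)" if "Suc a < n" for a
    using that by (simp_all add: bform_adj bform_adj_sym N A(2))
  show ?thesis
  proof (cases "even m")
    case True
    then have m: "m = 2 * n" using mn by auto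
    have r: "r = n" using True by (simp add: r_def)
    define path where "path = [0..<n] @ rev [1..<n]"
    \<comment> \<open>The coefficients of the sum of the positive roots of \<open>A_m\<close>. This
      sum pairs with every simple root to 2, and since no orbit is fixed, summing over orbits gives
      row sums 2.\<close>
    define v where "v = (\<lambda>a::nat. int (Suc a) * (int m - int a))"
    \<comment> \<open>Together with the node 0, the path runs through every position exactly
      twice.\<close>
    have E: "(\<Sum>t\<leftarrow>path. bform T (L ! b) (L ! t)) + bform T (L ! b) (L ! 0) =
        (\<Sum>a<length L. 2 * bform T (L ! a) (L ! b))" if "b < n" for b
    proof -
      have "[0..<n] = 0 # [1..<n]" using n1 by (simp add: upt_conv_Cons)
      then have "(\<Sum>t\<leftarrow>path. bform T (L ! b) (L ! t)) + bform T (L ! b) (L ! 0) =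
        (\<Sum>t\<leftarrow>[0..<n]. bform T (L ! b) (L ! t)) + (\<Sum>t\<leftarrow>[0..<n]. bform T (L ! b) (L ! t))"
        by (simp add: path_def rev_map[symmetric] sum_list_rev)
      then show ?thesis using that by (simp add: upt_sum N sum.distrib[symmetric])
    qed
    have Eps: "bform T (L ! b) (L ! 0) + (\<Sum>t\<leftarrow>path. bform T (L ! b) (L ! t)) =
        (if b = 0 then 2 else 0)" if "b < n" for b
    proof (cases b)
      case 0 then show ?thesis
        using E[OF that] row_sum[of b "\<lambda>_. 2"] that by (cases "Suc b < n") (auto simp: N self adj r m)
    next
      case (Suc c) then show ?thesis
        using E[OF that] row_sum[of b "\<lambda>_. 2"] that by (cases "Suc b < n") (auto simp: N self adj r m)
    qed
    have "chain_datum T L r path v"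
    proof
      have "map ((!) L) path = map Suc path" by (rule map_cong) (auto simp: path_def L)
      also have "\<dots> = [1..<Suc n] @ rev [2..<Suc n]"
        by (simp add: path_def rev_map[symmetric] map_Suc_upt numeral_2_eq_2 del: upt_Suc)
      finally show "root_path T = (L ! 0, map ((!) L) path)" using n1 m by (simp add: root_path_def X L)
      show "set path \<subseteq> {..<length L}" by (auto simp: path_def N)
      fix b assume "b < length L"
      then have b: "b < n" by (simp add: N)
      show "bform T (L ! b) (L ! b) * affine_cartan T (Orbit (L ! b)) Eps =
        - 2 * (bform T (L ! b) (L ! 0) + (\<Sum>t\<leftarrow>path. bform T (L ! b) (L ! t)))"
        unfolding Eps[OF b] self[OF b] using b n1 by (auto simp: affine_edge_def X m L r)
      show "two_d T Eps * affine_cartan T Eps (Orbit (L ! b)) =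
        - 2 * (bform T (L ! b) (L ! 0) + (\<Sum>t\<leftarrow>path. bform T (L ! b) (L ! t)))"
        unfolding Eps[OF b] using b n1 by (auto simp: affine_edge_def X m L)
      show "v b > 0" using b m by (simp add: v_def)
      show "(\<Sum>a<length L. v a * bform T (L ! a) (L ! b)) > 0"
      proof (cases b)
        case 0 then show ?thesis
          using row_sum[of b v] b by (cases "Suc b < n") (auto simp: N self adj r m v_def algebra_simps)
      next
        case (Suc c) then show ?thesis
          using row_sum[of b v] b by (cases "Suc b < n") (auto simp: N self adj r m v_def algebra_simps)
      qed
    qed
    then show ?thesis by blast
  next
    case False
    then have m: "m = 2 * n - 1" and n2: "2 \<le> n" using mn A(1) by auto
    have r: "r = n - 1" using False by (simp add: r_def)
    define path where "path = [1..<n - 1] @ rev [1..<n]"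
    define c where "c = (\<lambda>j. int j * (2 * int n - int j))"
    \<comment> \<open>\<open>c\<close> lists the coefficients of the sum of the positive roots. As
      \<open>bform\<close> counts a fixed node \<open>M\<close> times, the coefficients on the other
      orbits are multiplied by \<open>M = 2\<close>; the row sums become 4. The certificates for the
      types D and E follow the same recipe.\<close>
    define v where "v = (\<lambda>a. if Suc a < n then 2 * c (Suc a) else c (Suc a))"
    \<comment> \<open>The multiplicity of \<open>a\<close> in \<open>0 # path\<close>: both ends
      occur once, inner positions twice.\<close>
    define w where "w = (\<lambda>a. (if 1 \<le> a \<and> a < n - 1 then 1 else 0) + 1 :: int)"
    have E: "(\<Sum>t\<leftarrow>path. bform T (L ! b) (L ! t)) + bform T (L ! b) (L ! 0) =
        (\<Sum>a<length L. w a * bform T (L ! a) (L ! b))" if "b < n" for b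
    proof -
      have "[0..<n] = 0 # [1..<n]" using n1 by (simp add: upt_conv_Cons)
      then have "(\<Sum>t\<leftarrow>path. bform T (L ! b) (L ! t)) + bform T (L ! b) (L ! 0) =
        (\<Sum>t\<leftarrow>[1..<n - 1]. bform T (L ! b) (L ! t)) + (\<Sum>t\<leftarrow>[0..<n]. bform T (L ! b) (L ! t))"
        by (simp add: path_def rev_map[symmetric] sum_list_rev)
      then show ?thesis using that by (simp add: upt_sum N sum.distrib[symmetric] w_def algebra_simps)
    qed
    have Eps: "bform T (L ! b) (L ! 0) + (\<Sum>t\<leftarrow>path. bform T (L ! b) (L ! t)) =
        (if b = 1 then if n = 2 then 2 else 1 else 0)" if "b < n" for b
    proof (cases b)
      case 0 then show ?thesis
        unfolding add.commute[of "bform T (L ! b) (L ! 0)"] E[OF that]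
        using row_sum[of b w] that n2 False by (auto simp: N self adj r w_def)
    next
      case (Suc d) then show ?thesis
        unfolding add.commute[of "bform T (L ! b) (L ! 0)"] E[OF that]
        using that n2 False by (cases "Suc b < n") (auto simp: row_sum[unfolded N] N self adj r w_def split: if_splits)
    qed
    have "chain_datum T L r path v"
    proof
      have "map ((!) L) path = map Suc path" by (rule map_cong) (auto simp: path_def L)
      also have "\<dots> = [2..<n] @ rev [2..<Suc n]"
        using n2 by (simp add: path_def rev_map[symmetric] map_Suc_upt numeral_2_eq_2 del: upt_Suc)
      finally show "root_path T = (L ! 0, map ((!) L) path)" using n2 False by (simp add: root_path_def X L n_def)
      show "set path \<subseteq> {..<length L}" by (auto simp: path_def N)
      fix b assume b': "b < length L"
      then have b: "b < n" by (simp add: N)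
      show "bform T (L ! b) (L ! b) * affine_cartan T (Orbit (L ! b)) Eps =
        - 2 * (bform T (L ! b) (L ! 0) + (\<Sum>t\<leftarrow>path. bform T (L ! b) (L ! t)))"
        unfolding Eps[OF b] self[OF b] using b n2 False m by (auto simp: affine_edge_def X L r)
      show "two_d T Eps * affine_cartan T Eps (Orbit (L ! b)) =
        - 2 * (bform T (L ! b) (L ! 0) + (\<Sum>t\<leftarrow>path. bform T (L ! b) (L ! t)))"
        unfolding Eps[OF b] using b n2 False m by (auto simp: affine_edge_def X L)
      have "c (Suc b) > 0" using b by (simp add: c_def)
      then show "v b > 0" by (simp add: v_def)
      show "(\<Sum>a<length L. v a * bform T (L ! a) (L ! b)) > 0"
      proof (cases b)
        case 0 then show ?thesis
          unfolding row_sum[OF b'] using b n2 False by (auto simp: N self adj r v_def c_def algebra_simps)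
      next
        case (Suc d) then show ?thesis
          unfolding row_sum[OF b'] using b n2 False by (cases "Suc b < n") (auto simp: N self adj r v_def c_def algebra_simps)
      qed
    qed
    then show ?thesis by blast
  qed
qed

end

context datum
begin

text \<open>Here \<sigma> exchanges the last two nodes and fixes all others. Since the chain has to
  begin with the orbit of size two, it runs against the labelling.\<close>

lemma chain_D_fixed:
  assumes X: "X = Type_D m" and 1: "\<sigma> 1 = 1"
  shows "\<exists>L r path v. chain_datum T L r path v"
proof -
  have m: "m \<ge> 4" using datum by (simp add: twisted_datum_def X)
  have I: "II T = {1..m}" by (simp add: X)
  have nb: "nbrs i = {j. 1 \<le> j \<and> j \<le> m \<and> j \<noteq> i \<and> adjacent (Type_D m) i j}" for i
    by (auto simp: nbrs_def X)
  have inj: "\<sigma> i \<noteq> \<sigma> j" if "1 \<le> i" "i < j" "j \<le> m" for i j using aut_inj[of i j] that by (simp add: I)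
  have fx: "\<sigma> i = i" if "1 \<le> i" "i \<le> m - 2" for i
    using that
  proof (induct i rule: less_induct)
    case (less i)
    show ?case
    proof (cases "i = 1")
      case True then show ?thesis using 1 by simp
    next
      case False
      define k where "k = i - 1"
      have k: "i = Suc k" "1 \<le> k" using False less(2) by (simp_all add: k_def)
      have 2: "\<sigma> k = k" using less(1)[of k] k less(3) by simp
      have "i \<in> nbrs k" using k less(2,3) m by (auto simp: nb)
      then have "\<sigma> i \<in> nbrs k" using nbrs_aut_in[of k i] 2 k less(3) by (simp add: I)
      then have "\<sigma> i = Suc k \<or> k = Suc (\<sigma> i)" using k less(3) m by (auto simp: nb doubleton_eq_iff)
      moreover have "k \<noteq> Suc (\<sigma> i)"
      proof
        assume a: "k = Suc (\<sigma> i)"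
        have "1 \<le> \<sigma> i" using aut_in[of i] less(2,3) by (simp add: I)
        have l: "\<sigma> i < i" "\<sigma> i \<le> m - 2" "i \<le> m" using a k(1) less(3) by linarith+
        have "\<sigma> (\<sigma> i) = \<sigma> i" by (rule less(1)[OF l(1) \<open>1 \<le> \<sigma> i\<close> l(2)])
        then show False using inj[OF \<open>1 \<le> \<sigma> i\<close> l(1,3)] by contradiction
      qed
      ultimately show ?thesis using k by simp
    qed
  qed
  have top: "\<sigma> i = m - 1 \<or> \<sigma> i = m" if "i = m - 1 \<or> i = m" for i
  proof -
    have i: "i \<in> II T" using that m by (auto simp: I)
    have "\<sigma> i \<in> II T" using aut_in[OF i] .
    moreover have "\<not> \<sigma> i \<le> m - 2"
    proof
      assume a: "\<sigma> i \<le> m - 2"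
      then have "\<sigma> (\<sigma> i) = \<sigma> i" using fx[of "\<sigma> i"] \<open>\<sigma> i \<in> II T\<close> by (simp add: I)
      then have "\<sigma> i = i" using aut_inj[OF \<open>\<sigma> i \<in> II T\<close> i] by simp
      then show False using a that m by auto
    qed
    ultimately show ?thesis using m by (auto simp: I)
  qed
  have sw: "\<sigma> (m - 1) = m" "\<sigma> m = m - 1"
  proof -
    have "\<sigma> (m - 1) \<noteq> m - 1"
    proof
      assume a: "\<sigma> (m - 1) = m - 1"
      have "m - 1 < m" "1 \<le> m - 1" using m by linarith+
      then have "\<sigma> m = m" using top[of m] inj[of "m - 1" m] a by auto
      moreover have "1 \<le> i \<and> i \<le> m - 2 \<or> i = m - 1 \<or> i = m" if "i \<in> II T" for i using that by (auto simp: I)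
      ultimately have "\<sigma> i = i" if "i \<in> II T" for i using fx a that by blast
      then show False using aut_nontrivial by auto
    qed
    then show "\<sigma> (m - 1) = m" using top[of "m - 1"] by simp
    moreover have "m - 1 < m" "1 \<le> m - 1" using m by linarith+
    ultimately show "\<sigma> m = m - 1" using top[of m] inj[of "m - 1" m] by auto
  qed
  have M: "M = 2"
  proof (rule ccontr)
    assume "M \<noteq> 2"
    then have "(\<sigma> ^^ 3) m = m" using M_cases aut_pow_M[of m] m by (auto simp: X)
    then show False using sw m by (simp add: numeral_3_eq_3)
  qed
  define N where "N = m - 1"
  define L where "L = rev [1..<m]"
  have N: "length L = N" by (simp add: L_def N_def)
  have L: "L ! a = N - a" if "a < N" for a using that by (simp add: L_def N_def rev_nth)
  have N3: "3 \<le> N" "m = Suc N" using m by (simp_all add: N_def)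
  have rep: "rep T i = (if i = m then N else i)" if "1 \<le> i" "i \<le> m" for i
  proof -
    have "{..<2::nat} = {0, 1}" by auto
    then have "rep T i = min i (\<sigma> i)" by (simp add: rep_def M)
    moreover have "i \<le> m - 2 \<or> i = N \<or> i = m" using that N3 by linarith
    moreover have "\<sigma> N = m" "\<sigma> m = N" "N < m" using sw N3 by simp_all
    ultimately show ?thesis using fx[OF that(1)] by (auto simp: min_def)
  qed
  have setL: "set L = rep T ` II T"
  proof (intro equalityI subsetI)
    fix i assume "i \<in> set L"
    then have "1 \<le> i" "i < m" by (auto simp: L_def)
    then have "rep T i = i" "i \<in> II T" using rep[of i] by (auto simp: X)
    then show "i \<in> rep T ` II T" by (metis image_eqI)
  next
    fix i assume "i \<in> rep T ` II T"
    then obtain j where j: "1 \<le> j" "j \<le> m" "i = (if j = m then N else j)" using rep by (auto simp: X)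
    then show "i \<in> set L" using N3 by (auto simp: L_def split: if_splits)
  qed
  have s1: "s = 1" if "1 \<le> s" "s < M" for s using that M by simp
  have s01: "s = 0 \<or> s = 1" if "s < M" for s using that M by auto
  have sg: "\<sigma> (L ! a) = (if a = 0 then m else N - a)" if "a < N" for a
    using fx[of "N - a"] sw(1) L[OF that] that N3 by auto
  have car: "cartan X i j = (if i = j then 2 else if adjacent (Type_D m) i j then - 1 else 0)" for i j
    by (simp add: cartan_def X)
  interpret chain_cartan T L 1
  proof
    show "distinct L" by (simp add: L_def)
    show "set L = rep T ` II T" by (rule setL)
    show "1 \<le> (1::nat)" "1 \<le> length L" using N3 by (auto simp: N)
    show "\<sigma> (L ! a) = L ! a \<longleftrightarrow> 1 \<le> a" if "a < length L" for a
      using sg[of a] L[of a] that N3 by (auto simp: N)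
    show "cartan X (L ! a) ((\<sigma> ^^ s) (L ! a)) = 0 \<or> M = 2 \<and> cartan X (L ! a) ((\<sigma> ^^ s) (L ! a)) = - 1"
      if "a < 1" "1 \<le> s" "s < M" for a s
      using s1[OF that(2,3)] M sg[of a] L[of a] that(1) N3 by (simp add: car doubleton_eq_iff)
    show "cartan X (L ! a) (L ! Suc a) = - 1" if "Suc a < length L" for a
      using that N3 by (auto simp: N L car)
    show "cartan X (L ! a) ((\<sigma> ^^ s) (L ! Suc a)) = 0" if "Suc a < 1" "1 \<le> s" "s < M" for a s
      using that by simp
    show "cartan X (L ! a) ((\<sigma> ^^ s) (L ! b)) = 0"
      if "a < length L" "b < length L" "Suc a < b \<or> Suc b < a" "s < M" for a b s
    proof -
      have ab: "a < N" "b < N" using that by (simp_all add: N)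
      have "cartan X (L ! a) (L ! b) = 0"
        using that(3) ab N3 by (auto simp: L car doubleton_eq_iff)
      moreover have "cartan X (L ! a) m = 0" if "b = 0"
        using \<open>Suc a < b \<or> Suc b < a\<close> that ab N3 by (auto simp: L car doubleton_eq_iff)
      ultimately show ?thesis using s01[OF that(4)] sg[OF ab(2)] L[OF ab(2)] by auto
    qed
  qed
  have self: "bform T (L ! a) (L ! a) = (if a = 0 then 2 else 4)" if "a < N" for a
  proof (cases "a = 0")
    case True
    have "L ! 0 = N" "\<sigma> (L ! 0) = Suc N" using L[of 0] sg[of 0] N3 by auto
    then have "cartan X (L ! 0) (\<sigma> (L ! 0)) = 0" using N3 by (simp add: car doubleton_eq_iff)
    then show ?thesis using bform_self[of 0] N3 True by (simp add: N M)
  qed (use that bform_self[of a] in \<open>simp add: N M\<close>)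
  have adj: "bform T (L ! a) (L ! Suc a) = - 2" "bform T (L ! Suc a) (L ! a) = - 2" if "Suc a < N" for a
    using that by (simp_all add: bform_adj bform_adj_sym N M)
  define path where "path = rev [1..<N]"
  \<comment> \<open>Position \<open>a\<close> carries the node \<open>m - 1 - a\<close>, at which
    the sum of the positive roots of \<open>D_m\<close> has this coefficient for
    \<open>a > 0\<close>. At \<open>a = 0\<close> it is twice the coefficient
    \<open>m * (m - 1) / 2\<close> of the spin nodes.\<close>
  define v where "v = (\<lambda>a::nat. int m * (int m - 1) - int a * (int a + 1))"
  have E: "bform T (L ! b) (L ! 0) + (\<Sum>t\<leftarrow>path. bform T (L ! b) (L ! t)) =
      (\<Sum>a<length L. 1 * bform T (L ! a) (L ! b))" if "b < N" for b
  proof -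
    have "[0..<N] = 0 # [1..<N]" using N3 by (simp add: upt_conv_Cons)
    then have "bform T (L ! b) (L ! 0) + (\<Sum>t\<leftarrow>path. bform T (L ! b) (L ! t)) = (\<Sum>t\<leftarrow>[0..<N]. bform T (L ! b) (L ! t))"
      by (simp add: path_def rev_map[symmetric] sum_list_rev)
    then show ?thesis using that by (simp add: upt_sum N)
  qed
  have Eps: "bform T (L ! b) (L ! 0) + (\<Sum>t\<leftarrow>path. bform T (L ! b) (L ! t)) =
      (if Suc b = N then 2 else 0)" if "b < N" for b
  proof -
    have R: "b < length L" using that by (simp add: N)
    show ?thesis
    proof (cases b)
      case 0 then show ?thesis unfolding E[OF that] row_sum[OF R] using that N3 by (auto simp: N self adj)
    next
      case (Suc d) then show ?thesis
        unfolding E[OF that] row_sum[OF R] using that N3 by (cases "Suc b < N") (auto simp: N self adj)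
    qed
  qed
  have chain: "D_chain m \<sigma> = [1..<m]" using 1 by (simp add: D_chain_def)
  have ll: "last [1..<m] = N" "butlast [1..<m] = [1..<N]" "hd [1..<m] = 1" using N3 by (simp_all add: upt_conv_Cons)
  have "chain_datum T L 1 path v"
  proof
    have "rev (map ((!) L) path) = map ((!) L) [1..<N]" by (simp add: path_def rev_map)
    also have "\<dots> = rev [1..<N]" by (rule nth_equalityI) (auto simp: L rev_nth)
    finally have "map ((!) L) path = [1..<N]" by (metis rev_rev_ident)
    then show "root_path T = (L ! 0, map ((!) L) path)"
      unfolding root_path_def X dynkin.case M chain ll using N3(1) by (simp add: L)
    show "set path \<subseteq> {..<length L}" by (auto simp: path_def N)
    fix b assume b': "b < length L"
    then have b: "b < N" by (simp add: N)
    have edge: "affine_edge T = (1, - 2, - 1)" unfolding affine_edge_def X dynkin.case M chain ll by simp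
    show "bform T (L ! b) (L ! b) * affine_cartan T (Orbit (L ! b)) Eps =
      - 2 * (bform T (L ! b) (L ! 0) + (\<Sum>t\<leftarrow>path. bform T (L ! b) (L ! t)))"
      unfolding Eps[OF b] self[OF b] using b N3 by (auto simp: edge L)
    show "two_d T Eps * affine_cartan T Eps (Orbit (L ! b)) =
      - 2 * (bform T (L ! b) (L ! 0) + (\<Sum>t\<leftarrow>path. bform T (L ! b) (L ! t)))"
      unfolding Eps[OF b] using b N3 by (auto simp: edge L X)
    have "int b * (int b + 1) \<le> int b * (int m - 1)" using b N3 by (intro mult_left_mono) auto
    also have "\<dots> < int m * (int m - 1)" using b N3 by (intro mult_strict_right_mono) auto
    finally have "int b * (int b + 1) < int m * (int m - 1)" .
    then show "v b > 0" by (simp add: v_def)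
    show "(\<Sum>a<length L. v a * bform T (L ! a) (L ! b)) > 0"
    proof (cases b)
      case 0 then show ?thesis
        unfolding row_sum[OF b'] using b N3 by (auto simp: N self adj v_def algebra_simps)
    next
      case (Suc d)
      then have "Suc b < N \<or> N = Suc (Suc d)" using b by linarith
      then show ?thesis
        unfolding row_sum[OF b'] using Suc b N3(2) by (elim disjE) (auto simp: N self adj v_def algebra_simps)
    qed
  qed
  then show ?thesis by blast
qed

text \<open>The branch node \<open>m - 2\<close> is the only one with three neighbours, hence fixed.
  For \<open>m \<ge> 5\<close> node 1 is the only leaf not attached to it.\<close>

lemma chain_D_ge_5:
  assumes X: "X = Type_D m" and m: "m \<ge> 5"
  shows "\<sigma> 1 = 1"
proof -
  have I: "II T = {1..m}" by (simp add: X)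
  have nb: "nbrs i = {j. 1 \<le> j \<and> j \<le> m \<and> j \<noteq> i \<and> adjacent (Type_D m) i j}" for i
    by (auto simp: nbrs_def X)
  have n: "nbrs 1 = {2}" "nbrs (m - 1) = {m - 2}" "nbrs m = {m - 2}" "nbrs (m - 2) = {m - 3, m - 1, m}"
    using m by (auto simp: nb doubleton_eq_iff)
  have n2: "nbrs i = {i - 1, Suc i}" if "1 < i" "i < m - 2" for i using that by (auto simp: nb doubleton_eq_iff)
  have c: "card (nbrs i) = (if i = m - 2 then 3 else if i = 1 \<or> i = m - 1 \<or> i = m then 1 else 2)" if "i \<in> II T" for i
  proof -
    have "i = 1 \<or> i = m - 1 \<or> i = m \<or> i = m - 2 \<or> 1 < i \<and> i < m - 2" using that by (auto simp: I)
    then consider "i = 1" | "i = m - 1" | "i = m" | "i = m - 2" | "1 < i" "i < m - 2" by blast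
    then show ?thesis
    proof cases
      case 4
      have "m - 3 \<noteq> m - 1" "m - 3 \<noteq> m" "m - 1 \<noteq> m" using m by linarith+
      then show ?thesis using n(4) 4 by simp
    next
      case 5
      then have "i - 1 \<noteq> Suc i" "i \<noteq> m - 1" "i \<noteq> m" "i \<noteq> 1" "i \<noteq> m - 2" by linarith+
      then show ?thesis using n2[OF 5] by simp
    qed (use n m in simp_all)
  qed
  have "card (nbrs (\<sigma> (m - 2))) = 3" using card_nbrs_aut[of "m - 2"] c[of "m - 2"] m by (simp add: I)
  then have t: "\<sigma> (m - 2) = m - 2" using c[of "\<sigma> (m - 2)"] aut_in[of "m - 2"] m by (simp add: I split: if_splits)
  have "card (nbrs (\<sigma> 1)) = 1" using card_nbrs_aut[of 1] c[of 1] m by (simp add: I)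
  moreover have "j = 1 \<or> j = m - 1 \<or> j = m" if "j \<in> II T" "card (nbrs j) = 1" for j
    using c[OF that(1)] that(2) by presburger
  moreover have "\<sigma> 1 \<in> II T" using aut_in[of 1] m by (simp add: I)
  ultimately have "\<sigma> 1 = 1 \<or> \<sigma> 1 = m - 1 \<or> \<sigma> 1 = m" by blast
  moreover have "\<sigma> 1 \<noteq> m - 1 \<and> \<sigma> 1 \<noteq> m"
  proof (rule ccontr)
    assume "\<not> ?thesis"
    then have "\<sigma> 2 = m - 2" using nbrs_aut_in[of 1 2] n m by (auto simp: I)
    then have "\<sigma> 2 = \<sigma> (m - 2)" using t by simp
    moreover have "(2::nat) \<noteq> m - 2" "2 \<in> II T" "m - 2 \<in> II T" unfolding I using m by auto
    ultimately show False using aut_inj by blast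
  qed
  ultimately show ?thesis by simp
qed

lemma less_4: "a < (4::nat) \<longleftrightarrow> a = 0 \<or> a = 1 \<or> a = 2 \<or> a = 3"
  and less_3: "a < (3::nat) \<longleftrightarrow> a = 0 \<or> a = 1 \<or> a = 2"
  and less_2: "a < (2::nat) \<longleftrightarrow> a = 0 \<or> a = 1"
  by auto

lemma nodes_D4: "X = Type_D 4 \<Longrightarrow> II T = {1, 2, 3, 4}" by auto

lemma aut_D4:
  assumes X: "X = Type_D 4"
  shows "\<sigma> 2 = 2" "M = 2 \<Longrightarrow> \<sigma> 1 \<noteq> 1 \<Longrightarrow> \<sigma> 1 = 3 \<and> \<sigma> 3 = 1 \<and> \<sigma> 4 = 4 \<or> \<sigma> 1 = 4 \<and> \<sigma> 4 = 1 \<and> \<sigma> 3 = 3"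
    "M = 3 \<Longrightarrow> \<sigma> 1 = 3 \<and> \<sigma> 3 = 4 \<and> \<sigma> 4 = 1 \<or> \<sigma> 1 = 4 \<and> \<sigma> 4 = 3 \<and> \<sigma> 3 = 1"
proof -
  note I = nodes_D4[OF X]
  have n: "nbrs 1 = {2}" "nbrs 2 = {1, 3, 4}" "nbrs 3 = {2}" "nbrs 4 = {2}"
    unfolding nbrs_def I by (auto simp: X doubleton_eq_iff)
  have "card (nbrs (\<sigma> 2)) = 3" using card_nbrs_aut[of 2] n by (simp add: I)
  moreover have "\<sigma> 2 \<in> {1, 2, 3, 4}" using aut_in[of 2] I by simp
  ultimately show 2: "\<sigma> 2 = 2" using n by auto
  have inj: "\<sigma> 1 \<noteq> \<sigma> 2" "\<sigma> 1 \<noteq> \<sigma> 3" "\<sigma> 1 \<noteq> \<sigma> 4" "\<sigma> 3 \<noteq> \<sigma> 2" "\<sigma> 4 \<noteq> \<sigma> 2" "\<sigma> 3 \<noteq> \<sigma> 4"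
    using aut_inj[of 1 2] aut_inj[of 1 3] aut_inj[of 1 4] aut_inj[of 3 2] aut_inj[of 4 2] aut_inj[of 3 4]
    unfolding I by simp_all
  have "\<sigma> 1 \<in> {1, 2, 3, 4}" "\<sigma> 3 \<in> {1, 2, 3, 4}" "\<sigma> 4 \<in> {1, 2, 3, 4}"
    using aut_in[of 1] aut_in[of 3] aut_in[of 4] unfolding I by simp_all
  then have cases: "\<sigma> 1 = 1 \<or> \<sigma> 1 = 3 \<or> \<sigma> 1 = 4" "\<sigma> 3 = 1 \<or> \<sigma> 3 = 3 \<or> \<sigma> 3 = 4" "\<sigma> 4 = 1 \<or> \<sigma> 4 = 3 \<or> \<sigma> 4 = 4"
    using inj 2 by auto
  have pow: "(\<sigma> ^^ M) 1 = 1" "(\<sigma> ^^ M) 3 = 3" "(\<sigma> ^^ M) 4 = 4" using aut_pow_M unfolding I by simp_all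
  have nt: "\<not> (\<sigma> 1 = 1 \<and> \<sigma> 3 = 3 \<and> \<sigma> 4 = 4)" using aut_nontrivial 2 unfolding I by auto
  show "\<sigma> 1 = 3 \<and> \<sigma> 3 = 1 \<and> \<sigma> 4 = 4 \<or> \<sigma> 1 = 4 \<and> \<sigma> 4 = 1 \<and> \<sigma> 3 = 3" if "M = 2" "\<sigma> 1 \<noteq> 1"
  proof -
    have "\<sigma> (\<sigma> 1) = 1" using pow that by (simp add: numeral_2_eq_2)
    then show ?thesis using cases inj that(2) by metis
  qed
  show "\<sigma> 1 = 3 \<and> \<sigma> 3 = 4 \<and> \<sigma> 4 = 1 \<or> \<sigma> 1 = 4 \<and> \<sigma> 4 = 3 \<and> \<sigma> 3 = 1" if "M = 3"
  proof -
    have "\<sigma> (\<sigma> (\<sigma> 1)) = 1" "\<sigma> (\<sigma> (\<sigma> 3)) = 3" "\<sigma> (\<sigma> (\<sigma> 4)) = 4"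
      using pow that by (simp_all add: numeral_3_eq_3)
    then show ?thesis using cases inj nt by metis
  qed
qed

lemma chain_D4_order_2:
  assumes X: "X = Type_D 4" and M: "M = 2" and 1: "\<sigma> 1 \<noteq> 1"
  shows "\<exists>L r path v. chain_datum T L r path v"
proof -
  note I = nodes_D4[OF X]
  define p where "p = \<sigma> 1"
  define p' where "p' = 7 - p"
  have p: "p = 3 \<and> p' = 4 \<or> p = 4 \<and> p' = 3" and s: "\<sigma> (Suc 0) = p" "\<sigma> p = Suc 0" "\<sigma> p' = p'" "\<sigma> 2 = 2"
    using aut_D4[OF X] M 1 by (auto simp: p_def p'_def)
  have car: "cartan X i j = (if i = j then 2 else if adjacent (Type_D 4) i j then - 1 else 0)" for i j
    by (simp add: cartan_def X)
  have sets: "{..<2::nat} = {0, 1}" "{1..2::nat} = {1, 2}" "{..<3::nat} = {0, 1, 2}" by auto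
  define L where "L = [1, 2, p']"
  have L: "L ! 0 = 1" "L ! 1 = 2" "L ! Suc 0 = 2" "L ! 2 = p'" "L ! Suc (Suc 0) = p'" "length L = 3" by (simp_all add: L_def numeral_2_eq_2)
  have rep: "rep T 1 = 1" "rep T 2 = 2" "rep T p = 1" "rep T p' = p'"
    using p s by (auto simp: rep_def M sets)
  have I': "II T = {1, 2, p', p}" using p I by auto
  have bf: "bform T i j = cartan X i (\<sigma> j) + cartan X i (\<sigma> (\<sigma> j))" for i j
    by (simp add: bform_def M sets numeral_2_eq_2)
  \<comment> \<open>The sum of the positive roots of \<open>D_4\<close> has coefficients 6 at the
    leaves and 10 at the branch node; the orbit of two leaves gets the double, 12.\<close>
  have "chain_datum T L 1 [2, 1] (\<lambda>a. if a = 0 then 12 else if a = 1 then 10 else 6)"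
  proof
    show "distinct L" using p by (auto simp: L_def)
    show "set L = rep T ` II T" using rep by (auto simp: L_def I')
    show "1 \<le> (1::nat)" "1 \<le> length L" by (simp_all add: L)
    show "\<sigma> (L ! a) = L ! a \<longleftrightarrow> 1 \<le> a" if "a < length L" for a
      using that p s by (auto simp: less_3 L)
    show "cartan X (L ! a) ((\<sigma> ^^ t) (L ! a)) = 0 \<or> M = 2 \<and> cartan X (L ! a) ((\<sigma> ^^ t) (L ! a)) = - 1"
      if "a < 1" "1 \<le> t" "t < M" for a t
    proof -
      have "t = 1" "a = 0" using that M by auto
      then show ?thesis using p by (auto simp: L s car doubleton_eq_iff)
    qed
    show "cartan X (L ! a) (L ! Suc a) = - 1" if "Suc a < length L" for a
    proof -
      have "a = 0 \<or> a = 1" using that L by auto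
      then show ?thesis using p by (auto simp: L car)
    qed
    show "cartan X (L ! a) ((\<sigma> ^^ t) (L ! Suc a)) = 0" if "Suc a < 1" "1 \<le> t" "t < M" for a t
      using that by simp
    show "cartan X (L ! a) ((\<sigma> ^^ t) (L ! b)) = 0"
      if "a < length L" "b < length L" "Suc a < b \<or> Suc b < a" "t < M" for a b t
    proof -
      have "a = 0 \<and> b = 2 \<or> a = 2 \<and> b = 0" "t = 0 \<or> t = 1" using that L(6) M by auto
      then show ?thesis using p s by (elim disjE conjE) (simp_all add: L car doubleton_eq_iff)
    qed
    have "D_chain 4 \<sigma> = [p', 2, 1]" using 1 by (simp add: D_chain_def p_def p'_def)
    then show "root_path T = (L ! 0, map ((!) L) [2, 1])" by (simp add: root_path_def X M L)
    show "set [2, 1] \<subseteq> {..<length L}" by (simp add: L)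
    have edge: "affine_edge T = (p', - 2, - 1)"
      using \<open>D_chain 4 \<sigma> = [p', 2, 1]\<close> by (simp add: affine_edge_def X M)
    fix b assume "b < length L"
    then have b: "b = 0 \<or> b = 1 \<or> b = 2" by (simp add: L less_3)
    show "bform T (L ! b) (L ! b) * affine_cartan T (Orbit (L ! b)) Eps =
      - 2 * (bform T (L ! b) (L ! 0) + (\<Sum>t\<leftarrow>[2, 1]. bform T (L ! b) (L ! t)))"
      using b p s by (elim disjE conjE) (simp_all add: L edge bf car doubleton_eq_iff)
    show "two_d T Eps * affine_cartan T Eps (Orbit (L ! b)) =
      - 2 * (bform T (L ! b) (L ! 0) + (\<Sum>t\<leftarrow>[2, 1]. bform T (L ! b) (L ! t)))"
      using b p s by (elim disjE conjE) (simp_all add: L edge bf cartan_def X doubleton_eq_iff)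
    show "(if b = 0 then 12 else if b = 1 then 10 else 6 :: int) > 0" by simp
    show "(\<Sum>a<length L. (if a = 0 then 12 else if a = 1 then 10 else 6) * bform T (L ! a) (L ! b)) > 0"
      using b p s by (elim disjE conjE) (simp_all add: L sets bf car doubleton_eq_iff)
  qed
  then show ?thesis by blast
qed

lemma chain_D4_order_3:
  assumes X: "X = Type_D 4" and M: "M = 3"
  shows "\<exists>L r path v. chain_datum T L r path v"
proof -
  note I = nodes_D4[OF X]
  define p where "p = \<sigma> 1"
  define p' where "p' = 7 - p"
  have p: "p = 3 \<and> p' = 4 \<or> p = 4 \<and> p' = 3" and s: "\<sigma> (Suc 0) = p" "\<sigma> p = p'" "\<sigma> p' = Suc 0" "\<sigma> 2 = 2"
    using aut_D4[OF X] M by (auto simp: p_def p'_def)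
  have car: "cartan X i j = (if i = j then 2 else if adjacent (Type_D 4) i j then - 1 else 0)" for i j
    by (simp add: cartan_def X)
  have sets: "{..<2::nat} = {0, 1}" "{1..3::nat} = {1, 2, 3}" "{..<3::nat} = {0, 1, 2}" by auto
  have rep: "rep T 1 = 1" "rep T 2 = 2" "rep T p = 1" "rep T p' = 1"
    using p s by (auto simp: rep_def M sets numeral_2_eq_2)
  have I': "II T = {1, 2, p', p}" using p I by auto
  have bf: "bform T i j = cartan X i (\<sigma> j) + cartan X i (\<sigma> (\<sigma> j)) + cartan X i (\<sigma> (\<sigma> (\<sigma> j)))" for i j
    by (simp add: bform_def M sets numeral_2_eq_2 numeral_3_eq_3)
  have L: "[1, 2] ! 0 = (1::nat)" "[1, 2] ! 1 = (2::nat)" "[1, 2] ! Suc 0 = (2::nat)" "length [1, 2::nat] = 2" by simp_all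
  \<comment> \<open>The leaves form a single orbit of three, so their coefficient 6 is
    tripled.\<close>
  have "chain_datum T [1, 2] 1 [0, 1] (\<lambda>a. if a = 0 then 18 else 10)"
  proof
    show "distinct [1, 2::nat]" by simp
    show "set [1, 2] = rep T ` II T" using rep by (auto simp: I')
    show "1 \<le> (1::nat)" "1 \<le> length [1, 2::nat]" by simp_all
    show "\<sigma> ([1, 2] ! a) = [1, 2] ! a \<longleftrightarrow> 1 \<le> a" if "a < length [1, 2::nat]" for a
      using that[unfolded L less_2] p s by auto
    show "cartan X ([1, 2] ! a) ((\<sigma> ^^ t) ([1, 2] ! a)) = 0 \<or> M = 2 \<and> cartan X ([1, 2] ! a) ((\<sigma> ^^ t) ([1, 2] ! a)) = - 1"
      if "a < 1" "1 \<le> t" "t < M" for a t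
    proof -
      have "t = 1 \<or> t = 2" "a = 0" using that M by auto
      then have "(\<sigma> ^^ t) 1 = p \<or> (\<sigma> ^^ t) 1 = p'" by (auto simp: s numeral_2_eq_2)
      then show ?thesis using p \<open>a = 0\<close> by (auto simp: car doubleton_eq_iff)
    qed
    show "cartan X ([1, 2] ! a) ([1, 2] ! Suc a) = - 1" if "Suc a < length [1, 2::nat]" for a
    proof -
      have "a = 0" using that by auto
      then show ?thesis using p by (auto simp: car)
    qed
    show "cartan X ([1, 2] ! a) ((\<sigma> ^^ t) ([1, 2] ! Suc a)) = 0" if "Suc a < 1" "1 \<le> t" "t < M" for a t
      using that by simp
    show "cartan X ([1, 2] ! a) ((\<sigma> ^^ t) ([1, 2] ! b)) = 0"
      if "a < length [1, 2::nat]" "b < length [1, 2::nat]" "Suc a < b \<or> Suc b < a" "t < M" for a b t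
      using that by auto
    show "root_path T = ([1, 2] ! 0, map ((!) [1, 2]) [0, 1])" by (simp add: root_path_def X M)
    show "set [0, 1] \<subseteq> {..<length [1, 2::nat]}" by simp
    have edge: "affine_edge T = (1, - 1, - 1)" by (simp add: affine_edge_def X M)
    fix b assume "b < length [1, 2::nat]"
    then have b: "b = 0 \<or> b = 1" unfolding L less_2 .
    show "bform T ([1, 2] ! b) ([1, 2] ! b) * affine_cartan T (Orbit ([1, 2] ! b)) Eps =
      - 2 * (bform T ([1, 2] ! b) ([1, 2] ! 0) + (\<Sum>t\<leftarrow>[0, 1]. bform T ([1, 2] ! b) ([1, 2] ! t)))"
      using b p s by (elim disjE conjE) (simp_all add: edge bf car doubleton_eq_iff)
    show "two_d T Eps * affine_cartan T Eps (Orbit ([1, 2] ! b)) =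
      - 2 * (bform T ([1, 2] ! b) ([1, 2] ! 0) + (\<Sum>t\<leftarrow>[0, 1]. bform T ([1, 2] ! b) ([1, 2] ! t)))"
      using b p s by (elim disjE conjE) (simp_all add: edge bf cartan_def X doubleton_eq_iff)
    show "(if b = 0 then 18 else 10 :: int) > 0" by simp
    show "(\<Sum>a<length [1, 2::nat]. (if a = 0 then 18 else 10) * bform T ([1, 2] ! a) ([1, 2] ! b)) > 0"
      using b p s unfolding L(4) sets by (elim disjE conjE) (simp_all add: bf car doubleton_eq_iff)
  qed
  then show ?thesis by blast
qed

lemma chain_D:
  assumes "X = Type_D m"
  shows "\<exists>L r path v. chain_datum T L r path v"
proof (cases "\<sigma> 1 = 1")
  case False
  then have "\<not> m \<ge> 5" using chain_D_ge_5[OF assms] by blast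
  moreover have "m \<ge> 4" using datum by (simp add: twisted_datum_def assms)
  ultimately have "X = Type_D 4" using assms by simp
  then show ?thesis using chain_D4_order_2 chain_D4_order_3 False M_cases by blast
qed (rule chain_D_fixed[OF assms])

text \<open>Node 4 is the only one with three neighbours and node 2 the only leaf next to it. Both
  are fixed, and a non-trivial \<sigma> has to exchange the two long arms.\<close>

lemma chain_E:
  assumes X: "X = Type_E6"
  shows "\<exists>L r path v. chain_datum T L r path v"
proof -
  have I: "II T = {1, 2, 3, 4, 5, 6}" by (auto simp: X)
  have n: "nbrs 1 = {3}" "nbrs 2 = {4}" "nbrs 3 = {1, 4}" "nbrs 4 = {2, 3, 5}" "nbrs 5 = {4, 6}" "nbrs 6 = {5}"
    unfolding nbrs_def I by (auto simp: X doubleton_eq_iff)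
  have in6: "\<sigma> i \<in> {1, 2, 3, 4, 5, 6}" if "i \<in> {1, 2, 3, 4, 5, 6}" for i using aut_in[of i] that unfolding I by simp
  have "card (nbrs (\<sigma> 4)) = 3" using card_nbrs_aut[of 4] n by (simp add: I)
  then have 4: "\<sigma> 4 = 4" using in6[of 4] n by auto
  have "card (nbrs (\<sigma> 2)) = 1" "\<sigma> 2 \<in> nbrs 4" using card_nbrs_aut[of 2] nbrs_aut_in[of 4 2] n 4 by (simp_all add: I)
  then have 2: "\<sigma> 2 = 2" using n by auto
  have s35: "\<sigma> 3 \<in> {3, 5}" "\<sigma> 5 \<in> {3, 5}"
    using nbrs_aut_in[of 4 3] nbrs_aut_in[of 4 5] aut_inj[of 2 3] aut_inj[of 2 5] n 4 2 by (auto simp: I)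
  have s1: "\<sigma> 1 \<in> nbrs (\<sigma> 3)" "\<sigma> 6 \<in> nbrs (\<sigma> 5)" "\<sigma> 1 \<noteq> 4" "\<sigma> 6 \<noteq> 4"
    using nbrs_aut_in[of 3 1] nbrs_aut_in[of 5 6] aut_inj[of 1 4] aut_inj[of 6 4] n 4 by (auto simp: I)
  have "\<sigma> 3 \<noteq> 3"
  proof
    assume 3: "\<sigma> 3 = 3"
    then have "\<sigma> 5 = 5" using s35 aut_inj[of 3 5] by (auto simp: I)
    then have "\<sigma> 1 = 1" "\<sigma> 6 = 6" using s1 3 n by auto
    then show False using aut_nontrivial 2 3 4 \<open>\<sigma> 5 = 5\<close> unfolding I by auto
  qed
  then have 3: "\<sigma> 3 = 5" using s35 by simp
  then have 5: "\<sigma> 5 = 3" using s35 aut_inj[of 3 5] by (auto simp: I)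
  have 1: "\<sigma> (Suc 0) = 6" and 6: "\<sigma> 6 = Suc 0" using s1 3 5 n by auto
  note s = 1 2 3 4 5 6
  have M: "M = 2"
  proof (rule ccontr)
    assume "M \<noteq> 2"
    then have "(\<sigma> ^^ 3) 1 = 1" using M_cases aut_pow_M[of 1] by (auto simp: I)
    then show False using s by (simp add: numeral_3_eq_3)
  qed
  have car: "cartan X i j = (if i = j then 2 else if adjacent Type_E6 i j then - 1 else 0)" for i j
    by (simp add: cartan_def X)
  have sets: "{..<2::nat} = {0, 1}" "{1..2::nat} = {1, 2}" "{..<4::nat} = {0, 1, 2, 3}" by auto
  define L where "L = [1, 3, 4, 2::nat]"
  have L: "L ! 0 = 1" "L ! 1 = 3" "L ! Suc 0 = 3" "L ! 2 = 4" "L ! Suc (Suc 0) = 4" "L ! 3 = 2" "L ! Suc (Suc (Suc 0)) = 2" "length L = 4"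
    by (simp_all add: L_def numeral_2_eq_2 numeral_3_eq_3)
  have rep: "rep T 1 = 1" "rep T 2 = 2" "rep T 3 = 3" "rep T 4 = 4" "rep T 5 = 3" "rep T 6 = 1"
    using s by (auto simp: rep_def M sets)
  have bf: "bform T i j = cartan X i (\<sigma> j) + cartan X i (\<sigma> (\<sigma> j))" for i j
    by (simp add: bform_def M sets numeral_2_eq_2)
  \<comment> \<open>The sum of the positive roots of \<open>E_6\<close> has coefficients 16, 30, 42,
    22 at the nodes 1, 3, 4, 2; the first two belong to orbits of size two and are doubled.\<close>
  define v where "v = (\<lambda>a::nat. if a = 0 then 32 else if a = 1 then 60 else if a = 2 then 42 else 22 :: int)"
  have "chain_datum T L 2 [0, 1, 2, 3, 1, 2, 1] v"
  proof
    show "distinct L" by (auto simp: L_def)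
    show "set L = rep T ` II T" using rep by (auto simp: L_def I)
    show "1 \<le> (2::nat)" "2 \<le> length L" by (simp_all add: L)
    show "\<sigma> (L ! a) = L ! a \<longleftrightarrow> 2 \<le> a" if "a < length L" for a
      using that[unfolded L less_4] s by (auto simp: L)
    show "cartan X (L ! a) ((\<sigma> ^^ t) (L ! a)) = 0 \<or> M = 2 \<and> cartan X (L ! a) ((\<sigma> ^^ t) (L ! a)) = - 1"
      if "a < 2" "1 \<le> t" "t < M" for a t
    proof -
      have t: "t = 1" and "a = 0 \<or> a = 1" using that M by auto
      then show ?thesis unfolding t by (elim disjE) (simp_all add: L s car doubleton_eq_iff)
    qed
    show "cartan X (L ! a) (L ! Suc a) = - 1" if "Suc a < length L" for a
    proof -
      have "a = 0 \<or> a = 1 \<or> a = 2" using that L by auto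
      then show ?thesis by (elim disjE) (simp_all add: L car doubleton_eq_iff)
    qed
    show "cartan X (L ! a) ((\<sigma> ^^ t) (L ! Suc a)) = 0" if "Suc a < 2" "1 \<le> t" "t < M" for a t
    proof -
      have "t = 1" "a = 0" using that M by auto
      then show ?thesis by (simp add: L s car doubleton_eq_iff)
    qed
    show "cartan X (L ! a) ((\<sigma> ^^ t) (L ! b)) = 0"
      if "a < length L" "b < length L" "Suc a < b \<or> Suc b < a" "t < M" for a b t
    proof -
      have "a = 0 \<or> a = 1 \<or> a = 2 \<or> a = 3" "b = 0 \<or> b = 1 \<or> b = 2 \<or> b = 3" "t = 0 \<or> t = 1"
        using that(1,2,4)[unfolded L M less_4 less_2] by simp_all
      then show ?thesis using that(3) by (elim disjE) (simp_all add: L s car doubleton_eq_iff)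
    qed
    show "root_path T = (L ! 0, map ((!) L) [0, 1, 2, 3, 1, 2, 1])" by (simp add: root_path_def X L)
    show "set [0, 1, 2, 3, 1, 2, 1] \<subseteq> {..<length L}" by (simp add: L)
    have edge: "affine_edge T = (1, - 1, - 1)" by (simp add: affine_edge_def X)
    fix b assume "b < length L"
    then have b: "b = 0 \<or> b = 1 \<or> b = 2 \<or> b = 3" unfolding L less_4 .
    show "bform T (L ! b) (L ! b) * affine_cartan T (Orbit (L ! b)) Eps =
      - 2 * (bform T (L ! b) (L ! 0) + (\<Sum>t\<leftarrow>[0, 1, 2, 3, 1, 2, 1]. bform T (L ! b) (L ! t)))"
      using b by (elim disjE) (simp_all add: L edge bf s car doubleton_eq_iff)
    show "two_d T Eps * affine_cartan T Eps (Orbit (L ! b)) =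
      - 2 * (bform T (L ! b) (L ! 0) + (\<Sum>t\<leftarrow>[0, 1, 2, 3, 1, 2, 1]. bform T (L ! b) (L ! t)))"
      using b by (elim disjE) (simp_all add: L edge bf s cartan_def X doubleton_eq_iff)
    show "v b > 0" by (simp add: v_def)
    show "(\<Sum>a<length L. v a * bform T (L ! a) (L ! b)) > 0"
      using b unfolding L(8) sets by (elim disjE) (simp_all add: L v_def bf s car doubleton_eq_iff)
  qed
  then show ?thesis by blast
qed

end

section \<open>Relations between the generators\<close>

unbundle fps_syntax

lemma mult_commute_with: "u * y = y * u \<Longrightarrow> v * y = y * v \<Longrightarrow> u * v * y = y * (u * v)"
  for y :: "'a::semigroup_mult"
  by (metis mult.assoc)

lemma fps_power_commute:
  fixes b :: "'u::complex_algebra_1 fps"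
  assumes "\<And>l. l \<le> m \<Longrightarrow> b $ l * y = y * b $ l" and "l \<le> m"
  shows "b ^ n $ l * y = y * b ^ n $ l"
  using assms(2)
proof (induct n arbitrary: l)
  case (Suc n)
  have "b $ i * b ^ n $ (l - i) * y = y * (b $ i * b ^ n $ (l - i))" if "i \<le> l" for i
    by (rule mult_commute_with) (use assms(1)[of i] Suc that in auto)
  then show ?case by (simp add: fps_mult_nth sum_distrib_left sum_distrib_right)
qed (cases l, simp_all)

lemma exp_coeff_commute:
  assumes "\<And>l. 1 \<le> l \<Longrightarrow> l \<le> m \<Longrightarrow> a l * y = y * a l"
  shows "exp_coeff a m * y = y * exp_coeff a m"
proof -
  have "Abs_fps (\<lambda>l. if l = 0 then 0 else a l) ^ n $ m * y = y * Abs_fps (\<lambda>l. if l = 0 then 0 else a l) ^ n $ m" for n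
    by (rule fps_power_commute[of m]) (use assms in auto)
  then show ?thesis by (simp add: exp_coeff_def sum_distrib_left sum_distrib_right scaleC_mult)
qed

lemma exp_coeff_0: "exp_coeff a 0 = 1"
  by (simp add: exp_coeff_def scaleC_one)

text \<open>The coefficient \<open>a m\<close> occurs in the linear term of the exponential only.
  Every other contribution to degree \<open>m\<close> is a product of coefficients of lower index,
  and these commute with \<open>y\<close>.\<close>

lemma exp_coeff_top:
  assumes "\<And>l. 1 \<le> l \<Longrightarrow> l < m \<Longrightarrow> a l * y = y * a l" and "1 \<le> m"
  shows "exp_coeff a m * y - y * exp_coeff a m = a m * y - y * a m"
proof -
  let ?b = "Abs_fps (\<lambda>l. if l = 0 then 0 else a l)"
  have comm: "?b ^ n $ m * y = y * ?b ^ n $ m" if "2 \<le> n" for n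
  proof -
    define k where "k = n - 2"
    have k: "n = Suc (Suc k)" using that by (simp add: k_def)
    have z: "?b ^ Suc k $ 0 = 0" by simp
    have "?b $ i * ?b ^ Suc k $ (m - i) * y = y * (?b $ i * ?b ^ Suc k $ (m - i))" if "i \<le> m" for i
    proof -
      have "i = 0 \<or> i = m \<or> 1 \<le> i \<and> i < m" using that by auto
      then consider "i = 0" | "i = m" | "1 \<le> i" "i < m" by blast
      then show ?thesis
      proof cases
        case 3
        have "?b ^ Suc k $ (m - i) * y = y * ?b ^ Suc k $ (m - i)"
          by (rule fps_power_commute[of "m - 1"]) (use assms 3 in auto)
        moreover have "?b $ i * y = y * ?b $ i" using assms(1)[OF 3] 3 by simp
        ultimately show ?thesis by (rule mult_commute_with[rotated])
      qed (use z in simp_all)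
    qed
    then have "(\<Sum>i=0..m. ?b $ i * ?b ^ Suc k $ (m - i)) * y = y * (\<Sum>i=0..m. ?b $ i * ?b ^ Suc k $ (m - i))"
      by (simp add: sum_distrib_left sum_distrib_right del: power_Suc)
    then show ?thesis unfolding k power_Suc[of ?b "Suc k"] fps_mult_nth .
  qed
  have split: "(\<Sum>n\<le>m. G n) = G 0 + G 1 + (\<Sum>n=2..m. G n)" for G :: "nat \<Rightarrow> 'a"
  proof -
    have "{..m} = insert 0 (insert 1 {2..m})" using assms(2) by auto
    then show ?thesis by (simp add: add.assoc)
  qed
  have "exp_coeff a m = a m + (\<Sum>n=2..m. (1 / fact n) *\<^sub>C (?b ^ n $ m))"
    unfolding exp_coeff_def split using assms(2) by (simp add: scaleC_one)
  moreover have "(\<Sum>n=2..m. (1 / fact n) *\<^sub>C (?b ^ n $ m)) * y = y * (\<Sum>n=2..m. (1 / fact n) *\<^sub>C (?b ^ n $ m))"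
    using comm by (simp add: sum_distrib_left sum_distrib_right scaleC_mult)
  ultimately show ?thesis by (simp add: algebra_simps)
qed

text \<open>The substitution of \<open>c\<close> u for u in the exponential series.\<close>

lemma exp_coeff_scale: "exp_coeff (\<lambda>l. c ^ l *\<^sub>C a l) m = c ^ m *\<^sub>C exp_coeff a m"
proof -
  let ?a = "Abs_fps (\<lambda>l. if l = 0 then 0 else a l)" and ?b = "Abs_fps (\<lambda>l. if l = 0 then 0 else c ^ l *\<^sub>C a l)"
  have "?b ^ n $ l = c ^ l *\<^sub>C (?a ^ n $ l)" for n l
  proof (induct n arbitrary: l)
    case 0 then show ?case by (cases l) (simp_all add: scaleC_one)
  next
    case (Suc n)
    have "?b $ i * ?b ^ n $ (l - i) = c ^ l *\<^sub>C (?a $ i * ?a ^ n $ (l - i))" if "i \<le> l" for i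
      using that by (simp add: Suc scaleC_mult scaleC_scaleC power_add[symmetric])
    then show ?case by (simp add: fps_mult_nth complex_vector.scale_sum_right)
  qed
  then show ?thesis
    by (simp add: exp_coeff_def complex_vector.scale_sum_right scaleC_scaleC mult.commute)
qed

lemma eval_free_superset:
  assumes "finite S" "Poly_Mapping.keys f \<subseteq> S"
  shows "eval_free g f = (\<Sum>w\<in>S. Poly_Mapping.lookup f w *\<^sub>C prod_list (map g (letters w)))"
  unfolding eval_free_def using assms by (intro sum.mono_neutral_left) (auto simp: in_keys_iff)

lemma eval_free_add: "eval_free g (f + f') = eval_free g f + eval_free g f'"
  using Poly_Mapping.keys_add[of f f']
  by (simp add: eval_free_superset[of "Poly_Mapping.keys f \<union> Poly_Mapping.keys f'"] lookup_add scaleC_add_left sum.distrib)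

lemma eval_free_single: "eval_free g (Poly_Mapping.single w c) = c *\<^sub>C prod_list (map g (letters w))"
  by (simp add: eval_free_superset[of "{w}"])

lemma eval_free_zero: "eval_free g 0 = 0" by (simp add: eval_free_def)

lemma eval_free_mult: "eval_free g (f * f') = eval_free g f * eval_free g f'"
proof (induct f rule: poly_mapping_additive_induct)
  case (single w c)
  show ?case
    by (induct f' rule: poly_mapping_additive_induct)
      (simp_all add: eval_free_zero eval_free_add eval_free_single mult_single distrib_left plus_word_def
        scaleC_mult scaleC_scaleC)
qed (simp_all add: eval_free_zero eval_free_add distrib_right)

lemma eval_free_diff: "eval_free g (f - f') = eval_free g f - eval_free g f'"
  using eval_free_add[of g "f - f'" f'] by simp

lemma eval_free_one: "eval_free g 1 = 1"
  unfolding single_one[symmetric] eval_free_single by (simp add: zero_word_def scaleC_one)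

lemma eval_free_letter: "eval_free g (letter y) = g y"
  by (simp add: letter_def eval_free_single scaleC_one)

lemma eval_free_scalar: "eval_free g (scalar c) = c *\<^sub>C 1"
  by (simp add: scalar_def eval_free_single zero_word_def)

lemma eval_free_power: "eval_free g (f ^ n) = eval_free g f ^ n"
  by (induct n) (simp_all add: eval_free_one eval_free_mult)

lemma eval_free_prod_list: "eval_free g (prod_list fs) = prod_list (map (eval_free g) fs)"
  by (induct fs) (simp_all add: eval_free_one eval_free_mult)

lemma eval_free_sum: "eval_free g (\<Sum>i\<in>S. F i) = (\<Sum>i\<in>S. eval_free g (F i))"
  by (induct S rule: infinite_finite_induct) (simp_all add: eval_free_zero eval_free_add)

lemmas eval_free_simps = eval_free_add eval_free_diff eval_free_mult eval_free_one eval_free_zero eval_free_letter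
  eval_free_scalar eval_free_power eval_free_prod_list eval_free_sum

lemma free_algebra_on_closed:
  "f \<in> free_algebra_on G \<Longrightarrow> f' \<in> free_algebra_on G \<Longrightarrow> f + f' \<in> free_algebra_on G"
  "f \<in> free_algebra_on G \<Longrightarrow> f' \<in> free_algebra_on G \<Longrightarrow> f - f' \<in> free_algebra_on G"
  "f \<in> free_algebra_on G \<Longrightarrow> f' \<in> free_algebra_on G \<Longrightarrow> f * f' \<in> free_algebra_on G"
  "0 \<in> free_algebra_on G" "1 \<in> free_algebra_on G" "scalar c \<in> free_algebra_on G"
  "y \<in> G \<Longrightarrow> letter y \<in> free_algebra_on G"
proof -
  show "f + f' \<in> free_algebra_on G" if "f \<in> free_algebra_on G" "f' \<in> free_algebra_on G" for f f'
    using that Poly_Mapping.keys_add[of f f'] unfolding free_algebra_on_def by blast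
  show "f - f' \<in> free_algebra_on G" if "f \<in> free_algebra_on G" "f' \<in> free_algebra_on G" for f f'
    using that Poly_Mapping.keys_diff[of f f'] unfolding free_algebra_on_def by blast
  show "f * f' \<in> free_algebra_on G" if "f \<in> free_algebra_on G" "f' \<in> free_algebra_on G" for f f'
    using that keys_mult[of f f'] unfolding free_algebra_on_def plus_word_def by fastforce
  show "0 \<in> free_algebra_on G" "scalar c \<in> free_algebra_on G" "y \<in> G \<Longrightarrow> letter y \<in> free_algebra_on G"
    by (auto simp: free_algebra_on_def scalar_def letter_def zero_word_def split: if_splits)
  then show "1 \<in> free_algebra_on G" by (auto simp: free_algebra_on_def zero_word_def)
qed

lemma free_algebra_on_power: "f \<in> free_algebra_on G \<Longrightarrow> f ^ n \<in> free_algebra_on G"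
  by (induct n) (simp_all add: free_algebra_on_closed)

lemma free_algebra_on_prod_list: "(\<And>f. f \<in> set fs \<Longrightarrow> f \<in> free_algebra_on G) \<Longrightarrow> prod_list fs \<in> free_algebra_on G"
  by (induct fs) (simp_all add: free_algebra_on_closed)

lemma free_algebra_on_sum: "(\<And>i. i \<in> S \<Longrightarrow> F i \<in> free_algebra_on G) \<Longrightarrow> (\<Sum>i\<in>S. F i) \<in> free_algebra_on G"
  by (induct S rule: infinite_finite_induct) (simp_all add: free_algebra_on_closed)

lemma presented_relation:
  assumes "presented_by G R g" "f \<in> R" "f \<in> free_algebra_on G"
  shows "eval_free g f = 0"
proof -
  have "0 + 1 * f * 1 \<in> relation_ideal G R"
    by (intro relation_ideal.intros free_algebra_on_closed assms(2))
  then show ?thesis using assms by (simp add: presented_by_def)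
qed

section \<open>Structure constants of the Drinfeld relations\<close>

context datum
begin

abbreviation "q \<equiv> qq T"

lemma q_powi_inj: "q powi m = q powi n \<longleftrightarrow> m = n"
proof
  have gen: False if "q powi m = q powi n" "m < n" for m n
  proof -
    have "q powi (n - m) = 1" using that(1) qq_nz by (simp add: power_int_diff)
    moreover have "q powi (n - m) = q ^ nat (n - m)" using that(2) by (simp add: power_int_def)
    ultimately show False using qq_root[of "nat (n - m)"] that(2) by simp
  qed
  assume "q powi m = q powi n"
  then show "m = n" using gen[of m n] gen[of n m] by (metis linorder_neqE)
qed simp

lemma q_powi_minus: "q powi n - q powi (- n) \<noteq> 0 \<longleftrightarrow> n \<noteq> 0"
  using q_powi_inj[of n "- n"] by auto

lemma qi_square: "(qi T (Orbit i))\<^sup>2 = q powi bform T i i"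
  by (simp add: qi_def qq_def power_int_power[symmetric] power_int_mult[symmetric] mult.commute
      power_int_power' flip: power_int_numeral)

definition DD :: "nat \<Rightarrow> complex" where
  "DD i = qi T (bar T i) - inverse (qi T (bar T i))"

text \<open>The structure constant of the commutator of \<open>h i n\<close> with the generators at
  \<open>j\<close>, freed of its sign and of the denominators \<open>n\<close> and
  \<open>DD i\<close>; see \<open>h_x\<close>. Whether it vanishes decides which series coefficients
  can serve as shifts.\<close>

definition omega_sum :: "nat \<Rightarrow> nat \<Rightarrow> int \<Rightarrow> complex" where
  "omega_sum i j n = (\<Sum>r=1..M. (q powi (n * cartan X i ((\<sigma> ^^ r) j)) - q powi (- (n * cartan X i ((\<sigma> ^^ r) j))))
      * omega T powi (n * int r))"

lemma omega_M: "omega T ^ M = 1"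
  using M_bounds by (simp add: omega_def DeMoivre)

lemma omega_nz: "omega T \<noteq> 0" by (simp add: omega_def)

lemma omega_nontrivial: "omega T \<noteq> 1"
proof
  assume "omega T = 1"
  then have "cos (2 * pi / real M) = 1" by (simp add: omega_def complex_eq_iff)
  then show False using M_cases by (auto simp: cos_120)
qed

lemma omega_powi_M: "omega T powi (int M * k) = 1"
  by (simp add: power_int_mult omega_M)

lemma omega_eq_1: "omega T powi n = 1 \<longleftrightarrow> int M dvd n"
proof -
  have M: "0 < int M" using M_bounds by simp
  have "omega T powi n = omega T powi (int M * (n div int M) + n mod int M)" by simp
  also have "\<dots> = omega T powi (n mod int M)"
    using omega_nz power_int_add[of "omega T" "int M * (n div int M)" "n mod int M"] by (simp add: omega_powi_M)
  finally have eq: "omega T powi n = omega T powi (n mod int M)" .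
  have "n mod int M = 0 \<or> n mod int M = 1 \<or> M = 3 \<and> n mod int M = 2"
    using M_cases M pos_mod_bound[OF M, of n] pos_mod_sign[OF M, of n] by auto
  moreover have "(omega T)\<^sup>2 \<noteq> 1" if "M = 3"
  proof
    assume "(omega T)\<^sup>2 = 1"
    moreover have "(omega T)\<^sup>2 * omega T = 1" using omega_M that by (simp add: numeral_3_eq_3 numeral_2_eq_2 mult.assoc)
    ultimately show False using omega_nontrivial by simp
  qed
  ultimately have "omega T powi (n mod int M) = 1 \<longleftrightarrow> n mod int M = 0"
    using omega_nontrivial by (auto simp: power_int_numeral)
  then show ?thesis unfolding eq dvd_eq_mod_eq_0 .
qed

lemma omega_powi_sum: "(\<Sum>r=1..M. omega T powi (int r * n)) = (if int M dvd n then of_nat M else 0)"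
proof -
  define \<zeta> where "\<zeta> = omega T powi n"
  have "omega T powi (int r * n) = \<zeta> ^ r" for r
    unfolding \<zeta>_def by (simp add: power_int_mult mult.commute[of "int r"])
  then have eq: "(\<Sum>r=1..M. omega T powi (int r * n)) = (\<Sum>r=1..M. \<zeta> ^ r)" by simp
  have "(\<Sum>r=1..M. \<zeta> ^ r) = (\<Sum>r<M. \<zeta> ^ Suc r)"
    by (rule sum.reindex_bij_witness[of _ Suc "\<lambda>r. r - 1"]) auto
  also have "\<dots> = \<zeta> * (\<Sum>r<M. \<zeta> ^ r)" by (simp add: sum_distrib_left)
  finally have s: "(\<Sum>r=1..M. \<zeta> ^ r) = \<zeta> * (\<Sum>r<M. \<zeta> ^ r)" .
  have "\<zeta> ^ M = omega T powi (n * int M)" by (simp add: \<zeta>_def power_int_mult)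
  then have "\<zeta> ^ M = 1" using omega_powi_M[of n] by (simp add: mult.commute)
  show ?thesis
  proof (cases "int M dvd n")
    case True
    then have "\<zeta> = 1" using omega_eq_1 by (simp add: \<zeta>_def)
    then show ?thesis unfolding eq using True by simp
  next
    case False
    then have "\<zeta> \<noteq> 1" using omega_eq_1 by (simp add: \<zeta>_def)
    moreover have "(\<zeta> - 1) * (\<Sum>r<M. \<zeta> ^ r) = 0" using \<open>\<zeta> ^ M = 1\<close> power_diff_1_eq[of \<zeta> M] by simp
    ultimately show ?thesis unfolding eq s using False by simp
  qed
qed

end


context chain_cartan
begin

lemma omega_sum_split: "j \<in> II T \<Longrightarrow> omega_sum i j n = q powi (n * cartan X i j) - q powi (- (n * cartan X i j)) +
  (\<Sum>s=1..<M. (q powi (n * cartan X i ((\<sigma> ^^ s) j)) - q powi (- (n * cartan X i ((\<sigma> ^^ s) j)))) * omega T powi (n * int s))"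
proof -
  assume j: "j \<in> II T"
  have "{1..M} = insert M {1..<M}" using M_bounds by auto
  moreover have "omega T powi (n * int M) = 1" using omega_powi_M[of n] by (simp add: mult.commute)
  ultimately show ?thesis by (simp add: omega_sum_def aut_pow_M[OF j])
qed

lemma omega_sum_fixed:
  assumes "b < N" "r \<le> b"
  shows "omega_sum i (L ! b) n =
    (q powi (n * cartan X i (L ! b)) - q powi (- (n * cartan X i (L ! b)))) * (if int M dvd n then of_nat M else 0)"
proof -
  have "omega_sum i (L ! b) n = (q powi (n * cartan X i (L ! b)) - q powi (- (n * cartan X i (L ! b)))) *
    (\<Sum>s=1..M. omega T powi (int s * n))"
    unfolding omega_sum_def sum_distrib_left fixed_pow[OF assms] by (simp add: mult.commute)
  then show ?thesis unfolding omega_powi_sum .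
qed

lemma omega_sum_adj_fixed_nz:
  assumes "Suc a < N" "r \<le> Suc a" "int M dvd n" "n \<noteq> 0"
  shows "omega_sum (L ! a) (L ! Suc a) n \<noteq> 0"
  using omega_sum_fixed[OF assms(1,2), of "L ! a" n] cartan_adj[OF assms(1)] q_powi_minus[of "- n"] assms M_bounds
  by simp

lemma omega_sum_adj_nz:
  assumes "Suc a < r" "n \<noteq> 0"
  shows "omega_sum (L ! a) (L ! Suc a) n \<noteq> 0"
proof -
  have a: "Suc a < N" using assms r_bounds by simp
  have "(\<Sum>s=1..<M. (q powi (n * cartan X (L ! a) ((\<sigma> ^^ s) (L ! Suc a))) -
    q powi (- (n * cartan X (L ! a) ((\<sigma> ^^ s) (L ! Suc a))))) * omega T powi (n * int s)) = 0"
    using cartan_adj'[OF assms(1)] by (intro sum.neutral) auto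
  then show ?thesis using omega_sum_split[OF L_in[OF a], of "L ! a" n] cartan_adj[OF a] q_powi_minus[of "- n"] assms(2)
    by simp
qed

text \<open>Unless \<sigma> maps the node to a neighbour, only the entry 2 of the Cartan matrix
  contributes. The exception is the middle pair in type A of even rank: there the sum is, up to
  sign, (q - q^-1)(q^2 + q + 1) / q, and q is no cube root of unity.\<close>

lemma omega_sum_self_nz:
  assumes "a < r" "n = 1 \<or> n = - 1"
  shows "omega_sum (L ! a) (L ! a) n \<noteq> 0"
proof -
  have a: "a < N" using assms r_bounds by simp
  note split = omega_sum_split[OF L_in[OF a], of "L ! a" n]
  show ?thesis
  proof (cases "M = 2 \<and> cartan X (L ! a) (\<sigma> (L ! a)) = - 1")
    case False
    have "cartan X (L ! a) ((\<sigma> ^^ s) (L ! a)) = 0" if "1 \<le> s" "s < M" for s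
    proof (cases "M = 2")
      case True
      then have "s = 1" using that by simp
      then show ?thesis using cartan_self[OF assms(1) that] False True by simp
    qed (use cartan_self[OF assms(1) that] in simp)
    then have "(\<Sum>s=1..<M. (q powi (n * cartan X (L ! a) ((\<sigma> ^^ s) (L ! a))) -
      q powi (- (n * cartan X (L ! a) ((\<sigma> ^^ s) (L ! a))))) * omega T powi (n * int s)) = 0"
      by (intro sum.neutral) auto
    then show ?thesis using split q_powi_minus[of "n * 2"] assms(2) by (auto simp: cartan_refl)
  next
    case True
    have "{1..<2} = {1::nat}" by auto
    then have s: "omega_sum (L ! a) (L ! a) n = q powi (2 * n) - q powi (- (2 * n)) +
      (q powi (- n) - q powi n) * omega T powi n"
      using True split by (simp add: cartan_refl mult.commute)
    have w: "omega T = - 1" using True by (simp add: omega_def)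
    have w1: "omega T powi n = - 1" using assms(2) by (auto simp: w)
    have "q ^ 3 \<noteq> 1" using qq_root[of 3] by simp
    then have "(q - 1) * (q\<^sup>2 + q + 1) \<noteq> 0" by (simp add: algebra_simps power2_eq_square power3_eq_cube)
    then have c: "q\<^sup>2 + q + 1 \<noteq> 0" by simp
    have 1: "q powi 2 - q powi (- 2) + (q - q powi (- 1)) = (q - q powi (- 1)) * ((q\<^sup>2 + q + 1) / q)"
      using qq_nz by (simp add: field_simps power2_eq_square power_int_minus)
    have 2: "q - q powi (- 1) \<noteq> 0" using q_powi_minus[of 1] by simp
    have 3: "q powi 2 - q powi (- 2) + (q - q powi (- 1)) \<noteq> 0" unfolding 1 using 2 c qq_nz by simp
    have "omega_sum (L ! a) (L ! a) n = q powi 2 - q powi (- 2) + (q - q powi (- 1)) \<or>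
      omega_sum (L ! a) (L ! a) n = - (q powi 2 - q powi (- 2) + (q - q powi (- 1)))"
      unfolding s w1 using assms(2) by (elim disjE) simp_all
    then show ?thesis using 3 by (metis neg_equal_0_iff_equal)
  qed
qed

lemma DD_nz: "a < N \<Longrightarrow> DD (L ! a) \<noteq> 0"
proof
  assume a: "a < N" and "DD (L ! a) = 0"
  then have "qi T (Orbit (L ! a)) = inverse (qi T (Orbit (L ! a)))" by (simp add: DD_def rep_L)
  moreover have "qi T (Orbit (L ! a)) \<noteq> 0" using qq_nz by (simp add: qi_def qq_def)
  ultimately have "(qi T (Orbit (L ! a)))\<^sup>2 = 1" by (metis power2_eq_square right_inverse)
  then have "q powi bform T (L ! a) (L ! a) = q powi 0" by (simp add: qi_square)
  then show False using bform_self_pos[OF a] unfolding q_powi_inj by simp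
qed

end


section \<open>The Chevalley relations in the algebra\<close>

locale loop_setting = chain_datum T L r path v
  for T :: twisted_datum and L :: "nat list" and r :: nat and path :: "nat list" and v :: "nat \<Rightarrow> int" +
  fixes mk :: "affine_node \<Rightarrow> nat" and g :: "chevalley \<Rightarrow> 'u::complex_algebra_1"
    and \<Delta> :: "'u \<Rightarrow> ('u, 'u) tensor" and x :: "pm \<Rightarrow> nat \<Rightarrow> int \<Rightarrow> 'u" and h :: "nat \<Rightarrow> int \<Rightarrow> 'u"
  assumes marks: "affine_marks T mk" and algebra: "quantum_loop_algebra T mk g"
    and coproduct: "coproduct T g \<Delta>" and drinfeld: "drinfeld_generators T g x h"
begin

lemma node_in: "a < N \<Longrightarrow> Orbit (L ! a) \<in> affine_nodes T" "Eps \<in> affine_nodes T"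
  using L_in rep_L by (force simp: affine_nodes_def)+

lemma affine_nodes_eq: "affine_nodes T = insert Eps (Orbit ` set L)"
  by (auto simp: affine_nodes_def set_L)

lemmas chevalley_relation =
  presented_relation[OF algebra[unfolded quantum_loop_algebra_def]]

lemma gens_free:
  "i \<in> affine_nodes T \<Longrightarrow> letter (Egen s i) \<in> free_algebra_on (chevalley_gens T)"
  "i \<in> affine_nodes T \<Longrightarrow> letter (Kgen i) \<in> free_algebra_on (chevalley_gens T)"
  "i \<in> affine_nodes T \<Longrightarrow> letter (Kgen_inv i) \<in> free_algebra_on (chevalley_gens T)"
  by (cases s; auto intro!: free_algebra_on_closed simp: chevalley_gens_def)+

lemmas gens_closed = gens_free free_algebra_on_closed(1-6) free_algebra_on_power free_algebra_on_prod_list free_algebra_on_sum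

lemma K_Kinv:
  assumes "i \<in> affine_nodes T"
  shows "g (Kgen i) * g (Kgen_inv i) = 1" "g (Kgen_inv i) * g (Kgen i) = 1"
proof -
  have "eval_free g (letter (Kgen i) * letter (Kgen_inv i) - 1) = 0"
    by (rule chevalley_relation, use assms in \<open>unfold chevalley_rels_def, blast\<close>) (intro gens_closed assms)
  then show "g (Kgen i) * g (Kgen_inv i) = 1" by (simp add: eval_free_simps)
  have "eval_free g (letter (Kgen_inv i) * letter (Kgen i) - 1) = 0"
    by (rule chevalley_relation, use assms in \<open>unfold chevalley_rels_def, blast\<close>) (intro gens_closed assms)
  then show "g (Kgen_inv i) * g (Kgen i) = 1" by (simp add: eval_free_simps)
qed

lemma K_K:
  assumes "i \<in> affine_nodes T" "j \<in> affine_nodes T"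
  shows "g (Kgen i) * g (Kgen j) = g (Kgen j) * g (Kgen i)"
proof -
  have "eval_free g (letter (Kgen i) * letter (Kgen j) - letter (Kgen j) * letter (Kgen i)) = 0"
    by (rule chevalley_relation, use assms in \<open>unfold chevalley_rels_def, blast\<close>) (intro gens_closed assms)
  then show ?thesis by (simp add: eval_free_simps)
qed

lemma K_E:
  assumes "i \<in> affine_nodes T" "j \<in> affine_nodes T"
  shows "g (Kgen i) * g (Egen s j) = qi T i powi (sgn_pm s * affine_cartan T i j) *\<^sub>C (g (Egen s j) * g (Kgen i))"
proof -
  have "eval_free g (letter (Kgen i) * letter (Egen s j)
        - scalar (qi T i powi (sgn_pm s * affine_cartan T i j)) * letter (Egen s j) * letter (Kgen i)) = 0"
    by (rule chevalley_relation, use assms in \<open>unfold chevalley_rels_def, blast\<close>) (intro gens_closed assms)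
  then show ?thesis by (simp add: eval_free_simps scaleC_mult)
qed

lemma E_F:
  assumes "i \<in> affine_nodes T" "j \<in> affine_nodes T"
  shows "g (Egen Plus i) * g (Egen Minus j) - g (Egen Minus j) * g (Egen Plus i) =
    (if i = j then (1 / (qi T i - inverse (qi T i))) *\<^sub>C (g (Kgen i) - g (Kgen_inv i)) else 0)"
proof -
  have m: "letter (Egen Plus i) * letter (Egen Minus j) - letter (Egen Minus j) * letter (Egen Plus i)
        - (if i = j then scalar (1 / (qi T i - inverse (qi T i))) * (letter (Kgen i) - letter (Kgen_inv i))
           else 0) \<in> chevalley_rels T mk"
    unfolding chevalley_rels_def
    by (rule UnI1, rule UnI1, rule UnI2, rule UN_I[OF assms(1)], rule UN_I[OF assms(2)], rule singletonI)
  have "eval_free g (letter (Egen Plus i) * letter (Egen Minus j) - letter (Egen Minus j) * letter (Egen Plus i)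
        - (if i = j then scalar (1 / (qi T i - inverse (qi T i))) * (letter (Kgen i) - letter (Kgen_inv i))
           else 0)) = 0"
    by (rule chevalley_relation[OF m]) (auto intro!: gens_closed assms)
  then show ?thesis by (cases "i = j") (simp_all add: eval_free_simps scaleC_mult)
qed

lemma E_E:
  assumes "i \<in> affine_nodes T" "j \<in> affine_nodes T" "i \<noteq> j" "affine_cartan T i j = 0" "qi T i \<noteq> inverse (qi T i)"
  shows "g (Egen s i) * g (Egen s j) = g (Egen s j) * g (Egen s i)"
proof -
  have m: "(let n = nat (1 - affine_cartan T i j) in
        \<Sum>r=0..n. scalar ((- 1) ^ r * q_binomial (qi T i) n r)
          * letter (Egen s i) ^ (n - r) * letter (Egen s j) * letter (Egen s i) ^ r) \<in> chevalley_rels T mk"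
    unfolding chevalley_rels_def
    by (rule UnI1, rule UnI2, rule UN_I[OF UNIV_I[of s]], rule UN_I[OF assms(1)], rule UN_I[of j])
      (use assms in simp_all)
  have "eval_free g (let n = nat (1 - affine_cartan T i j) in
        \<Sum>r=0..n. scalar ((- 1) ^ r * q_binomial (qi T i) n r)
          * letter (Egen s i) ^ (n - r) * letter (Egen s j) * letter (Egen s i) ^ r) = 0"
    by (rule chevalley_relation[OF m]) (unfold Let_def, intro gens_closed assms)
  moreover have "q_fact (qi T i) 0 = 1" "q_fact (qi T i) 1 = 1"
    using assms(5) by (simp_all add: q_fact_def q_int_def)
  ultimately show ?thesis using assms(4)
    by (simp add: eval_free_simps q_binomial_def scaleC_mult scaleC_one)
qed

lemma K_marks: "prod_list (map (\<lambda>i. g (Kgen i) ^ mk i) (affine_node_list T)) = 1"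
proof -
  have nl: "i \<in> affine_nodes T" if "i \<in> set (affine_node_list T)" for i
    using that finite_II by (auto simp: affine_node_list_def affine_nodes_def)
  have m: "prod_list (map (\<lambda>i. letter (Kgen i) ^ mk i) (affine_node_list T)) - 1 \<in> chevalley_rels T mk"
    unfolding chevalley_rels_def by (rule UnI2, rule singletonI)
  have "eval_free g (prod_list (map (\<lambda>i. letter (Kgen i) ^ mk i) (affine_node_list T)) - 1) = 0"
    by (rule chevalley_relation[OF m]) (use nl in \<open>auto intro!: gens_closed\<close>)
  then show ?thesis by (simp add: eval_free_simps o_def)
qed

end

section \<open>The Drinfeld relations at the representatives\<close>

context loop_setting
begin

lemma rels: "drinfeld_relations T g x h" and ident: "drinfeld_identification T g x"
  using drinfeld by (auto simp: drinfeld_generators_def)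

lemmas rels' = rels[unfolded drinfeld_relations_def]

lemma x_aut: "i \<in> II T \<Longrightarrow> x s (\<sigma> i) m = omega T powi m *\<^sub>C x s i m"
  by (rule rels'[THEN conjunct1, rule_format])

lemma h_aut: "i \<in> II T \<Longrightarrow> n \<noteq> 0 \<Longrightarrow> h (\<sigma> i) n = omega T powi n *\<^sub>C h i n"
  by (rule rels'[THEN conjunct2, THEN conjunct1, rule_format])

lemma h_h: "i \<in> II T \<Longrightarrow> j \<in> II T \<Longrightarrow> n \<noteq> 0 \<Longrightarrow> t \<noteq> 0 \<Longrightarrow> h i n * h j t = h j t * h i n"
  by (rule rels'[THEN conjunct2, THEN conjunct2, THEN conjunct1, rule_format])

lemma K_h: "i \<in> II T \<Longrightarrow> j \<in> II T \<Longrightarrow> n \<noteq> 0 \<Longrightarrow> g (Kgen (bar T i)) * h j n = h j n * g (Kgen (bar T i))"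
  by (rule rels'[THEN conjunct2, THEN conjunct2, THEN conjunct2, THEN conjunct1, rule_format])

lemma K_x: "i \<in> II T \<Longrightarrow> j \<in> II T \<Longrightarrow> g (Kgen (bar T i)) * x s j m =
    q powi (sgn_pm s * bform T i j) *\<^sub>C (x s j m * g (Kgen (bar T i)))"
  by (rule rels'[THEN conjunct2, THEN conjunct2, THEN conjunct2, THEN conjunct2, THEN conjunct1, rule_format])

lemma h_x:
  assumes "i \<in> II T" "j \<in> II T" "n \<noteq> 0"
  shows "h i n * x s j l - x s j l * h i n =
    (of_int (sgn_pm s) / of_int n * (omega_sum i j n / DD i)) *\<^sub>C x s j (n + l)"
proof -
  have "omega_sum i j n / DD i = (\<Sum>r=1..M. (q powi (n * cartan X i ((\<sigma> ^^ r) j)) - q powi (- (n * cartan X i ((\<sigma> ^^ r) j)))) /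
      (qi T (bar T i) - inverse (qi T (bar T i))) * omega T powi (n * int r))"
    by (simp add: omega_sum_def DD_def sum_divide_distrib)
  then show ?thesis
    using rels'[THEN conjunct2, THEN conjunct2, THEN conjunct2, THEN conjunct2, THEN conjunct2, THEN conjunct1, rule_format, OF assms, of s l] by simp
qed

lemma x_x: "i \<in> II T \<Longrightarrow> j \<in> II T \<Longrightarrow> x Plus i n * x Minus j l - x Minus j l * x Plus i n =
    ((\<Sum>r=1..M. if (\<sigma> ^^ r) i = j then omega T powi (int r * l) else 0)
          / (if \<sigma> i = i then of_nat M else 1) / DD i)
        *\<^sub>C (phi T g h Plus i (n + l) - phi T g h Minus i (n + l))"
  unfolding DD_def by (rule rels'[THEN conjunct2, THEN conjunct2, THEN conjunct2, THEN conjunct2, THEN conjunct2, THEN conjunct2, rule_format])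

lemma x_0: "a < N \<Longrightarrow> x s (L ! a) 0 = g (Egen s (Orbit (L ! a)))"
  using ident nth_mem[of a L] unfolding drinfeld_identification_def set_L by blast

lemma DD_aut: "i \<in> II T \<Longrightarrow> DD (\<sigma> i) = DD i"
  by (simp add: DD_def rep_aut)

text \<open>The series coefficients of \<phi> without the factor \<open>Kgen\<close> or
  \<open>Kgen_inv\<close>, for both signs at once; \<open>phi_Plus\<close> and
  \<open>phi_Minus\<close> put the factor back. In this form they have a lift whose empty word
  carries no group-like element.\<close>

definition psi :: "pm \<Rightarrow> nat \<Rightarrow> nat \<Rightarrow> 'u" where
  "psi s i = exp_coeff (\<lambda>l. (of_int (sgn_pm s) * DD i) *\<^sub>C h i (sgn_pm s * int l))"

lemma phi_Plus: "phi T g h Plus i m = (if m < 0 then 0 else g (Kgen (bar T i)) * psi Plus i (nat m))"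
  and phi_Minus: "phi T g h Minus i m = (if m > 0 then 0 else g (Kgen_inv (bar T i)) * psi Minus i (nat (- m)))"
  by (simp_all add: psi_def DD_def)

declare phi.simps [simp del]

lemma sgn_pm_cases: "sgn_pm s = 1 \<or> sgn_pm s = - 1" by (cases s) auto

lemma sgn_pm_nz: "l \<ge> 1 \<Longrightarrow> sgn_pm s * int l \<noteq> 0" "of_int (sgn_pm s) \<noteq> (0 :: complex)" "sgn_pm s \<noteq> 0"
  using sgn_pm_cases[of s] by auto

lemma psi_0: "psi s i 0 = 1" by (simp add: psi_def exp_coeff_0)

lemma psi_commute:
  assumes "\<And>l. 1 \<le> l \<Longrightarrow> l \<le> m \<Longrightarrow> h i (sgn_pm s * int l) * y = y * h i (sgn_pm s * int l)"
  shows "psi s i m * y = y * psi s i m"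
  unfolding psi_def by (rule exp_coeff_commute) (simp add: assms scaleC_mult)

lemma psi_psi: "i \<in> II T \<Longrightarrow> j \<in> II T \<Longrightarrow> psi s i m * psi s' j n = psi s' j n * psi s i m"
proof (rule psi_commute)
  fix l :: nat assume "i \<in> II T" "j \<in> II T" "1 \<le> l"
  then show "h i (sgn_pm s * int l) * psi s' j n = psi s' j n * h i (sgn_pm s * int l)"
    by (intro psi_commute[symmetric]) (auto intro!: h_h simp: sgn_pm_nz)
qed

lemma K_psi: "i \<in> II T \<Longrightarrow> j \<in> II T \<Longrightarrow> g (Kgen (bar T i)) * psi s j m = psi s j m * g (Kgen (bar T i))"
  by (intro psi_commute[symmetric]) (auto intro!: K_h[symmetric] simp: sgn_pm_nz)

lemma psi_aut:
  assumes "i \<in> II T"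
  shows "psi s (\<sigma> i) m = omega T powi (sgn_pm s * int m) *\<^sub>C psi s i m"
proof -
  define c where "c = omega T powi sgn_pm s"
  have c: "omega T powi (sgn_pm s * int l) = c ^ l" for l by (simp add: c_def power_int_mult)
  have "psi s (\<sigma> i) m = exp_coeff (\<lambda>l. c ^ l *\<^sub>C (of_int (sgn_pm s) * DD i) *\<^sub>C h i (sgn_pm s * int l)) m"
  proof -
    have "(\<lambda>l. if l = 0 then 0 else (of_int (sgn_pm s) * DD (\<sigma> i)) *\<^sub>C h (\<sigma> i) (sgn_pm s * int l)) =
      (\<lambda>l. if l = 0 then 0 else c ^ l *\<^sub>C (of_int (sgn_pm s) * DD i) *\<^sub>C h i (sgn_pm s * int l))"
      using assms by (auto simp: fun_eq_iff DD_aut h_aut sgn_pm_nz c scaleC_scaleC mult.commute)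
    then show ?thesis by (simp only: psi_def exp_coeff_def)
  qed
  then show ?thesis by (simp only: exp_coeff_scale psi_def c)
qed

lemma scaleC_fixed: "u = c *\<^sub>C u \<Longrightarrow> c \<noteq> 1 \<Longrightarrow> u = (0::'u)"
proof -
  assume a: "u = c *\<^sub>C u" "c \<noteq> 1"
  have "(1 - c) *\<^sub>C u = 0" using a(1) complex_vector.scale_left_diff_distrib[of 1 c u] by (simp add: scaleC_one)
  then show "u = 0" using a(2) by simp
qed

text \<open>For a fixed node the relation between the generators at \<open>i\<close> and at its
  image says that a generator of degree \<open>n\<close> equals \<open>omega T powi n\<close> times
  itself.\<close>

lemma fixed_vanish:
  assumes "i \<in> II T" "\<sigma> i = i" "\<not> int M dvd n"
  shows "x s i n = 0" "h i n = 0" "n = sgn_pm s * int m \<Longrightarrow> psi s i m = 0"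
proof -
  have w: "omega T powi n \<noteq> 1" using assms(3) omega_eq_1 by simp
  show "x s i n = 0" using scaleC_fixed[OF _ w] x_aut[OF assms(1), of s n] assms(2) by simp
  show "h i n = 0" using scaleC_fixed[OF _ w] h_aut[OF assms(1), of n] assms(2,3) by force
  show "psi s i m = 0" if "n = sgn_pm s * int m" using scaleC_fixed[OF _ w] psi_aut[OF assms(1), of s m] assms(2) that by simp
qed

text \<open>When the elements \<open>h i\<close> of lower degree commute with the generators at
  \<open>j\<close>, \<open>exp_coeff_top\<close> leaves only the linear term of the exponential, and
  its factor \<open>DD i\<close> cancels the denominator in \<open>h_x\<close>.\<close>

lemma psi_x:
  assumes "i \<in> II T" "j \<in> II T" "1 \<le> m" and lower: "\<And>n. 1 \<le> n \<Longrightarrow> n < m \<Longrightarrow> omega_sum i j (sgn_pm s * int n) = 0"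
    and D: "DD i \<noteq> 0"
  shows "psi s i m * x s' j l - x s' j l * psi s i m =
    (of_int (sgn_pm s') / of_nat m * omega_sum i j (sgn_pm s * int m)) *\<^sub>C x s' j (l + sgn_pm s * int m)"
proof -
  have "psi s i m * x s' j l - x s' j l * psi s i m =
     (of_int (sgn_pm s) * DD i) *\<^sub>C (h i (sgn_pm s * int m) * x s' j l - x s' j l * h i (sgn_pm s * int m))"
    unfolding psi_def
  proof (subst exp_coeff_top)
    fix n :: nat assume n: "1 \<le> n" "n < m"
    then have "h i (sgn_pm s * int n) * x s' j l - x s' j l * h i (sgn_pm s * int n) = 0"
      using h_x[OF assms(1,2), of "sgn_pm s * int n" s' l] lower[OF n] by (simp add: sgn_pm_nz)
    then show "(of_int (sgn_pm s) * DD i) *\<^sub>C h i (sgn_pm s * int n) * x s' j l = x s' j l * (of_int (sgn_pm s) * DD i) *\<^sub>C h i (sgn_pm s * int n)"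
      by (simp add: scaleC_mult)
  qed (use assms(3) in \<open>simp_all add: scaleC_mult scaleC_right_diff\<close>)
  also have "\<dots> = (of_int (sgn_pm s) * DD i * (of_int (sgn_pm s') / of_int (sgn_pm s * int m) * (omega_sum i j (sgn_pm s * int m) / DD i))) *\<^sub>C
      x s' j (sgn_pm s * int m + l)"
    by (simp only: h_x[OF assms(1,2) sgn_pm_nz(1)[OF assms(3)]] scaleC_scaleC)
  also have "of_int (sgn_pm s) * DD i * (of_int (sgn_pm s') / of_int (sgn_pm s * int m) * (omega_sum i j (sgn_pm s * int m) / DD i)) =
    of_int (sgn_pm s') / of_nat m * omega_sum i j (sgn_pm s * int m)"
    using D sgn_pm_nz(2)[of s] assms(3) by (simp add: field_simps)
  finally show ?thesis by (simp add: add.commute)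
qed

lemma psi_x_lower:
  assumes "i \<in> II T" "j \<in> II T" and "\<And>n. 1 \<le> n \<Longrightarrow> n \<le> m \<Longrightarrow> omega_sum i j (sgn_pm s * int n) = 0"
  shows "psi s i m * x s' j l = x s' j l * psi s i m"
proof (rule psi_commute)
  fix n :: nat assume n: "1 \<le> n" "n \<le> m"
  then have "h i (sgn_pm s * int n) * x s' j l - x s' j l * h i (sgn_pm s * int n) = 0"
    using h_x[OF assms(1,2), of "sgn_pm s * int n" s' l] assms(3)[OF n] by (simp add: sgn_pm_nz)
  then show "h i (sgn_pm s * int n) * x s' j l = x s' j l * h i (sgn_pm s * int n)" by simp
qed

lemma orbit_period:
  assumes "i \<in> II T" "\<sigma> i \<noteq> i" "1 \<le> n" "n < M"
  shows "(\<sigma> ^^ n) i \<noteq> i"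
proof
  assume a: "(\<sigma> ^^ n) i = i"
  have "n = 1 \<or> M = 3 \<and> n = 2" using assms M_cases by auto
  then show False
  proof
    assume "n = 1" then show False using a assms by simp
  next
    assume "M = 3 \<and> n = 2"
    then have "\<sigma> i = (\<sigma> ^^ M) i" using a by (simp add: numeral_3_eq_3 numeral_2_eq_2)
    then show False using assms aut_pow_M by simp
  qed
qed

lemma x_x_other:
  assumes "a < N" "b < N" "a \<noteq> b"
  shows "x Plus (L ! a) n * x Minus (L ! b) l = x Minus (L ! b) l * x Plus (L ! a) n"
proof -
  have "(\<sigma> ^^ t) (L ! a) \<noteq> L ! b" for t
    using rep_aut_pow[OF L_in[OF assms(1)], of t] rep_L[OF assms(1)] rep_L[OF assms(2)] assms distinct_L
    by (auto simp: nth_eq_iff_index_eq)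
  then show ?thesis using x_x[OF L_in[OF assms(1)] L_in[OF assms(2)], of n l] by simp
qed

text \<open>Generators at position \<open>a\<close> vanish in all degrees not divisible by it, see
  \<open>vanish\<close>.\<close>

definition period :: "nat \<Rightarrow> nat" where "period a = (if a < r then 1 else M)"

lemma period_pos: "1 \<le> period a" using M_bounds by (simp add: period_def)

lemma vanish:
  assumes "a < N" "\<not> int (period a) dvd n"
  shows "x s (L ! a) n = 0" "h (L ! a) n = 0" "n = sgn_pm s * int m \<Longrightarrow> psi s (L ! a) m = 0" "phi T g h s (L ! a) n = 0"
proof -
  have *: "\<sigma> (L ! a) = L ! a" "\<not> int M dvd n"
    using assms fixed_iff[OF assms(1)] by (auto simp: period_def split: if_splits)
  note fv = fixed_vanish[OF L_in[OF assms(1)] *]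
  show "x s (L ! a) n = 0" "h (L ! a) n = 0" "n = sgn_pm s * int m \<Longrightarrow> psi s (L ! a) m = 0" by (rule fv; assumption?)+
  show "phi T g h s (L ! a) n = 0"
    by (cases s) (use fv(3)[of Plus "nat n"] fv(3)[of Minus "nat (- n)"] in \<open>auto simp: phi_Plus phi_Minus\<close>)
qed

text \<open>In an orbit of size \<open>M\<close> only \<open>r = M\<close> returns to the node, with
  coefficient 1. At a fixed node the sum over the powers of \<omega> is \<open>M\<close> for
  \<open>l\<close> divisible by \<open>M\<close>, which the normalisation cancels. For other
  \<open>l\<close> both sides vanish, because \<open>n + l\<close> is not divisible by
  \<open>M\<close> either.\<close>

lemma x_x_same:
  assumes "a < N" "int (period a) dvd n"
  shows "x Plus (L ! a) n * x Minus (L ! a) l - x Minus (L ! a) l * x Plus (L ! a) n =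
    (1 / DD (L ! a)) *\<^sub>C (phi T g h Plus (L ! a) (n + l) - phi T g h Minus (L ! a) (n + l))"
proof (cases "a < r")
  case True
  then have nf: "\<sigma> (L ! a) \<noteq> L ! a" using fixed_iff[OF assms(1)] by simp
  have "(\<Sum>r=1..M. if (\<sigma> ^^ r) (L ! a) = L ! a then omega T powi (int r * l) else 0) =
    (\<Sum>r\<in>{M}. if (\<sigma> ^^ r) (L ! a) = L ! a then omega T powi (int r * l) else 0)"
    using orbit_period[OF L_in[OF assms(1)] nf] M_bounds by (intro sum.mono_neutral_right) auto
  also have "\<dots> = 1" using aut_pow_M[OF L_in[OF assms(1)]] by (simp add: omega_powi_M)
  finally show ?thesis using x_x[OF L_in[OF assms(1)] L_in[OF assms(1)], of n l] nf by simp
next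
  case False
  then have f: "r \<le> a" "period a = M" by (simp_all add: period_def)
  show ?thesis
  proof (cases "int M dvd l")
    case True
    have "(\<Sum>r=1..M. if (\<sigma> ^^ r) (L ! a) = L ! a then omega T powi (int r * l) else 0) = of_nat M"
      using omega_powi_sum[of l] True by (simp add: fixed_pow[OF assms(1) f(1)])
    then show ?thesis using x_x[OF L_in[OF assms(1)] L_in[OF assms(1)], of n l] fixed_iff[OF assms(1)] f M_bounds by simp
  next
    case F: False
    then have "\<not> int M dvd n + l" using assms(2) f by (simp add: dvd_add_right_iff)
    then show ?thesis using F vanish[OF assms(1)] f(2) by simp
  qed
qed


text \<open>The generators and structure constants, indexed by positions in \<open>L\<close>. They are padded by trivial values
  beyond \<open>N\<close>, since the indices in \<open>coproduct_data\<close> are unbounded.\<close>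

definition Bf :: "nat \<Rightarrow> nat \<Rightarrow> int" where "Bf a b = (if a < N \<and> b < N then bform T (L ! a) (L ! b) else 0)"
definition Df :: "nat \<Rightarrow> complex" where "Df a = (if a < N then DD (L ! a) else 1)"
definition ee :: "pm \<Rightarrow> nat \<Rightarrow> 'u" where "ee s a = (if a < N then g (Egen s (Orbit (L ! a))) else 0)"
definition kk :: "nat \<Rightarrow> 'u" where "kk a = (if a < N then g (Kgen (Orbit (L ! a))) else 1)"
definition kki :: "nat \<Rightarrow> 'u" where "kki a = (if a < N then g (Kgen_inv (Orbit (L ! a))) else 1)"
definition xx :: "pm \<Rightarrow> nat \<Rightarrow> int \<Rightarrow> 'u" where "xx s a m = (if a < N then x s (L ! a) m else 0)"
definition pp :: "pm \<Rightarrow> nat \<Rightarrow> nat \<Rightarrow> 'u" where "pp s a m = (if a < N then psi s (L ! a) m else if m = 0 then 1 else 0)"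

lemma xx_0: "xx s a 0 = ee s a" by (simp add: xx_def ee_def x_0)

lemma kk_kki: "kk a * kki a = 1" "kki a * kk a = 1"
  using K_Kinv node_in by (simp_all add: kk_def kki_def)

lemma kk_kk: "kk a * kk b = kk b * kk a"
  using K_K node_in by (simp add: kk_def)

lemma kk_xx: "kk a * xx s b m = q powi (sgn_pm s * Bf a b) *\<^sub>C (xx s b m * kk a)"
  using K_x[of "L ! a" "L ! b" s m] by (auto simp: kk_def xx_def Bf_def L_in rep_L scaleC_one)

lemma kk_ee: "kk a * ee s b = q powi (sgn_pm s * Bf a b) *\<^sub>C (ee s b * kk a)"
  using kk_xx[of a s b 0] by (simp add: xx_0)

lemma kk_pp: "kk a * pp s b m = pp s b m * kk a"
  using K_psi[of "L ! a" "L ! b"] by (auto simp: kk_def pp_def L_in rep_L)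

lemma pp_pp: "pp s a m * pp s' b n = pp s' b n * pp s a m"
  using psi_psi by (auto simp: pp_def L_in)

lemma pp_0: "pp s a 0 = 1" by (simp add: pp_def psi_0)

lemma Bf_sym: "Bf a b = Bf b a" by (simp add: Bf_def bform_sym L_in)

lemma Df_nz: "Df a \<noteq> 0" by (simp add: Df_def DD_nz)

lemma ee_ee: "ee Plus a * ee Minus b - ee Minus b * ee Plus a = (if a = b then (1 / Df a) *\<^sub>C (kk a - kki a) else 0)"
proof (cases "a < N \<and> b < N")
  case True
  then have "L ! a = L ! b \<longleftrightarrow> a = b" using distinct_L by (simp add: nth_eq_iff_index_eq)
  then show ?thesis using E_F[OF node_in(1) node_in(1), of a b] True
    by (simp add: ee_def kk_def kki_def Df_def DD_def rep_L)
qed (auto simp: ee_def kk_def kki_def)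

lemma ee_comm:
  assumes "nonadj a b"
  shows "ee s a * ee s b = ee s b * ee s a"
proof (cases "a < N \<and> b < N")
  case True
  have "L ! a \<noteq> L ! b" using True distinct_L assms by (auto simp: nth_eq_iff_index_eq nonadj_def)
  moreover have "bform T (L ! a) (L ! b) = 0" using bform_far True assms by (auto simp: nonadj_def)
  moreover have "qi T (Orbit (L ! a)) \<noteq> inverse (qi T (Orbit (L ! a)))"
    using DD_nz[of a] True by (simp add: DD_def rep_L)
  ultimately show ?thesis using E_E[OF node_in(1) node_in(1), of a b s] True by (simp add: ee_def)
qed (auto simp: ee_def)

lemma xx_other: "a \<noteq> b \<Longrightarrow> xx Plus a n * xx Minus b l = xx Minus b l * xx Plus a n"
  using x_x_other by (simp add: xx_def)

lemma xx_same:
  assumes "a < N" "int (period a) dvd n"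
  shows "xx Plus a n * xx Minus a l - xx Minus a l * xx Plus a n =
    (1 / Df a) *\<^sub>C (phi T g h Plus (L ! a) (n + l) - phi T g h Minus (L ! a) (n + l))"
  using x_x_same[OF assms] assms by (simp add: xx_def Df_def)

lemma phi_Plus_pp: "a < N \<Longrightarrow> phi T g h Plus (L ! a) m = (if m < 0 then 0 else kk a * pp Plus a (nat m))"
  and phi_Minus_pp: "a < N \<Longrightarrow> phi T g h Minus (L ! a) m = (if m > 0 then 0 else kki a * pp Minus a (nat (- m)))"
  by (simp_all add: phi_Plus phi_Minus kk_def kki_def pp_def rep_L)

definition shift_const :: "pm \<Rightarrow> nat \<Rightarrow> nat \<Rightarrow> nat \<Rightarrow> complex" where
  "shift_const s a b m = omega_sum (L ! a) (L ! b) (sgn_pm s * int m) / of_nat m"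

lemma pp_xx_1:
  assumes "a < N"
  shows "pp s a 1 * xx s' b l - xx s' b l * pp s a 1 = (of_int (sgn_pm s') * shift_const s a b 1) *\<^sub>C xx s' b (l + sgn_pm s)"
  using psi_x[OF L_in L_in, of a b 1 s s' l] assms DD_nz[OF assms] by (simp add: pp_def xx_def shift_const_def)

lemma pp_xx_M:
  assumes "a < N" "r \<le> b"
  shows "pp s a M * xx s' b l - xx s' b l * pp s a M = (of_int (sgn_pm s') * shift_const s a b M) *\<^sub>C xx s' b (l + sgn_pm s * int M)"
proof (cases "b < N")
  case True
  have "omega_sum (L ! a) (L ! b) (sgn_pm s * int n) = 0" if "1 \<le> n" "n < M" for n
  proof -
    have "\<not> M dvd n" using that by (simp add: nat_dvd_not_less)
    then have "\<not> int M dvd sgn_pm s * int n" using sgn_pm_cases[of s] by auto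
    then show ?thesis using omega_sum_fixed[OF True assms(2)] by simp
  qed
  then show ?thesis using psi_x[OF L_in L_in, of a b M s s' l] assms True DD_nz[OF assms(1)] M_bounds
    by (simp add: pp_def xx_def shift_const_def)
qed (simp add: xx_def)

lemma pp_xx_lower:
  assumes "r \<le> b" "n < M"
  shows "pp s a n * xx s' b l = xx s' b l * pp s a n"
proof (cases "a < N \<and> b < N")
  case True
  have "omega_sum (L ! a) (L ! b) (sgn_pm s * int m) = 0" if "1 \<le> m" "m \<le> n" for m
  proof -
    have "\<not> M dvd m" using that assms by (simp add: nat_dvd_not_less)
    then have "\<not> int M dvd sgn_pm s * int m" using sgn_pm_cases[of s] by auto
    then show ?thesis using omega_sum_fixed[of b] True assms(1) by simp
  qed
  then show ?thesis using psi_x_lower[OF L_in L_in, of a b n s] True by (simp add: pp_def xx_def)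
qed (auto simp: pp_def xx_def)

lemma pp_fixed: "r \<le> a \<Longrightarrow> 1 \<le> n \<Longrightarrow> n < M \<Longrightarrow> pp s a n = 0"
proof (cases "a < N")
  assume a: "r \<le> a" "1 \<le> n" "n < M"
  case True
  have "\<not> M dvd n" using a by (simp add: nat_dvd_not_less)
  then have "\<not> int (period a) dvd sgn_pm s * int n" using a sgn_pm_cases[of s] by (auto simp: period_def)
  then show ?thesis using vanish(3)[OF True] True by (simp add: pp_def)
qed (simp add: pp_def)

lemma shift_const_nz:
  "a < r \<Longrightarrow> shift_const s a a 1 \<noteq> 0" "Suc a < r \<Longrightarrow> shift_const s a (Suc a) 1 \<noteq> 0"
  "Suc a < N \<Longrightarrow> r \<le> Suc a \<Longrightarrow> shift_const s a (Suc a) M \<noteq> 0"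
  using omega_sum_self_nz[of a "sgn_pm s"] omega_sum_adj_nz[of a "sgn_pm s"]
    omega_sum_adj_fixed_nz[of a "sgn_pm s * int M"] sgn_pm_cases[of s] sgn_pm_nz(3)[of s] M_bounds
  by (auto simp: shift_const_def)

lemma Bf_adj_nz: "Suc a < N \<Longrightarrow> q powi Bf a (Suc a) * q powi Bf a (Suc a) \<noteq> 1"
proof
  assume a: "Suc a < N" and 1: "q powi Bf a (Suc a) * q powi Bf a (Suc a) = 1"
  have "q powi (Bf a (Suc a) + Bf a (Suc a)) = q powi 0"
    by (subst power_int_add) (simp_all only: qq_nz 1 power_int_0_right not_False_eq_True simp_thms)
  then have "Bf a (Suc a) = 0" unfolding q_powi_inj by simp
  then show False using a bform_adj[OF a] M_bounds by (simp add: Bf_def split: if_splits)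
qed

end

section \<open>The opposite algebra\<close>

lemma prod_list_power_step:
  fixes F :: "'b \<Rightarrow> 'a::monoid_mult"
  assumes "\<And>i j. i \<in> set xs \<Longrightarrow> j \<in> set xs \<Longrightarrow> F i * F j = F j * F i" and "distinct xs" "t \<in> set xs"
  shows "F t * prod_list (map (\<lambda>i. F i ^ c i) xs) = prod_list (map (\<lambda>i. F i ^ (c i + (if i = t then 1 else 0))) xs)"
  using assms
proof (induct xs)
  case (Cons y xs)
  show ?case
  proof (cases "y = t")
    case True
    then have eq: "map (\<lambda>i. F i ^ (c i + (if i = t then 1 else 0))) xs = map (\<lambda>i. F i ^ c i) xs"
      using Cons(3) by auto
    show ?thesis unfolding list.map prod_list.Cons eq using True by (simp add: mult.assoc)
  next
    case False
    have "F t * F y ^ c y = F y ^ c y * F t"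
      using Cons(2)[of t y] Cons(4) by (induct "c y") (simp_all, metis power_commuting_commutes)
    then have "F t * prod_list (map (\<lambda>i. F i ^ c i) (y # xs)) = F y ^ c y * (F t * prod_list (map (\<lambda>i. F i ^ c i) xs))"
      by (simp add: mult.assoc[symmetric])
    also have "\<dots> = F y ^ c y * prod_list (map (\<lambda>i. F i ^ (c i + (if i = t then 1 else 0))) xs)"
      using Cons False by simp
    finally show ?thesis using False by simp
  qed
qed simp

lemma prod_list_count:
  fixes F :: "'b \<Rightarrow> 'a::monoid_mult"
  assumes "\<And>i j. i \<in> set xs \<Longrightarrow> j \<in> set xs \<Longrightarrow> F i * F j = F j * F i" and "distinct xs" and "set ts \<subseteq> set xs"
  shows "prod_list (map F ts) = prod_list (map (\<lambda>i. F i ^ count_list ts i) xs)"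
  using assms(3)
proof (induct ts)
  case Nil show ?case by (induct xs) simp_all
next
  case (Cons t ts)
  have eq: "map (\<lambda>i. F i ^ count_list (t # ts) i) xs = map (\<lambda>i. F i ^ (count_list ts i + (if i = t then 1 else 0))) xs"
    by auto
  have "F t * prod_list (map (\<lambda>i. F i ^ count_list ts i) xs) = prod_list (map (\<lambda>i. F i ^ (count_list ts i + (if i = t then 1 else 0))) xs)"
    by (rule prod_list_power_step) (use assms(1,2) Cons in auto)
  then show ?case unfolding eq using Cons by simp
qed

lemma sum_list_count:
  fixes F :: "'b \<Rightarrow> int"
  assumes "finite S" "set ts \<subseteq> S"
  shows "(\<Sum>t\<leftarrow>ts. F t) = (\<Sum>i\<in>S. int (count_list ts i) * F i)"
  using assms(2)
proof (induct ts)
  case (Cons t ts)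
  have "(\<Sum>i\<in>S. int (count_list (t # ts) i) * F i) = (\<Sum>i\<in>S. (if i = t then F i else 0) + int (count_list ts i) * F i)"
    by (intro sum.cong) (auto simp: algebra_simps)
  then show ?case using Cons assms(1) by (simp add: sum.distrib)
qed simp

datatype 'a opposite = Op (unop: 'a)

instantiation opposite :: (complex_algebra_1) complex_algebra_1
begin

definition "0 = Op 0"
definition "1 = Op 1"
definition "u + v = Op (unop u + unop v)"
definition "u - v = Op (unop u - unop v)"
definition "- u = Op (- unop u)"
definition "u * v = Op (unop v * unop u)"
definition "c *\<^sub>C u = Op (c *\<^sub>C unop u)"

lemmas opposite_defs = zero_opposite_def one_opposite_def plus_opposite_def minus_opposite_def
  uminus_opposite_def times_opposite_def scaleC_opposite_def

instance
  by standard
    (simp_all add: opposite_defs algebra_simps scaleC_add_left scaleC_add_right scaleC_scaleC scaleC_one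
      mult_scaleC_left mult_scaleC_right)

end

lemma Op_simps:
  "Op u * Op v = Op (v * u)" "Op u + Op v = Op (u + v)" "Op u - Op v = Op (u - v)" "- Op u = Op (- u)"
  "c *\<^sub>C Op u = Op (c *\<^sub>C u)" "0 = Op 0" "1 = Op 1"
  by (simp_all add: opposite_defs)

lemma prod_list_Op: "prod_list (map (\<lambda>i. Op (F i)) xs) = Op (prod_list (map F (rev xs)))"
  by (induct xs) (simp_all add: Op_simps)

section \<open>The affine node and the two quantum group structures\<close>

context loop_setting
begin

lemma K_z: "kk a * g (Egen s Eps) = q powi (sgn_pm s * (- Bf a 0 - (\<Sum>t\<leftarrow>path. Bf a t))) *\<^sub>C (g (Egen s Eps) * kk a)"
proof (cases "a < N")
  case True
  have b: "(\<Sum>t\<leftarrow>path. Bf a t) = (\<Sum>t\<leftarrow>path. bform T (L ! a) (L ! t))" "Bf a 0 = bform T (L ! a) (L ! 0)"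
    using True path_in r_bounds by (auto simp: Bf_def intro!: arg_cong[of _ _ sum_list])
  \<comment> \<open>The exponent of q coming from \<open>qi\<close> may be half-integral at an
    intermediate stage, so the computation takes place in powers of \<open>sqrt_q\<close>;
    \<open>Eps_right\<close> then supplies an even exponent.\<close>
  have "qi T (Orbit (L ! a)) powi (sgn_pm s * affine_cartan T (Orbit (L ! a)) Eps) =
      sqrt_q T powi (sgn_pm s * (bform T (L ! a) (L ! a) * affine_cartan T (Orbit (L ! a)) Eps))"
    unfolding qi_def power_int_mult[symmetric] by (simp add: mult.assoc mult.left_commute)
  also have "\<dots> = sqrt_q T powi (2 * (sgn_pm s * (- Bf a 0 - (\<Sum>t\<leftarrow>path. Bf a t))))"
    unfolding Eps_right[OF True] b by (simp add: algebra_simps)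
  also have "\<dots> = q powi (sgn_pm s * (- Bf a 0 - (\<Sum>t\<leftarrow>path. Bf a t)))"
    unfolding power_int_mult by (simp add: qq_def)
  finally show ?thesis using K_E[OF node_in, of a s] True by (simp add: kk_def)
qed (simp add: kk_def Bf_def scaleC_one)

text \<open>The division in \<open>affine_cartan\<close> is exact: for a node that is not fixed the
  divisor is 1 or 2, and for a fixed node it is \<open>2 * M\<close> while every entry of its row is
  a multiple of \<open>M\<close>.\<close>

lemma double_bform_div: "a < N \<Longrightarrow> b < N \<Longrightarrow> bform T (L ! a) (L ! a) * (2 * bform T (L ! a) (L ! b) div bform T (L ! a) (L ! a)) =
   2 * bform T (L ! a) (L ! b)"
proof (rule dvd_mult_div_cancel)
  assume ab: "a < N" "b < N"
  show "bform T (L ! a) (L ! a) dvd 2 * bform T (L ! a) (L ! b)"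
  proof (cases "r \<le> a")
    case True
    have "bform T (L ! a) (L ! b) = int M * cartan X (L ! b) (L ! a)"
      using bform_fixed[OF ab(2,1) True] bform_sym[OF L_in L_in, OF ab] by simp
    then show ?thesis using True ab by (simp add: bform_self)
  next
    case False
    then show ?thesis using ab cartan_self[of a 1] M_bounds by (auto simp: bform_self)
  qed
qed

text \<open>By \<open>Eps_left\<close> the multiplicities in \<open>0 # path\<close> solve the same
  linear system as the marks, with the same value 1 at \<open>Eps\<close>. Nondegeneracy of
  \<open>bform\<close> makes the solution unique.\<close>

lemma mark_count:
  assumes "a < N"
  shows "mk (Orbit (L ! a)) = count_list (0 # path) a"
proof -
  define cn where "cn = count_list (0 # path)"
  define y where "y = (\<lambda>a. int (mk (Orbit (L ! a))) - int (cn a))"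
  have path': "set (0 # path) \<subseteq> {..<N}" using path_in r_bounds by auto
  have "(\<Sum>a<N. y a * bform T (L ! a) (L ! b)) = 0" if b: "b < N" for b
  proof -
    have "0 = (\<Sum>i\<in>affine_nodes T. int (mk i) * two_d T i * affine_cartan T i (Orbit (L ! b)))"
      using marks node_in(1)[OF b] by (simp add: affine_marks_def)
    also have "\<dots> = two_d T Eps * affine_cartan T Eps (Orbit (L ! b)) +
      (\<Sum>j\<in>set L. int (mk (Orbit j)) * two_d T (Orbit j) * affine_cartan T (Orbit j) (Orbit (L ! b)))"
      using marks unfolding affine_nodes_eq
      by (subst sum.insert) (auto simp: affine_marks_def sum.reindex inj_on_def)
    also have "(\<Sum>j\<in>set L. int (mk (Orbit j)) * two_d T (Orbit j) * affine_cartan T (Orbit j) (Orbit (L ! b))) =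
      (\<Sum>a<N. int (mk (Orbit (L ! a))) * (2 * bform T (L ! a) (L ! b)))"
    proof (rule sum.reindex_bij_betw[OF bij_betw_nth[OF distinct_L refl refl], symmetric, THEN trans])
      show "(\<Sum>a<N. int (mk (Orbit (L ! a))) * two_d T (Orbit (L ! a)) * affine_cartan T (Orbit (L ! a)) (Orbit (L ! b))) =
        (\<Sum>a<N. int (mk (Orbit (L ! a))) * (2 * bform T (L ! a) (L ! b)))"
        by (intro sum.cong) (simp_all add: mult.assoc double_bform_div b)
    qed
    also have "two_d T Eps * affine_cartan T Eps (Orbit (L ! b)) = - 2 * (\<Sum>t\<leftarrow>0 # path. bform T (L ! b) (L ! t))"
      using Eps_left[OF b] by simp
    also have "(\<Sum>t\<leftarrow>0 # path. bform T (L ! b) (L ! t)) = (\<Sum>a<N. int (cn a) * bform T (L ! b) (L ! a))"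
      unfolding cn_def by (rule sum_list_count[OF _ path']) simp
    also have "\<dots> = (\<Sum>a<N. int (cn a) * bform T (L ! a) (L ! b))"
      by (intro sum.cong) (use b in \<open>auto simp: bform_sym L_in\<close>)
    finally have "0 = - 2 * (\<Sum>a<N. int (cn a) * bform T (L ! a) (L ! b)) +
      (\<Sum>a<N. int (mk (Orbit (L ! a))) * (2 * bform T (L ! a) (L ! b)))" .
    moreover have "(\<Sum>a<N. int (mk (Orbit (L ! a))) * (2 * bform T (L ! a) (L ! b))) =
        2 * (\<Sum>a<N. int (mk (Orbit (L ! a))) * bform T (L ! a) (L ! b))"
      by (simp add: sum_distrib_left mult.left_commute)
    moreover have "(\<Sum>a<N. y a * bform T (L ! a) (L ! b)) =
        (\<Sum>a<N. int (mk (Orbit (L ! a))) * bform T (L ! a) (L ! b)) - (\<Sum>a<N. int (cn a) * bform T (L ! a) (L ! b))"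
      by (simp add: y_def left_diff_distrib sum_subtractf)
    ultimately show ?thesis by linarith
  qed
  then have "y a = 0" using bform_nondegenerate assms by blast
  then show ?thesis by (simp add: y_def cn_def)
qed

lemma prod_kk:
  assumes "\<And>a. count_list ts a = count_list (0 # path) a"
  shows "g (Kgen Eps) * prod_list (map kk ts) = 1"
proof -
  have path': "set (0 # path) \<subseteq> {..<N}" using path_in r_bounds by auto
  have "set ts = set (0 # path)" using assms count_list_0_iff by (metis set_eqI)
  then have ts: "set ts \<subseteq> {..<N}" using path' by simp
  define F where "F = (\<lambda>i. g (Kgen (Orbit i)))"
  define nl where "nl = sorted_list_of_set (rep T ` II T)"
  have nl: "set nl = set L" "distinct nl" using finite_II by (simp_all add: nl_def set_L)
  have Fc: "F i * F j = F j * F i" if "i \<in> set nl" "j \<in> set nl" for i j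
    unfolding F_def by (rule K_K) (use that nl in \<open>auto simp: affine_nodes_eq\<close>)
  have inj: "inj_on ((!) L) {..<N}" using distinct_L by (simp add: inj_on_nth)
  have cnt: "count_list (map ((!) L) ts) (L ! a) = count_list ts a" if "a < N" for a
    using that ts
  proof (induct ts)
    case (Cons t ts)
    have "L ! t = L ! a \<longleftrightarrow> t = a" using inj Cons(2,3) by (auto simp: inj_on_def)
    then show ?case using Cons by auto
  qed simp
  have "map kk ts = map F (map ((!) L) ts)" using ts by (auto simp: kk_def F_def)
  then have "prod_list (map kk ts) = prod_list (map F (map ((!) L) ts))" by (simp only:)
  also have "\<dots> = prod_list (map (\<lambda>i. F i ^ count_list (map ((!) L) ts) i) nl)"
    by (rule prod_list_count[OF Fc nl(2)]) (use ts nl in auto)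
  also have "map (\<lambda>i. F i ^ count_list (map ((!) L) ts) i) nl = map (\<lambda>i. F i ^ mk (Orbit i)) nl"
  proof (rule map_cong)
    fix i assume "i \<in> set nl"
    then obtain a where "a < N" "i = L ! a" using nl by (auto simp: in_set_conv_nth)
    then show "F i ^ count_list (map ((!) L) ts) i = F i ^ mk (Orbit i)"
      using cnt assms mark_count by simp
  qed simp
  finally have "prod_list (map kk ts) = prod_list (map (\<lambda>i. F i ^ mk (Orbit i)) nl)" .
  moreover have "g (Kgen Eps) * prod_list (map (\<lambda>i. F i ^ mk (Orbit i)) nl) = 1"
    using K_marks marks by (simp add: affine_node_list_def affine_marks_def nl_def F_def o_def)
  ultimately show ?thesis by simp
qed


sublocale pl: coproduct_data N Bf q Df "ee Plus" "ee Minus" kk kki "(\<otimes>)" \<Delta>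
proof
  show "q \<noteq> 0" by (rule qq_nz)
  show "Bf a b = Bf b a" for a b by (rule Bf_sym)
  show "Bf a b = 0" if "b \<ge> N" for a b using that by (simp add: Bf_def)
  show "algebra_hom \<Delta>" using coproduct by (simp add: coproduct_def)
  show "kk a * ee Plus b = q powi Bf a b *\<^sub>C (ee Plus b * kk a)" for a b using kk_ee[of a Plus b] by simp
  show "kk a * ee Minus b = q powi (- Bf a b) *\<^sub>C (ee Minus b * kk a)" for a b using kk_ee[of a Minus b] by simp
  have \<Delta>: "\<Delta> 1 = 1" "\<Delta> 0 = 0" using algebra_homD[of \<Delta>] coproduct by (auto simp: coproduct_def)
  have C: "\<Delta> (g (Kgen (Orbit (L ! a)))) = g (Kgen (Orbit (L ! a))) \<otimes> g (Kgen (Orbit (L ! a)))"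
      "\<Delta> (g (Egen Plus (Orbit (L ! a)))) = g (Egen Plus (Orbit (L ! a))) \<otimes> 1 + g (Kgen (Orbit (L ! a))) \<otimes> g (Egen Plus (Orbit (L ! a)))"
      "\<Delta> (g (Egen Minus (Orbit (L ! a)))) = g (Egen Minus (Orbit (L ! a))) \<otimes> g (Kgen_inv (Orbit (L ! a))) + 1 \<otimes> g (Egen Minus (Orbit (L ! a)))"
    if "a < N" for a using coproduct node_in(1)[OF that] by (auto simp: coproduct_def)
  have z: "(0::'u) \<otimes> (b::'u) = 0" "(b::'u) \<otimes> (0::'u) = 0" for b
    using tens_scale_left[of 0 0 b] tens_scale_right[of b 0 0] by simp_all
  show "\<Delta> (ee Plus a) = ee Plus a \<otimes> 1 + kk a \<otimes> ee Plus a" for a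
    using C(2)[of a] by (auto simp: ee_def kk_def \<Delta> z)
  show "\<Delta> (ee Minus a) = ee Minus a \<otimes> kki a + 1 \<otimes> ee Minus a" for a
    using C(3)[of a] by (auto simp: ee_def kki_def \<Delta> z)
  show "\<Delta> (kk a) = kk a \<otimes> kk a" for a
    using C(1)[of a] by (auto simp: kk_def \<Delta> tens_one)
qed (rule tens_add_left tens_add_right tens_scale_left tens_scale_right tens_mult tens_one kk_kki kk_kk Df_nz ee_ee)+

lemma K_Eps: "g (Kgen Eps) = kki 0 * prod_list (map kki path)"
proof -
  have "g (Kgen Eps) = g (Kgen Eps) * prod_list (map kk (rev (0 # path))) * prod_list (map kki (0 # path))"
    by (simp only: mult.assoc pl.prod_k_kinv mult_1_right)
  also have "g (Kgen Eps) * prod_list (map kk (rev (0 # path))) = 1"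
    by (rule prod_kk) (simp add: count_list_rev)
  finally show ?thesis by simp
qed

lemma K_inv_Eps: "g (Kgen_inv Eps) = prod_list (map kk (rev path)) * kk 0"
proof -
  have "g (Kgen_inv Eps) = g (Kgen_inv Eps) * (g (Kgen Eps) * prod_list (map kk (rev (0 # path))))"
    using prod_kk[of "rev (0 # path)"] by (simp add: count_list_rev)
  then show ?thesis by (simp add: mult.assoc[symmetric] K_Kinv node_in)
qed

lemma kki_xx: "kki a * xx s b m = q powi (- (sgn_pm s * Bf a b)) *\<^sub>C (xx s b m * kki a)"
  by (rule pl.kinv_comm[OF kk_xx])

lemma xx_kki: "xx s b m * kki a = q powi (sgn_pm s * Bf a b) *\<^sub>C (kki a * xx s b m)"
  by (simp add: kki_xx scaleC_scaleC pl.q_minus scaleC_one)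

text \<open>Exchanging \<open>e\<close> with \<open>f\<close>, \<open>k\<close> with \<open>k\<^sup>-\<^sup>1\<close>, \<open>q\<close> with \<open>q\<^sup>-\<^sup>1\<close> and the tensor factors, the opposite algebra is
  again of the same kind. This reduces negative loop degrees to positive ones.\<close>

definition \<Delta>op :: "'u opposite \<Rightarrow> ('u, 'u) tensor opposite" where "\<Delta>op u = Op (\<Delta> (unop u))"
definition tpop :: "'u opposite \<Rightarrow> 'u opposite \<Rightarrow> ('u, 'u) tensor opposite" where "tpop u w = Op (unop w \<otimes> unop u)"

lemma tpop_Op: "tpop (Op u) (Op w) = Op (w \<otimes> u)" by (simp add: tpop_def)

text \<open>The sign of \<open>Df a\<close> changes because the exchange of \<open>kk\<close> with
  \<open>kki\<close> reverses the right-hand side of the commutator of \<open>e\<close> and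
  \<open>f\<close>, on top of the reversal caused by the opposite product and the exchange of the
  two generators.\<close>

sublocale mi: coproduct_data N Bf "inverse q" "\<lambda>a. - Df a" "\<lambda>a. Op (ee Minus a)" "\<lambda>a. Op (ee Plus a)"
  "\<lambda>a. Op (kki a)" "\<lambda>a. Op (kk a)" tpop \<Delta>op
proof
  show "inverse q \<noteq> 0" using qq_nz by simp
  show "Bf a b = Bf b a" for a b by (rule Bf_sym)
  show "Bf a b = 0" if "b \<ge> N" for a b using that by (simp add: Bf_def)
  show "algebra_hom \<Delta>op"
    unfolding algebra_hom_def by (simp add: \<Delta>op_def opposite_defs pl.\<Delta>)
  show "tpop (u + u') w = tpop u w + tpop u' w" "tpop u (w + w') = tpop u w + tpop u w'"
    "tpop (c *\<^sub>C u) w = c *\<^sub>C tpop u w" "tpop u (c *\<^sub>C w) = c *\<^sub>C tpop u w"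
    "tpop u w * tpop u' w' = tpop (u * u') (w * w')" "tpop 1 1 = 1" for u u' w w' c
    by (simp_all add: tpop_def opposite_defs tens_add_left tens_add_right tens_scale_left tens_scale_right tens_mult tens_one)
  show "Op (kki a) * Op (kk a) = 1" "Op (kk a) * Op (kki a) = 1" for a by (simp_all add: Op_simps kk_kki)
  show "Op (kki a) * Op (kki b) = Op (kki b) * Op (kki a)" for a b by (simp add: Op_simps pl.kinv_kinv)
  show "Op (kki a) * Op (ee Minus b) = inverse q powi Bf a b *\<^sub>C (Op (ee Minus b) * Op (kki a))" for a b
    using xx_kki[of Minus b 0 a] by (simp add: Op_simps xx_0 power_int_minus power_int_inverse)
  show "Op (kki a) * Op (ee Plus b) = inverse q powi (- Bf a b) *\<^sub>C (Op (ee Plus b) * Op (kki a))" for a b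
    using xx_kki[of Plus b 0 a] by (simp add: Op_simps xx_0 power_int_minus power_int_inverse)
  show "- Df a \<noteq> 0" for a using Df_nz by simp
  show "Op (ee Minus a) * Op (ee Plus b) - Op (ee Plus b) * Op (ee Minus a) =
    (if a = b then (1 / - Df a) *\<^sub>C (Op (kki a) - Op (kk a)) else 0)" for a b
    using ee_ee[of b a] by (auto simp: Op_simps scaleC_right_diff)
  show "\<Delta>op (Op (ee Minus a)) = tpop (Op (ee Minus a)) 1 + tpop (Op (kki a)) (Op (ee Minus a))" for a
    by (simp add: \<Delta>op_def tpop_def opposite_defs pl.\<Delta>_f add.commute)
  show "\<Delta>op (Op (ee Plus a)) = tpop (Op (ee Plus a)) (Op (kk a)) + tpop 1 (Op (ee Plus a))" for a
    by (simp add: \<Delta>op_def tpop_def opposite_defs pl.\<Delta>_e add.commute)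
  show "\<Delta>op (Op (kki a)) = tpop (Op (kki a)) (Op (kki a))" for a
    by (simp add: \<Delta>op_def tpop_def pl.\<Delta>_kinv)
qed

end

context loop_setting
begin

lemma mi_weight: "Op u \<in> mi.weight_space \<beta> \<longleftrightarrow> u \<in> pl.weight_space (\<lambda>b. - \<beta> b)"
proof -
  have "u * kki a = inverse q powi pl.wt a \<beta> *\<^sub>C (kki a * u) \<longleftrightarrow> kk a * u = q powi (- pl.wt a \<beta>) *\<^sub>C (u * kk a)" for a
  proof
    assume "u * kki a = inverse q powi pl.wt a \<beta> *\<^sub>C (kki a * u)"
    then have "kk a * (u * kki a) * kk a = inverse q powi pl.wt a \<beta> *\<^sub>C (kk a * (kki a * u) * kk a)"
      by (simp add: scaleC_mult)
    then show "kk a * u = q powi (- pl.wt a \<beta>) *\<^sub>C (u * kk a)"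
      by (simp add: mult.assoc kk_kki power_int_minus power_int_inverse) (simp add: mult.assoc[symmetric] kk_kki)
  next
    assume "kk a * u = q powi (- pl.wt a \<beta>) *\<^sub>C (u * kk a)"
    then have "kki a * u = q powi pl.wt a \<beta> *\<^sub>C (u * kki a)" using pl.kinv_comm[of a u "- pl.wt a \<beta>"] by simp
    then show "u * kki a = inverse q powi pl.wt a \<beta> *\<^sub>C (kki a * u)"
      by (simp add: scaleC_scaleC power_int_inverse scaleC_one qq_nz)
  qed
  then show ?thesis unfolding mi.weight_space_def pl.weight_space_def
    by (simp add: Op_simps pl.wt_minus)
qed

lemma xx_weight: "xx s a m \<in> pl.weight_space (\<lambda>b. sgn_pm s * simple_root a b)"
proof -
  have "pl.wt c (\<lambda>b. sgn_pm s * simple_root a b) = sgn_pm s * Bf c a" for c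
    using pl.wt_simple_root[of c a] sgn_pm_cases[of s] by (auto simp: pl.wt_minus)
  then show ?thesis by (simp add: pl.weight_space_def kk_xx)
qed

lemma pp_weight: "pp s a m \<in> pl.weight_space (\<lambda>_. 0)"
  by (simp add: pl.weight_space_def pl.wt_zero kk_pp scaleC_one)

lemma z_weight: "g (Egen s Eps) \<in> pl.weight_space (\<lambda>b. sgn_pm s * (- simple_root 0 b - (\<Sum>t\<leftarrow>path. simple_root t b)))"
proof -
  have "pl.wt c (\<lambda>b. sgn_pm s * (- simple_root 0 b - (\<Sum>t\<leftarrow>path. simple_root t b))) =
    sgn_pm s * (- Bf c 0 - (\<Sum>t\<leftarrow>path. Bf c t))" for c
    using sgn_pm_cases[of s] by (auto simp: pl.wt_minus pl.wt_diff pl.wt_add pl.wt_sum_list pl.wt_simple_root)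
  then show ?thesis by (simp add: pl.weight_space_def K_z)
qed

lemma fold_bracket_plus: "set ts \<subseteq> {..<N} \<Longrightarrow> fold (bracket_plus g) (map ((!) L) ts) u = fold pl.bracket ts u"
proof (induct ts arbitrary: u)
  case (Cons t ts)
  then have "bracket_plus g (L ! t) u = pl.bracket t u"
    by (simp add: bracket_plus_def pl.bracket_def ee_def kk_def kki_def)
  then show ?case using Cons by simp
qed simp

lemma fold_bracket_minus: "set ts \<subseteq> {..<N} \<Longrightarrow> Op (fold (bracket_minus g) (map ((!) L) ts) u) = fold mi.bracket ts (Op u)"
proof (induct ts arbitrary: u)
  case (Cons t ts)
  then have "Op (bracket_minus g (L ! t) u) = mi.bracket t (Op u)"
    unfolding bracket_minus_def mi.bracket_def by (simp add: ee_def kk_def kki_def Op_simps mult.assoc)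
  then show ?case using Cons by simp
qed simp

lemma z_ee: "g (Egen Plus Eps) * ee Minus a = ee Minus a * g (Egen Plus Eps)"
  "g (Egen Minus Eps) * ee Plus a = ee Plus a * g (Egen Minus Eps)"
  using E_F[OF node_in(2) node_in(1), of a] E_F[OF node_in(1,2), of a] by (auto simp: ee_def)

lemma root_vectors:
  "\<exists>c. xx Minus 0 1 = c *\<^sub>C (fold pl.bracket path (g (Egen Plus Eps)) * kk 0)"
  "\<exists>c. Op (xx Plus 0 (- 1)) = c *\<^sub>C (fold mi.bracket path (Op (g (Egen Minus Eps))) * Op (kki 0))"
proof -
  have 0: "0 < N" using r_bounds by linarith
  obtain c c' where c: "x Minus (L ! 0) 1 = c *\<^sub>C (fold (bracket_plus g) (map ((!) L) path) (g (Egen Plus Eps)) * g (Kgen (Orbit (L ! 0))))"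
      "x Plus (L ! 0) (- 1) = c' *\<^sub>C (g (Kgen_inv (Orbit (L ! 0))) * fold (bracket_minus g) (map ((!) L) path) (g (Egen Minus Eps)))"
    using ident unfolding drinfeld_identification_def root_path by auto
  show "\<exists>c. xx Minus 0 1 = c *\<^sub>C (fold pl.bracket path (g (Egen Plus Eps)) * kk 0)"
    using c(1) 0 path_in by (auto simp: xx_def kk_def fold_bracket_plus)
  have "Op (xx Plus 0 (- 1)) = c' *\<^sub>C (Op (fold (bracket_minus g) (map ((!) L) path) (g (Egen Minus Eps))) * Op (kki 0))"
    using c(2) 0 by (simp add: xx_def kki_def Op_simps)
  then show "\<exists>c. Op (xx Plus 0 (- 1)) = c *\<^sub>C (fold mi.bracket path (Op (g (Egen Minus Eps))) * Op (kki 0))"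
    using fold_bracket_minus[OF path_in] by auto
qed

lemma E_coproduct:
  "\<Delta> (g (Egen Plus Eps)) = g (Egen Plus Eps) \<otimes> 1 + g (Kgen Eps) \<otimes> g (Egen Plus Eps)"
  "\<Delta> (g (Egen Minus Eps)) = g (Egen Minus Eps) \<otimes> g (Kgen_inv Eps) + 1 \<otimes> g (Egen Minus Eps)"
  using coproduct node_in(2) by (auto simp: coproduct_def)

lemma r_less: "a < r \<Longrightarrow> a < N" using r_bounds by simp

lemma e_xm: 
  assumes "a < N" "int (period a) dvd n" "n + l > 0"
  shows "xx Plus a n * xx Minus a l - xx Minus a l * xx Plus a n = (1 / Df a) *\<^sub>C (kk a * pp Plus a (nat (n + l)))"
  using xx_same[OF assms(1,2), of l] assms by (simp add: phi_Plus_pp phi_Minus_pp)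

lemma e_xm':
  assumes "a < N" "int (period a) dvd n" "n + l < 0"
  shows "xx Plus a n * xx Minus a l - xx Minus a l * xx Plus a n = (1 / - Df a) *\<^sub>C (kki a * pp Minus a (nat (- (n + l))))"
  using xx_same[OF assms(1,2), of l] assms by (simp add: phi_Plus_pp phi_Minus_pp)

lemma kki_pp: "kki a * pp s b m = pp s b m * kki a"
  using pl.kinv_comm[of a "pp s b m" 0] by (simp add: kk_pp scaleC_one)

sublocale plus: loop_chain N Bf q Df "ee Plus" "ee Minus" kk kki "(\<otimes>)" \<Delta> r M "g (Egen Plus Eps)" "g (Kgen Eps)"
  path "\<lambda>a m. xx Plus a (int m)" "\<lambda>a m. xx Minus a (int m)" "pp Plus"
  "\<lambda>a. shift_const Plus a a 1" "\<lambda>a. shift_const Plus a (Suc a) 1" "\<lambda>a. shift_const Plus a (Suc a) M"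
proof
  show "ee Plus b = 0" if "N \<le> b" for b using that by (simp add: ee_def)
  show "Bf a b = 0" if "nonadj a b" for a b using that bform_far by (auto simp: Bf_def nonadj_def)
  show "q powi Bf a (Suc a) * q powi Bf a (Suc a) \<noteq> 1" if "Suc a < N" for a by (rule Bf_adj_nz[OF that])
  show "ee Plus a * ee Plus b = ee Plus b * ee Plus a" if "nonadj a b" for a b by (rule ee_comm[OF that])
  show "0 < r" "r \<le> N" "1 < M" using r_bounds M_bounds by auto
  show "g (Egen Plus Eps) \<in> pl.weight_space (\<lambda>b. - simple_root 0 b - (\<Sum>t\<leftarrow>path. simple_root t b))"
    using z_weight[of Plus] by simp
  show "\<exists>c. xx Minus 0 (int 1) = c *\<^sub>C (fold pl.bracket path (g (Egen Plus Eps)) * kk 0)"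
    using root_vectors(1) by simp
  show "xx Plus a (int 0) = ee Plus a" for a by (simp add: xx_0)
  show "xx Plus a (int m) \<in> pl.weight_space (simple_root a)" for a m using xx_weight[of Plus a "int m"] by simp
  show "xx Minus a (int m) \<in> pl.weight_space (\<lambda>b. - simple_root a b)" for a m using xx_weight[of Minus a "int m"] by simp
  show "xx Plus a (int m) * ee Minus b = ee Minus b * xx Plus a (int m)" if "a \<noteq> b" for a b m
    using xx_other[OF that, of "int m" 0] by (simp add: xx_0)
  show "xx Plus a (int m) * xx Minus a (int 1) - xx Minus a (int 1) * xx Plus a (int m) = (1 / Df a) *\<^sub>C (kk a * pp Plus a (Suc m))"
    if "a < r" for a m using e_xm[of a "int m" 1] that r_less[OF that] by (simp add: period_def nat_add_distrib)
  show "ee Plus a * xx Minus a (int M) - xx Minus a (int M) * ee Plus a = (1 / Df a) *\<^sub>C (kk a * pp Plus a M)"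
    if "r \<le> a" "a < N" for a using e_xm[of a 0 "int M"] that M_bounds by (simp add: xx_0)
  show "pp Plus a 1 * xx Plus a (int m) - xx Plus a (int m) * pp Plus a 1 = shift_const Plus a a 1 *\<^sub>C xx Plus a (int (Suc m))"
    if "a < r" for a m using pp_xx_1[OF r_less[OF that], of Plus Plus a "int m"] by (simp add: add.commute)
  show "pp Plus a 1 * ee Minus a - ee Minus a * pp Plus a 1 = - shift_const Plus a a 1 *\<^sub>C xx Minus a (int 1)"
    if "a < r" for a using pp_xx_1[OF r_less[OF that], of Plus Minus a 0] by (simp add: xx_0)
  show "pp Plus a 1 * ee Minus (Suc a) - ee Minus (Suc a) * pp Plus a 1 = - shift_const Plus a (Suc a) 1 *\<^sub>C xx Minus (Suc a) (int 1)"
    if "Suc a < r" for a using pp_xx_1[of a Plus Minus "Suc a" 0] r_less[OF that] by (simp add: xx_0)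
  show "pp Plus (r - 1) n * ee Minus b = ee Minus b * pp Plus (r - 1) n" if "r \<le> b" "1 \<le> n" "n < M" for b n
    using pp_xx_lower[OF that(1,3), of Plus "r - 1" Minus 0] by (simp add: xx_0)
  show "pp Plus a M * ee Minus (Suc a) - ee Minus (Suc a) * pp Plus a M = - shift_const Plus a (Suc a) M *\<^sub>C xx Minus (Suc a) (int M)"
    if "r \<le> Suc a" "Suc a < N" for a using pp_xx_M[of a "Suc a" Plus Minus 0] that by (simp add: xx_0)
  show "shift_const Plus a a 1 \<noteq> 0" if "a < r" for a by (rule shift_const_nz(1)[OF that])
  show "shift_const Plus a (Suc a) 1 \<noteq> 0" if "Suc a < r" for a by (rule shift_const_nz(2)[OF that])
  show "shift_const Plus a (Suc a) M \<noteq> 0" if "r \<le> Suc a" "Suc a < N" for a by (rule shift_const_nz(3)[OF that(2,1)])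
qed (auto simp only: z_ee E_coproduct K_Eps pp_weight pp_0 intro: pp_pp pp_fixed)

text \<open>Here x^- in degree - m plays the part of x^+ in degree m, and conversely; the starting
  point of the chain is the formula for x^+ in degree -1. Minus signs from the opposite product are
  absorbed by applying \<open>uminus\<close> to the relations.\<close>

sublocale minus: loop_chain N Bf "inverse q" "\<lambda>a. - Df a" "\<lambda>a. Op (ee Minus a)" "\<lambda>a. Op (ee Plus a)"
  "\<lambda>a. Op (kki a)" "\<lambda>a. Op (kk a)" tpop \<Delta>op r M "Op (g (Egen Minus Eps))" "Op (g (Kgen_inv Eps))"
  path "\<lambda>a m. Op (xx Minus a (- int m))" "\<lambda>a m. Op (xx Plus a (- int m))" "\<lambda>a m. Op (pp Minus a m)"
  "\<lambda>a. shift_const Minus a a 1" "\<lambda>a. shift_const Minus a (Suc a) 1" "\<lambda>a. shift_const Minus a (Suc a) M"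
proof
  show "Op (ee Minus b) = 0" if "N \<le> b" for b using that by (simp add: ee_def Op_simps)
  show "Bf a b = 0" if "nonadj a b" for a b using that bform_far by (auto simp: Bf_def nonadj_def)
  show "inverse q powi Bf a (Suc a) * inverse q powi Bf a (Suc a) \<noteq> 1" if "Suc a < N" for a
    using Bf_adj_nz[OF that] by (metis inverse_1 inverse_inverse_eq inverse_mult_distrib power_int_inverse)
  show "Op (ee Minus a) * Op (ee Minus b) = Op (ee Minus b) * Op (ee Minus a)" if "nonadj a b" for a b
    using ee_comm[OF that] by (simp add: Op_simps)
  show "0 < r" "r \<le> N" "1 < M" using r_bounds M_bounds by auto
  show "Op (g (Egen Minus Eps)) \<in> mi.weight_space (\<lambda>b. - simple_root 0 b - (\<Sum>t\<leftarrow>path. simple_root t b))"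
    unfolding mi_weight using z_weight[of Minus] by simp
  show "Op (g (Egen Minus Eps)) * Op (ee Plus a) = Op (ee Plus a) * Op (g (Egen Minus Eps))" for a
    by (simp add: Op_simps z_ee)
  show "\<Delta>op (Op (g (Egen Minus Eps))) = tpop (Op (g (Egen Minus Eps))) 1 + tpop (Op (g (Kgen_inv Eps))) (Op (g (Egen Minus Eps)))"
    by (simp add: \<Delta>op_def tpop_def opposite_defs E_coproduct add.commute)
  show "Op (g (Kgen_inv Eps)) = Op (kk 0) * prod_list (map (\<lambda>a. Op (kk a)) path)"
    by (simp add: prod_list_Op Op_simps K_inv_Eps)
  show "\<exists>c. Op (xx Plus 0 (- int 1)) = c *\<^sub>C (fold mi.bracket path (Op (g (Egen Minus Eps))) * Op (kki 0))"
    using root_vectors(2) by simp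
  show "Op (xx Minus a (- int 0)) = Op (ee Minus a)" for a by (simp add: xx_0)
  show "Op (xx Minus a (- int m)) \<in> mi.weight_space (simple_root a)" for a m
    unfolding mi_weight using xx_weight[of Minus a "- int m"] by simp
  show "Op (xx Plus a (- int m)) \<in> mi.weight_space (\<lambda>b. - simple_root a b)" for a m
    unfolding mi_weight using xx_weight[of Plus a "- int m"] by simp
  show "Op (pp Minus a m) \<in> mi.weight_space (\<lambda>_. 0)" for a m unfolding mi_weight using pp_weight by simp
  show "Op (pp Minus a 0) = 1" for a by (simp add: pp_0 Op_simps)
  show "Op (pp Minus a m) * Op (pp Minus a n) = Op (pp Minus a n) * Op (pp Minus a m)" for a m n
    by (simp add: Op_simps pp_pp[of Minus a n])
  show "Op (xx Minus a (- int m)) * Op (ee Plus b) = Op (ee Plus b) * Op (xx Minus a (- int m))" if "a \<noteq> b" for a b m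
    using xx_other[OF that[symmetric], of 0 "- int m"] by (simp add: xx_0 Op_simps)
  show "Op (xx Minus a (- int m)) * Op (xx Plus a (- int 1)) - Op (xx Plus a (- int 1)) * Op (xx Minus a (- int m)) =
    (1 / - Df a) *\<^sub>C (Op (kki a) * Op (pp Minus a (Suc m)))"
    if "a < r" for a m using e_xm'[of a "- 1" "- int m"] that r_less[OF that]
    by (simp add: period_def Op_simps kki_pp nat_add_distrib)
  show "Op (ee Minus a) * Op (xx Plus a (- int M)) - Op (xx Plus a (- int M)) * Op (ee Minus a) =
    (1 / - Df a) *\<^sub>C (Op (kki a) * Op (pp Minus a M))"
    if "r \<le> a" "a < N" for a using e_xm'[of a "- int M" 0] that M_bounds by (simp add: period_def xx_0 Op_simps kki_pp)
  show "Op (pp Minus a 1) * Op (xx Minus a (- int m)) - Op (xx Minus a (- int m)) * Op (pp Minus a 1) =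
    shift_const Minus a a 1 *\<^sub>C Op (xx Minus a (- int (Suc m)))"
    if "a < r" for a m
  proof -
    have eq: "- int m - 1 = - int (Suc m)" by simp
    show ?thesis using arg_cong[OF pp_xx_1[OF r_less[OF that], of Minus Minus a "- int m"], of uminus]
      by (simp add: Op_simps eq del: of_nat_Suc)
  qed
  show "Op (pp Minus a 1) * Op (ee Plus a) - Op (ee Plus a) * Op (pp Minus a 1) = - shift_const Minus a a 1 *\<^sub>C Op (xx Plus a (- int 1))"
    if "a < r" for a using arg_cong[OF pp_xx_1[OF r_less[OF that], of Minus Plus a 0], of uminus] by (simp add: xx_0 Op_simps)
  show "Op (pp Minus a 1) * Op (ee Plus (Suc a)) - Op (ee Plus (Suc a)) * Op (pp Minus a 1) =
    - shift_const Minus a (Suc a) 1 *\<^sub>C Op (xx Plus (Suc a) (- int 1))"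
    if "Suc a < r" for a using arg_cong[OF pp_xx_1[of a Minus Plus "Suc a" 0], of uminus] r_less[OF that] by (simp add: xx_0 Op_simps)
  show "Op (pp Minus (r - 1) n) * Op (ee Plus b) = Op (ee Plus b) * Op (pp Minus (r - 1) n)" if "r \<le> b" "1 \<le> n" "n < M" for b n
    using pp_xx_lower[OF that(1,3), of Minus "r - 1" Plus 0] by (simp add: xx_0 Op_simps)
  show "Op (pp Minus a n) = 0" if "r \<le> a" "1 \<le> n" "n < M" for a n using pp_fixed[OF that] by (simp add: Op_simps)
  show "Op (pp Minus a M) * Op (ee Plus (Suc a)) - Op (ee Plus (Suc a)) * Op (pp Minus a M) =
    - shift_const Minus a (Suc a) M *\<^sub>C Op (xx Plus (Suc a) (- int M))"
    if "r \<le> Suc a" "Suc a < N" for a using arg_cong[OF pp_xx_M[of a "Suc a" Minus Plus 0], of uminus] that by (simp add: xx_0 Op_simps)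
  show "shift_const Minus a a 1 \<noteq> 0" if "a < r" for a by (rule shift_const_nz(1)[OF that])
  show "shift_const Minus a (Suc a) 1 \<noteq> 0" if "Suc a < r" for a by (rule shift_const_nz(2)[OF that])
  show "shift_const Minus a (Suc a) M \<noteq> 0" if "r \<le> Suc a" "Suc a < N" for a by (rule shift_const_nz(3)[OF that(2,1)])
qed

end

section \<open>Triangular decomposition\<close>

lemma generated_algebra_zero: "0 \<in> generated_algebra G"
  using generated_algebra.intros(5)[OF generated_algebra.intros(2), of 0 G] by simp

lemma generated_algebra_sum: "(\<And>i. i \<in> S \<Longrightarrow> F i \<in> generated_algebra G) \<Longrightarrow> (\<Sum>i\<in>S. F i) \<in> generated_algebra G"
  by (induct S rule: infinite_finite_induct) (auto intro: generated_algebra_zero generated_algebra.intros)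

lemma generated_algebra_diff: "u \<in> generated_algebra G \<Longrightarrow> w \<in> generated_algebra G \<Longrightarrow> u - w \<in> generated_algebra G"
  using generated_algebra.intros(3)[of u G "(- 1) *\<^sub>C w"] generated_algebra.intros(5)[of w G "- 1"]
  by (simp add: scaleC_one)

lemma generated_algebra_mono: "u \<in> generated_algebra G \<Longrightarrow> G \<subseteq> generated_algebra H \<Longrightarrow> u \<in> generated_algebra H"
  by (induct rule: generated_algebra.induct) (auto intro: generated_algebra.intros)

lemma exp_coeff_generated:
  assumes "\<And>l. 1 \<le> l \<Longrightarrow> a l \<in> generated_algebra G"
  shows "exp_coeff a m \<in> generated_algebra G"
proof -
  have "Abs_fps (\<lambda>l. if l = 0 then 0 else a l) ^ n $ l \<in> generated_algebra G" for n l
  proof (induct n arbitrary: l)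
    case 0 show ?case by (cases l) (auto intro: generated_algebra_zero generated_algebra.intros)
  next
    case (Suc n)
    show ?case using assms Suc
      by (auto simp: fps_mult_nth intro!: generated_algebra_sum generated_algebra.intros(4) generated_algebra_zero)
  qed
  then show ?thesis unfolding exp_coeff_def
    by (intro generated_algebra_sum generated_algebra.intros(5))
qed

context loop_setting
begin

definition hh :: "nat \<Rightarrow> int \<Rightarrow> 'u" where "hh a n = (if a < N \<and> n \<noteq> 0 then h (L ! a) n else 0)"

lemma rep_index: "i \<in> II T \<Longrightarrow> \<exists>a<N. rep T i = L ! a"
  using set_L by (metis image_eqI in_set_conv_nth)

lemma node_scaling:
  assumes "i \<in> II T"
  obtains a t where "a < N" "\<And>s m. x s i m = (omega T powi m) ^ t *\<^sub>C xx s a m"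
    "\<And>n. n \<noteq> 0 \<Longrightarrow> h i n = (omega T powi n) ^ t *\<^sub>C hh a n"
    "\<And>s m. psi s i m = (omega T powi (sgn_pm s * int m)) ^ t *\<^sub>C pp s a m" "rep T i = L ! a"
proof -
  obtain a where a: "a < N" "rep T i = L ! a" using rep_index assms by blast
  obtain t where t: "i = (\<sigma> ^^ t) (L ! a)" using node_of_rep[OF assms] a by metis
  have "x s ((\<sigma> ^^ t) (L ! a)) m = (omega T powi m) ^ t *\<^sub>C xx s a m" for s m
    by (induct t) (simp_all add: xx_def a scaleC_one x_aut aut_pow_in L_in scaleC_scaleC)
  moreover have "h ((\<sigma> ^^ t) (L ! a)) n = (omega T powi n) ^ t *\<^sub>C hh a n" if "n \<noteq> 0" for n
    by (induct t) (simp_all add: hh_def a that scaleC_one h_aut aut_pow_in L_in scaleC_scaleC)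
  moreover have "psi s ((\<sigma> ^^ t) (L ! a)) m = (omega T powi (sgn_pm s * int m)) ^ t *\<^sub>C pp s a m" for s m
    by (induct t) (simp_all add: pp_def a scaleC_one psi_aut aut_pow_in L_in scaleC_scaleC)
  ultimately show ?thesis using that[of a t] a t by blast
qed

definition UX :: "'u set" where "UX = complex_vector.span {b * c | b c. c \<in> X_plus T x}"

lemma UX_zero: "0 \<in> UX" and UX_add: "u \<in> UX \<Longrightarrow> w \<in> UX \<Longrightarrow> u + w \<in> UX"
  and UX_diff: "u \<in> UX \<Longrightarrow> w \<in> UX \<Longrightarrow> u - w \<in> UX" and UX_scaleC: "u \<in> UX \<Longrightarrow> c *\<^sub>C u \<in> UX"
  by (simp_all add: UX_def complex_vector.span_zero complex_vector.span_add complex_vector.span_diff complex_vector.span_scale)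

lemma xx_X_plus: "xx Plus a m \<in> X_plus T x"
proof (cases "a < N")
  case True
  then show ?thesis unfolding X_plus_def xx_def using L_in[OF True] by (auto intro!: complex_vector.span_base)
qed (simp add: xx_def X_plus_def complex_vector.span_zero)

lemma UX_xx: "u * xx Plus a m \<in> UX"
  unfolding UX_def using xx_X_plus by (intro complex_vector.span_base) blast

lemma UX_induct [consumes 1, case_names gen zero add scale]:
  assumes "w \<in> UX"
    and gen: "\<And>u a m. a < N \<Longrightarrow> R (u * xx Plus a m)"
    and R: "R 0" "\<And>u w. R u \<Longrightarrow> R w \<Longrightarrow> R (u + w)" "\<And>c u. R u \<Longrightarrow> R (c *\<^sub>C u)"
  shows "R w"
  using assms(1) unfolding UX_def
proof (induct rule: complex_vector.span_induct_alt)
  case base show ?case by (rule R)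
next
  case (step c w w')
  then obtain b c' where b: "w = b * c'" "c' \<in> X_plus T x" by blast
  have "R (b * c')" using b(2) unfolding X_plus_def
  proof (induct rule: complex_vector.span_induct_alt)
    case base show ?case using R by simp
  next
    case (step d y y')
    then obtain j m where "y = x Plus j m" "j \<in> II T" by blast
    moreover obtain a t where "a < N" "x Plus j m = (omega T powi m) ^ t *\<^sub>C xx Plus a m"
      using node_scaling[OF \<open>j \<in> II T\<close>] by metis
    ultimately have "b * (d *\<^sub>C y + y') = d *\<^sub>C (omega T powi m) ^ t *\<^sub>C (b * xx Plus a m) + b * y'"
      by (simp add: distrib_left scaleC_mult)
    then show ?case using gen[OF \<open>a < N\<close>, of b m] R(2,3) step by simp
  qed
  then show ?case using R step b by simp
qed

lemma UX_left: "w \<in> UX \<Longrightarrow> u * w \<in> UX"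
  by (induct rule: UX_induct)
    (simp_all add: UX_xx mult.assoc[symmetric] UX_zero distrib_left UX_add scaleC_mult UX_scaleC)

text \<open>\<open>UX\<close> is a left ideal by construction. On the right it only admits factors
  that carry every x^+ into it, and all later weight bounds serve to verify this condition.\<close>

lemma UX_right:
  assumes "\<And>a m. a < N \<Longrightarrow> xx Plus a m * y \<in> UX" and "w \<in> UX"
  shows "w * y \<in> UX"
  using assms(2)
  by (induct rule: UX_induct)
    (simp_all add: assms(1) UX_left mult.assoc UX_zero distrib_right UX_add scaleC_mult UX_scaleC)

definition neg_gens :: "'u set" where
  "neg_gens = {xx Minus a m | a m. True} \<union> {hh a n | a n. True} \<union> range kk \<union> range kki"

abbreviation "neg \<equiv> generated_algebra neg_gens"

lemma neg_intros: "xx Minus a m \<in> neg" "hh a n \<in> neg" "kk a \<in> neg" "kki a \<in> neg"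
  by (auto intro!: generated_algebra.intros(1) simp: neg_gens_def)

lemma pp_neg: "pp s a m \<in> neg"
proof (cases "a < N")
  case True
  have "h (L ! a) (sgn_pm s * int l) \<in> neg" if "1 \<le> l" for l
    using neg_intros(2)[of a "sgn_pm s * int l"] True sgn_pm_nz(1)[OF that, of s] by (simp add: hh_def)
  then have "psi s (L ! a) m \<in> neg"
    unfolding psi_def by (intro exp_coeff_generated generated_algebra.intros(5))
  then show ?thesis using True by (simp add: pp_def)
qed (auto simp: pp_def intro: generated_algebra_zero generated_algebra.intros)

lemma phi_neg: "a < N \<Longrightarrow> phi T g h s (L ! a) m \<in> neg"
  by (cases s) (auto simp: phi_Plus_pp phi_Minus_pp intro: generated_algebra_zero generated_algebra.intros neg_intros pp_neg)

lemma xx_commutator_neg: "xx Plus a m * xx Minus b l - xx Minus b l * xx Plus a m \<in> neg"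
proof (cases "a = b \<and> a < N")
  case True
  then show ?thesis using x_x[OF L_in L_in, of a a m l]
    by (auto simp: xx_def intro!: generated_algebra.intros(5) generated_algebra_diff phi_neg)
next
  case False
  then have "xx Plus a m * xx Minus b l - xx Minus b l * xx Plus a m = 0"
    using xx_other[of a b m l] by (auto simp: xx_def)
  then show ?thesis by (simp add: generated_algebra_zero)
qed

definition tri :: "'u set" where "tri = {u + w | u w. u \<in> neg \<and> w \<in> UX}"

lemma triI: "u \<in> neg \<Longrightarrow> w \<in> UX \<Longrightarrow> u + w \<in> tri"
  by (auto simp: tri_def)

lemma neg_tri: "u \<in> neg \<Longrightarrow> u \<in> tri"
  using triI[OF _ UX_zero] by simp

lemma UX_tri: "w \<in> UX \<Longrightarrow> w \<in> tri"
  using triI[OF generated_algebra_zero] by simp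

lemma tri_add: "u \<in> tri \<Longrightarrow> w \<in> tri \<Longrightarrow> u + w \<in> tri"
proof -
  assume "u \<in> tri" "w \<in> tri"
  then obtain n n' y y' where "u = n + y" "w = n' + y'" "n \<in> neg" "n' \<in> neg" "y \<in> UX" "y' \<in> UX"
    by (auto simp: tri_def)
  then show "u + w \<in> tri"
    using triI[of "n + n'" "y + y'"] by (simp add: UX_add generated_algebra.intros algebra_simps)
qed

lemma tri_scaleC: "u \<in> tri \<Longrightarrow> c *\<^sub>C u \<in> tri"
proof -
  assume "u \<in> tri"
  then obtain n y where "u = n + y" "n \<in> neg" "y \<in> UX" by (auto simp: tri_def)
  then show "c *\<^sub>C u \<in> tri"
    using triI[of "c *\<^sub>C n" "c *\<^sub>C y"] by (simp add: UX_scaleC generated_algebra.intros scaleC_add_right)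
qed

lemma tri_diff: "u \<in> tri \<Longrightarrow> w \<in> tri \<Longrightarrow> u - w \<in> tri"
  using tri_add[of u "(- 1) *\<^sub>C w"] tri_scaleC[of w "- 1"] by (simp add: scaleC_one)

lemma neg_tri_mult: "n \<in> neg \<Longrightarrow> u \<in> tri \<Longrightarrow> n * u \<in> tri"
proof -
  assume n: "n \<in> neg" and "u \<in> tri"
  then obtain n' y where "u = n' + y" "n' \<in> neg" "y \<in> UX" by (auto simp: tri_def)
  then show "n * u \<in> tri"
    using triI[of "n * n'" "n * y"] n by (simp add: UX_left generated_algebra.intros distrib_left)
qed

text \<open>x^+ is moved to the right past one generator of \<open>neg\<close> at a time. The
  commutator lies in \<open>neg\<close> for x^-, is a multiple of another x^+ for the elements
  \<open>hh\<close>, and is a mere power of q for \<open>kk\<close> and \<open>kki\<close>. The set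
  \<open>S\<close> quantifies over all x^+ since the middle case changes the degree.\<close>

lemma neg_plus:
  assumes "n \<in> neg"
  shows "xx Plus a m * n \<in> tri"
proof -
  define S where "S = {u \<in> neg. \<forall>a m. xx Plus a m * u \<in> tri}"
  have gen: "y * u \<in> S" if y: "y \<in> neg_gens" and u: "u \<in> S" for y u
  proof -
    have yn: "y * u \<in> neg" using generated_algebra.intros(1)[OF y] u by (auto simp: S_def intro: generated_algebra.intros(4))
    have un: "u \<in> neg" and ut: "\<And>a m. xx Plus a m * u \<in> tri" using u by (auto simp: S_def)
    have "xx Plus a m * (y * u) \<in> tri" for a m
    proof -
      from y consider b l where "y = xx Minus b l" | b l where "y = hh b l" | b where "y = kk b" | b where "y = kki b"
        by (auto simp: neg_gens_def)
      then show ?thesis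
      proof cases
        case 1
        have "xx Plus a m * (y * u) = (xx Plus a m * xx Minus b l - xx Minus b l * xx Plus a m) * u + xx Minus b l * (xx Plus a m * u)"
          by (simp add: 1 algebra_simps)
        then show ?thesis
          using tri_add[OF neg_tri_mult[OF xx_commutator_neg neg_tri[OF un]] neg_tri_mult[OF neg_intros(1) ut]] by simp
      next
        case 2
        show ?thesis
        proof (cases "a < N \<and> b < N \<and> l \<noteq> 0")
          case True
          then have "hh b l * xx Plus a m - xx Plus a m * hh b l =
            (1 / of_int l * (omega_sum (L ! b) (L ! a) l / DD (L ! b))) *\<^sub>C xx Plus a (l + m)"
            using h_x[OF L_in L_in, of b a l Plus m] by (simp add: hh_def xx_def)
          then obtain c where "hh b l * xx Plus a m - xx Plus a m * hh b l = c *\<^sub>C xx Plus a (l + m)" by blast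
          then have "xx Plus a m * hh b l = hh b l * xx Plus a m - c *\<^sub>C xx Plus a (l + m)" by (simp add: algebra_simps)
          then have "xx Plus a m * hh b l * u = hh b l * (xx Plus a m * u) - c *\<^sub>C (xx Plus a (l + m) * u)"
            by (simp add: left_diff_distrib scaleC_mult mult.assoc)
          then show ?thesis
            using tri_diff[OF neg_tri_mult[OF neg_intros(2) ut] tri_scaleC[OF ut]] by (simp add: 2 mult.assoc)
        qed (auto simp: 2 hh_def xx_def intro: neg_tri generated_algebra_zero)
      next
        case 3
        have "xx Plus a m * kk b = q powi (- Bf b a) *\<^sub>C (kk b * xx Plus a m)"
          by (simp add: kk_xx scaleC_scaleC pl.q_minus scaleC_one)
        then have "xx Plus a m * kk b * u = q powi (- Bf b a) *\<^sub>C (kk b * (xx Plus a m * u))"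
          by (simp add: scaleC_mult mult.assoc)
        then show ?thesis using tri_scaleC[OF neg_tri_mult[OF neg_intros(3) ut]] by (simp add: 3 mult.assoc)
      next
        case 4
        have "xx Plus a m * kki b * u = q powi (sgn_pm Plus * Bf b a) *\<^sub>C (kki b * (xx Plus a m * u))"
          unfolding xx_kki by (simp add: scaleC_mult mult.assoc)
        then show ?thesis using tri_scaleC[OF neg_tri_mult[OF neg_intros(4) ut]] by (simp add: 4 mult.assoc)
      qed
    qed
    then show ?thesis using yn by (simp add: S_def)
  qed
  have "y * u \<in> S" if "y \<in> neg" "u \<in> S" for y u
    using that
  proof (induct arbitrary: u rule: generated_algebra.induct)
    case (3 y y')
    then show ?case by (simp add: S_def distrib_right distrib_left generated_algebra.intros tri_add)
  next
    case (5 y c)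
    then show ?case by (simp add: S_def scaleC_mult generated_algebra.intros tri_scaleC)
  qed (simp_all add: gen mult.assoc)
  moreover have "1 \<in> S" using UX_tri UX_xx[of 1] by (auto simp: S_def intro: generated_algebra.intros)
  ultimately have "n \<in> S" using assms by fastforce
  then show ?thesis by (simp add: S_def)
qed

lemma generators_index: "generated_algebra (neg_gens \<union> {xx Plus a m | a m. True}) = UNIV" (is "generated_algebra ?G = _")
proof -
  have x: "xx s a m \<in> generated_algebra ?G" and hk: "hh a n \<in> generated_algebra ?G"
      "kk a \<in> generated_algebra ?G" "kki a \<in> generated_algebra ?G" for s a m n
    by (cases s) (auto intro!: generated_algebra.intros(1) simp: neg_gens_def)
  have "u \<in> generated_algebra ?G" if "u \<in> {x s i m | s i m. i \<in> II T} \<union> {h i r | i r. i \<in> II T \<and> r \<noteq> 0} \<union>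
      {g (Kgen (bar T i)) | i. i \<in> II T} \<union> {g (Kgen_inv (bar T i)) | i. i \<in> II T}" for u
  proof -
    from that obtain i where i: "i \<in> II T" and u: "(\<exists>s m. u = x s i m) \<or> (\<exists>n. n \<noteq> 0 \<and> u = h i n) \<or> u = g (Kgen (bar T i)) \<or> u = g (Kgen_inv (bar T i))"
      by auto
    obtain a t where a: "a < N" "\<And>s m. x s i m = (omega T powi m) ^ t *\<^sub>C xx s a m"
      "\<And>n. n \<noteq> 0 \<Longrightarrow> h i n = (omega T powi n) ^ t *\<^sub>C hh a n" "rep T i = L ! a" using node_scaling[OF i] by metis
    have "g (Kgen (bar T i)) = kk a" "g (Kgen_inv (bar T i)) = kki a" using a by (simp_all add: kk_def kki_def)
    then show ?thesis using u a(2,3) x hk by (auto intro!: generated_algebra.intros(5))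
  qed
  then have sub: "{x s i m | s i m. i \<in> II T} \<union> {h i r | i r. i \<in> II T \<and> r \<noteq> 0} \<union>
      {g (Kgen (bar T i)) | i. i \<in> II T} \<union> {g (Kgen_inv (bar T i)) | i. i \<in> II T} \<subseteq> generated_algebra ?G"
    by (rule subsetI)
  have gen: "generated_algebra ({x s i m | s i m. i \<in> II T} \<union> {h i r | i r. i \<in> II T \<and> r \<noteq> 0} \<union>
      {g (Kgen (bar T i)) | i. i \<in> II T} \<union> {g (Kgen_inv (bar T i)) | i. i \<in> II T}) = UNIV"
    using drinfeld by (simp add: drinfeld_generators_def)
  show ?thesis
  proof (rule UNIV_eq_I[symmetric])
    fix u show "u \<in> generated_algebra ?G"
      by (rule generated_algebra_mono[OF _ sub]) (simp only: gen UNIV_I)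
  qed
qed

text \<open>\<open>tri\<close> contains 1 and is stable under left multiplication by all generators.
  It is only the spanning half of a triangular decomposition, without any statement of
  uniqueness.\<close>

lemma tri_UNIV: "u \<in> tri"
proof -
  have "u * w \<in> tri" if "u \<in> generated_algebra (neg_gens \<union> {xx Plus a m | a m. True})" "w \<in> tri" for u w
    using that
  proof (induct arbitrary: w rule: generated_algebra.induct)
    case (1 y)
    then consider "y \<in> neg" | a m where "y = xx Plus a m" by (auto intro: generated_algebra.intros)
    then show ?case
    proof cases
      case 2
      obtain n y' where "w = n + y'" "n \<in> neg" "y' \<in> UX" using 1 by (auto simp: tri_def)
      then show ?thesis using neg_plus[of n a m] UX_tri[OF UX_left[of y' "xx Plus a m"]]
        by (simp add: 2 distrib_left tri_add)
    qed (use 1 neg_tri_mult in simp)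
  qed (simp_all add: distrib_right tri_add scaleC_mult tri_scaleC mult.assoc)
  moreover have "1 \<in> tri" by (intro neg_tri generated_algebra.intros)
  ultimately show ?thesis using generators_index by fastforce
qed

end

lemma tensor_induct [case_names gen add]:
  fixes Z :: "('a::complex_algebra_1, 'b::complex_algebra_1) tensor"
  assumes gen: "\<And>u w. R (u \<otimes> w)" and add: "\<And>u w. R u \<Longrightarrow> R w \<Longrightarrow> R (u + w)"
  shows "R Z"
proof (induct Z rule: tensor.abs_induct)
  case (1 f)
  show ?case
  proof (induct f rule: poly_mapping_additive_induct)
    case zero
    have "0 \<otimes> 0 = (0 :: ('a, 'b) tensor)" using tens_scale_left[of 0 0 0] by simp
    then show ?case using gen[of 0 0] by (simp add: zero_tensor_def)
  next
    case (single k c)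
    obtain u w where k: "k = Pure u w" by (cases k)
    have "(c *\<^sub>C u) \<otimes> w = c *\<^sub>C (u \<otimes> w)" by (rule tens_scale_left)
    also have "\<dots> = abs_tensor (Poly_Mapping.single k c)"
      by (simp add: k tens.abs_eq scaleC_tensor.abs_eq mult_single zero_pure_def)
    finally have "(c *\<^sub>C u) \<otimes> w = abs_tensor (Poly_Mapping.single k c)" .
    then show ?case using gen by metis
  next
    case (add f g)
    then show ?case using assms(2) by (simp add: plus_tensor.abs_eq[symmetric])
  qed
qed

section \<open>Elements of non-negative weight and the left ideal\<close>

context loop_setting
begin

definition neg_weights :: "'u set" where
  "neg_weights = (\<Union>\<gamma>\<in>{\<gamma>. \<forall>b. \<gamma> b \<ge> 0}. pl.weight_space (\<lambda>b. - \<gamma> b))"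

lemma hh_weight: "hh a n \<in> pl.weight_space (\<lambda>_. 0)"
proof -
  have "kk b * hh a n = hh a n * kk b" for b
    using K_h[of "L ! b" "L ! a" n] by (auto simp: hh_def kk_def L_in rep_L)
  then show ?thesis by (simp add: pl.weight_space_def pl.wt_zero scaleC_one)
qed

lemma neg_weights_mult: "u \<in> neg_weights \<Longrightarrow> w \<in> neg_weights \<Longrightarrow> u * w \<in> neg_weights"
proof -
  assume "u \<in> neg_weights" "w \<in> neg_weights"
  then obtain \<gamma> \<gamma>' where a: "\<forall>b. \<gamma> b \<ge> 0" "\<forall>b. \<gamma>' b \<ge> 0" "u \<in> pl.weight_space (\<lambda>b. - \<gamma> b)" "w \<in> pl.weight_space (\<lambda>b. - \<gamma>' b)"
    by (auto simp: neg_weights_def)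
  have "u * w \<in> pl.weight_space (\<lambda>b. - (\<gamma> b + \<gamma>' b))"
    using pl.weight_space_mult[OF a(3,4)] by simp
  then show ?thesis using a(1,2) unfolding neg_weights_def by (intro UN_I[of "\<lambda>b. \<gamma> b + \<gamma>' b"]) auto
qed

lemma neg_weights_scaleC: "u \<in> neg_weights \<Longrightarrow> c *\<^sub>C u \<in> neg_weights"
  unfolding neg_weights_def using pl.weight_space_scaleC by blast

lemma span_neg_weights_mult:
  assumes "u \<in> complex_vector.span neg_weights" "w \<in> complex_vector.span neg_weights"
  shows "u * w \<in> complex_vector.span neg_weights"
  using assms(1)
proof (induct rule: complex_vector.span_induct_alt)
  case base show ?case by (simp add: complex_vector.span_zero)
next
  case (step c y u)
  have "y * w \<in> complex_vector.span neg_weights" using assms(2)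
  proof (induct rule: complex_vector.span_induct_alt)
    case base show ?case by (simp add: complex_vector.span_zero)
  next
    case (step d z w)
    then show ?case using neg_weights_mult[OF \<open>y \<in> neg_weights\<close> step(1)]
      by (simp add: distrib_left scaleC_mult complex_vector.span_add complex_vector.span_scale complex_vector.span_base)
  qed
  then show ?case using step
    by (simp add: distrib_right scaleC_mult complex_vector.span_add complex_vector.span_scale)
qed

lemma neg_span: "n \<in> neg \<Longrightarrow> n \<in> complex_vector.span neg_weights"
proof (induct rule: generated_algebra.induct)
  case (1 y)
  have 0: "u \<in> neg_weights" if "u \<in> pl.weight_space (\<lambda>_. 0)" for u
    unfolding neg_weights_def by (rule UN_I[of "\<lambda>_. 0"]) (use that in auto)
  have m: "xx Minus a m \<in> neg_weights" for a m
    unfolding neg_weights_def by (rule UN_I[of "simple_root a"]) (use xx_weight[of Minus a m] in \<open>auto simp: simple_root_def\<close>)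
  have "y \<in> neg_weights" using 1 m 0 hh_weight pl.weight_space_simps by (auto simp: neg_gens_def)
  then show ?case by (rule complex_vector.span_base)
next
  case 2
  have "1 \<in> neg_weights" unfolding neg_weights_def by (rule UN_I[of "\<lambda>_. 0"]) (use pl.weight_space_simps(2) in auto)
  then show ?case by (rule complex_vector.span_base)
qed (simp_all add: span_neg_weights_mult complex_vector.span_add complex_vector.span_scale)

lemma span_neg_weights_list:
  assumes "u \<in> complex_vector.span neg_weights"
  shows "\<exists>ns. set ns \<subseteq> neg_weights \<and> u = sum_list ns"
  using assms
proof (induct rule: complex_vector.span_induct_alt)
  case base show ?case by (intro exI[of _ "[]"]) simp
next
  case (step c y u)
  then obtain ns where "set ns \<subseteq> neg_weights" "u = sum_list ns" by blast
  moreover have "c *\<^sub>C y \<in> neg_weights" using step(1) by (rule neg_weights_scaleC)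
  ultimately show ?case by (intro exI[of _ "c *\<^sub>C y # ns"]) auto
qed

text \<open>A difference of weights orthogonal to all simple roots vanishes below \<open>N\<close>,
  again by nondegeneracy of \<open>bform\<close>. With q not a root of unity, the
  \<open>kk a\<close> thus tell weights apart.\<close>

lemma wt_separates:
  assumes "b < N" "\<beta> b \<noteq> \<gamma> b"
  shows "\<exists>a<N. pl.wt a \<beta> \<noteq> pl.wt a \<gamma>"
proof (rule ccontr)
  assume "\<not> ?thesis"
  then have "pl.wt a (\<lambda>b. \<beta> b - \<gamma> b) = 0" if "a < N" for a using that by (simp add: pl.wt_diff)
  moreover have "pl.wt a (\<lambda>b. \<beta> b - \<gamma> b) = (\<Sum>b<N. (\<beta> b - \<gamma> b) * bform T (L ! b) (L ! a))" if "a < N" for a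
    unfolding pl.wt_def Bf_sym[of a] by (intro sum.cong) (use that in \<open>auto simp: Bf_def\<close>)
  ultimately have "(\<Sum>b<N. (\<beta> b - \<gamma> b) * bform T (L ! b) (L ! a)) = 0" if "a < N" for a
    using that by simp
  then have "\<beta> b - \<gamma> b = 0" using bform_nondegenerate[of "\<lambda>b. \<beta> b - \<gamma> b" b] assms(1) by blast
  then show False using assms by simp
qed

definition eigen_op :: "nat \<Rightarrow> complex \<Rightarrow> 'u \<Rightarrow> 'u" where
  "eigen_op a c u = kk a * u * kki a - c *\<^sub>C u"

lemma eigen_op_diff: "eigen_op a c (u - w) = eigen_op a c u - eigen_op a c w"
  and eigen_op_add: "eigen_op a c (u + w) = eigen_op a c u + eigen_op a c w"
  by (simp_all add: eigen_op_def algebra_simps scaleC_add_right scaleC_right_diff)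

lemma eigen_op_sum_list: "eigen_op a c (sum_list ns) = sum_list (map (eigen_op a c) ns)"
  by (induct ns) (simp_all add: eigen_op_add, simp add: eigen_op_def)

lemma eigen_op_weight:
  assumes "u \<in> pl.weight_space \<beta>"
  shows "eigen_op a c u = (q powi pl.wt a \<beta> - c) *\<^sub>C u"
proof -
  have "kk a * u * kki a = q powi pl.wt a \<beta> *\<^sub>C (u * (kk a * kki a))"
    using pl.weight_k[OF assms, of a] by (simp add: scaleC_mult mult.assoc)
  then show ?thesis by (simp add: eigen_op_def kk_kki complex_vector.scale_left_diff_distrib)
qed

lemma eigen_op_UX: "w \<in> UX \<Longrightarrow> eigen_op a c w \<in> UX"
proof -
  assume w: "w \<in> UX"
  have "kk a * w * kki a \<in> UX"
    by (rule UX_right[OF _ UX_left[OF w]]) (simp add: xx_kki UX_scaleC UX_xx)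
  then show ?thesis using UX_scaleC[OF w] by (simp add: eigen_op_def UX_diff)
qed

text \<open>The summands of weight \<open>- \<gamma> \<noteq> \<beta>\<close> are killed one after the other by operators \<open>eigen_op\<close> that act on
  \<open>u\<close> by a non-zero scalar.\<close>

lemma weight_UX_aux:
  assumes "set ns \<subseteq> neg_weights" "u \<in> pl.weight_space \<beta>" "u - sum_list ns \<in> UX" "b < N" "\<beta> b > 0"
  shows "u \<in> UX"
  using assms(1-3)
proof (induct "length ns" arbitrary: ns u)
  case 0 then show ?case by simp
next
  case (Suc l)
  then obtain n0 ns' where ns: "ns = n0 # ns'" by (cases ns) auto
  obtain \<gamma> where \<gamma>: "\<forall>b. \<gamma> b \<ge> 0" "n0 \<in> pl.weight_space (\<lambda>b. - \<gamma> b)"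
    using Suc(3) by (auto simp: ns neg_weights_def)
  then have "\<gamma> b \<ge> 0" by blast
  then obtain a where a: "pl.wt a \<beta> \<noteq> pl.wt a (\<lambda>b. - \<gamma> b)"
    using wt_separates[of b \<beta> "\<lambda>b. - \<gamma> b"] assms(4,5) by auto
  define c where "c = q powi pl.wt a (\<lambda>b. - \<gamma> b)"
  have c: "q powi pl.wt a \<beta> - c \<noteq> 0" using a by (simp add: c_def q_powi_inj)
  have "eigen_op a c n0 = 0" by (simp add: eigen_op_weight[OF \<gamma>(2)] c_def)
  then have e: "eigen_op a c u - sum_list (map (eigen_op a c) ns') \<in> UX"
    using eigen_op_UX[OF Suc(5), of a c] by (simp add: eigen_op_diff eigen_op_add ns eigen_op_sum_list)
  have "eigen_op a c n \<in> neg_weights" if n: "n \<in> neg_weights" for n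
  proof -
    obtain \<gamma>' where "\<forall>b. \<gamma>' b \<ge> 0" "n \<in> pl.weight_space (\<lambda>b. - \<gamma>' b)" using n by (auto simp: neg_weights_def)
    then show ?thesis using neg_weights_scaleC[OF n] by (simp add: eigen_op_weight)
  qed
  then have "set (map (eigen_op a c) ns') \<subseteq> neg_weights" using Suc(3) ns by auto
  moreover have "eigen_op a c u \<in> pl.weight_space \<beta>"
    using Suc(4) by (simp add: eigen_op_weight pl.weight_space_scaleC)
  ultimately have "eigen_op a c u \<in> UX" using Suc(1)[of "map (eigen_op a c) ns'" "eigen_op a c u"] e Suc(2) ns by simp
  then have "(1 / (q powi pl.wt a \<beta> - c)) *\<^sub>C eigen_op a c u \<in> UX" by (rule UX_scaleC)
  then show ?case using c by (simp add: eigen_op_weight[OF Suc(4)] scaleC_scaleC scaleC_one)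
qed

lemma weight_UX:
  assumes "u \<in> pl.weight_space \<beta>" "b < N" "\<beta> b > 0"
  shows "u \<in> UX"
proof -
  obtain n w where u: "u = n + w" "n \<in> neg" "w \<in> UX" using tri_UNIV[of u] by (auto simp: tri_def)
  obtain ns where "set ns \<subseteq> neg_weights" "n = sum_list ns" using span_neg_weights_list[OF neg_span[OF u(2)]] by blast
  then show ?thesis using weight_UX_aux[OF _ assms(1) _ assms(2,3), of ns] u by simp
qed

definition JJ :: "('u, 'u) tensor set" where "JJ = complex_vector.span {a \<otimes> (b * c) | a b c. c \<in> X_plus T x}"

lemma JJ_zero: "0 \<in> JJ" and JJ_add: "u \<in> JJ \<Longrightarrow> w \<in> JJ \<Longrightarrow> u + w \<in> JJ"
  and JJ_diff: "u \<in> JJ \<Longrightarrow> w \<in> JJ \<Longrightarrow> u - w \<in> JJ" and JJ_scaleC: "u \<in> JJ \<Longrightarrow> c *\<^sub>C u \<in> JJ"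
  by (simp_all add: JJ_def complex_vector.span_zero complex_vector.span_add complex_vector.span_diff complex_vector.span_scale)

lemma JJ_sum: "(\<And>i. i \<in> S \<Longrightarrow> F i \<in> JJ) \<Longrightarrow> (\<Sum>i\<in>S. F i) \<in> JJ"
  by (induct S rule: infinite_finite_induct) (auto intro: JJ_zero JJ_add)

lemma UX_JJ: "w \<in> UX \<Longrightarrow> u \<otimes> w \<in> JJ"
proof (induct rule: UX_induct)
  case (gen w a m)
  then show ?case unfolding JJ_def using xx_X_plus by (intro complex_vector.span_base) blast
qed (simp_all add: JJ_zero tens_add_right JJ_add tens_scale_right JJ_scaleC)

lemma JJ_induct [consumes 1, case_names gen zero add scale]:
  assumes "Z \<in> JJ"
    and gen: "\<And>u w. w \<in> UX \<Longrightarrow> R (u \<otimes> w)"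
    and R: "R 0" "\<And>u w. R u \<Longrightarrow> R w \<Longrightarrow> R (u + w)" "\<And>c u. R u \<Longrightarrow> R (c *\<^sub>C u)"
  shows "R Z"
  using assms(1) unfolding JJ_def
proof (induct rule: complex_vector.span_induct_alt)
  case base show ?case by (rule R)
next
  case (step c y z)
  then obtain a' b' c' where "y = a' \<otimes> (b' * c')" "c' \<in> X_plus T x" by blast
  moreover from this(2) have "b' * c' \<in> UX" unfolding UX_def by (intro complex_vector.span_base) blast
  ultimately show ?case using R gen step by simp
qed

end

section \<open>The action of the shift elements\<close>

lemma Op_sum: "(\<Sum>i\<in>S. Op (F i)) = Op (\<Sum>i\<in>S. F i)"
  by (induct S rule: infinite_finite_induct) (simp_all add: Op_simps)

context loop_setting
begin

lemma JJ_left: "W \<in> JJ \<Longrightarrow> Z * W \<in> JJ"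
proof (induct Z rule: tensor_induct)
  case (gen u w)
  from gen show ?case
    by (induct rule: JJ_induct)
      (simp_all add: tens_mult UX_JJ UX_left JJ_zero distrib_left JJ_add scaleC_mult JJ_scaleC)
next
  case (add u w) then show ?case by (simp add: distrib_right JJ_add)
qed

lemma JJ_right:
  assumes "\<And>a m. a < N \<Longrightarrow> xx Plus a m * w \<in> UX" and "Z \<in> JJ"
  shows "Z * (u \<otimes> w) \<in> JJ"
  using assms(2)
proof (induct rule: JJ_induct)
  case (gen y z)
  then show ?case using UX_right[OF assms(1), of z] by (simp add: tens_mult UX_JJ)
qed (simp_all add: JJ_zero distrib_right JJ_add scaleC_mult JJ_scaleC)

text \<open>x^+ at \<open>a\<close> times \<open>w\<close> has a weight with positive entry at
  \<open>a\<close>, so it falls into \<open>UX\<close> by \<open>weight_UX\<close>.\<close>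

lemma JJ_right_weight:
  assumes "w \<in> pl.weight_space \<delta>" "\<And>b. b < N \<Longrightarrow> \<delta> b \<ge> 0" "Z \<in> JJ"
  shows "Z * (u \<otimes> w) \<in> JJ"
proof (rule JJ_right[OF _ assms(3)])
  fix a m assume a: "a < N"
  show "xx Plus a m * w \<in> UX"
    by (rule weight_UX[OF pl.weight_space_mult[OF xx_weight assms(1)] a]) (use assms(2)[OF a] in \<open>simp add: simple_root_def\<close>)
qed

lemma junk_JJ_right: "Z \<in> pl.junk \<tau> (simple_root j) \<Longrightarrow> W \<in> JJ \<Longrightarrow> W * Z \<in> JJ"
proof (induct rule: pl.junk_induct)
  case (tensor u w \<beta> \<gamma> b)
  show ?case
  proof (rule JJ_right[OF _ tensor(6)])
    fix a m assume a: "a < N"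
    show "xx Plus a m * w \<in> UX"
      by (rule weight_UX[OF pl.weight_space_mult[OF xx_weight tensor(2)] tensor(4)])
        (use tensor(5) in \<open>auto simp: simple_root_def split: if_splits\<close>)
  qed
qed (simp_all add: JJ_zero distrib_left JJ_add scaleC_mult JJ_scaleC)

text \<open>This is what the bound \<alpha>_j is made for: a second factor of weight at least -
  \<alpha>_j, such as x^- at \<open>j\<close>, leaves a positive entry in the weight of the product,
  which then lies in \<open>UX\<close>.\<close>

lemma junk_safe:
  assumes "w \<in> pl.weight_space \<delta>" "\<And>b. b < N \<Longrightarrow> \<delta> b \<ge> - simple_root j b" "Z \<in> pl.junk \<tau> (simple_root j)"
  shows "Z * (u \<otimes> w) \<in> JJ" "(u \<otimes> w) * Z \<in> JJ"
proof -
  show "Z * (u \<otimes> w) \<in> JJ" using assms(3)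
  proof (induct rule: pl.junk_induct)
    case (tensor v z \<beta> \<gamma> b)
    have "z * w \<in> UX"
      by (rule weight_UX[OF pl.weight_space_mult[OF tensor(2) assms(1)] tensor(4)]) (use tensor(5) assms(2)[OF tensor(4)] in simp)
    then show ?case by (simp add: tens_mult UX_JJ)
  qed (simp_all add: JJ_zero distrib_right JJ_add scaleC_mult JJ_scaleC)
  show "(u \<otimes> w) * Z \<in> JJ" using assms(3)
  proof (induct rule: pl.junk_induct)
    case (tensor v z \<beta> \<gamma> b)
    have "w * z \<in> UX"
      by (rule weight_UX[OF pl.weight_space_mult[OF assms(1) tensor(2)] tensor(4)]) (use tensor(5) assms(2)[OF tensor(4)] in simp)
    then show ?case by (simp add: tens_mult UX_JJ)
  qed (simp_all add: JJ_zero distrib_left JJ_add scaleC_mult JJ_scaleC)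
qed

text \<open>A fixed node borrows the series of its predecessor, whose coproduct still shows the term
  with the generator at \<open>j\<close>.\<close>

definition pr :: "nat \<Rightarrow> nat" where "pr j = (if j < r then j else j - 1)"

lemma pr: "j < N \<Longrightarrow> pr j < N" "r \<le> j \<Longrightarrow> pr j = j - 1" "r \<le> j \<Longrightarrow> Suc (pr j) = j" "j < r \<Longrightarrow> pr j = j"
  using r_bounds by (auto simp: pr_def)

definition shifter :: "pm \<Rightarrow> nat \<Rightarrow> 'u" where "shifter s j = pp s (pr j) (period j)"

definition shiftc :: "pm \<Rightarrow> nat \<Rightarrow> complex" where "shiftc s j = shift_const s (pr j) j (period j)"

lemma shiftc_nz: "j < N \<Longrightarrow> shiftc s j \<noteq> 0"
  using shift_const_nz(1)[of j s] shift_const_nz(3)[of "j - 1" s] r_bounds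
  by (cases "j < r") (auto simp: shiftc_def pr_def period_def)

lemma shifter_xx:
  assumes "j < N"
  shows "shifter s j * xx s' j l - xx s' j l * shifter s j = (of_int (sgn_pm s') * shiftc s j) *\<^sub>C xx s' j (l + sgn_pm s * int (period j))"
proof (cases "j < r")
  case True
  then show ?thesis using pp_xx_1[OF assms, of s s' j l] by (simp add: shifter_def shiftc_def pr period_def)
next
  case False
  then show ?thesis using pp_xx_M[of "pr j" j s s' l] pr[of j] assms by (simp add: shifter_def shiftc_def period_def)
qed

definition middle :: "pm \<Rightarrow> nat \<Rightarrow> ('u, 'u) tensor" where
  "middle s j = (if j < r then 0 else \<Sum>n<M - 1. pp s (pr j) (M - 1 - n) \<otimes> pp s (pr j) (Suc n))"

text \<open>The first-order term of the coproduct, up to the identification by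
  \<open>shifter_xx\<close>: D_j [u, f_j] \<otimes> e_j for positive degrees and its mirror image
  f_j \<otimes> D_j [u, e_j] for negative ones, where u is the shifter.\<close>

definition left_part :: "pm \<Rightarrow> nat \<Rightarrow> 'u" where
  "left_part s j = (case s of Plus \<Rightarrow> - (Df j * shiftc Plus j) *\<^sub>C xx Minus j (int (period j)) | Minus \<Rightarrow> ee Minus j)"

definition right_part :: "pm \<Rightarrow> nat \<Rightarrow> 'u" where
  "right_part s j = (case s of Plus \<Rightarrow> ee Plus j | Minus \<Rightarrow> (Df j * shiftc Minus j) *\<^sub>C xx Plus j (- int (period j)))"

lemma right_part_weight: "right_part s j \<in> pl.weight_space (simple_root j)"
  using xx_weight[of Plus j] by (cases s) (simp_all add: right_part_def pl.weight_space_scaleC flip: xx_0)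

lemma junk_opposite:
  assumes "W \<in> mi.junk (\<lambda>_. 0) \<zeta>"
  shows "unop W \<in> pl.junk (\<lambda>_. 0) \<zeta>"
  using assms
proof (induct rule: mi.junk_induct)
  case (tensor u w \<beta> \<gamma> b)
  obtain u' w' where u: "u = Op u'" "w = Op w'" by (cases u; cases w)
  have "w' \<otimes> u' \<in> pl.junk (\<lambda>_. 0) \<zeta>"
    by (rule pl.junkI[of _ "\<lambda>b. - \<gamma> b" _ "\<lambda>b. - \<beta> b" _ b])
      (use tensor mi_weight u in \<open>force simp: eq_neg_iff_add_eq_0 add.commute\<close>)+
  then show ?case by (simp add: u tpop_def)
qed (simp_all add: opposite_defs pl.junk_0 pl.junk_add pl.junk_scaleC)

lemma \<Delta>_shifter:
  assumes "j < N"
  shows "\<Delta> (shifter s j) - (1 \<otimes> shifter s j + shifter s j \<otimes> 1 + middle s j + left_part s j \<otimes> right_part s j) \<in> pl.junk (\<lambda>_. 0) (simple_root j)"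
proof (cases s)
  case Plus
  have "Df j *\<^sub>C (shifter Plus j * ee Minus j - ee Minus j * shifter Plus j) = left_part Plus j"
    using shifter_xx[OF assms, of Plus Minus 0] by (simp add: xx_0 left_part_def scaleC_scaleC)
  moreover have "plus.Omega (pr j) = middle Plus j" if "r \<le> j" using that by (simp add: plus.Omega_def middle_def)
  ultimately show ?thesis
    using plus.shift_nonfixed[of j] plus.shift_fixed[of "pr j"] assms pr[of j]
    by (cases "j < r") (simp_all add: Plus shifter_def period_def middle_def right_part_def)
next
  case Minus
  have A: "Df j *\<^sub>C (shifter Minus j * ee Plus j - ee Plus j * shifter Minus j) = right_part Minus j"
    using shifter_xx[OF assms, of Minus Plus 0] by (simp add: xx_0 right_part_def scaleC_scaleC)
  have O: "minus.Omega (pr j) = Op (middle Minus j)" if "r \<le> j"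
  proof -
    define F where "F n = Op (pp Minus (pr j) (M - 1 - n) \<otimes> pp Minus (pr j) (Suc n))" for n
    have "minus.Omega (pr j) = (\<Sum>n<M - 1. Op (pp Minus (pr j) (Suc n) \<otimes> pp Minus (pr j) (M - 1 - n)))"
      by (simp add: minus.Omega_def tpop_Op)
    \<comment> \<open>\<open>tpop\<close> flips the tensor factors; reversing the order of summation
      undoes this, since the two degrees always add up to \<open>M\<close>.\<close>
    also have "\<dots> = (\<Sum>n<M - 1. F (M - 1 - Suc n))"
    proof (rule sum.cong[OF refl])
      fix n assume "n \<in> {..<M - 1}"
      then have "Suc (M - 1 - Suc n) = M - 1 - n" "M - 1 - (M - 1 - Suc n) = Suc n" by auto
      then show "Op (pp Minus (pr j) (Suc n) \<otimes> pp Minus (pr j) (M - 1 - n)) = F (M - 1 - Suc n)"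
        by (simp only: F_def)
    qed
    also have "\<dots> = (\<Sum>n<M - 1. F n)" by (rule sum.nat_diff_reindex)
    also have "\<dots> = (\<Sum>n<M - 1. Op (pp Minus (pr j) (M - 1 - n) \<otimes> pp Minus (pr j) (Suc n)))" by (simp only: F_def)
    also have "\<dots> = Op (\<Sum>n<M - 1. pp Minus (pr j) (M - 1 - n) \<otimes> pp Minus (pr j) (Suc n))"
      by (rule Op_sum)
    finally show ?thesis using that by (simp add: middle_def)
  qed
  have "\<Delta>op (Op (shifter Minus j)) - (tpop 1 (Op (shifter Minus j)) + tpop (Op (shifter Minus j)) 1 + Op (middle Minus j) +
     tpop ((- Df j) *\<^sub>C (Op (shifter Minus j) * Op (ee Plus j) - Op (ee Plus j) * Op (shifter Minus j))) (Op (ee Minus j))) \<in> mi.junk (\<lambda>_. 0) (simple_root j)"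
  proof (cases "j < r")
    case True
    then show ?thesis using minus.shift_nonfixed[OF True]
      by (simp add: shifter_def period_def middle_def pr zero_opposite_def[symmetric])
  next
    case False
    then show ?thesis using minus.shift_fixed[of "pr j"] assms pr[of j] O
      by (simp add: shifter_def period_def)
  qed
  from junk_opposite[OF this] show ?thesis
    by (simp add: \<Delta>op_def tpop_def opposite_defs Minus left_part_def A[symmetric] scaleC_right_diff algebra_simps)
qed

end

section \<open>Induction on the degree\<close>

context loop_setting
begin

definition main_part :: "pm \<Rightarrow> nat \<Rightarrow> ('u, 'u) tensor" where
  "main_part s j = 1 \<otimes> shifter s j + shifter s j \<otimes> 1 + middle s j + left_part s j \<otimes> right_part s j"

lemma \<Delta>_shifter': "j < N \<Longrightarrow> \<exists>Z\<in>pl.junk (\<lambda>_. 0) (simple_root j). \<Delta> (shifter s j) = main_part s j + Z"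
  using \<Delta>_shifter[of j s] by (intro bexI) (auto simp: main_part_def)

text \<open>Elements that commute with the factors of \<open>middle\<close>. The generators at a
  fixed \<open>j\<close> belong here because the series coefficients in degrees below
  \<open>M\<close> do not act on them.\<close>

definition cen :: "nat \<Rightarrow> 'u set" where
  "cen j = {y. \<forall>s m. r \<le> j \<longrightarrow> m < M \<longrightarrow> pp s (pr j) m * y = y * pp s (pr j) m}"

lemma cen_intros: "1 \<in> cen j" "xx s j l \<in> cen j" "pp s a m \<in> cen j" "kk a \<in> cen j" "kki a \<in> cen j"
  by (simp_all add: cen_def pp_xx_lower pp_pp kk_pp kki_pp)

lemma cen_mult: "u \<in> cen j \<Longrightarrow> w \<in> cen j \<Longrightarrow> u * w \<in> cen j"
  by (auto simp: cen_def intro!: mult_commute_with[symmetric])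

lemma middle_commute:
  assumes "u \<in> cen j" "w \<in> cen j"
  shows "middle s j * (u \<otimes> w) = (u \<otimes> w) * middle s j"
proof (cases "r \<le> j")
  case True
  have "pp s (pr j) (M - 1 - n) * u = u * pp s (pr j) (M - 1 - n)" "pp s (pr j) (Suc n) * w = w * pp s (pr j) (Suc n)"
    if "n < M - 1" for n using assms True that by (simp_all add: cen_def)
  then show ?thesis unfolding middle_def using True
    by (auto simp: sum_distrib_left sum_distrib_right tens_mult intro!: sum.cong)
qed (simp add: middle_def)

lemma middle_JJ: "W \<in> JJ \<Longrightarrow> W * middle s j \<in> JJ"
  unfolding middle_def by (auto simp: JJ_zero sum_distrib_left intro!: JJ_sum JJ_right_weight[OF pp_weight])

lemma shifter_weight: "shifter s j \<in> pl.weight_space (\<lambda>_. 0)"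
  by (simp add: shifter_def pp_weight)

lemma main_part_JJ: "W \<in> JJ \<Longrightarrow> W * main_part s j \<in> JJ"
  unfolding main_part_def distrib_left
  by (intro JJ_add JJ_right_weight[OF shifter_weight] JJ_right_weight[OF pl.weight_space_simps(2)] middle_JJ
      JJ_right_weight[OF right_part_weight]) (auto simp: simple_root_def)

lemma \<Delta>_shifter_JJ: "j < N \<Longrightarrow> W \<in> JJ \<Longrightarrow> W * \<Delta> (shifter s j) \<in> JJ"
proof -
  assume a: "j < N" "W \<in> JJ"
  obtain Z where Z: "Z \<in> pl.junk (\<lambda>_. 0) (simple_root j)" "\<Delta> (shifter s j) = main_part s j + Z"
    using \<Delta>_shifter'[OF a(1)] by blast
  show ?thesis unfolding Z(2) distrib_left by (rule JJ_add[OF main_part_JJ[OF a(2)] junk_JJ_right[OF Z(1) a(2)]])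
qed

definition safe :: "nat \<Rightarrow> ('u, 'u) tensor set" where
  "safe j = {W. \<forall>Z\<in>pl.junk (\<lambda>_. 0) (simple_root j). Z * W \<in> JJ \<and> W * Z \<in> JJ}"

lemma safe_add: "u \<in> safe j \<Longrightarrow> w \<in> safe j \<Longrightarrow> u + w \<in> safe j"
  by (auto simp: safe_def distrib_left distrib_right intro: JJ_add)

lemma safe_sum: "(\<And>i. i \<in> S \<Longrightarrow> F i \<in> safe j) \<Longrightarrow> (\<Sum>i\<in>S. F i) \<in> safe j"
proof (induct S rule: infinite_finite_induct)
  case (insert i S) then show ?case by (simp add: safe_add)
qed (simp_all add: safe_def JJ_zero)

lemma safe_tens: "w \<in> pl.weight_space \<delta> \<Longrightarrow> (\<And>b. \<delta> b \<ge> - simple_root j b) \<Longrightarrow> u \<otimes> w \<in> safe j"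
  using junk_safe[of w \<delta> j _ "\<lambda>_. 0" u] unfolding safe_def by blast

text \<open>Replacing the coproduct of \<open>y\<close> by \<Psi> requires right multiplication of
  \<open>JJ\<close> by the coproduct of the shifter, which \<open>\<Delta>_shifter_JJ\<close>
  provides although \<open>JJ\<close> is no right ideal. Replacing that coproduct by
  \<open>main_part\<close> costs products of \<Psi> with junk, and for these \<Psi> has to be
  safe.\<close>

lemma shift_commutator:
  assumes "j < N" "\<Delta> y - \<Psi> \<in> JJ" "\<Psi> \<in> safe j"
  shows "\<Delta> (shifter s j * y - y * shifter s j) - (main_part s j * \<Psi> - \<Psi> * main_part s j) \<in> JJ"
proof -
  obtain Z where Z: "Z \<in> pl.junk (\<lambda>_. 0) (simple_root j)" "\<Delta> (shifter s j) = main_part s j + Z"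
    using \<Delta>_shifter'[OF assms(1)] by blast
  have "\<Delta> (shifter s j * y - y * shifter s j) - (main_part s j * \<Psi> - \<Psi> * main_part s j) =
    \<Delta> (shifter s j) * (\<Delta> y - \<Psi>) - (\<Delta> y - \<Psi>) * \<Delta> (shifter s j) + (Z * \<Psi> - \<Psi> * Z)"
    by (simp add: pl.\<Delta> Z(2) algebra_simps)
  also have "\<dots> \<in> JJ"
    using assms(3) Z(1) by (intro JJ_add JJ_diff JJ_left[OF assms(2)] \<Delta>_shifter_JJ[OF assms(1,2)]) (auto simp: safe_def JJ_diff)
  finally show ?thesis .
qed

lemma main_part_one_tens:
  assumes "y \<in> cen j"
  shows "main_part s j * (1 \<otimes> y) - (1 \<otimes> y) * main_part s j =
    1 \<otimes> (shifter s j * y - y * shifter s j) + left_part s j \<otimes> (right_part s j * y - y * right_part s j)"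
  using middle_commute[OF cen_intros(1) assms, of s]
  by (simp add: main_part_def algebra_simps tens_mult pl.tp_diff_right)

text \<open>With \<open>w\<close> of weight zero, the first-order term has second factors of weight
  \<alpha>_j and disappears in \<open>JJ\<close>. It survives in \<open>main_part_one_tens\<close>,
  where the second factor may lower the weight.\<close>

lemma main_part_tens:
  assumes "y \<in> cen j" "w \<in> cen j" "w \<in> pl.weight_space (\<lambda>_. 0)" "shifter s j * w = w * shifter s j" "j < N"
  shows "main_part s j * (y \<otimes> w) - (y \<otimes> w) * main_part s j - (shifter s j * y - y * shifter s j) \<otimes> w \<in> JJ"
proof -
  have "main_part s j * (y \<otimes> w) - (y \<otimes> w) * main_part s j - (shifter s j * y - y * shifter s j) \<otimes> w =
    (left_part s j * y) \<otimes> (right_part s j * w) - (y * left_part s j) \<otimes> (w * right_part s j)"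
    using middle_commute[OF assms(1,2), of s] assms(4)
    by (simp add: main_part_def algebra_simps tens_mult pl.tp_diff_left)
  moreover have "right_part s j * w \<in> UX"
    by (rule weight_UX[OF pl.weight_space_mult[OF right_part_weight assms(3)] assms(5)]) (simp add: simple_root_def)
  moreover have "w * right_part s j \<in> UX" by (rule weight_UX[OF pl.weight_space_mult[OF assms(3) right_part_weight] assms(5)]) (simp add: simple_root_def)
  ultimately show ?thesis by (simp add: JJ_diff UX_JJ)
qed

text \<open>The coefficient of \<phi>^s at the representative in position \<open>j\<close>, in
  degree \<open>n\<close> for \<open>Plus\<close> and \<open>- n\<close> for
  \<open>Minus\<close>.\<close>

definition ph :: "pm \<Rightarrow> nat \<Rightarrow> nat \<Rightarrow> 'u" where
  "ph s j n = (case s of Plus \<Rightarrow> kk j | Minus \<Rightarrow> kki j) * pp s j n"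

lemma ph_props:
  "ph s j n \<in> cen j" "ph s j n \<in> pl.weight_space (\<lambda>_. 0)" "shifter s' j * ph s j n = ph s j n * shifter s' j"
proof -
  show "ph s j n \<in> cen j" by (cases s) (simp_all add: ph_def cen_mult cen_intros)
  show "ph s j n \<in> pl.weight_space (\<lambda>_. 0)"
    using pl.weight_space_mult[OF pl.weight_space_simps(3) pp_weight, of j s j n]
      pl.weight_space_mult[OF pl.weight_space_simps(4) pp_weight, of j s j n]
    by (cases s) (simp_all add: ph_def)
  have "kk j * pp s j n * pp s' a m = pp s' a m * (kk j * pp s j n)" "kki j * pp s j n * pp s' a m = pp s' a m * (kki j * pp s j n)" for a m
    by (rule mult_commute_with; simp add: kk_pp kki_pp pp_pp[of s])+
  then show "shifter s' j * ph s j n = ph s j n * shifter s' j"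
    by (cases s) (simp_all add: ph_def shifter_def)
qed

lemma ph_vanish: "j < N \<Longrightarrow> \<not> period j dvd n \<Longrightarrow> ph s j n = 0"
proof -
  assume j: "j < N" "\<not> period j dvd n"
  then have "\<not> int (period j) dvd sgn_pm s * int n" using sgn_pm_cases[of s] by auto
  then show "ph s j n = 0" using vanish(3)[OF j(1)] j by (simp add: ph_def pp_def)
qed

lemma xx_vanish: "j < N \<Longrightarrow> \<not> int (period j) dvd n \<Longrightarrow> xx s j n = 0"
  using vanish(1) by (simp add: xx_def)

lemma ee_xx_Minus:
  assumes "j < N"
  shows "n \<ge> 1 \<Longrightarrow> ee Plus j * xx Minus j (int n) - xx Minus j (int n) * ee Plus j = (1 / Df j) *\<^sub>C ph Plus j n"
    "n \<ge> 1 \<Longrightarrow> ee Plus j * xx Minus j (- int n) - xx Minus j (- int n) * ee Plus j = - ((1 / Df j) *\<^sub>C ph Minus j n)"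
    "ee Plus j * xx Minus j 0 - xx Minus j 0 * ee Plus j = (1 / Df j) *\<^sub>C (kk j - kki j)"
  using e_xm[OF assms, of 0 "int n"] e_xm'[OF assms, of 0 "- int n"] ee_ee[of j j] by (simp_all add: ph_def xx_0)

lemma commutator_divide:
  assumes "\<Delta> (c *\<^sub>C y) - c *\<^sub>C W \<in> JJ" "c \<noteq> 0"
  shows "\<Delta> y - W \<in> JJ"
  using JJ_scaleC[OF assms(1), of "1 / c"] assms(2) by (simp add: pl.\<Delta> scaleC_right_diff scaleC_scaleC scaleC_one)

lemma \<Delta>_xx_Plus_step:
  assumes "j < N" "\<Delta> (xx Plus j n) - xx Plus j n \<otimes> 1 \<in> JJ"
  shows "\<Delta> (xx Plus j (n + sgn_pm s * int (period j))) - xx Plus j (n + sgn_pm s * int (period j)) \<otimes> 1 \<in> JJ"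
proof -
  have "xx Plus j n \<otimes> 1 \<in> safe j" by (rule safe_tens[OF pl.weight_space_simps(2)]) (simp add: simple_root_def)
  from JJ_add[OF shift_commutator[OF assms this, of s] main_part_tens[where y = "xx Plus j n" and w = 1 and s = s and j = j, OF cen_intros(2) cen_intros(1) pl.weight_space_simps(2) _ assms(1)]]
  have "\<Delta> (shifter s j * xx Plus j n - xx Plus j n * shifter s j) - (shifter s j * xx Plus j n - xx Plus j n * shifter s j) \<otimes> 1 \<in> JJ"
    by simp
  then show ?thesis using commutator_divide[of "shiftc s j"] shiftc_nz[OF assms(1)]
    by (simp add: shifter_xx[OF assms(1)] tens_scale_left)
qed

lemma \<Delta>_xx_Plus:
  assumes "j < N"
  shows "\<Delta> (xx Plus j n) - xx Plus j n \<otimes> 1 \<in> JJ"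
proof (cases "int (period j) dvd n")
  case True
  then obtain l where n: "n = l * int (period j)" by (metis dvd_def mult.commute)
  show ?thesis unfolding n
  proof (induct l rule: int_induct[where k = 0])
    case base
    have "kk j \<otimes> ee Plus j \<in> JJ" using UX_xx[of 1 j 0] by (intro UX_JJ) (simp add: xx_0)
    then show ?case by (simp add: xx_0 pl.\<Delta>_e)
  next
    case (step1 i)
    then show ?case using \<Delta>_xx_Plus_step[OF assms, of "i * int (period j)" Plus] by (simp add: algebra_simps)
  next
    case (step2 i)
    then show ?case using \<Delta>_xx_Plus_step[OF assms, of "i * int (period j)" Minus] by (simp add: algebra_simps)
  qed
next
  case False
  then show ?thesis using xx_vanish[OF assms] by (simp add: pl.\<Delta> JJ_zero)
qed

definition Psi_plus :: "nat \<Rightarrow> nat \<Rightarrow> ('u, 'u) tensor" where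
  "Psi_plus j l = 1 \<otimes> xx Minus j (int l) + (\<Sum>n=1..l. xx Minus j (int n) \<otimes> ph Plus j (l - n))"

definition Psi_minus :: "nat \<Rightarrow> nat \<Rightarrow> ('u, 'u) tensor" where
  "Psi_minus j l = 1 \<otimes> xx Minus j (- int l) + (\<Sum>n=0..l. xx Minus j (- int n) \<otimes> ph Minus j (l - n))"

end

context loop_setting
begin

lemma sum_head: "(\<Sum>n=0..l. F n) = F 0 + (\<Sum>n=1..l. F n)" for F :: "nat \<Rightarrow> ('u, 'u) tensor"
  by (simp add: sum.atLeast_Suc_atMost One_nat_def)

lemma tens_minus: "(- u) \<otimes> w = - (u \<otimes> w)" "u \<otimes> (- w) = - (u \<otimes> w)" for u w :: 'u
  using tens_scale_left[of "- 1" u w] tens_scale_right[of u "- 1" w] by (simp_all add: scaleC_one)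

lemma main_part_sum:
  assumes "j < N" "\<And>n. n \<in> S \<Longrightarrow> y n \<in> cen j"
    and "\<And>n. n \<in> S \<Longrightarrow> w n \<in> cen j \<and> w n \<in> pl.weight_space (\<lambda>_. 0) \<and> shifter s j * w n = w n * shifter s j"
  shows "main_part s j * (\<Sum>n\<in>S. y n \<otimes> w n) - (\<Sum>n\<in>S. y n \<otimes> w n) * main_part s j -
    (\<Sum>n\<in>S. (shifter s j * y n - y n * shifter s j) \<otimes> w n) \<in> JJ"
  unfolding sum_distrib_left sum_distrib_right sum_subtractf[symmetric]
  by (rule JJ_sum) (use main_part_tens assms in blast)

text \<open>A shift moves the first factors of the sum and leaves the second ones, which have weight
  zero. The single new summand comes from the first-order term, by the commutator of its second
  factor with x^-.\<close>

lemma Psi_step: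
  assumes "j < N" "\<And>n. n \<in> S \<Longrightarrow> w n \<in> cen j \<and> w n \<in> pl.weight_space (\<lambda>_. 0) \<and> shifter s j * w n = w n * shifter s j"
    and "\<Delta> (xx Minus j l) - (1 \<otimes> xx Minus j l + (\<Sum>n\<in>S. xx Minus j (i n) \<otimes> w n)) \<in> JJ"
  shows "\<Delta> ((- shiftc s j) *\<^sub>C xx Minus j (l + sgn_pm s * int (period j))) -
    ((- shiftc s j) *\<^sub>C (1 \<otimes> xx Minus j (l + sgn_pm s * int (period j)) +
      (\<Sum>n\<in>S. xx Minus j (i n + sgn_pm s * int (period j)) \<otimes> w n)) +
     left_part s j \<otimes> (right_part s j * xx Minus j l - xx Minus j l * right_part s j)) \<in> JJ"
proof -
  have "1 \<otimes> xx Minus j l \<in> safe j"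
    by (rule safe_tens[OF xx_weight]) (simp add: simple_root_def)
  moreover have "(\<Sum>n\<in>S. xx Minus j (i n) \<otimes> w n) \<in> safe j"
  proof (rule safe_sum)
    fix n assume "n \<in> S"
    then show "xx Minus j (i n) \<otimes> w n \<in> safe j"
      using assms(2) by (intro safe_tens[of _ "\<lambda>_. 0"]) (auto simp: simple_root_def)
  qed
  ultimately have "1 \<otimes> xx Minus j l + (\<Sum>n\<in>S. xx Minus j (i n) \<otimes> w n) \<in> safe j" by (rule safe_add)
  from JJ_add[OF shift_commutator[OF assms(1,3) this, of s] main_part_sum[where S = S and y = "\<lambda>n. xx Minus j (i n)" and w = w and s = s, OF assms(1) cen_intros(2) assms(2)]]
  have "\<Delta> (shifter s j * xx Minus j l - xx Minus j l * shifter s j) -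
    (main_part s j * (1 \<otimes> xx Minus j l) - (1 \<otimes> xx Minus j l) * main_part s j) -
    (\<Sum>n\<in>S. (shifter s j * xx Minus j (i n) - xx Minus j (i n) * shifter s j) \<otimes> w n) \<in> JJ"
    by (simp add: distrib_left distrib_right algebra_simps)
  then show ?thesis
    unfolding main_part_one_tens[OF cen_intros(2)] shifter_xx[OF assms(1)]
    by (simp add: tens_scale_left tens_scale_right tens_minus scaleC_add_right complex_vector.scale_sum_right sum_negf
        pl.\<Delta> algebra_simps)
qed

lemma sum_period_shift:
  fixes F :: "nat \<Rightarrow> ('u, 'u) tensor"
  assumes "\<And>n. \<not> t dvd n \<Longrightarrow> F n = 0" "1 \<le> t"
  shows "(\<Sum>n=1..l + t. F n) = (\<Sum>n=0..l. F (n + t))"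
proof -
  have "(\<Sum>n=1..l + t. F n) = (\<Sum>n=t..l + t. F n)"
    using assms by (intro sum.mono_neutral_right) (auto simp: nat_dvd_not_less)
  also have "\<dots> = (\<Sum>n=0..l. F (n + t))" using sum.shift_bounds_cl_nat_ivl[of F 0 t l] by simp
  finally show ?thesis .
qed

lemma period_nat: "\<not> period j dvd n \<Longrightarrow> \<not> int (period j) dvd int n" "\<not> period j dvd n \<Longrightarrow> \<not> int (period j) dvd - int n"
  by simp_all

lemma Psi_plus_shift:
  assumes "j < N"
  shows "Psi_plus j (l + period j) = 1 \<otimes> xx Minus j (int (l + period j)) +
    (xx Minus j (int (period j)) \<otimes> ph Plus j l + (\<Sum>n=1..l. xx Minus j (int (n + period j)) \<otimes> ph Plus j (l - n)))"
  unfolding Psi_plus_def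
  by (subst sum_period_shift) (use xx_vanish[OF assms period_nat(1)] period_pos in \<open>simp_all add: sum_head\<close>)

lemma Psi_minus_shift:
  assumes "j < N"
  shows "Psi_minus j (l + period j) = 1 \<otimes> xx Minus j (- int (l + period j)) +
    (xx Minus j 0 \<otimes> ph Minus j (l + period j) + (\<Sum>n=0..l. xx Minus j (- int (n + period j)) \<otimes> ph Minus j (l - n)))"
proof -
  have "(\<Sum>n=1..l + period j. xx Minus j (- int n) \<otimes> ph Minus j (l + period j - n)) =
      (\<Sum>n=0..l. xx Minus j (- int (n + period j)) \<otimes> ph Minus j (l + period j - (n + period j)))"
    by (rule sum_period_shift) (use xx_vanish[OF assms period_nat(2)] period_pos in simp_all)
  then show ?thesis unfolding Psi_minus_def sum_head[of _ "l + period j"] by simp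
qed

lemma \<Delta>_xx_Minus_step:
  assumes "j < N" "1 \<le> l" "\<Delta> (xx Minus j (int l)) - Psi_plus j l \<in> JJ"
  shows "\<Delta> (xx Minus j (int (l + period j))) - Psi_plus j (l + period j) \<in> JJ"
proof -
  have "left_part Plus j \<otimes> (right_part Plus j * xx Minus j (int l) - xx Minus j (int l) * right_part Plus j) =
    (- shiftc Plus j) *\<^sub>C (xx Minus j (int (period j)) \<otimes> ph Plus j l)"
    using ee_xx_Minus(1)[OF assms(1,2)] Df_nz[of j]
    by (simp add: left_part_def right_part_def tens_scale_left tens_scale_right tens_minus scaleC_scaleC)
  then have "\<Delta> ((- shiftc Plus j) *\<^sub>C xx Minus j (int (l + period j))) - (- shiftc Plus j) *\<^sub>C Psi_plus j (l + period j) \<in> JJ"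
    using Psi_step[where S = "{1..l}" and i = int and w = "\<lambda>n. ph Plus j (l - n)" and l = "int l" and s = Plus, OF assms(1) _ assms(3)[unfolded Psi_plus_def]]
    unfolding Psi_plus_shift[OF assms(1)] by (simp add: ph_props scaleC_add_right algebra_simps)
  then show ?thesis by (rule commutator_divide) (use shiftc_nz[OF assms(1)] in simp)
qed

text \<open>The coproduct of \<open>f\<close> at \<open>j\<close> ends in \<open>kki j\<close>, and
  the shift alone would keep that factor. The first-order term adds the difference
  \<open>kk j - kki j\<close> and so turns it into \<open>kk j\<close>. This is the origin of
  \<phi>^+ and of the lower limit 1 in positive degrees.\<close>

lemma \<Delta>_xx_Minus_first:
  assumes "j < N"
  shows "\<Delta> (xx Minus j (int (period j))) - Psi_plus j (period j) \<in> JJ"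
proof -
  have "left_part Plus j \<otimes> (right_part Plus j * xx Minus j 0 - xx Minus j 0 * right_part Plus j) =
    (- shiftc Plus j) *\<^sub>C (xx Minus j (int (period j)) \<otimes> (kk j - kki j))"
    using ee_xx_Minus(3)[OF assms] Df_nz[of j]
    by (simp add: left_part_def right_part_def tens_scale_left tens_scale_right tens_minus scaleC_scaleC)
  moreover have "kki j \<in> cen j \<and> kki j \<in> pl.weight_space (\<lambda>_. 0) \<and> shifter Plus j * kki j = kki j * shifter Plus j"
    by (simp add: cen_intros pl.weight_space_simps shifter_def kki_pp)
  moreover have "\<Delta> (xx Minus j 0) - (1 \<otimes> xx Minus j 0 + (\<Sum>n\<in>{0::nat}. xx Minus j 0 \<otimes> kki j)) \<in> JJ"
    by (simp add: xx_0 pl.\<Delta>_f JJ_zero)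
  moreover have "(- shiftc Plus j) *\<^sub>C (1 \<otimes> xx Minus j (int (period j)) + xx Minus j (int (period j)) \<otimes> kki j) +
      (- shiftc Plus j) *\<^sub>C (xx Minus j (int (period j)) \<otimes> (kk j - kki j)) =
     (- shiftc Plus j) *\<^sub>C (1 \<otimes> xx Minus j (int (period j)) + xx Minus j (int (period j)) \<otimes> kk j)"
    unfolding scaleC_add_right[symmetric] pl.tp_diff_right by simp
  ultimately have "\<Delta> ((- shiftc Plus j) *\<^sub>C xx Minus j (int (period j))) -
     (- shiftc Plus j) *\<^sub>C (1 \<otimes> xx Minus j (int (period j)) + xx Minus j (int (period j)) \<otimes> kk j) \<in> JJ"
    using Psi_step[where S = "{0::nat}" and i = "\<lambda>_. 0" and w = "\<lambda>_. kki j" and l = 0 and s = Plus, OF assms]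
    by simp
  moreover have "Psi_plus j (period j) = 1 \<otimes> xx Minus j (int (period j)) + xx Minus j (int (period j)) \<otimes> kk j"
    using Psi_plus_shift[OF assms, of 0] by (simp add: ph_def pp_0)
  ultimately show ?thesis using commutator_divide[of "- shiftc Plus j"] shiftc_nz[OF assms] by simp
qed

lemma \<Delta>_xx_Minus_plus:
  assumes "j < N" "1 \<le> l"
  shows "\<Delta> (xx Minus j (int l)) - Psi_plus j l \<in> JJ"
proof (cases "period j dvd l")
  case True
  then obtain d where d: "l = period j * d" by blast
  then obtain c where c: "l = Suc c * period j" using assms(2) by (cases d) auto
  show ?thesis unfolding c
  proof (induct c)
    case 0 show ?case using \<Delta>_xx_Minus_first[OF assms(1)] by simp
  next
    case (Suc c)
    then show ?case using \<Delta>_xx_Minus_step[OF assms(1), of "Suc c * period j"] period_pos[of j]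
      by (simp add: add.commute add.left_commute)
  qed
next
  case False
  \<comment> \<open>As \<open>period j\<close> does not divide \<open>l\<close>, it cannot divide
    both \<open>n\<close> and \<open>l - n\<close>, and each factor vanishes outside the multiples
    of the period.\<close>
  have "xx Minus j (int n) \<otimes> ph Plus j (l - n) = 0" if "n \<in> {1..l}" for n
  proof (cases "period j dvd n")
    case True
    then have "\<not> period j dvd l - n" using dvd_diffD[of "period j" l n] False that by auto
    then show ?thesis using ph_vanish[OF assms(1)] by simp
  qed (use xx_vanish[OF assms(1) period_nat(1)] in simp)
  then have "Psi_plus j l = 0"
    using xx_vanish[OF assms(1) period_nat(1)[OF False]] by (simp add: Psi_plus_def)
  then show ?thesis using xx_vanish[OF assms(1) period_nat(1)[OF False]] by (simp add: pl.\<Delta> JJ_zero)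
qed

text \<open>In the mirror image the first factor of the first-order term is
  \<open>ee Minus j\<close> itself, so the new summand appears at index zero; the formula in
  non-positive degrees accordingly starts there.\<close>

lemma \<Delta>_xx_Minus_minus_step:
  assumes "j < N" "\<Delta> (xx Minus j (- int l)) - Psi_minus j l \<in> JJ"
  shows "\<Delta> (xx Minus j (- int (l + period j))) - Psi_minus j (l + period j) \<in> JJ"
proof -
  have "xx Plus j (- int (period j)) * xx Minus j (- int l) - xx Minus j (- int l) * xx Plus j (- int (period j)) =
      (1 / - Df j) *\<^sub>C ph Minus j (l + period j)"
    using e_xm'[OF assms(1), of "- int (period j)" "- int l"] period_pos[of j]
    by (simp add: ph_def nat_add_distrib add.commute)
  then have "left_part Minus j \<otimes> (right_part Minus j * xx Minus j (- int l) - xx Minus j (- int l) * right_part Minus j) =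
    (- shiftc Minus j) *\<^sub>C (xx Minus j 0 \<otimes> ph Minus j (l + period j))"
    using Df_nz[of j]
    by (simp add: left_part_def right_part_def tens_scale_left tens_scale_right tens_minus scaleC_scaleC scaleC_mult xx_0
        flip: scaleC_right_diff)
  then have "\<Delta> ((- shiftc Minus j) *\<^sub>C xx Minus j (- int (l + period j))) - (- shiftc Minus j) *\<^sub>C Psi_minus j (l + period j) \<in> JJ"
    using Psi_step[where S = "{0..l}" and i = "\<lambda>n. - int n" and w = "\<lambda>n. ph Minus j (l - n)" and l = "- int l" and s = Minus, OF assms(1) _ assms(2)[unfolded Psi_minus_def]]
    unfolding Psi_minus_shift[OF assms(1)] by (simp add: ph_props scaleC_add_right algebra_simps)
  then show ?thesis by (rule commutator_divide) (use shiftc_nz[OF assms(1)] in simp)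
qed

lemma \<Delta>_xx_Minus_minus:
  assumes "j < N"
  shows "\<Delta> (xx Minus j (- int l)) - Psi_minus j l \<in> JJ"
proof (cases "period j dvd l")
  case True
  then obtain c where c: "l = c * period j" by (metis dvd_def mult.commute)
  show ?thesis unfolding c
  proof (induct c)
    case 0 show ?case by (simp add: Psi_minus_def xx_0 pl.\<Delta>_f ph_def pp_0 JJ_zero)
  next
    case (Suc c)
    then show ?case using \<Delta>_xx_Minus_minus_step[OF assms, of "c * period j"]
      by (simp add: add.commute)
  qed
next
  case False
  have "xx Minus j (- int n) \<otimes> ph Minus j (l - n) = 0" if "n \<in> {0..l}" for n
  proof (cases "period j dvd n")
    case True
    then have "\<not> period j dvd l - n" using dvd_diffD[of "period j" l n] False that by auto
    then show ?thesis using ph_vanish[OF assms(1)] by simp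
  qed (use xx_vanish[OF assms(1) period_nat(2)] in simp)
  then have "Psi_minus j l = 0"
    using xx_vanish[OF assms(1) period_nat(2)[OF False]] by (simp add: Psi_minus_def)
  then show ?thesis using xx_vanish[OF assms(1) period_nat(2)[OF False]] by (simp add: pl.\<Delta> JJ_zero)
qed

text \<open>The coproduct of \<open>e\<close> at \<open>j\<close> has the second factors 1 and
  \<open>ee Plus j\<close>. The latter next to a second factor of weight zero falls into
  \<open>JJ\<close>, so on the sum only the commutators of the first factors remain; on
  \<open>1 \<otimes> y\<close> only the commutator of the second.\<close>

lemma ee_commutator:
  assumes "j < N" "\<Delta> y - (1 \<otimes> y + (\<Sum>n\<in>S. z n \<otimes> w n)) \<in> JJ" "\<And>n. n \<in> S \<Longrightarrow> w n \<in> pl.weight_space (\<lambda>_. 0)"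
  shows "\<Delta> (ee Plus j * y - y * ee Plus j) -
    (kk j \<otimes> (ee Plus j * y - y * ee Plus j) + (\<Sum>n\<in>S. (ee Plus j * z n - z n * ee Plus j) \<otimes> w n)) \<in> JJ"
proof -
  define E where "E = ee Plus j \<otimes> 1 + kk j \<otimes> ee Plus j"
  define \<Psi> where "\<Psi> = 1 \<otimes> y + (\<Sum>n\<in>S. z n \<otimes> w n)"
  have a: "\<Delta> (ee Plus j * y - y * ee Plus j) - (E * \<Psi> - \<Psi> * E) \<in> JJ"
  proof -
    have "\<Delta> (ee Plus j * y - y * ee Plus j) - (E * \<Psi> - \<Psi> * E) = E * (\<Delta> y - \<Psi>) - (\<Delta> y - \<Psi>) * E"
      by (simp add: pl.\<Delta> pl.\<Delta>_e E_def[symmetric] algebra_simps)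
    moreover have "(\<Delta> y - \<Psi>) * E \<in> JJ" unfolding E_def distrib_left
      by (intro JJ_add JJ_right_weight[OF pl.weight_space_simps(2)] JJ_right_weight[OF pl.weight_space_simps(5)])
        (use assms(2) in \<open>auto simp: simple_root_def \<Psi>_def\<close>)
    ultimately show ?thesis using JJ_left[OF assms(2), of E] by (simp add: \<Psi>_def JJ_diff)
  qed
  have b: "E * (z n \<otimes> w n) - (z n \<otimes> w n) * E - (ee Plus j * z n - z n * ee Plus j) \<otimes> w n \<in> JJ" if "n \<in> S" for n
  proof -
    have "E * (z n \<otimes> w n) - (z n \<otimes> w n) * E - (ee Plus j * z n - z n * ee Plus j) \<otimes> w n =
      (kk j * z n) \<otimes> (ee Plus j * w n) - (z n * kk j) \<otimes> (w n * ee Plus j)"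
      by (simp add: E_def algebra_simps tens_mult pl.tp_diff_left)
    moreover have "ee Plus j * w n \<in> UX" "w n * ee Plus j \<in> UX"
      by (rule weight_UX[OF pl.weight_space_mult[OF pl.weight_space_simps(5) assms(3)[OF that]] assms(1)]; simp add: simple_root_def)
        (rule weight_UX[OF pl.weight_space_mult[OF assms(3)[OF that] pl.weight_space_simps(5)] assms(1)]; simp add: simple_root_def)
    ultimately show ?thesis by (simp add: JJ_diff UX_JJ)
  qed
  have c: "E * (\<Sum>n\<in>S. z n \<otimes> w n) - (\<Sum>n\<in>S. z n \<otimes> w n) * E - (\<Sum>n\<in>S. (ee Plus j * z n - z n * ee Plus j) \<otimes> w n) \<in> JJ"
    unfolding sum_distrib_left sum_distrib_right sum_subtractf[symmetric] by (rule JJ_sum) (rule b)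
  have d: "E * (1 \<otimes> y) - (1 \<otimes> y) * E = kk j \<otimes> (ee Plus j * y - y * ee Plus j)"
    by (simp add: E_def algebra_simps tens_mult pl.tp_diff_right)
  have eq: "\<Delta> (ee Plus j * y - y * ee Plus j) -
    (kk j \<otimes> (ee Plus j * y - y * ee Plus j) + (\<Sum>n\<in>S. (ee Plus j * z n - z n * ee Plus j) \<otimes> w n)) =
    (\<Delta> (ee Plus j * y - y * ee Plus j) - (E * \<Psi> - \<Psi> * E)) +
    (E * (\<Sum>n\<in>S. z n \<otimes> w n) - (\<Sum>n\<in>S. z n \<otimes> w n) * E - (\<Sum>n\<in>S. (ee Plus j * z n - z n * ee Plus j) \<otimes> w n))"
    unfolding d[symmetric] by (simp add: \<Psi>_def algebra_simps)
  show ?thesis unfolding eq by (rule JJ_add[OF a c])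
qed

lemma \<Delta>_ph_Plus:
  assumes "j < N"
  shows "\<Delta> (ph Plus j n) - (\<Sum>m=0..n. ph Plus j m \<otimes> ph Plus j (n - m)) \<in> JJ"
proof (cases "n = 0")
  case True
  then show ?thesis by (simp add: ph_def pp_0 pl.\<Delta>_k JJ_zero)
next
  case False
  then have n: "1 \<le> n" by simp
  have k: "kk j = ph Plus j 0" by (simp add: ph_def pp_0)
  have eq: "(\<Sum>m=1..n. (ee Plus j * xx Minus j (int m) - xx Minus j (int m) * ee Plus j) \<otimes> ph Plus j (n - m)) =
     (1 / Df j) *\<^sub>C (\<Sum>m=1..n. ph Plus j m \<otimes> ph Plus j (n - m))"
    unfolding complex_vector.scale_sum_right
    by (intro sum.cong) (simp_all add: ee_xx_Minus(1)[OF assms] tens_scale_left)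
  have "\<Delta> ((1 / Df j) *\<^sub>C ph Plus j n) - (1 / Df j) *\<^sub>C (\<Sum>m=0..n. ph Plus j m \<otimes> ph Plus j (n - m)) \<in> JJ"
    using ee_commutator[OF assms \<Delta>_xx_Minus_plus[OF assms n, unfolded Psi_plus_def] ph_props(2)]
    unfolding eq ee_xx_Minus(1)[OF assms n]
    by (simp add: sum_head k scaleC_add_right tens_scale_right)
  then show ?thesis by (rule commutator_divide) (use Df_nz in simp)
qed

lemma \<Delta>_ph_Minus:
  assumes "j < N"
  shows "\<Delta> (ph Minus j n) - (\<Sum>m=0..n. ph Minus j m \<otimes> ph Minus j (n - m)) \<in> JJ"
proof (cases "n = 0")
  case True
  then show ?thesis by (simp add: ph_def pp_0 pl.\<Delta>_kinv JJ_zero)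
next
  case False
  then have n: "1 \<le> n" by simp
  have k: "kki j = ph Minus j 0" by (simp add: ph_def pp_0)
  define S where "S = (\<Sum>m=1..n. ph Minus j m \<otimes> ph Minus j (n - m))"
  have "(\<Sum>m=1..n. (ee Plus j * xx Minus j (- int m) - xx Minus j (- int m) * ee Plus j) \<otimes> ph Minus j (n - m)) =
     - ((1 / Df j) *\<^sub>C S)"
    unfolding S_def complex_vector.scale_sum_right sum_negf[symmetric]
    by (intro sum.cong) (simp_all add: ee_xx_Minus(2)[OF assms] tens_scale_left flip: complex_vector.scale_minus_left)
  \<comment> \<open>Unlike in positive degrees, index zero contributes \<open>kk j - kki j\<close>.
    Its first half will cancel the term that \<open>1 \<otimes> y\<close> produces, and the second
    half is the missing summand with \<open>kki j\<close>.\<close>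
  then have eq: "(\<Sum>m=0..n. (ee Plus j * xx Minus j (- int m) - xx Minus j (- int m) * ee Plus j) \<otimes> ph Minus j (n - m)) =
     (1 / Df j) *\<^sub>C ((kk j - kki j) \<otimes> ph Minus j n) - (1 / Df j) *\<^sub>C S"
    using ee_xx_Minus(3)[OF assms] by (simp add: sum_head tens_scale_left)
  have S: "(\<Sum>m=0..n. ph Minus j m \<otimes> ph Minus j (n - m)) = kki j \<otimes> ph Minus j n + S"
    by (simp add: sum_head k S_def)
  have "\<Delta> ((- (1 / Df j)) *\<^sub>C ph Minus j n) - (- (1 / Df j)) *\<^sub>C (\<Sum>m=0..n. ph Minus j m \<otimes> ph Minus j (n - m)) \<in> JJ"
    using ee_commutator[OF assms \<Delta>_xx_Minus_minus[OF assms, of n, unfolded Psi_minus_def] ph_props(2)]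
    unfolding eq ee_xx_Minus(2)[OF assms n] S
    by (simp add: scaleC_add_right scaleC_right_diff tens_scale_right tens_minus pl.tp_diff_left pl.\<Delta> algebra_simps)
  then show ?thesis by (rule commutator_divide) (use Df_nz in simp)
qed

end

lemma sum_int_interval:
  assumes "\<And>n. m \<le> n \<Longrightarrow> n \<le> k \<Longrightarrow> F (int n) = G n"
  shows "(\<Sum>j=int m..int k. F j) = (\<Sum>n=m..k. G n)"
  unfolding sum.atLeast_int_atMost_int_shift using assms by (intro sum.cong) auto

section \<open>From the representatives to all nodes\<close>

context loop_setting
begin

theorem coproduct_generators:
  assumes i: "i \<in> II T" and "k \<ge> 0" and "l > 0"
  shows "cong_X_plus T x (\<Delta> (x Plus i m)) (x Plus i m \<otimes> 1) \<and>
      cong_X_plus T x (\<Delta> (x Minus i l))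
           (1 \<otimes> x Minus i l + (\<Sum>j=1..l. x Minus i j \<otimes> phi T g h Plus i (l - j))) \<and>
      cong_X_plus T x (\<Delta> (x Minus i (- k)))
           (1 \<otimes> x Minus i (- k) + (\<Sum>j=0..k. x Minus i (- j) \<otimes> phi T g h Minus i (- k + j))) \<and>
      cong_X_plus T x (\<Delta> (phi T g h Plus i k))
           (\<Sum>j=0..k. phi T g h Plus i (k - j) \<otimes> phi T g h Plus i j) \<and>
      cong_X_plus T x (\<Delta> (phi T g h Minus i (- k)))
           (\<Sum>j=0..k. phi T g h Minus i (- k + j) \<otimes> phi T g h Minus i (- j))"
proof -
  have cong: "cong_X_plus T x y z" if "y = c *\<^sub>C y'" "z = c *\<^sub>C z'" "y' - z' \<in> JJ" for y z y' z' c
    using JJ_scaleC[OF that(3), of c] unfolding cong_X_plus_def JJ_def that(1,2) by (simp only: scaleC_right_diff)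
  obtain a t where a: "a < N" and xi: "\<And>s m. x s i m = (omega T powi m) ^ t *\<^sub>C xx s a m"
    and psii: "\<And>s m. psi s i m = (omega T powi (sgn_pm s * int m)) ^ t *\<^sub>C pp s a m" and rep: "rep T i = L ! a"
    using node_scaling[OF i] by metis
  \<comment> \<open>The generators at \<open>i\<close> in degree \<open>m\<close> are
    \<open>c m\<close> times those at the representative. Both sides of each congruence are
    homogeneous in the degree and \<open>c\<close> is multiplicative, so one common factor can be
    extracted.\<close>
  define c where "c m = (omega T powi m) ^ t" for m
  have c_add: "c (m + n) = c m * c n" for m n
    using omega_nz by (simp add: c_def power_int_add power_mult_distrib)
  have c_cancel: "c m * c n = c k" if "m + n = k" for m n k using c_add that by metis
  have x: "x s i m = c m *\<^sub>C xx s a m" for s m by (simp add: xi c_def)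
  have phi: "phi T g h s i (sgn_pm s * int n) = c (sgn_pm s * int n) *\<^sub>C ph s a n" for s n
    using a by (cases s) (simp_all add: phi_Plus phi_Minus psii ph_def kk_def kki_def rep c_def scaleC_mult)
  note phiP = phi[of Plus, simplified] and phiM = phi[of Minus, simplified]
  obtain k' l' where k: "k = int k'" and l: "l = int l'" "1 \<le> l'"
    using assms(2,3) by (metis zero_le_imp_eq_int less_imp_le nat_one_as_int of_nat_0_less_iff Suc_leI One_nat_def)
  have 1: "cong_X_plus T x (\<Delta> (x Plus i m)) (x Plus i m \<otimes> 1)"
    by (rule cong[OF _ _ \<Delta>_xx_Plus[OF a]]) (simp_all add: x pl.\<Delta> tens_scale_left)
  have "(\<Sum>j=1..l. x Minus i j \<otimes> phi T g h Plus i (l - j)) = (\<Sum>n=1..l'. c l *\<^sub>C (xx Minus a (int n) \<otimes> ph Plus a (l' - n)))"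
  proof -
    have "(\<Sum>j=int 1..int l'. x Minus i j \<otimes> phi T g h Plus i (l - j)) = (\<Sum>n=1..l'. c l *\<^sub>C (xx Minus a (int n) \<otimes> ph Plus a (l' - n)))"
    proof (rule sum_int_interval)
      fix n assume n: "1 \<le> n" "n \<le> l'"
      then have d: "l - int n = int (l' - n)" by (simp add: l)
      have "c (int (l' - n)) * c (int n) = c l" using d by (intro c_cancel) simp
      then show "x Minus i (int n) \<otimes> phi T g h Plus i (l - int n) = c l *\<^sub>C (xx Minus a (int n) \<otimes> ph Plus a (l' - n))"
        by (simp only: d phiP x tens_scale_left tens_scale_right scaleC_scaleC mult.commute)
    qed
    then show ?thesis by (simp add: l(1))
  qed
  then have 2: "cong_X_plus T x (\<Delta> (x Minus i l)) (1 \<otimes> x Minus i l + (\<Sum>j=1..l. x Minus i j \<otimes> phi T g h Plus i (l - j)))"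
    by (intro cong[OF _ _ \<Delta>_xx_Minus_plus[OF a l(2)], of _ "c l"])
      (simp_all add: x pl.\<Delta> tens_scale_right Psi_plus_def scaleC_add_right complex_vector.scale_sum_right l(1))
  have "(\<Sum>j=int 0..int k'. x Minus i (- j) \<otimes> phi T g h Minus i (- k + j)) =
    (\<Sum>n=0..k'. c (- k) *\<^sub>C (xx Minus a (- int n) \<otimes> ph Minus a (k' - n)))"
  proof (rule sum_int_interval)
    fix n assume n: "n \<le> k'"
    then have d: "- k + int n = - int (k' - n)" by (simp add: k)
    have "c (- int (k' - n)) * c (- int n) = c (- k)" using d by (intro c_cancel) simp
    then show "x Minus i (- int n) \<otimes> phi T g h Minus i (- k + int n) = c (- k) *\<^sub>C (xx Minus a (- int n) \<otimes> ph Minus a (k' - n))"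
      by (simp only: d phiM x tens_scale_left tens_scale_right scaleC_scaleC mult.commute)
  qed
  then have 3: "cong_X_plus T x (\<Delta> (x Minus i (- k))) (1 \<otimes> x Minus i (- k) + (\<Sum>j=0..k. x Minus i (- j) \<otimes> phi T g h Minus i (- k + j)))"
    by (intro cong[OF _ _ \<Delta>_xx_Minus_minus[OF a, of k'], of _ "c (- k)"])
      (simp_all add: x pl.\<Delta> tens_scale_right Psi_minus_def scaleC_add_right complex_vector.scale_sum_right k)
  have "(\<Sum>j=int 0..int k'. phi T g h Plus i (k - j) \<otimes> phi T g h Plus i j) =
    (\<Sum>n=0..k'. c k *\<^sub>C (ph Plus a (k' - n) \<otimes> ph Plus a n))"
  proof (rule sum_int_interval)
    fix n assume n: "n \<le> k'"
    then have d: "k - int n = int (k' - n)" by (simp add: k)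
    have "c (int (k' - n)) * c (int n) = c k" using d by (intro c_cancel) simp
    then show "phi T g h Plus i (k - int n) \<otimes> phi T g h Plus i (int n) = c k *\<^sub>C (ph Plus a (k' - n) \<otimes> ph Plus a n)"
      by (simp only: d phiP tens_scale_left tens_scale_right scaleC_scaleC mult.commute)
  qed
  moreover have rev: "(\<Sum>n=0..k'. ph s a (k' - n) \<otimes> ph s a n) = (\<Sum>n=0..k'. ph s a n \<otimes> ph s a (k' - n))" for s
    by (rule sum.reindex_bij_witness[of _ "\<lambda>n. k' - n" "\<lambda>n. k' - n"]) auto
  ultimately have 4: "cong_X_plus T x (\<Delta> (phi T g h Plus i k)) (\<Sum>j=0..k. phi T g h Plus i (k - j) \<otimes> phi T g h Plus i j)"
    by (intro cong[OF _ _ \<Delta>_ph_Plus[OF a, of k', folded rev], of _ "c k"])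
      (simp_all add: pl.\<Delta> phiP k flip: complex_vector.scale_sum_right)
  have "(\<Sum>j=int 0..int k'. phi T g h Minus i (- k + j) \<otimes> phi T g h Minus i (- j)) =
    (\<Sum>n=0..k'. c (- k) *\<^sub>C (ph Minus a (k' - n) \<otimes> ph Minus a n))"
  proof (rule sum_int_interval)
    fix n assume n: "n \<le> k'"
    then have d: "- k + int n = - int (k' - n)" by (simp add: k)
    have "c (- int (k' - n)) * c (- int n) = c (- k)" using d by (intro c_cancel) simp
    then show "phi T g h Minus i (- k + int n) \<otimes> phi T g h Minus i (- int n) = c (- k) *\<^sub>C (ph Minus a (k' - n) \<otimes> ph Minus a n)"
      by (simp only: d phiM tens_scale_left tens_scale_right scaleC_scaleC mult.commute)
  qed
  then have 5: "cong_X_plus T x (\<Delta> (phi T g h Minus i (- k))) (\<Sum>j=0..k. phi T g h Minus i (- k + j) \<otimes> phi T g h Minus i (- j))"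
    by (intro cong[OF _ _ \<Delta>_ph_Minus[OF a, of k', folded rev], of _ "c (- k)"])
      (simp_all add: pl.\<Delta> phiM k flip: complex_vector.scale_sum_right)
  show ?thesis using 1 2 3 4 5 by blast
qed

end

theorem proposition3p4:
  fixes T :: twisted_datum and a :: "affine_node \<Rightarrow> nat"
    and g :: "chevalley \<Rightarrow> 'u::complex_algebra_1"
    and \<Delta> :: "'u \<Rightarrow> ('u, 'u) tensor"
    and x :: "pm \<Rightarrow> nat \<Rightarrow> int \<Rightarrow> 'u" and h :: "nat \<Rightarrow> int \<Rightarrow> 'u"
    and i :: nat and m k l :: int
  assumes "twisted_datum T" and "affine_marks T a"
    and "quantum_loop_algebra T a g"
    and "coproduct T g \<Delta>"
    and "drinfeld_generators T g x h"
    and "i \<in> II T" and "k \<ge> 0" and "l > 0"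
  shows "cong_X_plus T x (\<Delta> (x Plus i m)) (x Plus i m \<otimes> 1) \<and>
      cong_X_plus T x (\<Delta> (x Minus i l))
           (1 \<otimes> x Minus i l + (\<Sum>j=1..l. x Minus i j \<otimes> phi T g h Plus i (l - j))) \<and>
      cong_X_plus T x (\<Delta> (x Minus i (- k)))
           (1 \<otimes> x Minus i (- k) + (\<Sum>j=0..k. x Minus i (- j) \<otimes> phi T g h Minus i (- k + j))) \<and>
      cong_X_plus T x (\<Delta> (phi T g h Plus i k))
           (\<Sum>j=0..k. phi T g h Plus i (k - j) \<otimes> phi T g h Plus i j) \<and>
      cong_X_plus T x (\<Delta> (phi T g h Minus i (- k)))
           (\<Sum>j=0..k. phi T g h Minus i (- k + j) \<otimes> phi T g h Minus i (- j))"
proof -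
  interpret datum T by unfold_locales (rule assms)
  obtain L r path v where "chain_datum T L r path v"
    using chain_A chain_D chain_E by (cases "type_of T") blast+
  then interpret loop_setting T L r path v a g \<Delta> x h
    by (intro loop_setting.intro loop_setting_axioms.intro assms)
  show ?thesis by (rule coproduct_generators) (rule assms)+
qed

end
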